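(* Let $(\Omega,\mathcal F,\mathbb P)$ with the shifts $\tau_z$ be stationary and ergodic. For any $\xi\in\mathbb R^d$ there exists a unique random field $\phi:\Omega\times\mathbb R^d\to\mathbb R$ (called the corrector associated with $\xi$) such that: (a) For $\mathbb P$-a.e. $a\in\Omega$ the function $\phi(a,\cdot)\in H^1_{\mathrm{loc}}(\mathbb R^d)$ is a distributional solution to $$-\nabla\cdot a(\nabla\phi(a,\cdot)+\xi)=0\qquad\text{in }\mathcal D'(\mathbb R^d),$$ with sublinear growth in the sense that $$\limsup_{R\to\infty}\frac1{R^2}\,\frac{1}{|R\Box|}\int_{R\Box}|\phi(a,y)|^2\,dy=0,$$ and $\phi(a,\cdot)$ is anchored in the sense that $\int_{\Box}\phi(a,y)\,dy=0$. (b) $\nabla\phi$ is stationary. (c) $\big\langle\int_\Box|\nabla\phi|^2\big\rangle\le\frac{1-\lambda^2}{\lambda^2}\big\langle\int_\Box|a\xi|^2\big\rangle$ and $\big\langle\int_\Box\nabla\phi\big\rangle=0$.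
   Context: Let $d\ge1$ and $\lambda>0$ be fixed. $\Omega$ is the set of measurable $a:\mathbb R^d\to\mathbb R^{d\times d}_{\mathrm{sym}}$ such that for a.e. $x$ and all $\xi\in\mathbb R^d$: $\xi\cdot a(x)\xi\ge\lambda|\xi|^2$ and $|a(x)\xi|\le|\xi|$. $(\Omega,\mathcal F,\mathbb P)$ is a probability space, $\langle\cdot\rangle$ the expectation, and the shift $\tau:\mathbb R^d\times\Omega\to\Omega$, $\tau(z,a)=\tau_za:=a(\cdot+z)$, is assumed measurable. $\Box:=(-\frac12,\frac12)^d$ (so $|\Box|=1$). Stationary: for all $z\in\mathbb R^d$ and $f\in L^1(\Omega,\mathbb P)$, $\langle f\circ\tau_z\rangle=\langle f\rangle$. Ergodic: for all $f\in L^1(\Omega,\mathbb P)$, $\lim_{R\uparrow\infty}\frac1{|R\Box|}\int_{R\Box}f(\tau_za)\,dz=\langle f\rangle$ for $\mathbb P$-a.e. $a$. A measurable $u:\Omega\times\mathbb R^d\to\mathbb R$ is a stationary ($L^1$-)random field if $\langle\int_Q|u|\rangle<\infty$ for all cubes $Q=x+r\Box$ ($x\in\mathbb R^d$, $r>0$) and for $\mathbb P$-a.e. $a$: $\int_{x+Q}u(a,y)\,dy=\int_Qu(\tau_xa,y)\,dy$ for all cubes $Q$ and all $x\in\mathbb R^d$. A vector field is stationary if its components are. Random fields are identified if they coincide $\mathbb P$-a.s., a.e. in $\mathbb R^d$.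
   Formalization: It is additionally assumed that integrals of the entries of a over cubes are F-measurable functions of a; without this the claim fails, e.g. for the trivial sigma-algebra F = {∅, Ω}, where random fields cannot depend on a. *)

theory Defs
  imports "HOL-Probability.Probability"
begin

definition unit_cube :: "(real ^ 'n) set" where
  "unit_cube = box (vec (- 1 / 2)) (vec (1 / 2))"

definition cube :: "real ^ 'n \<Rightarrow> real \<Rightarrow> (real ^ 'n) set" where
  "cube x r = (\<lambda>y. x + r *\<^sub>R y) ` unit_cube"

definition average :: "(real ^ 'n) set \<Rightarrow> (real ^ 'n \<Rightarrow> real) \<Rightarrow> real" where
  "average Q u = 1 / measure lebesgue Q * (LINT y:Q|lebesgue. u y)"

definition partial_deriv :: "'n::finite \<Rightarrow> (real ^ 'n \<Rightarrow> real) \<Rightarrow> real ^ 'n \<Rightarrow> real" where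
  "partial_deriv i f x = frechet_derivative f (at x) (axis i 1)"

definition gradient :: "(real ^ 'n \<Rightarrow> real) \<Rightarrow> real ^ 'n \<Rightarrow> real ^ 'n" where
  "gradient f x = (\<chi> i. partial_deriv i f x)"

text \<open>Infinite differentiability: every iterated partial derivative is differentiable
  everywhere, hence in particular continuous.\<close>

definition smooth :: "(real ^ 'n \<Rightarrow> real) \<Rightarrow> bool" where
  "smooth f \<longleftrightarrow> (\<forall>is x. foldr partial_deriv is f differentiable (at x))"

definition test_function :: "(real ^ 'n \<Rightarrow> real) \<Rightarrow> bool" where
  "test_function \<eta> \<longleftrightarrow> smooth \<eta> \<and> compact (closure {x. \<eta> x \<noteq> 0})"

definition L1_loc :: "(real ^ 'n \<Rightarrow> 'b::euclidean_space) \<Rightarrow> bool" where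
  "L1_loc u \<longleftrightarrow> (\<forall>K. compact K \<longrightarrow> set_integrable lebesgue K u)"

definition L2_loc :: "(real ^ 'n \<Rightarrow> 'b::euclidean_space) \<Rightarrow> bool" where
  "L2_loc u \<longleftrightarrow> u \<in> borel_measurable lebesgue \<and>
     (\<forall>K. compact K \<longrightarrow> set_integrable lebesgue K (\<lambda>x. (norm (u x))\<^sup>2))"

definition has_weak_gradient :: "(real ^ 'n \<Rightarrow> real) \<Rightarrow> (real ^ 'n \<Rightarrow> real ^ 'n) \<Rightarrow> bool" where
  "has_weak_gradient u g \<longleftrightarrow> L1_loc u \<and> L1_loc g \<and>
     (\<forall>\<eta> i. test_function \<eta> \<longrightarrow>
        (LINT x|lebesgue. u x * partial_deriv i \<eta> x) = - (LINT x|lebesgue. g x $ i * \<eta> x))"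

definition H1_loc :: "(real ^ 'n \<Rightarrow> real) \<Rightarrow> bool" where
  "H1_loc u \<longleftrightarrow> L2_loc u \<and> (\<exists>g. L2_loc g \<and> has_weak_gradient u g)"

text \<open>The equation \<open>- div F = 0\<close> in the sense of distributions.\<close>

definition distr_div_zero :: "(real ^ 'n \<Rightarrow> real ^ 'n) \<Rightarrow> bool" where
  "distr_div_zero F \<longleftrightarrow> L1_loc F \<and>
     (\<forall>\<eta>. test_function \<eta> \<longrightarrow> (LINT x|lebesgue. gradient \<eta> x \<bullet> F x) = 0)"

type_synonym 'n coeff = "real ^ 'n \<Rightarrow> real ^ 'n ^ 'n"

definition Omega :: "real \<Rightarrow> 'n::finite coeff set" where
  "Omega lam = {a. a \<in> borel_measurable lebesgue \<and> (\<forall>x. transpose (a x) = a x) \<and>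
     (AE x in lebesgue. \<forall>\<xi>. \<xi> \<bullet> (a x *v \<xi>) \<ge> lam * (norm \<xi>)\<^sup>2 \<and> norm (a x *v \<xi>) \<le> norm \<xi>)}"

definition shift :: "real ^ 'n \<Rightarrow> 'n::finite coeff \<Rightarrow> 'n coeff" where
  "shift z a = (\<lambda>x. a (x + z))"

definition shift_measurable :: "'n::finite coeff measure \<Rightarrow> bool" where
  "shift_measurable M \<longleftrightarrow> (\<lambda>(z, a). shift z a) \<in> lebesgue \<Otimes>\<^sub>M M \<rightarrow>\<^sub>M M"

text \<open>The coefficient field is observable: its local averages are random variables.  This is
  implicit whenever one writes expectations of expressions in \<open>a\<close>; without it
  the trivial sigma-algebra would be admissible, whose random fields do not depend on \<open>a\<close> at
  all.  Joint measurability of \<open>(a, x) \<mapsto> a x\<close> implies it, but is not required, so that a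
  sigma-algebra that does not see null sets of \<open>x\<close> is covered as well.\<close>

definition coeff_measurable :: "'n::finite coeff measure \<Rightarrow> bool" where
  "coeff_measurable M \<longleftrightarrow>
     (\<forall>i j x r. r > 0 \<longrightarrow> (\<lambda>a. LINT y:cube x r|lebesgue. a y $ i $ j) \<in> borel_measurable M)"

definition stationary :: "'n::finite coeff measure \<Rightarrow> bool" where
  "stationary M \<longleftrightarrow> (\<forall>z (f :: 'n coeff \<Rightarrow> real). integrable M f \<longrightarrow>
     (LINT a|M. f (shift z a)) = (LINT a|M. f a))"

definition ergodic :: "'n::finite coeff measure \<Rightarrow> bool" where
  "ergodic M \<longleftrightarrow> (\<forall>f :: 'n coeff \<Rightarrow> real. integrable M f \<longrightarrow>
     (AE a in M. ((\<lambda>R. average (cube 0 R) (\<lambda>z. f (shift z a))) \<longlongrightarrow> (LINT a|M. f a)) at_top))"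

definition random_field ::
  "'n::finite coeff measure \<Rightarrow> ('n coeff \<Rightarrow> real ^ 'n \<Rightarrow> real) \<Rightarrow> bool" where
  "random_field M u \<longleftrightarrow> (\<lambda>(a, x). u a x) \<in> borel_measurable (M \<Otimes>\<^sub>M lebesgue)"

text \<open>Existence of the integral over \<open>Q\<close> of the shifted field is part of the shift identity.  It
  is spelled out because the integral of a non-integrable function is 0 by convention; on the
  other side of the identity almost sure integrability follows from the first moment bound.\<close>

definition stationary_field ::
  "'n::finite coeff measure \<Rightarrow> ('n coeff \<Rightarrow> real ^ 'n \<Rightarrow> real) \<Rightarrow> bool" where
  "stationary_field M u \<longleftrightarrow> random_field M u \<and>
     (\<forall>x r. r > 0 \<longrightarrow>
        (\<integral>\<^sup>+a. (\<integral>\<^sup>+y\<in>cube x r. ennreal \<bar>u a y\<bar> \<partial>lebesgue) \<partial>M) < \<infinity>) \<and>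
     (AE a in M. \<forall>x0 r x. r > 0 \<longrightarrow>
        set_integrable lebesgue (cube x0 r) (u (shift x a)) \<and>
        (LINT y:(\<lambda>q. x + q) ` cube x0 r|lebesgue. u a y)
          = (LINT y:cube x0 r|lebesgue. u (shift x a) y))"

definition same_field ::
  "'n::finite coeff measure \<Rightarrow> ('n coeff \<Rightarrow> real ^ 'n \<Rightarrow> real) \<Rightarrow>
    ('n coeff \<Rightarrow> real ^ 'n \<Rightarrow> real) \<Rightarrow> bool" where
  "same_field M u v \<longleftrightarrow> (AE a in M. AE x in lebesgue. u a x = v a x)"

text \<open>A jointly measurable version \<open>G\<close> of the gradient of \<open>\<phi>\<close> in the space variable; it is
  unique up to \<^const>\<open>same_field\<close> in each component.\<close>

definition gradient_field ::
  "'n::finite coeff measure \<Rightarrow> ('n coeff \<Rightarrow> real ^ 'n \<Rightarrow> real) \<Rightarrow>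
    ('n coeff \<Rightarrow> real ^ 'n \<Rightarrow> real ^ 'n) \<Rightarrow> bool" where
  "gradient_field M \<phi> G \<longleftrightarrow> (\<forall>i. random_field M (\<lambda>a x. G a x $ i)) \<and>
     (AE a in M. has_weak_gradient (\<phi> a) (G a))"

definition sublinear :: "(real ^ 'n \<Rightarrow> real) \<Rightarrow> bool" where
  "sublinear u \<longleftrightarrow>
     Limsup at_top (\<lambda>R. ereal (1 / R\<^sup>2 * average (cube 0 R) (\<lambda>y. \<bar>u y\<bar>\<^sup>2))) = 0"

definition anchored :: "(real ^ 'n \<Rightarrow> real) \<Rightarrow> bool" where
  "anchored u \<longleftrightarrow> (LINT y:unit_cube|lebesgue. u y) = 0"

definition is_corrector ::
  "real \<Rightarrow> 'n::finite coeff measure \<Rightarrow> real ^ 'n \<Rightarrow> ('n coeff \<Rightarrow> real ^ 'n \<Rightarrow> real) \<Rightarrow> bool" where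
  "is_corrector lam M \<xi> \<phi> \<longleftrightarrow> random_field M \<phi> \<and>
     (\<exists>G. gradient_field M \<phi> G \<and>
       (AE a in M. H1_loc (\<phi> a) \<and> distr_div_zero (\<lambda>x. a x *v (G a x + \<xi>)) \<and>
          sublinear (\<phi> a) \<and> anchored (\<phi> a)) \<and>
       (\<forall>i. stationary_field M (\<lambda>a x. G a x $ i)) \<and>
       (\<integral>\<^sup>+a. (\<integral>\<^sup>+y\<in>unit_cube. ennreal ((norm (G a y))\<^sup>2) \<partial>lebesgue) \<partial>M)
         \<le> ennreal ((1 - lam\<^sup>2) / lam\<^sup>2) *
            (\<integral>\<^sup>+a. (\<integral>\<^sup>+y\<in>unit_cube. ennreal ((norm (a y *v \<xi>))\<^sup>2) \<partial>lebesgue) \<partial>M) \<and>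
       (LINT a|M. (LINT y:unit_cube|lebesgue. G a y)) = 0)"

end

theory Submission
  imports Defs
begin

text \<open>Existence. Among the pairs \<open>(\<zeta>, h)\<close> of bounded functions on \<open>\<Omega>\<close> such that
  \<open>x \<mapsto> \<zeta>(\<tau>\<^sub>x a)\<close> is continuously differentiable with gradient \<open>h(\<tau>\<^sub>x a)\<close>, minimise the
  energy \<open>\<langle>(h + \<xi>) \<cdot> a(0) (h + \<xi>)\<rangle>\<close>; the point value \<open>a(0)\<close> makes sense as a limit of local averages.
  The parallelogram law makes a minimising sequence \<open>h\<^sub>n\<close> Cauchy in mean square.  Its limit \<open>g\<close> has mean
  zero, and Euler-Lagrange gives the energy bound.  Choosing the sequence to converge fast,
  \<open>\<zeta>\<^sub>n(\<tau>\<^sub>x a)\<close> minus its mean over the unit cube converges locally in mean square for almost every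
  \<open>a\<close>, by Poincare's inequality, to a potential \<open>\<phi>\<close> with gradient \<open>g(\<tau>\<^sub>x a)\<close>.  Testing Euler-Lagrange
  with mollified functions along orbits yields the equation.  Since \<open>\<zeta>\<^sub>n\<close> is bounded, Poincare and
  the ergodic theorem bound the oscillation of \<open>\<phi>\<close> on a cube of size \<open>R\<close> by \<open>o(R)\<close>, and summing over
  dyadic scales gives sublinearity.

  Uniqueness. The difference \<open>u\<close> of two correctors has a stationary gradient, solves the homogeneous
  equation and is sublinear, so by Caccioppoli's inequality the averages of \<open>\<bar>\<nabla>u\<bar>\<^sup>2\<close> over large cubes tend to
  zero.  By ergodicity they tend to \<open>\<langle>\<integral>\<bar>\<nabla>u\<bar>\<^sup>2\<rangle>\<close>, hence \<open>\<nabla>u = 0\<close>, and anchoring gives \<open>u = 0\<close>.\<close>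

subsection \<open>Lebesgue measure and cubes\<close>

text \<open>Measurability on the environment is weak: the map (a, x) \<mapsto> a x need not be
  jointly measurable, only averages over cubes are observable. Random objects are therefore explicit
  functions of the environment read along orbits, and limits such as \<open>g\<close> and
  \<open>potential\<close> are pointwise limits of rapidly converging sequences, so that joint
  measurability is inherited. The infimum of the energy need not be attained; an approximate
  Euler-Lagrange inequality, read off from a discriminant, takes the place of a minimiser.

  Exceptional sets need care, since there are uncountably many shifts and test functions. The
  equation is reduced to countably many mollifiers, and stationarity becomes an identity for all
  shifts by Lebesgue differentiation. In the uniqueness part the gradient of a competitor is not
  given as a function of the shifted environment; ergodicity is applied to its energy in the unit
  cube, which depends on \<open>a\<close> alone.

  Poincare's inequality is used for double integrals of squared differences: these ignore additive
  constants and pass to limits by Fatou's lemma.\<close>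

lemma sigma_finite_lebesgue: "sigma_finite_measure (lebesgue :: 'a::euclidean_space measure)"
proof -
  obtain F :: "'a set set" where F: "countable F" "F \<subseteq> sets lborel" "\<Union>F = space lborel"
      "\<forall>a\<in>F. emeasure lborel a \<noteq> \<infinity>"
    using sigma_finite_lborel[unfolded sigma_finite_measure_def] by blast
  show ?thesis
    unfolding sigma_finite_measure_def
    using F by (intro exI[of _ F]) (auto intro: sets_completionI_sets)
qed

interpretation lebesgue: sigma_finite_measure "lebesgue :: 'a::euclidean_space measure"
  by (rule sigma_finite_lebesgue)

interpretation lebesgue_pair: pair_sigma_finite
  "lebesgue :: 'a::euclidean_space measure" "lebesgue :: 'b::euclidean_space measure" ..

lemma continuous_on_imp_lebesgue_measurable:
  fixes f :: "'a::euclidean_space \<Rightarrow> 'b::topological_space"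
  assumes "continuous_on UNIV f"
  shows "f \<in> borel_measurable lebesgue"
  by (rule measurable_completion) (use borel_measurable_continuous_onI[OF assms] in simp)

lemma affine_lebesgue_measurable:
  fixes t :: "'a::euclidean_space"
  assumes "c \<noteq> 0"
  shows "(\<lambda>x. t + c *\<^sub>R x) \<in> lebesgue \<rightarrow>\<^sub>M lebesgue"
  using lebesgue_affine_measurable[of "\<lambda>_::'a. c" t] assms
  unfolding scaleR_scaleR[symmetric] scaleR_sum_right[symmetric] euclidean_representation by simp

lemma lebesgue_affine:
  fixes t :: "'a::euclidean_space"
  assumes "c \<noteq> 0"
  shows "lebesgue = density (distr lebesgue lebesgue (\<lambda>x. t + c *\<^sub>R x)) (\<lambda>_. ennreal (\<bar>c\<bar> ^ DIM('a)))"
  using lebesgue_affine_euclidean[of "\<lambda>_::'a. c" t] assms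
  unfolding scaleR_scaleR[symmetric] scaleR_sum_right[symmetric] euclidean_representation prod_constant
  by (simp add: ennreal_power)

lemma nn_integral_lebesgue_affine:
  fixes f :: "'a::euclidean_space \<Rightarrow> ennreal"
  assumes f[measurable]: "f \<in> borel_measurable lebesgue" and c: "c \<noteq> 0"
  shows "(\<integral>\<^sup>+x. f x \<partial>lebesgue) = ennreal (\<bar>c\<bar> ^ DIM('a)) * (\<integral>\<^sup>+x. f (t + c *\<^sub>R x) \<partial>lebesgue)"
proof -
  note [measurable] = affine_lebesgue_measurable[OF c, of t]
  show ?thesis
    by (subst lebesgue_affine[OF c, of t])
       (simp add: nn_integral_density nn_integral_distr nn_integral_cmult)
qed

lemma nn_integral_lebesgue_shift:
  fixes f :: "'a::euclidean_space \<Rightarrow> ennreal"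
  assumes "f \<in> borel_measurable lebesgue"
  shows "(\<integral>\<^sup>+x. f (x + t) \<partial>lebesgue) = (\<integral>\<^sup>+x. f x \<partial>lebesgue)"
  using nn_integral_lebesgue_affine[OF assms, of 1 t] by (simp add: add.commute)

lemma shift_lebesgue_measurable:
  fixes t :: "'a::euclidean_space"
  shows "(\<lambda>x. x + t) \<in> lebesgue \<rightarrow>\<^sub>M lebesgue"
  using affine_lebesgue_measurable[of 1 t] by (simp add: add.commute)

lemma distr_lebesgue_shift:
  fixes t :: "'a::euclidean_space"
  shows "distr lebesgue lebesgue (\<lambda>x. x + t) = lebesgue"
  using lebesgue_affine[of 1 t] by (simp add: add.commute density_1)

lemma integral_lebesgue_shift:
  fixes f :: "'a::euclidean_space \<Rightarrow> 'b::{banach, second_countable_topology}"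
  assumes "f \<in> borel_measurable lebesgue"
  shows "(LINT x|lebesgue. f (x + t)) = (LINT x|lebesgue. f x)"
  by (subst (2) distr_lebesgue_shift[symmetric, of t])
     (rule integral_distr[OF shift_lebesgue_measurable assms, symmetric])

lemma integrable_lebesgue_shift:
  fixes f :: "'a::euclidean_space \<Rightarrow> 'b::{banach, second_countable_topology}"
  assumes "integrable lebesgue f"
  shows "integrable lebesgue (\<lambda>x. f (x + t))"
  using integrable_distr[OF shift_lebesgue_measurable, of t f] assms by (simp add: distr_lebesgue_shift)

lemma cube_eq_box:
  fixes x :: "real ^ 'n"
  assumes "r > 0"
  shows "cube x r = box (x - vec (r / 2)) (x + vec (r / 2))"
proof -
  have "cube x r = {z. (1 / r) *\<^sub>R (z - x) \<in> unit_cube}"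
  proof (safe)
    fix z assume "z \<in> cube x r" then show "(1 / r) *\<^sub>R (z - x) \<in> unit_cube"
      using assms by (auto simp: cube_def)
  next
    fix z assume "(1 / r) *\<^sub>R (z - x) \<in> unit_cube"
    then show "z \<in> cube x r" using assms unfolding cube_def
      by (intro image_eqI[of _ _ "(1 / r) *\<^sub>R (z - x)"]) auto
  qed
  also have "\<dots> = box (x - vec (r / 2)) (x + vec (r / 2))"
    using assms by (auto simp: unit_cube_def mem_box_cart field_simps)
  finally show ?thesis .
qed

lemma mem_cube:
  fixes x :: "real ^ 'n"
  assumes "r > 0"
  shows "z \<in> cube x r \<longleftrightarrow> (\<forall>i. \<bar>z $ i - x $ i\<bar> < r / 2)"
  unfolding cube_eq_box[OF assms] mem_box_cart abs_less_iff
  by (intro iff_allI) (auto simp: algebra_simps)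

lemma unit_cube_eq: "unit_cube = (cube 0 1 :: (real ^ 'n) set)"
  by (simp add: cube_eq_box) (simp add: unit_cube_def vec_eq_iff, metis (no_types, lifting) vec_component vec_eq_iff vector_uminus_component)

lemma cube_sets [measurable, simp]: "cube x r \<in> sets lebesgue" if "r > 0" for x :: "real ^ 'n"
  by (simp add: cube_eq_box that)

lemma cube_borel: "cube x r \<in> sets borel" if "r > 0" for x :: "real ^ 'n"
  by (simp add: cube_eq_box that)

lemma unit_cube_sets [measurable, simp]: "(unit_cube :: (real ^ 'n) set) \<in> sets lebesgue"
  by (simp add: unit_cube_eq)

lemma emeasure_cube:
  fixes x :: "real ^ 'n"
  assumes "r > 0"
  shows "emeasure lebesgue (cube x r) = ennreal (r ^ CARD('n))"
proof -
  have "emeasure lebesgue (cube x r) = (\<Prod>b\<in>Basis. ennreal ((vec r :: real ^ 'n) \<bullet> b))"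
  proof -
    have le: "(x - vec (r / 2)) \<bullet> b \<le> (x + vec (r / 2)) \<bullet> b" if "b \<in> Basis" for b
      using that assms by (auto simp: Basis_vec_def inner_axis inner_simps)
    have eq: "(x + vec (r / 2) - (x - vec (r / 2))) \<bullet> b = (vec r :: real ^ 'n) \<bullet> b" if "b \<in> Basis" for b
      using that by (auto simp: Basis_vec_def inner_axis inner_simps)
    have "emeasure lebesgue (cube x r) = emeasure lborel (box (x - vec (r / 2)) (x + vec (r / 2)))"
      using assms by (simp add: cube_eq_box)
    also have "\<dots> = ennreal (\<Prod>b\<in>Basis. (x + vec (r / 2) - (x - vec (r / 2))) \<bullet> b)"
      using le by (rule emeasure_lborel_box)
    also have "\<dots> = ennreal (\<Prod>b\<in>Basis. (vec r :: real ^ 'n) \<bullet> b)"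
      using eq by (simp cong: prod.cong)
    also have "\<dots> = (\<Prod>b\<in>Basis. ennreal ((vec r :: real ^ 'n) \<bullet> b))"
      using assms by (intro prod_ennreal[symmetric]) (auto simp: Basis_vec_def inner_axis)
    finally show ?thesis .
  qed
  also have "\<dots> = (\<Prod>b\<in>(Basis :: (real ^ 'n) set). ennreal r)"
    by (intro prod.cong) (auto simp: Basis_vec_def inner_axis)
  finally show ?thesis using assms by (simp add: ennreal_power)
qed

lemma measure_cube:
  fixes x :: "real ^ 'n"
  assumes "r > 0"
  shows "measure lebesgue (cube x r) = r ^ CARD('n)"
  using emeasure_cube[OF assms, of x] assms by (simp add: measure_def)

lemma bounded_cube: "bounded (cube x r)" if "r > 0" for x :: "real ^ 'n"
  by (simp add: cube_eq_box that)

text \<open>The detour over the l1 norm costs a dimensional factor, which is harmless: only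
  proportionality to the side \<open>r\<close> matters.\<close>

lemma norm_cube_le:
  fixes z :: "real ^ 'n" and r :: real
  assumes "r > 0" "z \<in> cube x r"
  shows "norm (z - x) \<le> CARD('n) * r"
proof -
  have "norm (z - x) \<le> (\<Sum>i\<in>UNIV. \<bar>(z - x) $ i\<bar>)" by (rule norm_le_l1_cart)
  also have "\<dots> \<le> (\<Sum>i\<in>(UNIV::'n set). r)"
  proof (intro sum_mono)
    fix i
    have "\<bar>z $ i - x $ i\<bar> < r / 2" using assms by (simp add: mem_cube)
    then show "\<bar>(z - x) $ i\<bar> \<le> r" using assms(1) by (simp only: vector_minus_component)
  qed
  finally show ?thesis by simp
qed

lemma ball_subset_cube:
  fixes z :: "real ^ 'n"
  assumes "r > 0" "norm (z - x) < r / 2"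
  shows "z \<in> cube x r"
proof -
  have "\<bar>z $ i - x $ i\<bar> < r / 2" for i
    using component_le_norm_cart[of "z - x" i] assms(2) by simp
  then show ?thesis using assms(1) by (simp add: mem_cube)
qed

lemma bounded_subset_cube:
  fixes K :: "(real ^ 'n) set"
  assumes "bounded K"
  obtains k :: nat where "k > 0" "K \<subseteq> cube 0 (real k)"
proof -
  obtain B where B: "\<And>z. z \<in> K \<Longrightarrow> norm z \<le> B" using assms by (auto simp: bounded_iff)
  obtain k :: nat where k: "real k > 2 * (\<bar>B\<bar> + 1)" using reals_Archimedean2 by blast
  show thesis
  proof (rule that[of k])
    show "k > 0" using k by (cases k) auto
    show "K \<subseteq> cube 0 (real k)"
    proof
      fix z assume "z \<in> K" then have "norm z \<le> B" using B by auto
      then show "z \<in> cube 0 (real k)" using k \<open>k > 0\<close> by (intro ball_subset_cube) auto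
    qed
  qed
qed

lemma cube_mono: "cube 0 r \<subseteq> cube (0 :: real ^ 'n) s" if "0 < r" "r \<le> s"
proof
  fix z :: "real ^ 'n" assume "z \<in> cube 0 r"
  then have "\<bar>z $ i\<bar> < s / 2" for i using that(2) unfolding mem_cube[OF that(1)]
    by (smt (verit) divide_right_mono zero_index)
  then show "z \<in> cube 0 s" using that by (simp add: mem_cube)
qed

lemma translate_cube: "(\<lambda>q. x + q) ` cube x0 r = cube (x + x0 :: real ^ 'n) r"
  by (auto simp: cube_def image_image add.assoc)

subsection \<open>Square integrable functions\<close>

lemma norm_sq_add_le: "(norm (x + y))\<^sup>2 \<le> 2 * (norm x)\<^sup>2 + 2 * (norm (y::'a::real_inner))\<^sup>2"
proof -
  have "(norm (x + y))\<^sup>2 + (norm (x - y))\<^sup>2 = 2 * (norm x)\<^sup>2 + 2 * (norm y)\<^sup>2"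
    by (simp add: power2_norm_eq_inner inner_simps)
  then show ?thesis by (smt (verit) zero_le_power2)
qed

lemma norm_sq_diff_le: "(norm (x - y))\<^sup>2 \<le> 2 * (norm x)\<^sup>2 + 2 * (norm (y::'a::real_inner))\<^sup>2"
  using norm_sq_add_le[of x "- y"] by simp

text \<open>Young's inequality with a free weight \<open>s\<close>, by completing the square. The
  freedom in \<open>s\<close> serves both to absorb cross terms into a coercive term and to imitate
  Cauchy-Schwarz for integrals that may be infinite.\<close>

lemma two_mult_le_scaled:
  fixes a b s :: real
  assumes "s > 0"
  shows "\<bar>a * b\<bar> \<le> s / 2 * a\<^sup>2 + b\<^sup>2 / (2 * s)"
proof -
  have "0 \<le> (s * \<bar>a\<bar> - \<bar>b\<bar>)\<^sup>2 / (2 * s)" using assms by auto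
  also have "(s * \<bar>a\<bar> - \<bar>b\<bar>)\<^sup>2 / (2 * s) = s / 2 * a\<^sup>2 + b\<^sup>2 / (2 * s) - \<bar>a * b\<bar>"
    using assms by (simp add: power2_diff field_simps abs_mult power2_eq_square)
  finally show ?thesis by simp
qed

lemma norm_scaleR_le_scaled:
  fixes b :: "'a::real_normed_vector"
  assumes "s > 0"
  shows "norm (a *\<^sub>R b) \<le> s / 2 * a\<^sup>2 + (norm b)\<^sup>2 / (2 * s)"
  using two_mult_le_scaled[OF assms, of a "norm b"] by (simp add: abs_mult)

lemma nn_integral_mult_le_scaled:
  fixes f :: "'a \<Rightarrow> 'b::{second_countable_topology,real_normed_vector}"
  assumes [measurable]: "f \<in> borel_measurable N" "\<theta> \<in> borel_measurable N" and s: "s > (0::real)"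
  shows "(\<integral>\<^sup>+x. ennreal (norm (\<theta> x *\<^sub>R f x)) \<partial>N)
      \<le> ennreal (s / 2) * (\<integral>\<^sup>+x. ennreal ((\<theta> x)\<^sup>2) \<partial>N)
        + ennreal (1 / (2 * s)) * (\<integral>\<^sup>+x. ennreal ((norm (f x))\<^sup>2) \<partial>N)"
proof -
  have "(\<integral>\<^sup>+x. ennreal (norm (\<theta> x *\<^sub>R f x)) \<partial>N)
     \<le> (\<integral>\<^sup>+x. ennreal (s / 2) * ennreal ((\<theta> x)\<^sup>2) + ennreal (1 / (2 * s)) * ennreal ((norm (f x))\<^sup>2) \<partial>N)"
    using norm_scaleR_le_scaled[OF s] s
    by (intro nn_integral_mono) (simp add: ennreal_mult[symmetric] ennreal_plus[symmetric] del: ennreal_plus)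
  also have "\<dots> = ennreal (s / 2) * (\<integral>\<^sup>+x. ennreal ((\<theta> x)\<^sup>2) \<partial>N)
        + ennreal (1 / (2 * s)) * (\<integral>\<^sup>+x. ennreal ((norm (f x))\<^sup>2) \<partial>N)"
    by (simp add: nn_integral_add nn_integral_cmult)
  finally show ?thesis .
qed

lemma integrable_mult_square:
  fixes f :: "'a \<Rightarrow> 'b::{second_countable_topology,banach}"
  assumes [measurable]: "f \<in> borel_measurable N" "\<theta> \<in> borel_measurable N"
    and "(\<integral>\<^sup>+x. ennreal ((\<theta> x :: real)\<^sup>2) \<partial>N) < \<infinity>" "(\<integral>\<^sup>+x. ennreal ((norm (f x))\<^sup>2) \<partial>N) < \<infinity>"
  shows "integrable N (\<lambda>x. \<theta> x *\<^sub>R f x)"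
proof (rule integrableI_bounded)
  have "(\<integral>\<^sup>+x. ennreal (norm (\<theta> x *\<^sub>R f x)) \<partial>N)
      \<le> ennreal (1 / 2) * (\<integral>\<^sup>+x. ennreal ((\<theta> x)\<^sup>2) \<partial>N)
        + ennreal (1 / (2 * 1)) * (\<integral>\<^sup>+x. ennreal ((norm (f x))\<^sup>2) \<partial>N)"
    by (rule nn_integral_mult_le_scaled) auto
  also have "\<dots> < \<infinity>" using assms(3,4) by (auto intro!: ennreal_mult_less_top[THEN iffD2] simp del: ennreal_half)
  finally show "(\<integral>\<^sup>+x. ennreal (norm (\<theta> x *\<^sub>R f x)) \<partial>N) < \<infinity>" .
qed measurable

text \<open>Stands in for Cauchy-Schwarz: \<open>s\<close> is fixed first so that the term with
  \<open>T\<close> is below half the tolerance, after which \<open>D n\<close> is made small against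
  the then fixed factor 1/(2s).\<close>

lemma tendsto_zero_scaled_bound:
  fixes u :: "nat \<Rightarrow> ennreal" and T :: ennreal
  assumes bd: "\<And>s n. s > 0 \<Longrightarrow> u n \<le> ennreal (s / 2) * T + ennreal (1 / (2 * s)) * D n"
    and T: "T < \<infinity>" and D: "D \<longlonglongrightarrow> 0"
  shows "u \<longlonglongrightarrow> 0"
proof (rule order_tendstoI)
  fix e :: ennreal assume "0 < e"
  then obtain e' :: real where e': "0 < e'" "ennreal e' < e"
    by (metis dense ennreal_cases ennreal_less_zero_iff less_imp_le less_irrefl neq_top_trans not_less order.strict_trans top_neq_ennreal)
  obtain t where t: "T = ennreal t" "t \<ge> 0" using T by (cases T) auto
  \<comment> \<open>Adding 1 keeps the quotient meaningful when \<open>T\<close> vanishes.\<close>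
  define s where "s = e' / (t + 1)"
  have s: "s > 0" using e' t by (auto simp: s_def)
  have "s / 2 * t \<le> e' / 2" using e' t by (auto simp: s_def field_simps)
  then have 1: "ennreal (s / 2) * T \<le> ennreal (e' / 2)"
    using t s by (simp add: ennreal_mult[symmetric] ennreal_leI)
  have "(\<lambda>n. ennreal (1 / (2 * s)) * D n) \<longlonglongrightarrow> ennreal (1 / (2 * s)) * 0"
    by (intro tendsto_mult_ennreal tendsto_const D) auto
  then have "eventually (\<lambda>n. ennreal (1 / (2 * s)) * D n < ennreal (e' / 2)) sequentially"
    by (rule order_tendstoD(2)) (use e' in auto)
  then show "eventually (\<lambda>n. u n < e) sequentially"
  proof eventually_elim
    case (elim n)
    have "u n \<le> ennreal (e' / 2) + ennreal (e' / 2)"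
      using bd[OF s, of n] 1 elim by (meson add_mono less_imp_le order_trans)
    also have "\<dots> = ennreal e'" using e' by (simp add: ennreal_plus[symmetric] del: ennreal_plus)
    also note \<open>\<dots> < e\<close>
    finally show ?case .
  qed
qed auto

text \<open>Convergence in mean square allows the limit under an integral against a fixed square
  integrable weight; the passages to the limit in weak identities rest on this.\<close>

lemma L2_weak_limit:
  fixes f :: "nat \<Rightarrow> 'a \<Rightarrow> 'b::{second_countable_topology,banach}"
  assumes [measurable]: "\<And>n. f n \<in> borel_measurable N" "g \<in> borel_measurable N" "\<theta> \<in> borel_measurable N"
    and T: "(\<integral>\<^sup>+x. ennreal ((\<theta> x :: real)\<^sup>2) \<partial>N) < \<infinity>"
    and int: "\<And>n. integrable N (\<lambda>x. \<theta> x *\<^sub>R f n x)" "integrable N (\<lambda>x. \<theta> x *\<^sub>R g x)"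
    and lim: "(\<lambda>n. \<integral>\<^sup>+x. ennreal ((norm (f n x - g x))\<^sup>2) \<partial>N) \<longlonglongrightarrow> 0"
  shows "(\<lambda>n. LINT x|N. \<theta> x *\<^sub>R f n x) \<longlonglongrightarrow> (LINT x|N. \<theta> x *\<^sub>R g x)"
proof (rule tendsto_L1_int[OF int])
  have "(\<integral>\<^sup>+x. norm (\<theta> x *\<^sub>R f n x - \<theta> x *\<^sub>R g x) \<partial>N) =
    (\<integral>\<^sup>+x. ennreal (norm (\<theta> x *\<^sub>R (f n x - g x))) \<partial>N)" for n
    by (simp add: scaleR_right_diff_distrib)
  then show "(\<lambda>n. \<integral>\<^sup>+x. norm (\<theta> x *\<^sub>R f n x - \<theta> x *\<^sub>R g x) \<partial>N) \<longlonglongrightarrow> 0"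
    by (simp del: norm_scaleR) (rule tendsto_zero_scaled_bound[OF nn_integral_mult_le_scaled T lim]; measurable)
qed

lemma nn_integral_norm_sq_triangle:
  fixes f g :: "'a \<Rightarrow> 'b::{second_countable_topology,real_inner}"
  assumes [measurable]: "f \<in> borel_measurable N" "g \<in> borel_measurable N"
  shows "(\<integral>\<^sup>+x. ennreal ((norm (f x + g x))\<^sup>2) \<partial>N)
     \<le> 2 * (\<integral>\<^sup>+x. ennreal ((norm (f x))\<^sup>2) \<partial>N) + 2 * (\<integral>\<^sup>+x. ennreal ((norm (g x))\<^sup>2) \<partial>N)"
proof -
  have "(\<integral>\<^sup>+x. ennreal ((norm (f x + g x))\<^sup>2) \<partial>N)
    \<le> (\<integral>\<^sup>+x. 2 * ennreal ((norm (f x))\<^sup>2) + 2 * ennreal ((norm (g x))\<^sup>2) \<partial>N)"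
  proof (rule nn_integral_mono)
    fix x
    have "ennreal ((norm (f x + g x))\<^sup>2) \<le> ennreal (2 * (norm (f x))\<^sup>2 + 2 * (norm (g x))\<^sup>2)"
      by (intro ennreal_leI norm_sq_add_le)
    also have "\<dots> = 2 * ennreal ((norm (f x))\<^sup>2) + 2 * ennreal ((norm (g x))\<^sup>2)"
      by (simp add: ennreal_mult)
    finally show "ennreal ((norm (f x + g x))\<^sup>2) \<le> 2 * ennreal ((norm (f x))\<^sup>2) + 2 * ennreal ((norm (g x))\<^sup>2)" .
  qed
  also have "\<dots> = 2 * (\<integral>\<^sup>+x. ennreal ((norm (f x))\<^sup>2) \<partial>N) + 2 * (\<integral>\<^sup>+x. ennreal ((norm (g x))\<^sup>2) \<partial>N)"
    by (simp add: nn_integral_add nn_integral_cmult)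
  finally show ?thesis .
qed

section \<open>Rapid convergence in mean square\<close>

lemma norm_sq_telescope:
  fixes f :: "nat \<Rightarrow> 'a::real_inner"
  shows "(norm (f (n + k) - f n))\<^sup>2 \<le> (\<Sum>j<k. 2 ^ (Suc j) * (norm (f (n + Suc j) - f (n + j)))\<^sup>2)"
proof (induction k arbitrary: n)
  case 0 show ?case by simp
next
  case (Suc k)
  have "(norm (f (n + Suc k) - f n))\<^sup>2 = (norm ((f (Suc n) - f n) + (f (Suc n + k) - f (Suc n))))\<^sup>2"
    by simp
  \<comment> \<open>Each splitting of a square doubles what remains, so the factors accumulate to
    powers of 2 on the later increments.\<close>
  also have "\<dots> \<le> 2 * (norm (f (Suc n) - f n))\<^sup>2 + 2 * (norm (f (Suc n + k) - f (Suc n)))\<^sup>2"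
    by (rule norm_sq_add_le)
  also have "\<dots> \<le> 2 * (norm (f (Suc n) - f n))\<^sup>2 +
      2 * (\<Sum>j<k. 2 ^ (Suc j) * (norm (f (Suc n + Suc j) - f (Suc n + j)))\<^sup>2)"
    using Suc[of "Suc n"] by simp
  also have "\<dots> = (\<Sum>j<Suc k. 2 ^ (Suc j) * (norm (f (n + Suc j) - f (n + j)))\<^sup>2)"
    unfolding sum.lessThan_Suc_shift by (simp add: sum_distrib_left mult.assoc)
  finally show ?case .
qed

text \<open>The weights 2^n trade squares for first powers: by Young, an increment of norm d
  satisfies d \<le> (1/2)^n + 2^n d^2, so the increments are absolutely summable.\<close>

lemma fast_Cauchy_convergent:
  fixes f :: "nat \<Rightarrow> 'a::{real_inner,banach}"
  assumes "summable (\<lambda>n. 2 ^ n * (norm (f (Suc n) - f n))\<^sup>2)"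
  shows "convergent f"
proof -
  have "norm (norm (f (Suc n) - f n)) \<le> (1/2) ^ n + 2 ^ n * (norm (f (Suc n) - f n))\<^sup>2" for n
  proof -
    have "\<bar>1 * norm (f (Suc n) - f n)\<bar> \<le> (1/2^n) / 2 * 1\<^sup>2 + (norm (f (Suc n) - f n))\<^sup>2 / (2 * (1/2^n))"
      by (rule two_mult_le_scaled) auto
    also have "\<dots> \<le> (1/2) ^ n + 2 ^ n * (norm (f (Suc n) - f n))\<^sup>2"
      by (intro add_mono) (auto simp: power_divide mult.commute divide_simps)
    finally show ?thesis by simp
  qed
  moreover have "summable (\<lambda>n. (1/2::real) ^ n + 2 ^ n * (norm (f (Suc n) - f n))\<^sup>2)"
    using assms by (intro summable_add summable_geometric) auto
  ultimately have "summable (\<lambda>n. norm (f (Suc n) - f n))"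
    by - (rule summable_comparison_test'[where N = 0], auto)
  then have "summable (\<lambda>n. f (Suc n) - f n)" by (rule summable_norm_cancel)
  then have "convergent (\<lambda>n. \<Sum>i<n. f (Suc i) - f i)"
    by (simp add: summable_iff_convergent)
  then have "convergent (\<lambda>n. f n - f 0)" by (simp add: sum_lessThan_telescope)
  then have "convergent (\<lambda>n. (f n - f 0) + f 0)" by (intro convergent_add convergent_const)
  then show ?thesis by simp
qed

text \<open>Riesz-Fischer with the limit given by the formula \<open>lim\<close> instead of an
  existence statement. The same expression then serves on all domains at once, and its measurability
  in further parameters is immediate.\<close>

lemma L2_fast_limit:
  fixes f :: "nat \<Rightarrow> 'a \<Rightarrow> 'b::{second_countable_topology,real_inner,banach}"
  assumes [measurable]: "\<And>n. f n \<in> borel_measurable N"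
    and fin: "(\<Sum>n. 2 ^ n * (\<integral>\<^sup>+x. ennreal ((norm (f (Suc n) x - f n x))\<^sup>2) \<partial>N)) < \<infinity>"
  shows "AE x in N. (\<lambda>n. f n x) \<longlonglongrightarrow> lim (\<lambda>n. f n x)" (is ?A)
    and "(\<lambda>n. \<integral>\<^sup>+x. ennreal ((norm (f n x - lim (\<lambda>n. f n x)))\<^sup>2) \<partial>N) \<longlonglongrightarrow> 0" (is ?B)
proof -
  let ?d = "\<lambda>n x. (norm (f (Suc n) x - f n x))\<^sup>2"
  define S where "S = (\<Sum>n. 2 ^ n * (\<integral>\<^sup>+x. ennreal (?d n x) \<partial>N))"
  have eq: "ennreal (2 ^ n * ?d n x) = 2 ^ n * ennreal (?d n x)" for n x
    by (simp add: ennreal_mult ennreal_power[symmetric])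
  have Seq: "(\<integral>\<^sup>+x. (\<Sum>n. ennreal (2 ^ n * ?d n x)) \<partial>N) = S"
    unfolding S_def eq by (subst nn_integral_suminf) (auto simp: nn_integral_cmult)
  have "AE x in N. (\<Sum>n. ennreal (2 ^ n * ?d n x)) \<noteq> \<infinity>"
    by (rule nn_integral_noteq_infinite) (use fin in \<open>auto simp: Seq S_def\<close>)
  then show A: ?A
  proof eventually_elim
    case (elim x)
    then have "summable (\<lambda>n. 2 ^ n * ?d n x)"
      by (intro summable_suminf_not_top) auto
    then have "convergent (\<lambda>n. f n x)" by (rule fast_Cauchy_convergent)
    then show ?case by (simp add: convergent_LIMSEQ_iff)
  qed
  \<comment> \<open>The telescoping weight 2^(j+1) equals 2/2^n times the weight 2^(n+j) of the
    series, which yields a rate.\<close>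
  have bd: "(\<integral>\<^sup>+x. ennreal ((norm (f n x - f (n + k) x))\<^sup>2) \<partial>N) \<le> ennreal (2 / 2 ^ n) * S" for n k
  proof -
    have "(norm (f n x - f (n + k) x))\<^sup>2 \<le> (\<Sum>j<k. 2 / 2 ^ n * (2 ^ (n + j) * ?d (n + j) x))" for x
      using norm_sq_telescope[of "\<lambda>i. f i x" n k] by (simp add: power_add norm_minus_commute mult.assoc)
    then have "(\<integral>\<^sup>+x. ennreal ((norm (f n x - f (n + k) x))\<^sup>2) \<partial>N)
      \<le> (\<integral>\<^sup>+x. (\<Sum>j<k. ennreal (2 / 2 ^ n) * (2 ^ (n + j) * ennreal (?d (n + j) x))) \<partial>N)"
    proof (intro nn_integral_mono)
      fix x assume *: "\<And>x. (norm (f n x - f (n + k) x))\<^sup>2 \<le> (\<Sum>j<k. 2 / 2 ^ n * (2 ^ (n + j) * ?d (n + j) x))"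
      have "ennreal ((norm (f n x - f (n + k) x))\<^sup>2) \<le> ennreal (\<Sum>j<k. 2 / 2 ^ n * (2 ^ (n + j) * ?d (n + j) x))"
        using * by (rule ennreal_leI)
      also have "\<dots> = (\<Sum>j<k. ennreal (2 / 2 ^ n * (2 ^ (n + j) * ?d (n + j) x)))"
        by (rule sum_ennreal[symmetric]) auto
      also have "\<dots> = (\<Sum>j<k. ennreal (2 / 2 ^ n) * (2 ^ (n + j) * ennreal (?d (n + j) x)))"
        by (intro sum.cong refl) (subst ennreal_mult; simp add: eq del: power_add)
      finally show "ennreal ((norm (f n x - f (n + k) x))\<^sup>2)
        \<le> (\<Sum>j<k. ennreal (2 / 2 ^ n) * (2 ^ (n + j) * ennreal (?d (n + j) x)))" .
    qed
    also have "\<dots> = ennreal (2 / 2 ^ n) * (\<Sum>j<k. 2 ^ (n + j) * (\<integral>\<^sup>+x. ennreal (?d (n + j) x) \<partial>N))"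
      by (simp add: nn_integral_sum nn_integral_cmult sum_distrib_left)
    also have "(\<Sum>j<k. 2 ^ (n + j) * (\<integral>\<^sup>+x. ennreal (?d (n + j) x) \<partial>N))
      = (\<Sum>j\<in>{n..<n+k}. 2 ^ j * (\<integral>\<^sup>+x. ennreal (?d j x) \<partial>N))"
      by (rule sum.reindex_bij_witness[of _ "\<lambda>j. j - n" "\<lambda>j. n + j"]) auto
    also have "\<dots> \<le> S" unfolding S_def by (rule sum_le_suminf) auto
    finally show ?thesis by (simp add: mult_left_mono)
  qed
  \<comment> \<open>Fatou's lemma as the second index tends to infinity.\<close>
  have bd2: "(\<integral>\<^sup>+x. ennreal ((norm (f n x - lim (\<lambda>n. f n x)))\<^sup>2) \<partial>N) \<le> ennreal (2 / 2 ^ n) * S" for n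
  proof -
    have "(\<integral>\<^sup>+x. ennreal ((norm (f n x - lim (\<lambda>n. f n x)))\<^sup>2) \<partial>N)
      \<le> (\<integral>\<^sup>+x. liminf (\<lambda>k. ennreal ((norm (f n x - f (n + k) x))\<^sup>2)) \<partial>N)"
    proof (rule nn_integral_mono_AE)
      show "AE x in N. ennreal ((norm (f n x - lim (\<lambda>n. f n x)))\<^sup>2) \<le> liminf (\<lambda>k. ennreal ((norm (f n x - f (n + k) x))\<^sup>2))"
        using A
      proof eventually_elim
        case (elim x)
        then have "(\<lambda>k. f (n + k) x) \<longlonglongrightarrow> lim (\<lambda>n. f n x)"
          using LIMSEQ_ignore_initial_segment[of "\<lambda>n. f n x" _ n] by (simp add: add.commute)
        then have "(\<lambda>k. ennreal ((norm (f n x - f (n + k) x))\<^sup>2)) \<longlonglongrightarrow> ennreal ((norm (f n x - lim (\<lambda>n. f n x)))\<^sup>2)"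
          by (intro tendsto_intros)
        then have "liminf (\<lambda>k. ennreal ((norm (f n x - f (n + k) x))\<^sup>2)) = ennreal ((norm (f n x - lim (\<lambda>n. f n x)))\<^sup>2)"
          by (intro lim_imp_Liminf) auto
        then show ?case by (simp only: order_refl)
      qed
    qed
    also have "\<dots> \<le> liminf (\<lambda>k. \<integral>\<^sup>+x. ennreal ((norm (f n x - f (n + k) x))\<^sup>2) \<partial>N)"
      by (rule nn_integral_liminf) measurable
    also have "\<dots> \<le> ennreal (2 / 2 ^ n) * S"
      by (intro Liminf_le always_eventually allI bd) auto
    finally show ?thesis .
  qed
  show ?B
  proof (rule tendsto_sandwich[OF _ _ tendsto_const])
    have "(\<lambda>n. ennreal (2 / 2 ^ n)) \<longlonglongrightarrow> ennreal 0"
      by (intro tendsto_ennrealI LIMSEQ_divide_realpow_zero) auto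
    then have "(\<lambda>n. ennreal (2 / 2 ^ n) * S) \<longlonglongrightarrow> ennreal 0 * S"
      using fin by (intro tendsto_mult_ennreal) (auto simp: S_def)
    then show "(\<lambda>n. ennreal (2 / 2 ^ n) * S) \<longlonglongrightarrow> 0" by simp
  qed (auto simp: bd2)
qed

subsection \<open>Smooth bump functions\<close>

text \<open>The flat functions p(1/t) exp(-1/t), extended by zero. The polynomial factor is there
  because differentiation produces one.\<close>

definition exp_poly :: "real poly \<Rightarrow> real \<Rightarrow> real" where
  "exp_poly p t = (if t > 0 then poly p (1 / t) * exp (- (1 / t)) else 0)"


lemma poly_mult_exp_tendsto_0: "((\<lambda>x. poly p x * exp (- x)) \<longlongrightarrow> (0::real)) at_top"
proof (induction p)
  case 0 show ?case by simp
next
  case (pCons c p)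
  have "((\<lambda>x. c * exp (- x) + x * (poly p x * exp (- x))) \<longlongrightarrow> c * 0 + 0) at_top"
  proof (intro tendsto_add tendsto_mult tendsto_const)
    show "((\<lambda>x::real. exp (- x)) \<longlongrightarrow> 0) at_top"
      by (rule filterlim_compose[OF exp_at_bot filterlim_uminus_at_bot_at_top])
    have "((\<lambda>x. \<Sum>i\<le>degree p. coeff p i * (x ^ Suc i / exp x)) \<longlongrightarrow> (\<Sum>i\<le>degree p. coeff p i * 0)) at_top"
      by (intro tendsto_sum tendsto_mult tendsto_const tendsto_power_div_exp_0)
    then show "((\<lambda>x. x * (poly p x * exp (- x))) \<longlongrightarrow> 0) at_top"
      by (simp add: poly_altdef sum_distrib_left sum_distrib_right exp_minus field_simps)
  qed
  then show ?case by (simp add: algebra_simps)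
qed

text \<open>For positive t the chain rule turns p(1/t) exp(-1/t) into X^2 (p - p') at 1/t times the
  exponential; \<open>[:0, 0, 1:]\<close> is X^2. At the origin the right difference quotient is
  again a polynomial in 1/t times the exponential and tends to zero.\<close>

lemma exp_poly_has_derivative:
  "(exp_poly p has_real_derivative exp_poly ([:0, 0, 1:] * (p - pderiv p)) t) (at t)"
proof -
  consider "t > 0" | "t < 0" | "t = 0" by linarith
  then show ?thesis
  proof cases
    case 1
    have "((\<lambda>t. poly p (1 / t) * exp (- (1 / t))) has_real_derivative exp_poly ([:0, 0, 1:] * (p - pderiv p)) t) (at t)"
      using 1 by (auto intro!: derivative_eq_intros simp: exp_poly_def power2_eq_square field_simps)
    then show ?thesis
      by (rule DERIV_cong_ev[OF refl _ refl, THEN iffD1, rotated])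
         (use 1 in \<open>auto simp: exp_poly_def intro: eventually_mono[OF eventually_nhds_in_open[of "{0<..}" t]]\<close>)
  next
    case 2
    have "((\<lambda>t. 0) has_real_derivative exp_poly ([:0, 0, 1:] * (p - pderiv p)) t) (at t)"
      using 2 by (auto simp: exp_poly_def)
    then show ?thesis
      by (rule DERIV_cong_ev[OF refl _ refl, THEN iffD1, rotated])
         (use 2 in \<open>auto simp: exp_poly_def intro: eventually_mono[OF eventually_nhds_in_open[of "{..<0}" t]]\<close>)
  next
    case 3
    have "((\<lambda>h. exp_poly p h / h) \<longlongrightarrow> 0) (at 0)"
    proof (subst filterlim_at_split, intro conjI)
      show "((\<lambda>h. exp_poly p h / h) \<longlongrightarrow> 0) (at_left 0)"
        by (rule tendsto_eventually) (auto simp: eventually_at_filter exp_poly_def)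
      have "((\<lambda>h. poly (pCons 0 p) (inverse h) * exp (- inverse h)) \<longlongrightarrow> 0) (at_right 0)"
        by (rule filterlim_compose[OF poly_mult_exp_tendsto_0 filterlim_inverse_at_top_right])
      then show "((\<lambda>h. exp_poly p h / h) \<longlongrightarrow> 0) (at_right 0)"
        by (rule Lim_transform_eventually) (auto simp: eventually_at_filter exp_poly_def field_simps)
    qed
    then show ?thesis using 3 by (simp add: DERIV_def exp_poly_def)
  qed
qed

text \<open>This class contains the bump functions below and is closed under partial derivatives.\<close>

inductive bump_algebra :: "(real ^ 'n::finite \<Rightarrow> real) \<Rightarrow> bool" where
  gen: "bump_algebra (\<lambda>x. exp_poly p (1 + s * x $ i))"
| const: "bump_algebra (\<lambda>x. c)"
| add: "bump_algebra f \<Longrightarrow> bump_algebra g \<Longrightarrow> bump_algebra (\<lambda>x. f x + g x)"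
| mult: "bump_algebra f \<Longrightarrow> bump_algebra g \<Longrightarrow> bump_algebra (\<lambda>x. f x * g x)"

text \<open>Differentiability is proved together with membership of the partial derivatives in the
  class, so that iteration reaches all orders.\<close>

lemma bump_algebra_derivative:
  "bump_algebra f \<Longrightarrow> \<exists>g. (\<forall>i. bump_algebra (g i)) \<and> 
     (\<forall>x. (f has_derivative (\<lambda>v. \<Sum>i\<in>UNIV. g i x * v $ i)) (at x))"
proof (induction rule: bump_algebra.induct)
  case (gen p s i)
  let ?q = "[:0, 0, 1:] * (p - pderiv p)"
  show ?case
  proof (intro exI[of _ "\<lambda>j x. (if j = i then s else 0) * exp_poly ?q (1 + s * x $ i)"] conjI allI)
    fix x :: "real ^ 'a"
    have "((\<lambda>x. exp_poly p (1 + s * x $ i)) has_derivative (\<lambda>v. (s * v $ i) * exp_poly ?q (1 + s * x $ i))) (at x)"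
      by (rule has_derivative_compose[OF _ exp_poly_has_derivative[unfolded has_field_derivative_def], THEN has_derivative_eq_rhs])
         (auto intro!: derivative_eq_intros bounded_linear.has_derivative[OF bounded_linear_vec_nth] simp: fun_eq_iff)
    moreover have "(\<lambda>v. (s * v $ i) * exp_poly ?q (1 + s * x $ i)) =
      (\<lambda>v::real ^ 'a. \<Sum>j\<in>UNIV. (if j = i then s else 0) * exp_poly ?q (1 + s * x $ i) * v $ j)"
      by (simp add: fun_eq_iff if_distrib[of "\<lambda>z. z * _"] sum.delta cong: if_cong)
    ultimately show "((\<lambda>x. exp_poly p (1 + s * x $ i)) has_derivative
      (\<lambda>v. \<Sum>j\<in>UNIV. (if j = i then s else 0) * exp_poly ?q (1 + s * x $ i) * v $ j)) (at x)"
      by simp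
  qed (intro bump_algebra.intros)
next
  case (const c)
  show ?case by (intro exI[of _ "\<lambda>j x. 0"]) (auto intro: bump_algebra.const)
next
  case (add f g)
  then obtain f' g' where "\<And>i. bump_algebra (f' i)" "\<And>i. bump_algebra (g' i)"
    and d: "\<And>x. (f has_derivative (\<lambda>v. \<Sum>i\<in>UNIV. f' i x * v $ i)) (at x)"
      "\<And>x. (g has_derivative (\<lambda>v. \<Sum>i\<in>UNIV. g' i x * v $ i)) (at x)" by blast
  then show ?case
    by (intro exI[of _ "\<lambda>i x. f' i x + g' i x"] conjI allI bump_algebra.add has_derivative_eq_rhs[OF has_derivative_add[OF d]])
       (auto simp: sum.distrib algebra_simps)
next
  case (mult f g)
  then obtain f' g' where "\<And>i. bump_algebra (f' i)" "\<And>i. bump_algebra (g' i)"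
    and d: "\<And>x. (f has_derivative (\<lambda>v. \<Sum>i\<in>UNIV. f' i x * v $ i)) (at x)"
      "\<And>x. (g has_derivative (\<lambda>v. \<Sum>i\<in>UNIV. g' i x * v $ i)) (at x)" by blast
  with mult.hyps show ?case
    by (intro exI[of _ "\<lambda>i x. f x * g' i x + f' i x * g x"] conjI allI bump_algebra.intros has_derivative_eq_rhs[OF has_derivative_mult[OF d]])
       (auto simp: sum.distrib sum_distrib_left sum_distrib_right algebra_simps)
qed

lemma partial_deriv_eq:
  assumes "(f has_derivative f') (at x)"
  shows "partial_deriv i f x = f' (axis i 1)"
  unfolding partial_deriv_def using frechet_derivative_at[OF assms] by simp

lemma bump_algebra_smooth:
  fixes f :: "real ^ 'n \<Rightarrow> real"
  assumes "bump_algebra f"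
  shows "smooth f"
proof -
  have "bump_algebra (foldr partial_deriv is f)" for "is" :: "'n list"
  proof (induction "is")
    case Nil then show ?case using assms by simp
  next
    case (Cons i "is")
    then obtain g where g: "\<And>i. bump_algebra (g i)"
      "\<And>x. (foldr partial_deriv is f has_derivative (\<lambda>v. \<Sum>i\<in>UNIV. g i x * v $ i)) (at x)"
      using bump_algebra_derivative by blast
    have "partial_deriv i (foldr partial_deriv is f) = g i"
      by (rule ext) (simp add: partial_deriv_eq[OF g(2)] axis_def if_distrib sum.delta cong: if_cong)
    then show ?case using g(1) by simp
  qed
  then show ?thesis unfolding smooth_def differentiable_def
    using bump_algebra_derivative by blast
qed

lemma bump_algebra_prod:
  "finite I \<Longrightarrow> (\<And>i. i \<in> I \<Longrightarrow> bump_algebra (f i)) \<Longrightarrow> bump_algebra (\<lambda>x. \<Prod>i\<in>I. f i x)"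
  by (induction rule: finite_induct) (auto intro: bump_algebra.intros)

text \<open>A product over coordinates, so that for positive \<open>s\<close> it is nonzero exactly
  on the open cube of side 2/s about the origin.\<close>

definition bump :: "real \<Rightarrow> real ^ 'n::finite \<Rightarrow> real" where
  "bump s x = (\<Prod>i\<in>UNIV. exp_poly 1 (1 + s * x $ i) * exp_poly 1 (1 + (- s) * x $ i))"

lemma bump_algebra_bump: "bump_algebra (bump s)"
  unfolding bump_def by (intro bump_algebra_prod bump_algebra.intros) auto

lemma bump_nonneg: "bump s x \<ge> 0"
  unfolding bump_def by (intro prod_nonneg) (auto simp: exp_poly_def)

lemma bump_eq_0:
  assumes "s > 0" "\<bar>x $ i\<bar> \<ge> 1 / s"
  shows "bump s x = 0"
proof -
  have "exp_poly 1 (1 + s * x $ i) * exp_poly 1 (1 + (- s) * x $ i) = 0"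
    using assms by (auto simp: exp_poly_def abs_if field_simps split: if_splits)
  then show ?thesis unfolding bump_def by (intro prod_zero) auto
qed

lemma bump_zero_pos: "bump s 0 > 0"
  unfolding bump_def by (intro prod_pos) (auto simp: exp_poly_def)

text \<open>Inside the unit cube every 1 + x_i and 1 - x_i exceeds 1/2, so each of the two
  exponential factors per coordinate is at least exp(-2).\<close>

lemma bump_lower_bound:
  fixes x :: "real ^ 'n"
  assumes "x \<in> cube 0 1"
  shows "bump 1 x \<ge> exp (- 4) ^ CARD('n)"
proof -
  have le: "exp (-2) \<le> exp_poly 1 t" if "t \<ge> 1/2" for t
    using that by (auto simp: exp_poly_def field_simps)
  have "(\<Prod>i\<in>(UNIV :: 'n set). exp (-2) * exp (-2)) \<le> bump 1 x"
    unfolding bump_def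
  proof (intro prod_mono conjI mult_mono le)
    fix i
    have "\<bar>x $ i\<bar> < 1 / 2" using assms by (auto simp: mem_cube)
    then show "1 / 2 \<le> 1 + 1 * x $ i" "1 / 2 \<le> 1 + - 1 * x $ i" by auto
  qed (auto simp: exp_poly_def)
  then show ?thesis by (simp add: mult_exp_exp)
qed

lemma smoothI_partial:
  "smooth f \<Longrightarrow> smooth (partial_deriv i f)"
  unfolding smooth_def
proof (intro allI)
  fix "is" x assume *: "\<forall>is x. foldr partial_deriv is f differentiable (at x)"
  \<comment> \<open>\<open>foldr\<close> applies the last index first, so one more initial
    derivative is an index appended at the end.\<close>
  show "foldr partial_deriv is (partial_deriv i f) differentiable (at x)"
    using *[rule_format, of "is @ [i]"] by simp
qed

lemma smooth_differentiable: "smooth f \<Longrightarrow> f differentiable (at x)"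
  unfolding smooth_def by (metis foldr.simps(1) id_apply)

lemma smooth_has_derivative:
  assumes "smooth f"
  shows "(f has_derivative (\<lambda>v. gradient f x \<bullet> v)) (at x)"
proof -
  have d: "(f has_derivative frechet_derivative f (at x)) (at x)"
    using smooth_differentiable[OF assms] frechet_derivative_works by blast
  interpret bounded_linear "frechet_derivative f (at x)" using d has_derivative_bounded_linear by blast
  have "frechet_derivative f (at x) v = gradient f x \<bullet> v" for v
  proof -
    have "v = (\<Sum>i\<in>UNIV. v $ i *\<^sub>R axis i 1)" by (simp add: basis_expansion scalar_mult_eq_scaleR[symmetric])
    from arg_cong[OF this, of "frechet_derivative f (at x)"]
    have "frechet_derivative f (at x) v = (\<Sum>i\<in>UNIV. v $ i * frechet_derivative f (at x) (axis i 1))"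
      by (simp only: sum scaleR real_scaleR_def)
    then show ?thesis by (simp add: gradient_def partial_deriv_def inner_vec_def mult.commute)
  qed
  then have "frechet_derivative f (at x) = (\<lambda>v. gradient f x \<bullet> v)" by (rule ext)
  then show ?thesis using d by simp
qed

subsection \<open>Compactly supported functions and convolution\<close>

definition Cc :: "('a::euclidean_space \<Rightarrow> 'b::euclidean_space) \<Rightarrow> bool" where
  "Cc k \<longleftrightarrow> continuous_on UNIV k \<and> (\<exists>r. \<forall>x. norm x \<ge> r \<longrightarrow> k x = 0)"

text \<open>A function bundled with its gradient. The class is wider than that of the smooth test
  functions and admits products with C^1 functions such as squared cut-offs; weak identities are
  carried over to it by mollification.\<close>

definition C1c :: "('a::euclidean_space \<Rightarrow> real) \<Rightarrow> ('a \<Rightarrow> 'a) \<Rightarrow> bool" where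
  "C1c \<eta> g \<longleftrightarrow> Cc \<eta> \<and> Cc g \<and> (\<forall>x. (\<eta> has_derivative (\<lambda>v. g x \<bullet> v)) (at x))"

lemma Cc_support:
  assumes "Cc k"
  obtains r where "r > 0" "\<And>x. norm x \<ge> r \<Longrightarrow> k x = 0"
proof -
  obtain r where r: "\<forall>x. norm x \<ge> r \<longrightarrow> k x = 0" using assms by (auto simp: Cc_def)
  show thesis by (rule that[of "max r 1"]) (use r in auto)
qed

lemma Cc_measurable [measurable_dest]: "Cc k \<Longrightarrow> k \<in> borel_measurable borel"
  by (simp add: Cc_def borel_measurable_continuous_onI)

lemma Cc_lebesgue_measurable: "Cc k \<Longrightarrow> k \<in> borel_measurable lebesgue"
  by (simp add: Cc_def continuous_on_imp_lebesgue_measurable)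

lemma Cc_bounded:
  assumes "Cc k"
  obtains B where "B > 0" "\<And>x. norm (k x) \<le> B"
proof -
  obtain r where r: "r > 0" "\<And>x. norm x \<ge> r \<Longrightarrow> k x = 0" using Cc_support[OF assms] by blast
  have "compact (k ` cball 0 r)"
    using assms by (intro compact_continuous_image) (auto simp: Cc_def intro: continuous_on_subset)
  then obtain B where B: "\<And>x. x \<in> cball 0 r \<Longrightarrow> norm (k x) \<le> B"
    by (meson bounded_iff compact_imp_bounded imageI)
  have "norm (k x) \<le> max B 1" for x
    by (cases "norm x \<ge> r") (use r B[of x] in auto)
  then show thesis using that[of "max B 1"] by auto
qed

lemma Cc_uniformly_continuous:
  assumes "Cc k" "e > 0"
  obtains d where "d > 0" "\<And>x y. norm (x - y) < d \<Longrightarrow> norm (k x - k y) < e"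
proof -
  obtain r where r: "r > 0" "\<And>x. norm x \<ge> r \<Longrightarrow> k x = 0" using Cc_support[OF assms(1)] by blast
  have "uniformly_continuous_on (cball 0 (r + 1)) k"
    using assms by (intro compact_uniformly_continuous) (auto simp: Cc_def intro: continuous_on_subset)
  then obtain d where d: "d > 0" "\<And>x y. x \<in> cball 0 (r + 1) \<Longrightarrow> y \<in> cball 0 (r + 1) \<Longrightarrow> dist y x < d \<Longrightarrow> dist (k y) (k x) < e"
    using assms(2) unfolding uniformly_continuous_on_def by metis
  have "norm (k x - k y) < e" if "norm (x - y) < min d 1" for x y
  proof (cases "x \<in> cball 0 (r + 1) \<and> y \<in> cball 0 (r + 1)")
    case True then show ?thesis using d(2)[of y x] that by (auto simp: dist_norm)
  next
    case False
    have "norm x \<le> norm y + norm (x - y)" "norm y \<le> norm x + norm (x - y)"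
      using norm_triangle_sub[of x y] norm_triangle_sub[of y x] by (auto simp: norm_minus_commute)
    then have "norm x \<ge> r" "norm y \<ge> r" using False that by auto
    then show ?thesis using r assms(2) by simp
  qed
  then show thesis using that[of "min d 1"] d(1) by auto
qed

lemma Cc_reflect:
  assumes "Cc k" shows "Cc (\<lambda>y. k (x - y))"
proof -
  obtain r where r: "r > 0" "\<And>x. norm x \<ge> r \<Longrightarrow> k x = 0" using Cc_support[OF assms] by blast
  have "k (x - y) = 0" if "norm y \<ge> norm x + r" for y
    using r(2)[of "x - y"] that norm_triangle_ineq2[of y x] by (simp add: norm_minus_commute)
  moreover have "continuous_on UNIV (\<lambda>y. k (x - y))"
    using assms unfolding Cc_def by (auto intro!: continuous_on_compose2[of UNIV k] continuous_intros)
  ultimately show ?thesis unfolding Cc_def by blast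
qed

lemma Cc_translate:
  assumes "Cc k" shows "Cc (\<lambda>y. k (y - x))"
proof -
  obtain r where r: "r > 0" "\<And>x. norm x \<ge> r \<Longrightarrow> k x = 0" using Cc_support[OF assms] by blast
  have "k (y - x) = 0" if "norm y \<ge> norm x + r" for y
    using r(2)[of "y - x"] that norm_triangle_ineq2[of y x] by simp
  moreover have "continuous_on UNIV (\<lambda>y. k (y - x))"
    using assms unfolding Cc_def by (auto intro!: continuous_on_compose2[of UNIV k] continuous_intros)
  ultimately show ?thesis unfolding Cc_def by blast
qed

lemma Cc_nth: "Cc k \<Longrightarrow> Cc (\<lambda>y. k y $ i)" for k :: "'a::euclidean_space \<Rightarrow> real ^ 'n"
  unfolding Cc_def by (auto intro!: continuous_intros) (metis zero_index)

lemma C1cD: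
  assumes "C1c \<eta> g"
  shows "Cc \<eta>" "Cc g" "(\<eta> has_derivative (\<lambda>v. g x \<bullet> v)) (at x)"
  using assms by (auto simp: C1c_def)

lemma C1c_reflect:
  assumes "C1c \<eta> g" shows "C1c (\<lambda>y. \<eta> (x - y)) (\<lambda>y. - g (x - y))"
  unfolding C1c_def
proof (intro conjI allI)
  show "Cc (\<lambda>y. \<eta> (x - y))" using assms by (intro Cc_reflect C1cD)
  have "Cc (\<lambda>y. g (x - y))" using assms by (intro Cc_reflect C1cD)
  then show "Cc (\<lambda>y. - g (x - y))" unfolding Cc_def by (auto intro: continuous_intros)
  fix y
  show "((\<lambda>y. \<eta> (x - y)) has_derivative (\<lambda>v. - g (x - y) \<bullet> v)) (at y)"
    by (rule has_derivative_compose[OF _ C1cD(3)[OF assms], THEN has_derivative_eq_rhs])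
       (auto intro!: derivative_eq_intros)
qed

lemma C1c_mult:
  assumes "C1c \<eta> g" and u: "continuous_on UNIV u" "continuous_on UNIV h"
    "\<And>x. (u has_derivative (\<lambda>v. h x \<bullet> v)) (at x)"
  shows "C1c (\<lambda>x. u x * \<eta> x) (\<lambda>x. u x *\<^sub>R g x + \<eta> x *\<^sub>R h x)"
  unfolding C1c_def
proof (intro conjI allI)
  obtain r where r: "\<And>x. norm x \<ge> r \<Longrightarrow> \<eta> x = 0" using Cc_support[OF C1cD(1)[OF assms(1)]] by blast
  obtain s where s: "\<And>x. norm x \<ge> s \<Longrightarrow> g x = 0" using Cc_support[OF C1cD(2)[OF assms(1)]] by blast
  have c: "continuous_on UNIV \<eta>" "continuous_on UNIV g" using assms(1) by (auto simp: C1c_def Cc_def)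
  show "Cc (\<lambda>x. u x * \<eta> x)"
    unfolding Cc_def using c u r by (intro conjI exI[of _ r] continuous_intros) auto
  show "Cc (\<lambda>x. u x *\<^sub>R g x + \<eta> x *\<^sub>R h x)"
    unfolding Cc_def using c u r s by (intro conjI exI[of _ "max r s"] continuous_intros) auto
  fix x show "((\<lambda>x. u x * \<eta> x) has_derivative (\<lambda>v. (u x *\<^sub>R g x + \<eta> x *\<^sub>R h x) \<bullet> v)) (at x)"
    by (rule has_derivative_mult[OF u(3) C1cD(3)[OF assms(1)], THEN has_derivative_eq_rhs])
       (auto simp: inner_simps algebra_simps fun_eq_iff)
qed

lemma gradient_eqI:
  assumes "(f has_derivative (\<lambda>v. g \<bullet> v)) (at x)"
  shows "gradient f x = g"
  by (simp add: vec_eq_iff gradient_def partial_deriv_eq[OF assms] inner_axis)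

lemma test_function_C1c:
  assumes "test_function \<eta>"
  shows "C1c \<eta> (gradient \<eta>)"
proof -
  have s: "smooth \<eta>" and K: "compact (closure {x. \<eta> x \<noteq> 0})" using assms by (auto simp: test_function_def)
  have d: "(\<eta> has_derivative (\<lambda>v. gradient \<eta> x \<bullet> v)) (at x)" for x by (rule smooth_has_derivative[OF s])
  obtain r where r: "\<And>x. x \<in> closure {x. \<eta> x \<noteq> 0} \<Longrightarrow> norm x \<le> r"
    using compact_imp_bounded[OF K] unfolding bounded_iff by blast
  have 0: "\<eta> x = 0" if "norm x > r" for x using r[of x] closure_subset[of "{x. \<eta> x \<noteq> 0}"] that by (auto simp: subset_iff)
  have g0: "gradient \<eta> x = 0" if "norm x > r" for x
  proof (rule gradient_eqI)
    have "open {x::real ^ 'a. norm x > r}" by (intro open_Collect_less continuous_intros)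
    moreover have "((\<lambda>x. 0::real) has_derivative (\<lambda>v. 0)) (at x)" by simp
    ultimately have "(\<eta> has_derivative (\<lambda>v. 0)) (at x)"
      using has_derivative_transform_within_open[of "\<lambda>x. 0" "\<lambda>v. 0" x UNIV "{x. norm x > r}" \<eta>] 0 that
      by (simp only: mem_Collect_eq)
    then show "(\<eta> has_derivative (\<lambda>v. 0 \<bullet> v)) (at x)" by simp
  qed
  have c: "continuous_on UNIV f" if "smooth f" for f :: "real ^ 'a \<Rightarrow> real"
    using smooth_differentiable[OF that] differentiable_imp_continuous_within continuous_on_eq_continuous_within by blast
  have "continuous_on UNIV (gradient \<eta>)"
    unfolding gradient_def[abs_def] by (intro continuous_on_vec_lambda c smoothI_partial s)
  then show ?thesis unfolding C1c_def Cc_def using c[OF s] d 0 g0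
    by (intro conjI exI[of _ "r + 1"] allI) auto
qed

lemma test_function_partial:
  assumes "test_function \<eta>" shows "test_function (partial_deriv i \<eta>)"
proof -
  obtain r where r: "\<And>x. norm x \<ge> r \<Longrightarrow> gradient \<eta> x = 0"
    using Cc_support[OF C1cD(2)[OF test_function_C1c[OF assms]]] by blast
  have "{x. partial_deriv i \<eta> x \<noteq> 0} \<subseteq> cball 0 r"
  proof
    fix x assume "x \<in> {x. partial_deriv i \<eta> x \<noteq> 0}"
    then have "gradient \<eta> x \<noteq> 0" by (auto simp: gradient_def vec_eq_iff)
    then show "x \<in> cball 0 r" using r[of x] by (cases "norm x \<ge> r") auto
  qed
  then have "compact (closure {x. partial_deriv i \<eta> x \<noteq> 0})"
    by (meson bounded_cball bounded_subset compact_closure)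
  then show ?thesis using assms by (simp add: test_function_def smoothI_partial)
qed

lemma test_functionI:
  assumes "smooth \<eta>" "\<And>x. norm x \<ge> r \<Longrightarrow> \<eta> x = 0"
  shows "test_function \<eta>"
proof -
  have "{x. \<eta> x \<noteq> 0} \<subseteq> cball 0 r" using assms(2) by (force simp: not_le)
  then have "compact (closure {x. \<eta> x \<noteq> 0})"
    by (meson bounded_cball bounded_subset compact_closure)
  then show ?thesis using assms(1) by (simp add: test_function_def)
qed

section \<open>Local integrability and pairings with compactly supported functions\<close>

lemma L1_loc_set_measurable:
  assumes "L1_loc u" shows "u \<in> borel_measurable lebesgue"
proof -
  have "(\<lambda>x. indicator (cball 0 (real n)) x *\<^sub>R u x) \<in> borel_measurable lebesgue" for n
  proof -
    have "set_integrable lebesgue (cball 0 (real n)) u" using assms by (simp add: L1_loc_def)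
    then show ?thesis unfolding set_integrable_def by (rule borel_measurable_integrable)
  qed
  moreover have "(\<lambda>n. indicator (cball 0 (real n)) x *\<^sub>R u x) \<longlonglongrightarrow> u x" for x
  proof (rule tendsto_eventually)
    obtain N :: nat where "norm x \<le> N" using real_arch_simple by blast
    then show "\<forall>\<^sub>F n in sequentially. indicator (cball 0 (real n)) x *\<^sub>R u x = u x"
      by (intro eventually_sequentiallyI[of N]) (auto simp: indicator_def)
  qed
  ultimately show ?thesis by (rule borel_measurable_LIMSEQ_metric)
qed

lemma integrable_mult_bounded_support:
  fixes u :: "real ^ 'n \<Rightarrow> real" and k :: "real ^ 'n \<Rightarrow> 'b::euclidean_space"
  assumes "L1_loc u" and [measurable]: "k \<in> borel_measurable lebesgue"
    and "\<And>x. norm (k x) \<le> B" "\<And>x. norm x \<ge> r \<Longrightarrow> k x = 0"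
  shows "integrable lebesgue (\<lambda>x. u x *\<^sub>R k x)"
proof -
  note [measurable] = L1_loc_set_measurable[OF assms(1)]
  have "integrable lebesgue (\<lambda>x. B *\<^sub>R (indicator (cball 0 r) x *\<^sub>R u x))"
    using assms(1) unfolding L1_loc_def set_integrable_def by auto
  then show ?thesis
  proof (rule Bochner_Integration.integrable_bound)
    show "AE x in lebesgue. norm (u x *\<^sub>R k x) \<le> norm (B *\<^sub>R (indicator (cball 0 r) x *\<^sub>R u x))"
    proof (rule AE_I2)
      fix x
      have "B \<ge> 0" using assms(3)[of 0] norm_ge_zero order_trans by blast
      then show "norm (u x *\<^sub>R k x) \<le> norm (B *\<^sub>R (indicator (cball 0 r) x *\<^sub>R u x))"
      proof (cases "norm x \<ge> r")
        case True then show ?thesis by (simp add: assms(4))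
      next
        case False
        then have "norm (B *\<^sub>R (indicator (cball 0 r) x *\<^sub>R u x)) = B * \<bar>u x\<bar>"
          using \<open>B \<ge> 0\<close> by (simp add: abs_mult)
        then show ?thesis
          using mult_right_mono[OF assms(3)[of x], of "\<bar>u x\<bar>"] by (simp add: mult.commute)
      qed
    qed
  qed measurable
qed

lemma integrable_mult_Cc:
  fixes u :: "real ^ 'n \<Rightarrow> real"
  assumes "L1_loc u" "Cc k"
  shows "integrable lebesgue (\<lambda>x. u x *\<^sub>R k x)"
proof -
  obtain B where "\<And>x. norm (k x) \<le> B" using Cc_bounded[OF assms(2)] by blast
  moreover obtain r where "\<And>x. norm x \<ge> r \<Longrightarrow> k x = 0" using Cc_support[OF assms(2)] by blast
  ultimately show ?thesis
    by (rule integrable_mult_bounded_support[OF assms(1) Cc_lebesgue_measurable[OF assms(2)]])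
qed

lemma L1_loc_continuous:
  assumes "continuous_on UNIV u" shows "L1_loc u"
  unfolding L1_loc_def
proof (intro allI impI)
  fix K :: "(real ^ 'a) set" assume K: "compact K"
  have "bounded (u ` K)"
    by (rule compact_imp_bounded[OF compact_continuous_image[OF continuous_on_subset[OF assms subset_UNIV] K]])
  then obtain B where B: "\<And>x. x \<in> K \<Longrightarrow> norm (u x) \<le> B" by (auto simp: bounded_iff)
  have "K \<in> lmeasurable" using K by (rule lmeasurable_compact)
  then have "K \<in> sets lebesgue" "emeasure lebesgue K < \<infinity>" unfolding fmeasurable_def by blast+
  then show "set_integrable lebesgue K u"
    unfolding set_integrable_def
    by (rule integrableI_bounded_set_indicator[OF _ continuous_on_imp_lebesgue_measurable[OF assms]])
       (rule AE_I2, use B in blast)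
qed

lemma Cc_integrable: "Cc k \<Longrightarrow> integrable lebesgue k" for k :: "real ^ 'n \<Rightarrow> 'b::euclidean_space"
proof -
  assume k: "Cc k"
  have "L1_loc (\<lambda>_::real ^ 'n. 1::real)" by (intro L1_loc_continuous continuous_on_const)
  from integrable_mult_Cc[OF this k] show ?thesis by (simp only: scaleR_one)
qed

text \<open>The kernel comes first and may be vector valued, so that the gradient of a convolution
  is again one, with the gradient of the kernel.\<close>

definition conv :: "(real ^ 'n \<Rightarrow> 'b::euclidean_space) \<Rightarrow> (real ^ 'n \<Rightarrow> real) \<Rightarrow> real ^ 'n \<Rightarrow> 'b" where
  "conv \<eta> u x = (LINT y|lebesgue. u y *\<^sub>R \<eta> (x - y))"

lemma conv_integrable: "L1_loc u \<Longrightarrow> Cc \<eta> \<Longrightarrow> integrable lebesgue (\<lambda>y. u y *\<^sub>R \<eta> (x - y))"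
  by (intro integrable_mult_Cc Cc_reflect)

lemma conv_nth:
  fixes \<eta> :: "real ^ 'n \<Rightarrow> real ^ 'n"
  assumes "L1_loc u" "Cc \<eta>" shows "conv \<eta> u x $ i = conv (\<lambda>z. \<eta> z $ i) u x"
  unfolding conv_def vector_scaleR_component[symmetric]
  by (rule integral_bounded_linear[OF bounded_linear_vec_nth conv_integrable[OF assms], symmetric])

lemma norm_conv_diff_le:
  fixes u :: "real ^ 'n \<Rightarrow> real" and k :: "real ^ 'n \<Rightarrow> 'b::euclidean_space"
  assumes u: "L1_loc u" and k: "k \<in> borel_measurable lebesgue" "integrable lebesgue (\<lambda>y. u y *\<^sub>R k y)"
    and "\<And>y. norm (k y) \<le> e" "\<And>y. norm (y - x) > r \<Longrightarrow> k y = 0"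
  shows "norm (LINT y|lebesgue. u y *\<^sub>R k y) \<le> e * (LINT y:cball x r|lebesgue. \<bar>u y\<bar>)"
proof -
  have int: "set_integrable lebesgue (cball x r) u" using u unfolding L1_loc_def by auto
  then have i: "integrable lebesgue (\<lambda>y. e * (indicator (cball x r) y *\<^sub>R \<bar>u y\<bar>))"
    using set_integrable_abs[OF int] unfolding set_integrable_def by auto
  have e: "e \<ge> 0" using assms(4)[of 0] norm_ge_zero order_trans by blast
  have "norm (LINT y|lebesgue. u y *\<^sub>R k y) \<le> (LINT y|lebesgue. e * (indicator (cball x r) y *\<^sub>R \<bar>u y\<bar>))"
  proof (rule Bochner_Integration.integral_norm_bound_integral[OF k(2) i])
    fix y
    show "norm (u y *\<^sub>R k y) \<le> e * (indicator (cball x r) y *\<^sub>R \<bar>u y\<bar>)"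
    proof (cases "norm (y - x) > r")
      case True then show ?thesis using assms(5) e by simp
    next
      case False
      then have "y \<in> cball x r" by (simp add: dist_norm norm_minus_commute)
      then show ?thesis
        using mult_right_mono[OF assms(4)[of y], of "\<bar>u y\<bar>"] by (simp add: mult.commute)
    qed
  qed
  then show ?thesis by (simp add: set_lebesgue_integral_def)
qed

text \<open>Since \<open>u\<close> is merely locally integrable, all regularity comes from the
  kernel: its first-order Taylor remainder is small uniformly in the integration variable and is
  integrated against |u| over a fixed ball.\<close>

lemma conv_has_derivative:
  fixes \<eta> :: "real ^ 'n \<Rightarrow> real"
  assumes u: "L1_loc u" and \<eta>: "C1c \<eta> g"
  shows "(conv \<eta> u has_derivative (\<lambda>v. conv g u x \<bullet> v)) (at x)"
  unfolding has_derivative_at_alt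
proof (intro conjI allI impI)
  show "bounded_linear ((\<bullet>) (conv g u x))" by (rule bounded_linear_inner_right)
  fix e :: real assume e: "e > 0"
  obtain r1 where r1: "r1 > 0" "\<And>x. norm x \<ge> r1 \<Longrightarrow> \<eta> x = 0" using Cc_support[OF C1cD(1)[OF \<eta>]] by blast
  obtain r2 where r2: "\<And>x. norm x \<ge> r2 \<Longrightarrow> g x = 0" using Cc_support[OF C1cD(2)[OF \<eta>]] by blast
  \<comment> \<open>Enlarging the radius by 1 makes one ball serve for all increments shorter than
    1.\<close>
  define r where "r = max r1 r2 + 1"
  define L where "L = (LINT y:cball x r|lebesgue. \<bar>u y\<bar>)"
  have L: "L \<ge> 0" unfolding L_def set_lebesgue_integral_def by (intro integral_nonneg_AE) auto
  define e' where "e' = e / (L + 1)"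
  have e': "e' > 0" using e L by (auto simp: e'_def)
  obtain d where d: "d > 0" "\<And>x y. norm (x - y) < d \<Longrightarrow> norm (g x - g y) < e'"
    using Cc_uniformly_continuous[OF C1cD(2)[OF \<eta>] e'] by blast
  show "\<exists>d>0. \<forall>y. norm (y - x) < d \<longrightarrow>
       norm (conv \<eta> u y - conv \<eta> u x - conv g u x \<bullet> (y - x)) \<le> e * norm (y - x)"
  proof (intro exI[of _ "min d 1"] conjI allI impI)
    fix x' assume x': "norm (x' - x) < min d 1"
    define v where "v = x' - x"
    define k where "k y = \<eta> (x' - y) - \<eta> (x - y) - g (x - y) \<bullet> v" for y
    have i: "integrable lebesgue (\<lambda>y. u y *\<^sub>R \<eta> (x' - y))" "integrable lebesgue (\<lambda>y. u y *\<^sub>R \<eta> (x - y))"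
      "integrable lebesgue (\<lambda>y. u y *\<^sub>R g (x - y))"
      by (intro conv_integrable u C1cD(1,2)[OF \<eta>])+
    have i3: "integrable lebesgue (\<lambda>y. (u y *\<^sub>R g (x - y)) \<bullet> v)" using i(3) by (intro integrable_inner_left)
    have keq: "(\<lambda>y. u y *\<^sub>R k y) = (\<lambda>y. u y *\<^sub>R \<eta> (x' - y) - u y *\<^sub>R \<eta> (x - y) - (u y *\<^sub>R g (x - y)) \<bullet> v)"
      by (auto simp: k_def algebra_simps)
    have "conv \<eta> u x' - conv \<eta> u x - conv g u x \<bullet> v = (LINT y|lebesgue. u y *\<^sub>R k y)"
    proof -
      have "(LINT y|lebesgue. (u y *\<^sub>R g (x - y)) \<bullet> v) = conv g u x \<bullet> v"
        unfolding conv_def by (rule integral_inner_left) (rule i(3))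
      then show ?thesis
        unfolding keq conv_def
        by (simp only: Bochner_Integration.integral_diff[OF Bochner_Integration.integrable_diff[OF i(1,2)] i3]
            Bochner_Integration.integral_diff[OF i(1,2)])
    qed
    moreover have "norm (LINT y|lebesgue. u y *\<^sub>R k y) \<le> (e' * norm v) * (LINT y:cball x r|lebesgue. \<bar>u y\<bar>)"
    proof (rule norm_conv_diff_le[OF u])
      show "k \<in> borel_measurable lebesgue"
        unfolding k_def using Cc_lebesgue_measurable[OF Cc_reflect[OF C1cD(1)[OF \<eta>]]]
          Cc_lebesgue_measurable[OF Cc_reflect[OF C1cD(2)[OF \<eta>]]] by (auto intro!: borel_measurable_diff)
      show "integrable lebesgue (\<lambda>y. u y *\<^sub>R k y)"
        unfolding keq by (rule Bochner_Integration.integrable_diff[OF Bochner_Integration.integrable_diff[OF i(1,2)] i3])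
      fix y
      show "norm (k y) \<le> e' * norm v"
      proof -
        \<comment> \<open>Subtracting the linear part at x - y reduces the Taylor remainder to a
          mean value estimate with the oscillation of \<open>g\<close>.\<close>
        define f where "f z = \<eta> z - g (x - y) \<bullet> z" for z
        have "norm (f (x' - y) - f (x - y)) \<le> e' * norm ((x' - y) - (x - y))"
        proof (rule differentiable_bound[of "closed_segment (x - y) (x' - y)" f "\<lambda>z v. (g z - g (x - y)) \<bullet> v"])
          fix z assume z: "z \<in> closed_segment (x - y) (x' - y)"
          have "(f has_derivative (\<lambda>v. g z \<bullet> v - g (x - y) \<bullet> v)) (at z)"
            unfolding f_def by (intro has_derivative_diff C1cD(3)[OF \<eta>] bounded_linear.has_derivative[OF bounded_linear_inner_right] has_derivative_ident)
          then show "(f has_derivative (\<lambda>v. (g z - g (x - y)) \<bullet> v)) (at z within closed_segment (x - y) (x' - y))"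
            by (simp add: inner_diff_left has_derivative_at_withinI)
          have "norm (z - (x - y)) \<le> norm ((x' - y) - (x - y))" using segment_bound1[OF z] by simp
          also have "\<dots> < d" using x' by simp
          finally have "norm (g z - g (x - y)) \<le> e'" using d(2)[of z "x - y"] by simp
          then show "onorm (\<lambda>v. (g z - g (x - y)) \<bullet> v) \<le> e'"
          proof (intro onorm_le)
            fix w
            have "norm ((g z - g (x - y)) \<bullet> w) \<le> norm (g z - g (x - y)) * norm w"
              by (simp add: Cauchy_Schwarz_ineq2)
            also have "\<dots> \<le> e' * norm w"
              using \<open>norm (g z - g (x - y)) \<le> e'\<close> by (rule mult_right_mono) simp
            finally show "norm ((g z - g (x - y)) \<bullet> w) \<le> e' * norm w" .
          qed
        qed auto
        then show ?thesis by (simp add: f_def k_def v_def inner_simps)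
      qed
      show "k y = 0" if y: "norm (y - x) > r"
      proof -
        have "norm (x - y) \<ge> r" using y by (simp add: norm_minus_commute)
        moreover have "norm (x' - y) \<ge> r - 1"
        proof -
          have "norm (x - y) \<le> norm (x' - y) + norm (x' - x)"
            using norm_triangle_ineq4[of "x' - y" "x' - x"] by simp
          then show ?thesis using calculation x' by simp
        qed
        ultimately show ?thesis using r1(2) r2 by (auto simp: k_def r_def)
      qed
    qed
    moreover have "(e' * norm v) * L \<le> e * norm v"
    proof -
      have "e' * (L + 1) = e" using L by (simp add: e'_def)
      then have "e' * L \<le> e" using e' by (simp add: distrib_left)
      then show ?thesis using mult_right_mono[of "e' * L" e "norm v"] by (simp add: mult_ac)
    qed
    ultimately show "norm (conv \<eta> u x' - conv \<eta> u x - conv g u x \<bullet> (x' - x)) \<le> e * norm (x' - x)"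
      by (simp add: L_def v_def)
  qed (use d in auto)
qed

lemma conv_continuous:
  fixes k :: "real ^ 'n \<Rightarrow> 'b::euclidean_space"
  assumes u: "L1_loc u" and k: "Cc k"
  shows "continuous_on UNIV (conv k u)"
  unfolding continuous_on_iff
proof (intro ballI allI impI)
  fix x :: "real ^ 'n" and e :: real assume e: "e > 0"
  obtain r1 where r1: "r1 > 0" "\<And>x. norm x \<ge> r1 \<Longrightarrow> k x = 0" using Cc_support[OF k] by blast
  define L where "L = (LINT y:cball x (r1 + 1)|lebesgue. \<bar>u y\<bar>)"
  have L: "L \<ge> 0" unfolding L_def set_lebesgue_integral_def by (intro integral_nonneg_AE) auto
  define e' where "e' = e / (L + 1)"
  have e': "e' > 0" using e L by (auto simp: e'_def)
  obtain d where d: "d > 0" "\<And>x y. norm (x - y) < d \<Longrightarrow> norm (k x - k y) < e'"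
    using Cc_uniformly_continuous[OF k e'] by blast
  show "\<exists>d>0. \<forall>x'\<in>UNIV. dist x' x < d \<longrightarrow> dist (conv k u x') (conv k u x) < e"
  proof (intro exI[of _ "min d 1"] conjI ballI impI)
    fix x' assume x': "dist x' x < min d 1"
    have i: "integrable lebesgue (\<lambda>y. u y *\<^sub>R k (x' - y))" "integrable lebesgue (\<lambda>y. u y *\<^sub>R k (x - y))"
      by (intro conv_integrable u k)+
    have "conv k u x' - conv k u x = (LINT y|lebesgue. u y *\<^sub>R (k (x' - y) - k (x - y)))"
      unfolding conv_def scaleR_right_diff_distrib by (rule Bochner_Integration.integral_diff[OF i, symmetric])
    moreover have "norm (LINT y|lebesgue. u y *\<^sub>R (k (x' - y) - k (x - y))) \<le> e' * (LINT y:cball x (r1 + 1)|lebesgue. \<bar>u y\<bar>)"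
    proof (rule norm_conv_diff_le[OF u])
      show "(\<lambda>y. k (x' - y) - k (x - y)) \<in> borel_measurable lebesgue"
        using Cc_lebesgue_measurable[OF Cc_reflect[OF k]] by (auto intro!: borel_measurable_diff)
      show "integrable lebesgue (\<lambda>y. u y *\<^sub>R (k (x' - y) - k (x - y)))"
        unfolding scaleR_right_diff_distrib by (rule Bochner_Integration.integrable_diff[OF i])
      fix y
      show "norm (k (x' - y) - k (x - y)) \<le> e'" using d(2)[of "x' - y" "x - y"] x' by (simp add: dist_norm)
      show "k (x' - y) - k (x - y) = 0" if y: "norm (y - x) > r1 + 1"
      proof -
        have "norm (x - y) \<le> norm (x' - y) + norm (x' - x)"
          using norm_triangle_ineq4[of "x' - y" "x' - x"] by simp
        then have "norm (x' - y) \<ge> r1" "norm (x - y) \<ge> r1" using x' y by (auto simp: dist_norm norm_minus_commute)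
        then show ?thesis using r1(2) by simp
      qed
    qed
    moreover have "e' * L < e"
    proof -
      have "e' * (L + 1) = e" using L by (simp add: e'_def)
      then show ?thesis using e' by (simp add: distrib_left)
    qed
    ultimately show "dist (conv k u x') (conv k u x) < e" by (simp add: L_def dist_norm)
  qed (use d in auto)
qed

lemma conv_support:
  fixes k :: "real ^ 'n \<Rightarrow> 'b::euclidean_space"
  assumes "\<And>x. norm x \<ge> r \<Longrightarrow> k x = 0" "\<And>x. norm x > s \<Longrightarrow> u x = 0" "norm x \<ge> r + s"
  shows "conv k u x = 0"
proof -
  have "u y *\<^sub>R k (x - y) = 0" for y
  proof (cases "norm y > s")
    case False
    then have "norm (x - y) \<ge> r" using assms(3) norm_triangle_ineq2[of x y] by linarith
    from assms(1)[OF this] show ?thesis by simp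
  next
    case True
    from assms(2)[OF this] show ?thesis by simp
  qed
  then have "(\<lambda>y. u y *\<^sub>R k (x - y)) = (\<lambda>y. 0)" by (intro ext)
  then show ?thesis unfolding conv_def by simp
qed

lemma partial_deriv_conv:
  assumes u: "L1_loc u" and \<eta>: "test_function \<eta>"
  shows "partial_deriv i (conv \<eta> u) = conv (partial_deriv i \<eta>) u"
proof
  fix x
  have c: "C1c \<eta> (gradient \<eta>)" by (rule test_function_C1c[OF \<eta>])
  have "partial_deriv i (conv \<eta> u) x = conv (gradient \<eta>) u x $ i"
    by (simp add: partial_deriv_eq[OF conv_has_derivative[OF u c]] inner_axis)
  also have "\<dots> = conv (\<lambda>z. gradient \<eta> z $ i) u x"
    by (rule conv_nth[OF u C1cD(2)[OF c]])
  finally show "partial_deriv i (conv \<eta> u) x = conv (partial_deriv i \<eta>) u x"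
    by (simp add: gradient_def)
qed

lemma smooth_conv:
  assumes u: "L1_loc u" and \<eta>: "test_function \<eta>"
  shows "smooth (conv \<eta> u)"
proof -
  have *: "test_function (foldr partial_deriv is \<eta>) \<and> foldr partial_deriv is (conv \<eta> u) = conv (foldr partial_deriv is \<eta>) u" for "is"
    by (induction "is") (auto simp: \<eta> test_function_partial partial_deriv_conv[OF u])
  then show ?thesis
    unfolding smooth_def differentiable_def using conv_has_derivative[OF u test_function_C1c] by (metis (no_types))
qed

lemma gradient_conv:
  assumes "L1_loc u" "C1c \<eta> g"
  shows "gradient (conv \<eta> u) x = conv g u x"
  by (rule gradient_eqI[OF conv_has_derivative[OF assms]])

lemma integral_reflect:
  fixes f :: "'a::euclidean_space \<Rightarrow> 'b::{banach, second_countable_topology}"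
  assumes [measurable]: "f \<in> borel_measurable lebesgue"
  shows "(LINT y|lebesgue. f (x - y)) = (LINT y|lebesgue. f y)"
proof -
  note [measurable] = affine_lebesgue_measurable[of "-1" x]
  have "lebesgue = distr lebesgue lebesgue (\<lambda>y. x + (-1) *\<^sub>R y)"
    using lebesgue_affine[of "-1" x] by (simp add: density_1)
  then have "(LINT y|lebesgue. f y) = (LINT y|distr lebesgue lebesgue (\<lambda>y. x + (-1) *\<^sub>R y). f y)"
    by simp
  also have "\<dots> = (LINT y|lebesgue. f (x - y))"
    by (subst integral_distr) (use affine_lebesgue_measurable[of "-1" x] in auto)
  finally show ?thesis ..
qed

text \<open>Convolving with the constant 1 gives a constant function, and the gradient of that
  constant is the integral in question. This replaces an integration coordinate by
  coordinate.\<close>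

lemma integral_gradient_zero:
  fixes g :: "real ^ 'n \<Rightarrow> real ^ 'n"
  assumes "C1c \<eta> g"
  shows "(LINT y|lebesgue. g y) = 0"
proof -
  have u: "L1_loc (\<lambda>_::real ^ 'n. 1::real)" by (intro L1_loc_continuous continuous_intros)
  have c: "conv \<eta> (\<lambda>_. 1) x = (LINT y|lebesgue. \<eta> y)" for x
    unfolding conv_def using integral_reflect[OF Cc_lebesgue_measurable[OF C1cD(1)[OF assms]]] by simp
  have "conv g (\<lambda>_. 1) 0 = gradient (conv \<eta> (\<lambda>_. 1)) 0"
    by (rule gradient_conv[OF u assms, symmetric])
  also have "conv \<eta> (\<lambda>_. 1) = (\<lambda>_. LINT y|lebesgue. \<eta> y)" using c by auto
  also have "gradient (\<lambda>_. LINT y|lebesgue. \<eta> y) (0::real ^ 'n) = 0"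
    by (rule gradient_eqI) simp
  finally show ?thesis
    unfolding conv_def using integral_reflect[OF Cc_lebesgue_measurable[OF C1cD(2)[OF assms]], of 0] by simp
qed

lemma Cc_mult_continuous:
  assumes "Cc k" "continuous_on UNIV u" shows "Cc (\<lambda>x. u x *\<^sub>R k x)"
  using assms unfolding Cc_def by (auto intro!: continuous_intros)

text \<open>The gradient of the product of \<open>u\<close> and \<open>\<eta>\<close> integrates to
  zero.\<close>

lemma integration_by_parts:
  fixes g :: "real ^ 'n \<Rightarrow> real ^ 'n"
  assumes \<eta>: "C1c \<eta> g" and u: "continuous_on UNIV u" "continuous_on UNIV h"
    "\<And>x. (u has_derivative (\<lambda>v. h x \<bullet> v)) (at x)"
  shows "(LINT y|lebesgue. u y *\<^sub>R g y) = - (LINT y|lebesgue. \<eta> y *\<^sub>R h y)"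
proof -
  have i: "integrable lebesgue (\<lambda>y. u y *\<^sub>R g y)"
    by (intro Cc_integrable Cc_mult_continuous u C1cD(2)[OF \<eta>])
  obtain r where r: "\<And>x. norm x \<ge> r \<Longrightarrow> \<eta> x = 0" using Cc_support[OF C1cD(1)[OF \<eta>]] by blast
  have "Cc (\<lambda>y. \<eta> y *\<^sub>R h y)"
    unfolding Cc_def using \<eta> u r by (intro conjI exI[of _ r] continuous_intros) (auto simp: C1c_def Cc_def)
  then have i2: "integrable lebesgue (\<lambda>y. \<eta> y *\<^sub>R h y)" by (rule Cc_integrable)
  have "(LINT y|lebesgue. u y *\<^sub>R g y + \<eta> y *\<^sub>R h y) = 0"
    by (rule integral_gradient_zero[OF C1c_mult[OF \<eta> u]])
  then show ?thesis using i i2 by (simp add: add_eq_0_iff)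
qed

text \<open>As a simp rule this turns \<open>emeasure lebesgue A\<close> into a statement about the Borel part of \<open>A\<close>.\<close>

declare emeasure_completion [simp del]

subsection \<open>Mollification\<close>

lemma bump_support:
  fixes x :: "real ^ 'n"
  assumes "s > 0" "norm x \<ge> CARD('n) / s"
  shows "bump s x = 0"
proof (rule ccontr)
  assume "bump s x \<noteq> 0"
  then have *: "\<bar>x $ i\<bar> < 1 / s" for i using bump_eq_0[OF assms(1), of x i] by force
  have "norm x \<le> (\<Sum>i\<in>UNIV. \<bar>x $ i\<bar>)" by (rule norm_le_l1_cart)
  also have "\<dots> < (\<Sum>i\<in>(UNIV::'n set). 1 / s)" by (intro sum_strict_mono *) auto
  finally show False using assms(2) by simp
qed

lemma test_function_bump: "s > 0 \<Longrightarrow> test_function (bump s :: real ^ 'n \<Rightarrow> real)"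
  by (rule test_functionI[OF bump_algebra_smooth[OF bump_algebra_bump] bump_support])

lemma integral_bump_pos:
  assumes "s > 0"
  shows "(LINT y|lebesgue. bump s (y :: real ^ 'n)) > 0"
proof -
  let ?b = "bump s :: real ^ 'n \<Rightarrow> real"
  have b0: "?b 0 > 0" by (rule bump_zero_pos)
  have C: "Cc ?b" by (rule C1cD(1)[OF test_function_C1c[OF test_function_bump[OF assms]]])
  obtain d where d: "d > 0" "\<And>x. norm x < d \<Longrightarrow> \<bar>?b x - ?b 0\<bar> < ?b 0 / 2"
    using Cc_uniformly_continuous[OF C, of "?b 0 / 2"] b0
    by (metis diff_zero half_gt_zero_iff real_norm_def)
  define r where "r = d / (2 * CARD('n))"
  have r: "r > 0" using d by (simp add: r_def)
  have low: "?b x \<ge> ?b 0 / 2" if "x \<in> cube 0 r" for x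
  proof -
    have "norm x < d" using norm_cube_le[OF r that] d by (simp add: r_def)
    then show ?thesis using d(2)[of x] by linarith
  qed
  have "0 < (?b 0 / 2) * r ^ CARD('n)" using r b0 by simp
  also have "\<dots> = (LINT y|lebesgue. (?b 0 / 2) * indicator (cube (0 :: real ^ 'n) r) y)"
    using r by (simp add: measure_cube)
  also have "\<dots> \<le> (LINT y|lebesgue. ?b y)"
  proof (rule integral_mono[OF _ Cc_integrable[OF C]])
    have "emeasure lebesgue (cube (0 :: real ^ 'n) r) < \<infinity>" unfolding emeasure_cube[OF r] by simp
    then have "integrable lebesgue (indicator (cube (0 :: real ^ 'n) r) :: _ \<Rightarrow> real)"
      using r by (intro integrable_real_indicator) auto
    then show "integrable lebesgue (\<lambda>y. (?b 0 / 2) * indicator (cube (0 :: real ^ 'n) r) y)"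
      by (intro integrable_mult_right)
    show "(?b 0 / 2) * indicator (cube (0 :: real ^ 'n) r) y \<le> ?b y" for y
      using low[of y] bump_nonneg[of s y] by (auto simp: indicator_def)
  qed
  finally show ?thesis .
qed

text \<open>The factor \<open>CARD('n)\<close> shrinks the cubic support of the bump enough to fit
  into the ball of radius 1/(n + 1).\<close>

definition moll :: "nat \<Rightarrow> real ^ 'n \<Rightarrow> real" where
  "moll n x = 1 / (LINT y|lebesgue. bump (CARD('n) * (real n + 1)) (y :: real ^ 'n)) * bump (CARD('n) * (real n + 1)) x"

lemma moll_nonneg: "moll n x \<ge> 0"
proof -
  have "0 < (LINT y|lebesgue. bump (CARD('a) * (real n + 1)) (y :: real ^ 'a))"
    by (intro integral_bump_pos mult_pos_pos) auto
  then show ?thesis unfolding moll_def by (intro mult_nonneg_nonneg bump_nonneg) simp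
qed

lemma integral_moll: "(LINT y|lebesgue. moll n (y :: real ^ 'n)) = 1"
  using integral_bump_pos[of "CARD('n) * (real n + 1)", where 'n='n] unfolding moll_def by simp

lemma moll_support: "norm x \<ge> 1 / (real n + 1) \<Longrightarrow> moll n (x :: real ^ 'n) = 0"
  using bump_support[of "CARD('n) * (real n + 1)" x] unfolding moll_def by simp

lemma test_function_moll: "test_function (moll n :: real ^ 'n \<Rightarrow> real)"
proof (rule test_functionI[OF bump_algebra_smooth moll_support])
  show "bump_algebra (moll n)" unfolding moll_def[abs_def] by (intro bump_algebra.intros bump_algebra_bump)
qed

lemmas C1c_moll = test_function_C1c[OF test_function_moll]
lemmas Cc_moll = C1cD(1)[OF C1c_moll]

lemma integral_moll_reflect: "(LINT y|lebesgue. moll n (x - y :: real ^ 'n)) = 1"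
  using integral_reflect[OF Cc_lebesgue_measurable[OF Cc_moll], of n x] by (simp add: integral_moll)

lemma conv_moll_close:
  fixes k :: "real ^ 'n \<Rightarrow> real"
  assumes k: "L1_loc k" and e: "\<And>y. norm (y - x) < 1 / (real n + 1) \<Longrightarrow> \<bar>k y - k x\<bar> \<le> e"
  shows "\<bar>conv (moll n) k x - k x\<bar> \<le> e"
proof -
  have i: "integrable lebesgue (\<lambda>y. k y *\<^sub>R moll n (x - y))" by (intro conv_integrable k Cc_moll)
  have im: "integrable lebesgue (\<lambda>y. moll n (x - y))" by (intro Cc_integrable Cc_reflect Cc_moll)
  have "conv (moll n) k x - k x = (LINT y|lebesgue. (k y - k x) * moll n (x - y))"
    using i im by (simp add: conv_def left_diff_distrib integral_moll_reflect)
  also have "\<bar>\<dots>\<bar> \<le> (LINT y|lebesgue. e * moll n (x - y))"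
    unfolding real_norm_def[symmetric]
  proof (rule Bochner_Integration.integral_norm_bound_integral)
    show "integrable lebesgue (\<lambda>y. (k y - k x) * moll n (x - y))"
      using i im by (simp add: left_diff_distrib)
    fix y
    show "norm ((k y - k x) * moll n (x - y)) \<le> e * moll n (x - y)"
    proof (cases "norm (x - y) \<ge> 1 / (real n + 1)")
      case True then show ?thesis by (simp add: moll_support)
    next
      case False
      then have "norm (y - x) < 1 / (real n + 1)" by (simp add: norm_minus_commute)
      from e[OF this] show ?thesis
        using moll_nonneg[of n "x - y"] by (auto simp: abs_mult intro!: mult_right_mono)
    qed
  qed (use im in auto)
  also have "\<dots> = e" by (simp add: integral_moll_reflect)
  finally show ?thesis .
qed

lemma conv_moll_uniform:
  fixes k :: "real ^ 'n \<Rightarrow> real"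
  assumes "Cc k" "e > 0"
  obtains N where "\<And>n x. n \<ge> N \<Longrightarrow> \<bar>conv (moll n) k x - k x\<bar> \<le> e"
proof -
  obtain d where d: "d > 0" "\<And>x y. norm (x - y) < d \<Longrightarrow> norm (k x - k y) < e"
    using Cc_uniformly_continuous[OF assms] by blast
  obtain N :: nat where N: "1 / (real N + 1) < d"
    using nat_approx_posE[OF d(1)] by (metis Suc_eq_plus1 of_nat_Suc add.commute)
  show thesis
  proof (rule that[of N])
    fix n x assume n: "N \<le> n"
    have "1 / (real n + 1) \<le> 1 / (real N + 1)" using n by (intro divide_left_mono) auto
    then have "1 / (real n + 1) < d" using N by linarith
    moreover have "\<bar>k y - k x\<bar> \<le> e" if "norm (y - x) < d" for y
      using d(2)[OF that] by simp
    ultimately show "\<bar>conv (moll n) k x - k x\<bar> \<le> e"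
      using assms(1) by (intro conv_moll_close L1_loc_continuous) (simp_all add: Cc_def)
  qed
qed

lemma conv_moll_support:
  assumes "\<And>x. norm x > s \<Longrightarrow> u x = 0" "norm x \<ge> s + 1"
  shows "conv (moll n) u x = 0"
proof (rule conv_support[of 1])
  fix x :: "real ^ 'a" assume "1 \<le> norm x"
  moreover have "1 / (real n + 1) \<le> 1" by simp
  ultimately have "1 / (real n + 1) \<le> norm x" by linarith
  then show "moll n x = 0" by (rule moll_support)
qed (use assms in auto)

lemma test_function_conv_moll:
  assumes "L1_loc u" "\<And>x. norm x > s \<Longrightarrow> u x = 0"
  shows "test_function (conv (moll n) u)"
  by (rule test_functionI[OF smooth_conv[OF assms(1) test_function_moll] conv_moll_support[OF assms(2)]])

text \<open>The mollified functions converge uniformly and keep their supports in one ball, which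
  suffices against a locally integrable \<open>u\<close>.\<close>

lemma tendsto_integral_conv_moll:
  fixes u k :: "real ^ 'n \<Rightarrow> real"
  assumes u: "L1_loc u" and k: "Cc k"
  shows "(\<lambda>n. LINT x|lebesgue. u x * conv (moll n) k x) \<longlonglongrightarrow> (LINT x|lebesgue. u x * k x)"
proof (rule LIMSEQ_I)
  fix e :: real assume e: "e > 0"
  obtain r where r: "r > 0" "\<And>x. norm x \<ge> r \<Longrightarrow> k x = 0" using Cc_support[OF k] by blast
  have kL: "L1_loc k" using k by (intro L1_loc_continuous) (simp add: Cc_def)
  define L where "L = (LINT y:cball 0 (r + 1)|lebesgue. \<bar>u y\<bar>)"
  have L: "L \<ge> 0" unfolding L_def set_lebesgue_integral_def by (intro integral_nonneg_AE) auto
  define e' where "e' = e / (L + 1)"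
  have e': "e' > 0" using e L by (auto simp: e'_def)
  have "e' * (L + 1) = e" using L by (simp add: e'_def)
  then have e'': "e' * L < e" using e' by (simp add: distrib_left)
  obtain N where N: "\<And>n x. n \<ge> N \<Longrightarrow> \<bar>conv (moll n) k x - k x\<bar> \<le> e'" using conv_moll_uniform[OF k e'] by blast
  have cs: "conv (moll n) k x = 0" if "norm x \<ge> r + 1" for n x
    by (rule conv_moll_support[of r]) (use r that in auto)
  have cc: "Cc (conv (moll n) k)" for n
    unfolding Cc_def using cs conv_continuous[OF kL Cc_moll] by blast
  show "\<exists>N. \<forall>n\<ge>N. norm ((LINT x|lebesgue. u x * conv (moll n) k x) - (LINT x|lebesgue. u x * k x)) < e"
  proof (intro exI[of _ N] allI impI)
    fix n assume n: "N \<le> n"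
    have i: "integrable lebesgue (\<lambda>x. u x *\<^sub>R conv (moll n) k x)" "integrable lebesgue (\<lambda>x. u x *\<^sub>R k x)"
      by (intro integrable_mult_Cc u cc k)+
    have "(LINT x|lebesgue. u x * conv (moll n) k x) - (LINT x|lebesgue. u x * k x)
       = (LINT x|lebesgue. u x *\<^sub>R (conv (moll n) k x - k x))"
      using i by (simp add: right_diff_distrib)
    also have "norm \<dots> \<le> e' * (LINT y:cball 0 (r + 1)|lebesgue. \<bar>u y\<bar>)"
    proof (rule norm_conv_diff_le[OF u])
      show "(\<lambda>x. conv (moll n) k x - k x) \<in> borel_measurable lebesgue"
        by (intro borel_measurable_diff Cc_lebesgue_measurable cc k)
      show "integrable lebesgue (\<lambda>x. u x *\<^sub>R (conv (moll n) k x - k x))"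
        using i by (simp add: right_diff_distrib)
      show "norm (conv (moll n) k y - k y) \<le> e'" for y using N[OF n] by simp
      show "conv (moll n) k y - k y = 0" if "norm (y - 0) > r + 1" for y
        using cs[of y n] r(2)[of y] that by simp
    qed
    finally show "norm ((LINT x|lebesgue. u x * conv (moll n) k x) - (LINT x|lebesgue. u x * k x)) < e"
      using e'' by (simp add: L_def)
  qed
qed

text \<open>The derivative is moved from the mollifier onto \<open>\<eta>\<close>, so the partial
  derivatives of the mollified function converge as well.\<close>

lemma conv_partial_moll:
  fixes \<eta> :: "real ^ 'n \<Rightarrow> real"
  assumes "C1c \<eta> h"
  shows "partial_deriv i (conv (moll n) \<eta>) x = conv (moll n) (\<lambda>y. h y $ i) x"
proof -
  have L: "L1_loc \<eta>" using assms by (intro L1_loc_continuous) (simp add: C1c_def Cc_def)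
  have "(LINT y|lebesgue. \<eta> y *\<^sub>R (- gradient (moll n) (x - y))) = - (LINT y|lebesgue. moll n (x - y) *\<^sub>R h y)"
    by (rule integration_by_parts[OF C1c_reflect[OF C1c_moll]]) (use assms in \<open>auto simp: C1c_def Cc_def\<close>)
  then have "conv (gradient (moll n)) \<eta> x = (LINT y|lebesgue. moll n (x - y) *\<^sub>R h y)"
    unfolding conv_def by simp
  then have "conv (gradient (moll n)) \<eta> x $ i = (LINT y|lebesgue. moll n (x - y) *\<^sub>R h y) $ i" by simp
  also have "\<dots> = (LINT y|lebesgue. (moll n (x - y) *\<^sub>R h y) $ i)"
  proof (rule integral_bounded_linear[OF bounded_linear_vec_nth, symmetric])
    have "Cc (\<lambda>y. moll n (x - y) *\<^sub>R h y)"
      using assms by (intro Cc_mult_continuous C1cD(2)[OF assms]) (use Cc_reflect[OF Cc_moll] in \<open>auto simp: Cc_def\<close>)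
    then show "integrable lebesgue (\<lambda>y. moll n (x - y) *\<^sub>R h y)" by (rule Cc_integrable)
  qed
  also have "\<dots> = conv (moll n) (\<lambda>y. h y $ i) x" by (simp add: conv_def mult.commute)
  finally show ?thesis
    using conv_nth[OF L C1cD(2)[OF C1c_moll], of n x i]
    by (simp add: partial_deriv_conv[OF L test_function_moll] gradient_def)
qed

lemma L1_loc_nth: "L1_loc g \<Longrightarrow> L1_loc (\<lambda>x. g x $ i)" for g :: "real ^ 'n \<Rightarrow> real ^ 'm"
proof -
  assume "L1_loc g"
  then have "integrable lebesgue (\<lambda>x. (indicator K x *\<^sub>R g x) $ i)" if "compact K" for K
    using that unfolding L1_loc_def set_integrable_def
    by (intro integrable_bounded_linear[OF bounded_linear_vec_nth]) auto
  then show ?thesis unfolding L1_loc_def set_integrable_def by simp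
qed

text \<open>Weak gradients are defined by smooth test functions only. Mollifying a C^1 function
  yields such test functions, with uniformly convergent derivatives, and both sides pass to the
  limit.\<close>

lemma weak_gradient_C1c:
  fixes u :: "real ^ 'n \<Rightarrow> real"
  assumes u: "has_weak_gradient u g" and \<eta>: "C1c \<eta> h"
  shows "(LINT x|lebesgue. u x * h x $ i) = - (LINT x|lebesgue. g x $ i * \<eta> x)"
proof -
  have L: "L1_loc \<eta>" using \<eta> by (intro L1_loc_continuous) (simp add: C1c_def Cc_def)
  obtain r where r: "r > 0" "\<And>x. norm x \<ge> r \<Longrightarrow> \<eta> x = 0" using Cc_support[OF C1cD(1)[OF \<eta>]] by blast
  have t: "test_function (conv (moll n) \<eta>)" for n
    by (rule test_function_conv_moll[OF L, of r]) (use r in auto)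
  have uL: "L1_loc u" "L1_loc (\<lambda>x. g x $ i)" using u by (auto simp: has_weak_gradient_def L1_loc_nth)
  have "(LINT x|lebesgue. u x * conv (moll n) (\<lambda>y. h y $ i) x) = - (LINT x|lebesgue. g x $ i * conv (moll n) \<eta> x)" for n
  proof -
    have "(LINT x|lebesgue. u x * partial_deriv i (conv (moll n) \<eta>) x) = - (LINT x|lebesgue. g x $ i * conv (moll n) \<eta> x)"
      using u t[of n] unfolding has_weak_gradient_def by blast
    then show ?thesis by (simp only: conv_partial_moll[OF \<eta>])
  qed
  moreover have "(\<lambda>n. LINT x|lebesgue. u x * conv (moll n) (\<lambda>y. h y $ i) x) \<longlonglongrightarrow> (LINT x|lebesgue. u x * h x $ i)"
    by (intro tendsto_integral_conv_moll uL Cc_nth C1cD(2)[OF \<eta>])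
  moreover have "(\<lambda>n. - (LINT x|lebesgue. g x $ i * conv (moll n) \<eta> x)) \<longlonglongrightarrow> - (LINT x|lebesgue. g x $ i * \<eta> x)"
    by (intro tendsto_minus tendsto_integral_conv_moll uL C1cD(1)[OF \<eta>])
  ultimately show ?thesis using LIMSEQ_unique by simp
qed

subsection \<open>Approximation in the mean square\<close>

lemma L2_loc_nn_integral:
  fixes u :: "real ^ 'n \<Rightarrow> 'b::euclidean_space"
  assumes u: "L2_loc u" and B: "bounded B" "B \<in> sets lebesgue"
  shows "(\<integral>\<^sup>+x\<in>B. ennreal ((norm (u x))\<^sup>2) \<partial>lebesgue) < \<infinity>"
proof -
  have "compact (closure B)" using B by auto
  then have "integrable lebesgue (\<lambda>x. indicator (closure B) x *\<^sub>R (norm (u x))\<^sup>2)"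
    using u unfolding L2_loc_def set_integrable_def by blast
  then have "(\<integral>\<^sup>+x. ennreal (norm (indicator (closure B) x *\<^sub>R (norm (u x))\<^sup>2)) \<partial>lebesgue) < \<infinity>"
    by (simp only: integrable_iff_bounded)
  moreover have "(\<integral>\<^sup>+x\<in>B. ennreal ((norm (u x))\<^sup>2) \<partial>lebesgue) \<le> (\<integral>\<^sup>+x. ennreal (norm (indicator (closure B) x *\<^sub>R (norm (u x))\<^sup>2)) \<partial>lebesgue)"
    using closure_subset[of B] by (intro nn_integral_mono) (auto simp: indicator_def)
  ultimately show ?thesis by (rule le_less_trans[rotated])
qed

text \<open>Integer cubes exhaust space, which reduces a local statement to countably many
  conditions; this matters for almost sure versions.\<close>

lemma L2_locI:
  fixes u :: "real ^ 'n \<Rightarrow> 'b::euclidean_space"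
  assumes [measurable]: "u \<in> borel_measurable lebesgue"
    and fin: "\<And>k::nat. k > 0 \<Longrightarrow> (\<integral>\<^sup>+x\<in>cube 0 (real k). ennreal ((norm (u x))\<^sup>2) \<partial>lebesgue) < \<infinity>"
  shows "L2_loc u"
  unfolding L2_loc_def
proof (intro conjI allI impI)
  fix K :: "(real ^ 'n) set" assume K: "compact K"
  then have [measurable]: "K \<in> sets lebesgue" by (simp add: lmeasurable_compact fmeasurableD)
  obtain k :: nat where k: "k > 0" "K \<subseteq> cube 0 (real k)" using bounded_subset_cube[OF compact_imp_bounded[OF K]] by blast
  show "set_integrable lebesgue K (\<lambda>x. (norm (u x))\<^sup>2)"
    unfolding set_integrable_def integrable_iff_bounded
  proof (intro conjI)
    have "(\<integral>\<^sup>+x. ennreal (norm (indicator K x *\<^sub>R (norm (u x))\<^sup>2)) \<partial>lebesgue) \<le> (\<integral>\<^sup>+x\<in>cube 0 (real k). ennreal ((norm (u x))\<^sup>2) \<partial>lebesgue)"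
      using k by (intro nn_integral_mono) (auto simp: indicator_def)
    then show "(\<integral>\<^sup>+x. ennreal (norm (indicator K x *\<^sub>R (norm (u x))\<^sup>2)) \<partial>lebesgue) < \<infinity>"
      using fin[OF k(1)] by (rule le_less_trans)
  qed measurable
qed fact

lemma L2_loc_set_integrable:
  fixes u :: "real ^ 'n \<Rightarrow> 'b::euclidean_space"
  assumes u: "L2_loc u" and B: "bounded B" "B \<in> sets lebesgue"
  shows "set_integrable lebesgue B u"
proof -
  have [measurable]: "u \<in> borel_measurable lebesgue" "B \<in> sets lebesgue" using u B by (auto simp: L2_loc_def)
  \<comment> \<open>The indicator is doubled: one copy acts as the square integrable weight, the
    other localises \<open>u\<close>.\<close>
  have "integrable lebesgue (\<lambda>x. indicator B x *\<^sub>R (indicator B x *\<^sub>R u x))"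
  proof (rule integrable_mult_square)
    have "emeasure lebesgue B < \<infinity>" using bounded_set_imp_lmeasurable[OF B] by (simp add: fmeasurable_def)
    moreover have "(\<integral>\<^sup>+x. ennreal ((indicator B x)\<^sup>2) \<partial>lebesgue) = (\<integral>\<^sup>+x. indicator B x \<partial>lebesgue)"
      by (intro nn_integral_cong) (simp add: indicator_def)
    ultimately show "(\<integral>\<^sup>+x. ennreal ((indicator B x)\<^sup>2) \<partial>lebesgue) < \<infinity>"
      using B by (simp only: nn_integral_indicator)
    have "(\<integral>\<^sup>+x. ennreal ((norm (indicator B x *\<^sub>R u x))\<^sup>2) \<partial>lebesgue) = (\<integral>\<^sup>+x\<in>B. ennreal ((norm (u x))\<^sup>2) \<partial>lebesgue)"
      by (intro nn_integral_cong) (auto simp: indicator_def)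
    then show "(\<integral>\<^sup>+x. ennreal ((norm (indicator B x *\<^sub>R u x))\<^sup>2) \<partial>lebesgue) < \<infinity>"
      using L2_loc_nn_integral[OF u B] by simp
  qed measurable
  then show ?thesis unfolding set_integrable_def
    by (rule Bochner_Integration.integrable_cong[THEN iffD1, rotated -1]) (auto simp: indicator_def)
qed

lemma L2_loc_imp_L1_loc: "L2_loc u \<Longrightarrow> L1_loc u"
  unfolding L1_loc_def
  by (auto intro!: L2_loc_set_integrable compact_imp_bounded simp: lmeasurable_compact fmeasurableD)

lemma L2_loc_nth: "L2_loc g \<Longrightarrow> L2_loc (\<lambda>x. g x $ i)" for g :: "real ^ 'n \<Rightarrow> real ^ 'm"
proof (rule L2_locI)
  assume g: "L2_loc g"
  then have [measurable]: "g \<in> borel_measurable lebesgue" by (simp add: L2_loc_def)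
  show "(\<lambda>x. g x $ i) \<in> borel_measurable lebesgue"
    by (rule measurable_compose[OF _ borel_measurable_nth]) measurable
  fix k :: nat assume k: "k > 0"
  have "(\<integral>\<^sup>+x\<in>cube 0 (real k). ennreal ((norm (g x $ i))\<^sup>2) \<partial>lebesgue) \<le> (\<integral>\<^sup>+x\<in>cube 0 (real k). ennreal ((norm (g x))\<^sup>2) \<partial>lebesgue)"
    using component_le_norm_cart by (intro nn_integral_mono mult_right_mono ennreal_leI power_mono) auto
  also have "\<dots> < \<infinity>" using k by (intro L2_loc_nn_integral[OF g] bounded_cube) auto
  finally show "(\<integral>\<^sup>+x\<in>cube 0 (real k). ennreal ((norm (g x $ i))\<^sup>2) \<partial>lebesgue) < \<infinity>" .
qed

text \<open>Mollification averages with a probability density and so contracts the mean square norm: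
  Jensen at each point, then Fubini.\<close>

lemma conv_moll_L2_le:
  fixes v :: "real ^ 'n \<Rightarrow> real"
  assumes v: "L1_loc v" and fin: "(\<integral>\<^sup>+y. ennreal ((v y)\<^sup>2) \<partial>lebesgue) < \<infinity>"
  shows "(\<integral>\<^sup>+x. ennreal ((conv (moll n) v x)\<^sup>2) \<partial>lebesgue) \<le> (\<integral>\<^sup>+y. ennreal ((v y)\<^sup>2) \<partial>lebesgue)"
proof -
  note [measurable] = L1_loc_set_measurable[OF v]
  have v2: "integrable lebesgue (\<lambda>y. (v y)\<^sup>2)"
    by (rule integrableI_bounded) (use fin in auto)
  obtain B where B: "\<And>x :: real ^ 'n. norm (moll n x) \<le> B"
    using Cc_bounded[OF Cc_moll] by blast
  have mm[measurable]: "(\<lambda>y. moll n (x - y)) \<in> borel_measurable lebesgue" for x :: "real ^ 'n"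
    by (intro Cc_lebesgue_measurable Cc_reflect Cc_moll)
  have pw: "ennreal ((conv (moll n) v x)\<^sup>2) \<le> (\<integral>\<^sup>+y. ennreal ((v y)\<^sup>2) * ennreal (moll n (x - y)) \<partial>lebesgue)" for x
  proof -
    define m where "m = conv (moll n) v x"
    have i2: "integrable lebesgue (\<lambda>y. (v y)\<^sup>2 * moll n (x - y))"
    proof (rule Bochner_Integration.integrable_bound[of _ "\<lambda>y. B * (v y)\<^sup>2"])
      show "AE y in lebesgue. norm ((v y)\<^sup>2 * moll n (x - y)) \<le> norm (B * (v y)\<^sup>2)"
      proof (rule AE_I2)
        fix y
        have "\<bar>moll n (x - y)\<bar> \<le> \<bar>B\<bar>" using B[of "x - y"] by simp
        then show "norm ((v y)\<^sup>2 * moll n (x - y)) \<le> norm (B * (v y)\<^sup>2)"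
          using mult_right_mono[of "\<bar>moll n (x - y)\<bar>" "\<bar>B\<bar>" "(v y)\<^sup>2"] by (simp add: abs_mult mult.commute)
      qed
    qed (use v2 in auto)
    have i1: "integrable lebesgue (\<lambda>y. v y * moll n (x - y))"
      using conv_integrable[OF v Cc_moll, of n x] by simp
    have i0: "integrable lebesgue (\<lambda>y. moll n (x - y))" by (intro Cc_integrable Cc_reflect Cc_moll)
    \<comment> \<open>Jensen's inequality for the square, as nonnegativity of a variance.\<close>
    have "0 \<le> (LINT y|lebesgue. (v y - m)\<^sup>2 * moll n (x - y))"
      by (intro integral_nonneg_AE AE_I2 mult_nonneg_nonneg moll_nonneg) auto
    also have "\<dots> = (LINT y|lebesgue. (v y)\<^sup>2 * moll n (x - y) - 2 * m * (v y * moll n (x - y)) + m\<^sup>2 * moll n (x - y))"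
      by (intro Bochner_Integration.integral_cong) (auto simp: power2_diff algebra_simps)
    also have "\<dots> = (LINT y|lebesgue. (v y)\<^sup>2 * moll n (x - y)) - 2 * m * (LINT y|lebesgue. v y * moll n (x - y)) + m\<^sup>2 * (LINT y|lebesgue. moll n (x - y))"
      using i0 i1 i2 by simp
    also have "(LINT y|lebesgue. v y * moll n (x - y)) = m" by (simp add: m_def conv_def)
    also have "(LINT y|lebesgue. moll n (x - y)) = 1" by (rule integral_moll_reflect)
    finally have "m\<^sup>2 \<le> (LINT y|lebesgue. (v y)\<^sup>2 * moll n (x - y))" by (simp add: power2_eq_square)
    then have "ennreal (m\<^sup>2) \<le> ennreal (LINT y|lebesgue. (v y)\<^sup>2 * moll n (x - y))" by (rule ennreal_leI)
    also have "\<dots> = (\<integral>\<^sup>+y. ennreal ((v y)\<^sup>2 * moll n (x - y)) \<partial>lebesgue)"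
      by (rule nn_integral_eq_integral[symmetric, OF i2]) (intro AE_I2 mult_nonneg_nonneg moll_nonneg zero_le_power2)
    also have "\<dots> = (\<integral>\<^sup>+y. ennreal ((v y)\<^sup>2) * ennreal (moll n (x - y)) \<partial>lebesgue)"
      by (intro nn_integral_cong ennreal_mult moll_nonneg) auto
    finally show ?thesis by (simp add: m_def)
  qed
  have [measurable]: "(\<lambda>x. x) \<in> lebesgue \<rightarrow>\<^sub>M (borel :: (real ^ 'n) measure)"
    by (rule measurable_completion) simp
  have mb[measurable]: "moll n \<in> borel_measurable (borel :: (real ^ 'n) measure)" by (rule Cc_measurable[OF Cc_moll])
  have [measurable]: "(\<lambda>(x, y). x - y) \<in> borel_measurable (lebesgue \<Otimes>\<^sub>M (lebesgue :: (real ^ 'n) measure))"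
    unfolding split_beta'
    by (intro borel_measurable_diff measurable_compose[OF measurable_fst] measurable_compose[OF measurable_snd]) measurable
  have m2[measurable]: "(\<lambda>(x, y). moll n (x - y)) \<in> borel_measurable (lebesgue \<Otimes>\<^sub>M (lebesgue :: (real ^ 'n) measure))"
    using measurable_compose[of "\<lambda>(x, y). x - y" _ borel "moll n"] by (simp add: split_beta')
  have "(\<integral>\<^sup>+x. ennreal ((conv (moll n) v x)\<^sup>2) \<partial>lebesgue)
    \<le> (\<integral>\<^sup>+x. (\<integral>\<^sup>+y. ennreal ((v y)\<^sup>2) * ennreal (moll n (x - y)) \<partial>lebesgue) \<partial>lebesgue)"
    by (intro nn_integral_mono pw)
  also have "\<dots> = (\<integral>\<^sup>+y. (\<integral>\<^sup>+x. ennreal ((v y)\<^sup>2) * ennreal (moll n (x - y)) \<partial>lebesgue) \<partial>lebesgue)"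
    by (rule lebesgue_pair.Fubini'[symmetric]) (use m2 in \<open>simp add: split_beta'\<close>)
  also have "\<dots> = (\<integral>\<^sup>+y. ennreal ((v y)\<^sup>2) \<partial>lebesgue)"
  proof (rule nn_integral_cong)
    fix y :: "real ^ 'n"
    have [measurable]: "(\<lambda>x. moll n (x - y)) \<in> borel_measurable lebesgue"
      by (intro Cc_lebesgue_measurable Cc_translate Cc_moll)
    have "(\<integral>\<^sup>+x. ennreal (moll n (x - y)) \<partial>lebesgue) = ennreal (LINT x|lebesgue. moll n (x - y))"
      by (intro nn_integral_eq_integral Cc_integrable Cc_translate Cc_moll) (use moll_nonneg in auto)
    also have "(LINT x|lebesgue. moll n (x - y)) = 1"
      using integral_lebesgue_shift[OF Cc_lebesgue_measurable[OF Cc_moll], of n "- y"] by (simp add: integral_moll)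
    finally show "(\<integral>\<^sup>+x. ennreal ((v y)\<^sup>2) * ennreal (moll n (x - y)) \<partial>lebesgue) = ennreal ((v y)\<^sup>2)"
      by (simp add: nn_integral_cmult)
  qed
  finally show ?thesis .
qed

lemma emeasure_bounded_finite:
  fixes B :: "'a::euclidean_space set"
  assumes "bounded B" "B \<in> sets lebesgue" shows "emeasure lebesgue B < \<infinity>"
  using bounded_set_imp_lmeasurable[OF assms] by (simp add: fmeasurable_def)

lemma L2_approx_truncation:
  fixes v :: "'a \<Rightarrow> real"
  assumes [measurable]: "v \<in> borel_measurable N" and fin: "(\<integral>\<^sup>+x. ennreal ((v x)\<^sup>2) \<partial>N) < \<infinity>"
  shows "(\<lambda>n. \<integral>\<^sup>+x. ennreal ((v x - max (- real n) (min (real n) (v x)))\<^sup>2) \<partial>N) \<longlonglongrightarrow> 0"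
proof -
  have "(\<lambda>n. \<integral>\<^sup>+x. ennreal ((v x - max (- real n) (min (real n) (v x)))\<^sup>2) \<partial>N) \<longlonglongrightarrow> (\<integral>\<^sup>+x. 0 \<partial>N)"
  proof (rule nn_integral_dominated_convergence[where w="\<lambda>x. ennreal ((v x)\<^sup>2)"])
    show "AE x in N. ennreal ((v x - max (- real n) (min (real n) (v x)))\<^sup>2) \<le> ennreal ((v x)\<^sup>2)" for n
      by (intro AE_I2 ennreal_leI abs_le_square_iff[THEN iffD1]) (simp add: max_def min_def)
    show "AE x in N. (\<lambda>n. ennreal ((v x - max (- real n) (min (real n) (v x)))\<^sup>2)) \<longlonglongrightarrow> 0"
    proof (rule AE_I2, rule tendsto_eventually)
      fix x
      obtain M :: nat where "\<bar>v x\<bar> \<le> M" using real_arch_simple by blast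
      then show "\<forall>\<^sub>F n in sequentially. ennreal ((v x - max (- real n) (min (real n) (v x)))\<^sup>2) = 0"
        by (intro eventually_sequentiallyI[of M]) (auto simp: max_def min_def)
    qed
  qed (use fin in auto)
  then show ?thesis by simp
qed

text \<open>Measurability supplies continuous functions converging almost everywhere. Clipping them
  at \<open>c\<close> and multiplying by a cut-off does not disturb the limit and provides a
  majorant for dominated convergence.\<close>

lemma L2_approx_bounded_Cc:
  fixes v :: "real ^ 'n \<Rightarrow> real"
  assumes [measurable]: "v \<in> borel_measurable lebesgue"
    and c: "\<And>x. \<bar>v x\<bar> \<le> c" and supp: "\<And>x. norm x > r \<Longrightarrow> v x = 0" and e: "e > 0"
  obtains k where "Cc k" "\<And>x. norm x \<ge> r + 1 \<Longrightarrow> k x = 0"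
    "(\<integral>\<^sup>+x. ennreal ((v x - k x)\<^sup>2) \<partial>lebesgue) \<le> ennreal e"
proof -
  have "v measurable_on UNIV" by (rule lebesgue_measurable_imp_measurable_on) auto
  then obtain Z g where Z: "negligible Z" and g: "\<And>n. continuous_on UNIV (g n)"
    and lim: "\<And>x. x \<notin> Z \<Longrightarrow> (\<lambda>n. g n x) \<longlonglongrightarrow> v x"
    unfolding measurable_on_def by auto
  define cut where "cut x = max 0 (min 1 (r + 1 - norm x))" for x :: "real ^ 'n"
  define k where "k n x = cut x * max (- c) (min c (g n x))" for n x
  have c0: "c \<ge> 0" using c[of 0] by linarith
  have cut: "0 \<le> cut x" "cut x \<le> 1" "norm x \<ge> r + 1 \<Longrightarrow> cut x = 0" "norm x \<le> r \<Longrightarrow> cut x = 1" for x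
    by (auto simp: cut_def)
  have k0: "k n x = 0" if "norm x \<ge> r + 1" for n x using cut(3)[OF that] by (simp add: k_def)
  have kc: "\<bar>k n x\<bar> \<le> c" for n x
  proof -
    have "\<bar>max (- c) (min c (g n x))\<bar> \<le> c" using c0 by (auto simp: max_def min_def)
    then have "\<bar>cut x\<bar> * \<bar>max (- c) (min c (g n x))\<bar> \<le> 1 * c"
      using cut(1,2)[of x] by (intro mult_mono) auto
    then show ?thesis by (simp add: k_def abs_mult)
  qed
  have kC: "Cc (k n)" for n
    unfolding Cc_def
  proof (intro conjI exI[of _ "r + 1"] allI impI k0)
    show "continuous_on UNIV (k n)" unfolding k_def cut_def by (intro continuous_intros g)
  qed
  have [measurable]: "k n \<in> borel_measurable lebesgue" for n by (rule Cc_lebesgue_measurable[OF kC])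
  have "(\<lambda>n. \<integral>\<^sup>+x. ennreal ((v x - k n x)\<^sup>2) \<partial>lebesgue) \<longlonglongrightarrow> (\<integral>\<^sup>+x. 0 \<partial>(lebesgue :: (real ^ 'n) measure))"
  proof (rule nn_integral_dominated_convergence[where w="\<lambda>x. ennreal ((2 * c)\<^sup>2) * indicator (cball 0 (r + 1)) x"])
    show "AE x in lebesgue. ennreal ((v x - k n x)\<^sup>2) \<le> ennreal ((2 * c)\<^sup>2) * indicator (cball 0 (r + 1)) x" for n
    proof (rule AE_I2)
      fix x :: "real ^ 'n"
      show "ennreal ((v x - k n x)\<^sup>2) \<le> ennreal ((2 * c)\<^sup>2) * indicator (cball 0 (r + 1)) x"
      proof (cases "norm x \<le> r + 1")
        case True
        have "\<bar>v x - k n x\<bar> \<le> \<bar>2 * c\<bar>" using c[of x] kc[of n x] by linarith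
        then have "(v x - k n x)\<^sup>2 \<le> (2 * c)\<^sup>2" by (rule abs_le_square_iff[THEN iffD1])
        then show ?thesis using True by (simp add: ennreal_leI)
      next
        case False
        then show ?thesis using k0[of x n] supp[of x] by simp
      qed
    qed
    have "emeasure lebesgue (cball (0 :: real ^ 'n) (r + 1)) < \<infinity>" by (rule emeasure_bounded_finite) auto
    then show "(\<integral>\<^sup>+x. ennreal ((2 * c)\<^sup>2) * indicator (cball (0 :: real ^ 'n) (r + 1)) x \<partial>lebesgue) < \<infinity>"
      by (subst nn_integral_cmult_indicator) (simp_all add: ennreal_mult_less_top)
    have "AE x in lebesgue. x \<notin> Z" using Z by (simp add: negligible_iff_null_sets AE_not_in)
    then show "AE x in lebesgue. (\<lambda>n. ennreal ((v x - k n x)\<^sup>2)) \<longlonglongrightarrow> 0"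
    proof eventually_elim
      case (elim x)
      have "(\<lambda>n. (v x - k n x)\<^sup>2) \<longlonglongrightarrow> (v x - cut x * max (- c) (min c (v x)))\<^sup>2"
        unfolding k_def by (intro tendsto_intros tendsto_max tendsto_min lim elim)
      also have "v x - cut x * max (- c) (min c (v x)) = 0"
        using c[of x] cut(4)[of x] supp[of x] by (cases "norm x \<le> r") (auto simp: max_def min_def)
      finally have "(\<lambda>n. ennreal ((v x - k n x)\<^sup>2)) \<longlonglongrightarrow> ennreal (0\<^sup>2)" by (rule tendsto_ennrealI)
      then show ?case by simp
    qed
    show "(\<lambda>x. ennreal ((2 * c)\<^sup>2) * indicator (cball (0 :: real ^ 'n) (r + 1)) x) \<in> borel_measurable lebesgue"
      by (rule measurable_compose[OF borel_measurable_indicator]) (simp, measurable)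
  qed measurable
  then have "eventually (\<lambda>n. (\<integral>\<^sup>+x. ennreal ((v x - k n x)\<^sup>2) \<partial>lebesgue) < ennreal e) sequentially"
    by (intro order_tendstoD(2)) (use e in auto)
  then obtain n where "(\<integral>\<^sup>+x. ennreal ((v x - k n x)\<^sup>2) \<partial>lebesgue) < ennreal e"
    by (auto simp: eventually_sequentially)
  then show thesis using that[OF kC k0] less_imp_le by blast
qed

lemma L2_approx_Cc:
  fixes v :: "real ^ 'n \<Rightarrow> real"
  assumes v[measurable]: "v \<in> borel_measurable lebesgue" and fin: "(\<integral>\<^sup>+x. ennreal ((v x)\<^sup>2) \<partial>lebesgue) < \<infinity>"
    and supp: "\<And>x. norm x > r \<Longrightarrow> v x = 0" and e: "e > 0"
  obtains k where "Cc k" "\<And>x. norm x \<ge> r + 1 \<Longrightarrow> k x = 0"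
    "(\<integral>\<^sup>+x. ennreal ((v x - k x)\<^sup>2) \<partial>lebesgue) \<le> ennreal e"
proof -
  have "eventually (\<lambda>n. (\<integral>\<^sup>+x. ennreal ((v x - max (- real n) (min (real n) (v x)))\<^sup>2) \<partial>lebesgue) < ennreal (e / 4)) sequentially"
    by (intro order_tendstoD(2)[OF L2_approx_truncation[OF v fin]]) (use e in auto)
  then obtain n where n: "(\<integral>\<^sup>+x. ennreal ((v x - max (- real n) (min (real n) (v x)))\<^sup>2) \<partial>lebesgue) < ennreal (e / 4)"
    by (auto simp: eventually_sequentially)
  define w where "w x = max (- real n) (min (real n) (v x))" for x
  have w[measurable]: "w \<in> borel_measurable lebesgue" unfolding w_def by measurable
  have "\<bar>w x\<bar> \<le> real n" "norm x > r \<Longrightarrow> w x = 0" for x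
    using supp[of x] by (auto simp: w_def max_def min_def)
  then obtain k where k: "Cc k" "\<And>x. norm x \<ge> r + 1 \<Longrightarrow> k x = 0"
    "(\<integral>\<^sup>+x. ennreal ((w x - k x)\<^sup>2) \<partial>lebesgue) \<le> ennreal (e / 4)"
    using L2_approx_bounded_Cc[OF w, of "real n" r "e / 4"] e by auto
  have [measurable]: "k \<in> borel_measurable lebesgue" by (rule Cc_lebesgue_measurable[OF k(1)])
  have "(\<integral>\<^sup>+x. ennreal ((norm ((v x - w x) + (w x - k x)))\<^sup>2) \<partial>lebesgue)
     \<le> 2 * (\<integral>\<^sup>+x. ennreal ((norm (v x - w x))\<^sup>2) \<partial>lebesgue) + 2 * (\<integral>\<^sup>+x. ennreal ((norm (w x - k x))\<^sup>2) \<partial>lebesgue)"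
    by (rule nn_integral_norm_sq_triangle) measurable
  also have "\<dots> \<le> 2 * ennreal (e / 4) + 2 * ennreal (e / 4)"
    using n k(3) by (intro add_mono mult_left_mono) (auto simp: w_def intro: less_imp_le)
  also have "\<dots> = ennreal e"
    using e by (simp add: ennreal_plus[symmetric] ennreal_mult'[symmetric] ennreal_numeral[symmetric] del: ennreal_plus ennreal_numeral)
  finally show thesis using that[OF k(1,2)] by simp
qed

lemma Cc_L2:
  fixes k :: "real ^ 'n \<Rightarrow> real"
  assumes "Cc k" shows "(\<integral>\<^sup>+x. ennreal ((k x)\<^sup>2) \<partial>lebesgue) < \<infinity>"
proof -
  have "continuous_on UNIV k" using assms by (simp add: Cc_def)
  then have "integrable lebesgue (\<lambda>x. k x *\<^sub>R k x)" by (intro Cc_integrable Cc_mult_continuous assms)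
  then have "(\<integral>\<^sup>+x. ennreal (norm (k x *\<^sub>R k x)) \<partial>lebesgue) < \<infinity>" unfolding integrable_iff_bounded by blast
  then show ?thesis by (simp add: abs_mult power2_eq_square)
qed

lemma L2_imp_L2_loc:
  fixes v :: "real ^ 'n \<Rightarrow> 'b::euclidean_space"
  assumes [measurable]: "v \<in> borel_measurable lebesgue" and fin: "(\<integral>\<^sup>+x. ennreal ((norm (v x))\<^sup>2) \<partial>lebesgue) < \<infinity>"
  shows "L2_loc v"
proof (rule L2_locI)
  fix k :: nat
  have "(\<integral>\<^sup>+x\<in>cube 0 (real k). ennreal ((norm (v x))\<^sup>2) \<partial>lebesgue) \<le> (\<integral>\<^sup>+x. ennreal ((norm (v x))\<^sup>2) \<partial>lebesgue)"
    by (intro nn_integral_mono) (auto simp: indicator_def)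
  then show "(\<integral>\<^sup>+x\<in>cube 0 (real k). ennreal ((norm (v x))\<^sup>2) \<partial>lebesgue) < \<infinity>" using fin by (rule le_less_trans)
qed measurable

lemma ennreal_tendsto_0I:
  fixes u :: "nat \<Rightarrow> ennreal"
  assumes "\<And>e::real. e > 0 \<Longrightarrow> eventually (\<lambda>n. u n \<le> ennreal e) sequentially"
  shows "u \<longlonglongrightarrow> 0"
proof (rule order_tendstoI)
  fix e :: ennreal assume "0 < e"
  then obtain e' :: real where e': "0 < e'" "ennreal e' < e"
    by (metis dense ennreal_cases ennreal_less_zero_iff less_imp_le less_irrefl neq_top_trans not_less order.strict_trans top_neq_ennreal)
  show "eventually (\<lambda>n. u n < e) sequentially"
    using assms[OF e'(1)] by eventually_elim (rule le_less_trans[OF _ e'(2)])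
qed auto

text \<open>Mollification converges uniformly on a continuous \<open>k\<close> close to
  \<open>v\<close>, and its contraction property controls the remainder v - k uniformly in the
  index.\<close>

lemma conv_moll_L2_tendsto:
  fixes v :: "real ^ 'n \<Rightarrow> real"
  assumes v[measurable]: "v \<in> borel_measurable lebesgue" and fin: "(\<integral>\<^sup>+x. ennreal ((v x)\<^sup>2) \<partial>lebesgue) < \<infinity>"
    and supp: "\<And>x. norm x > r \<Longrightarrow> v x = 0"
  shows "(\<lambda>n. \<integral>\<^sup>+x. ennreal ((conv (moll n) v x - v x)\<^sup>2) \<partial>lebesgue) \<longlonglongrightarrow> 0"
proof (rule ennreal_tendsto_0I)
  fix e :: real assume e: "e > 0"
  \<comment> \<open>The two nested splittings of squares below give a total of (2 + 4 + 4) e/16,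
    less than \<open>e\<close>.\<close>
  obtain k where k: "Cc k" "\<And>x. norm x \<ge> r + 1 \<Longrightarrow> k x = 0"
    "(\<integral>\<^sup>+x. ennreal ((v x - k x)\<^sup>2) \<partial>lebesgue) \<le> ennreal (e / 16)"
    by (rule L2_approx_Cc[OF v fin supp, of r "e / 16"]) (use e in auto)
  have km[measurable]: "k \<in> borel_measurable lebesgue" by (rule Cc_lebesgue_measurable[OF k(1)])
  have vL: "L1_loc v" using L2_imp_L2_loc[OF v] fin by (intro L2_loc_imp_L1_loc) simp
  have kL: "L1_loc k" using k(1) by (intro L1_loc_continuous) (simp add: Cc_def)
  have finvk: "(\<integral>\<^sup>+x. ennreal ((v x - k x)\<^sup>2) \<partial>lebesgue) < \<infinity>"
    using k(3) by (rule le_less_trans) simp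
  have vkL: "L1_loc (\<lambda>x. v x - k x)" using L2_imp_L2_loc[of "\<lambda>x. v x - k x"] finvk by (intro L2_loc_imp_L1_loc) simp
  define K where "K = cball (0 :: real ^ 'n) (r + 2)"
  have "emeasure lebesgue K < \<infinity>" unfolding K_def by (rule emeasure_bounded_finite) auto
  then obtain m where m: "emeasure lebesgue K = ennreal m" "m \<ge> 0" by (cases "emeasure lebesgue K") auto
  \<comment> \<open>A uniform error \<open>d\<close> on the ball \<open>K\<close> of measure
    \<open>m\<close> then contributes at most e/16 to the squared norm.\<close>
  define d where "d = sqrt (e / (16 * (m + 1)))"
  have d: "d > 0" "d\<^sup>2 * m \<le> e / 16" using e m by (auto simp: d_def field_simps)
  obtain M where M: "\<And>n x. n \<ge> M \<Longrightarrow> \<bar>conv (moll n) k x - k x\<bar> \<le> d" using conv_moll_uniform[OF k(1) d(1)] by blast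
  show "eventually (\<lambda>n. (\<integral>\<^sup>+x. ennreal ((conv (moll n) v x - v x)\<^sup>2) \<partial>lebesgue) \<le> ennreal e) sequentially"
  proof (rule eventually_sequentiallyI[of M])
    fix n assume n: "M \<le> n"
    have [measurable]: "conv (moll n) v \<in> borel_measurable lebesgue" "conv (moll n) k \<in> borel_measurable lebesgue"
      "conv (moll n) (\<lambda>x. v x - k x) \<in> borel_measurable lebesgue"
      by (intro continuous_on_imp_lebesgue_measurable conv_continuous vL kL vkL Cc_moll)+
    have split: "conv (moll n) v x = conv (moll n) (\<lambda>x. v x - k x) x + conv (moll n) k x" for x
      using conv_integrable[OF vL Cc_moll, of n x] conv_integrable[OF kL Cc_moll, of n x]
      unfolding conv_def by (simp add: left_diff_distrib)
    have 1: "(\<integral>\<^sup>+x. ennreal ((norm (conv (moll n) (\<lambda>x. v x - k x) x))\<^sup>2) \<partial>lebesgue) \<le> ennreal (e / 16)"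
      using order_trans[OF conv_moll_L2_le[OF vkL finvk] k(3)] by simp
    have 2: "(\<integral>\<^sup>+x. ennreal ((norm (conv (moll n) k x - k x))\<^sup>2) \<partial>lebesgue) \<le> ennreal (e / 16)"
    proof -
      have "(\<integral>\<^sup>+x. ennreal ((norm (conv (moll n) k x - k x))\<^sup>2) \<partial>lebesgue) \<le> (\<integral>\<^sup>+x. ennreal (d\<^sup>2) * indicator K x \<partial>lebesgue)"
      proof (rule nn_integral_mono)
        fix x :: "real ^ 'n"
        show "ennreal ((norm (conv (moll n) k x - k x))\<^sup>2) \<le> ennreal (d\<^sup>2) * indicator K x"
        proof (cases "x \<in> K")
          case True
          have "\<bar>conv (moll n) k x - k x\<bar> \<le> \<bar>d\<bar>" using M[OF n, of x] by simp
          then have "(conv (moll n) k x - k x)\<^sup>2 \<le> d\<^sup>2" by (rule abs_le_square_iff[THEN iffD1])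
          then show ?thesis using True by (simp add: ennreal_leI)
        next
          case False
          then have nx: "norm x > r + 2" by (simp add: K_def)
          have "k y = 0" if "norm y > r + 1" for y using k(2)[of y] that by simp
          then have "conv (moll n) k x = 0" using nx by (intro conv_moll_support[of "r + 1"]) auto
          moreover have "k x = 0" using nx by (intro k(2)) simp
          ultimately show ?thesis by simp
        qed
      qed
      also have "\<dots> = ennreal (d\<^sup>2 * m)"
        using m by (simp add: K_def nn_integral_cmult_indicator ennreal_mult[symmetric])
      also have "\<dots> \<le> ennreal (e / 16)" using d(2) by (rule ennreal_leI)
      finally show ?thesis .
    qed
    have 3: "(\<integral>\<^sup>+x. ennreal ((norm (k x - v x))\<^sup>2) \<partial>lebesgue) \<le> ennreal (e / 16)"
      using k(3) by (simp add: power2_commute)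
    have 4: "(\<integral>\<^sup>+x. ennreal ((norm ((conv (moll n) k x - k x) + (k x - v x)))\<^sup>2) \<partial>lebesgue) \<le> 2 * ennreal (e / 16) + 2 * ennreal (e / 16)"
      by (rule order_trans[OF nn_integral_norm_sq_triangle add_mono[OF mult_left_mono[OF 2] mult_left_mono[OF 3]]]) simp_all
    have "(\<integral>\<^sup>+x. ennreal ((norm (conv (moll n) (\<lambda>x. v x - k x) x + ((conv (moll n) k x - k x) + (k x - v x))))\<^sup>2) \<partial>lebesgue)
      \<le> 2 * ennreal (e / 16) + 2 * (2 * ennreal (e / 16) + 2 * ennreal (e / 16))"
      by (rule order_trans[OF nn_integral_norm_sq_triangle add_mono[OF mult_left_mono[OF 1] mult_left_mono[OF 4]]]) simp_all
    also have "\<dots> = ennreal (10 * e / 16)"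
      using e by (simp add: ennreal_plus[symmetric] ennreal_mult'[symmetric] ennreal_numeral[symmetric] del: ennreal_plus ennreal_numeral)
    also have "\<dots> \<le> ennreal e" using e by (intro ennreal_leI) simp
    finally show "(\<integral>\<^sup>+x. ennreal ((conv (moll n) v x - v x)\<^sup>2) \<partial>lebesgue) \<le> ennreal e"
      by (simp add: split algebra_simps)
  qed
qed

text \<open>Admits as test function any compactly supported \<open>w\<close> with square integrable
  weak gradient \<open>W\<close>, such as a squared cut-off times the solution. Mollification makes
  \<open>w\<close> smooth, and the local square integrability of \<open>F\<close> carries the
  equation to the limit.\<close>

lemma div_zero_weak_gradient:
  fixes F W :: "real ^ 'n \<Rightarrow> real ^ 'n"
  assumes F: "distr_div_zero F" "L2_loc F" and w: "L1_loc w" "\<And>x. norm x > r \<Longrightarrow> w x = 0"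
    and W[measurable]: "W \<in> borel_measurable lebesgue" and finW: "(\<integral>\<^sup>+x. ennreal ((norm (W x))\<^sup>2) \<partial>lebesgue) < \<infinity>"
    and suppW: "\<And>x. norm x > r \<Longrightarrow> W x = 0"
    and weak: "\<And>\<eta> h i. C1c \<eta> h \<Longrightarrow> (LINT x|lebesgue. w x * h x $ i) = - (LINT x|lebesgue. W x $ i * \<eta> x)"
  shows "(LINT x|lebesgue. W x \<bullet> F x) = 0"
proof -
  define K where "K = cball (0 :: real ^ 'n) (r + 1)"
  have K[measurable]: "K \<in> sets lebesgue" unfolding K_def by auto
  have Fm[measurable]: "(\<lambda>x. F x $ i) \<in> borel_measurable lebesgue" for i
    using L2_loc_nth[OF F(2)] by (simp add: L2_loc_def)
  have Wm[measurable]: "(\<lambda>x. W x $ i) \<in> borel_measurable lebesgue" for i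
    by (rule measurable_compose[OF W borel_measurable_nth])
  have finWi: "(\<integral>\<^sup>+x. ennreal ((W x $ i)\<^sup>2) \<partial>lebesgue) < \<infinity>" for i
  proof -
    have "(W x $ i)\<^sup>2 \<le> (norm (W x))\<^sup>2" for x
      using component_le_norm_cart[of "W x" i] by (simp add: abs_le_square_iff[symmetric])
    then have "(\<integral>\<^sup>+x. ennreal ((W x $ i)\<^sup>2) \<partial>lebesgue) \<le> (\<integral>\<^sup>+x. ennreal ((norm (W x))\<^sup>2) \<partial>lebesgue)"
      by (intro nn_integral_mono ennreal_leI)
    then show ?thesis using finW by (rule le_less_trans)
  qed
  have WL: "L1_loc (\<lambda>x. W x $ i)" for i
    using L2_imp_L2_loc[OF Wm] finWi by (intro L2_loc_imp_L1_loc) simp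
  have suppWi: "W x $ i = 0" if "norm x > r" for x i using suppW[OF that] by simp
  \<comment> \<open>All mollified gradients vanish outside \<open>K\<close>, so truncating
    \<open>F\<close> there yields square integrable weights without changing the pairings.\<close>
  define \<theta> where "\<theta> i x = F x $ i * indicator K x" for i x
  have \<theta>m[measurable]: "\<theta> i \<in> borel_measurable lebesgue" for i unfolding \<theta>_def by measurable
  have fin\<theta>: "(\<integral>\<^sup>+x. ennreal ((\<theta> i x)\<^sup>2) \<partial>lebesgue) < \<infinity>" for i
  proof -
    have "(\<integral>\<^sup>+x. ennreal ((\<theta> i x)\<^sup>2) \<partial>lebesgue) = (\<integral>\<^sup>+x\<in>K. ennreal ((norm (F x $ i))\<^sup>2) \<partial>lebesgue)"
      by (intro nn_integral_cong) (auto simp: \<theta>_def indicator_def)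
    also have "\<dots> < \<infinity>" by (rule L2_loc_nn_integral[OF L2_loc_nth[OF F(2)] _ K]) (auto simp: K_def)
    finally show ?thesis .
  qed
  define f where "f i n = conv (moll n) (\<lambda>y. W y $ i)" for i n
  have fm[measurable]: "f i n \<in> borel_measurable lebesgue" for i n
    unfolding f_def by (intro continuous_on_imp_lebesgue_measurable conv_continuous WL Cc_moll)
  have fin_f: "(\<integral>\<^sup>+x. ennreal ((f i n x)\<^sup>2) \<partial>lebesgue) < \<infinity>" for i n
    unfolding f_def using conv_moll_L2_le[OF WL finWi] finWi by (rule le_less_trans)
  have i1: "integrable lebesgue (\<lambda>x. \<theta> i x *\<^sub>R f i n x)" for i n
    using fin\<theta> fin_f by (intro integrable_mult_square) auto
  have i2: "integrable lebesgue (\<lambda>x. \<theta> i x *\<^sub>R W x $ i)" for i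
    using fin\<theta> finWi by (intro integrable_mult_square) auto
  have lim: "(\<lambda>n. LINT x|lebesgue. \<theta> i x *\<^sub>R f i n x) \<longlonglongrightarrow> (LINT x|lebesgue. \<theta> i x *\<^sub>R W x $ i)" for i
  proof (rule L2_weak_limit[OF fm Wm \<theta>m fin\<theta> i1 i2])
    show "(\<lambda>n. \<integral>\<^sup>+x. ennreal ((norm (f i n x - W x $ i))\<^sup>2) \<partial>lebesgue) \<longlonglongrightarrow> 0"
      using conv_moll_L2_tendsto[OF Wm finWi suppWi, where r=r] by (simp add: f_def)
  qed
  have grad: "gradient (conv (moll n) w) x $ i = f i n x" for i n x
  proof -
    have "gradient (conv (moll n) w) x $ i = conv (gradient (moll n)) w x $ i"
      by (simp add: gradient_conv[OF w(1) C1c_moll])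
    also have "\<dots> = conv (\<lambda>z. gradient (moll n) z $ i) w x"
      by (rule conv_nth[OF w(1) C1cD(2)[OF C1c_moll]])
    also have "\<dots> = - (LINT y|lebesgue. w y * (- gradient (moll n) (x - y)) $ i)"
      by (simp add: conv_def)
    also have "\<dots> = (LINT y|lebesgue. W y $ i * moll n (x - y))"
      by (subst weak[OF C1c_reflect[OF C1c_moll]]) simp
    finally show ?thesis by (simp add: f_def conv_def)
  qed
  have f0: "f i n x = 0" if "x \<notin> K" for i n x
    unfolding f_def using that by (intro conv_moll_support[of r]) (auto simp: K_def suppWi)
  have "(\<Sum>i\<in>UNIV. LINT x|lebesgue. \<theta> i x *\<^sub>R f i n x) = 0" for n
  proof -
    have "test_function (conv (moll n) w)" by (rule test_function_conv_moll[OF w])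
    then have "0 = (LINT x|lebesgue. gradient (conv (moll n) w) x \<bullet> F x)"
      using F(1) unfolding distr_div_zero_def by simp
    also have "\<dots> = (LINT x|lebesgue. (\<Sum>i\<in>UNIV. \<theta> i x *\<^sub>R f i n x))"
      unfolding inner_vec_def grad
      by (intro Bochner_Integration.integral_cong refl sum.cong) (use f0 in \<open>auto simp: \<theta>_def indicator_def\<close>)
    also have "\<dots> = (\<Sum>i\<in>UNIV. LINT x|lebesgue. \<theta> i x *\<^sub>R f i n x)"
      by (rule Bochner_Integration.integral_sum) (rule i1)
    finally show ?thesis ..
  qed
  moreover have "(\<lambda>n. \<Sum>i\<in>UNIV. LINT x|lebesgue. \<theta> i x *\<^sub>R f i n x) \<longlonglongrightarrow> (\<Sum>i\<in>UNIV. LINT x|lebesgue. \<theta> i x *\<^sub>R W x $ i)"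
    by (intro tendsto_sum lim)
  ultimately have "(\<Sum>i\<in>UNIV. LINT x|lebesgue. \<theta> i x *\<^sub>R W x $ i) = 0"
    using LIMSEQ_unique[OF _ tendsto_const] by simp
  also have "(\<Sum>i\<in>UNIV. LINT x|lebesgue. \<theta> i x *\<^sub>R W x $ i) = (LINT x|lebesgue. (\<Sum>i\<in>UNIV. \<theta> i x *\<^sub>R W x $ i))"
    by (rule Bochner_Integration.integral_sum[symmetric]) (rule i2)
  also have "\<dots> = (LINT x|lebesgue. W x \<bullet> F x)"
    unfolding inner_vec_def
    by (intro Bochner_Integration.integral_cong refl sum.cong) (use suppWi in \<open>auto simp: \<theta>_def indicator_def K_def\<close>)
  finally show ?thesis .
qed

text \<open>Each mollification of \<open>u\<close> has vanishing gradient, hence is a constant. The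
  constants converge to \<open>u\<close> in mean square on cubes, and on the unit cube anchoring
  forces them to zero.\<close>

lemma anchored_zero_gradient:
  fixes u :: "real ^ 'n \<Rightarrow> real"
  assumes u: "L2_loc u" "has_weak_gradient u g" "anchored u" and g: "AE x in lebesgue. g x = 0"
  shows "AE x in lebesgue. u x = 0"
proof -
  have uL: "L1_loc u" by (rule L2_loc_imp_L1_loc[OF u(1)])
  have um[measurable]: "u \<in> borel_measurable lebesgue" using u(1) by (simp add: L2_loc_def)
  have gm: "(\<lambda>x. g x $ i) \<in> borel_measurable lebesgue" for i
    using u(2) by (intro L1_loc_set_measurable L1_loc_nth) (simp add: has_weak_gradient_def)
  define c where "c n = conv (moll n) u 0" for n
  have const: "conv (moll n) u x = c n" for n x
  proof -
    have "conv (gradient (moll n)) u x = 0" for x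
    proof -
      have "conv (gradient (moll n)) u x $ i = 0" for i
      proof -
        have "conv (gradient (moll n)) u x $ i = conv (\<lambda>z. gradient (moll n) z $ i) u x"
          by (rule conv_nth[OF uL C1cD(2)[OF C1c_moll]])
        also have "\<dots> = - (LINT y|lebesgue. u y * (- gradient (moll n) (x - y)) $ i)"
          by (simp add: conv_def)
        also have "\<dots> = (LINT y|lebesgue. g y $ i * moll n (x - y))"
          by (subst weak_gradient_C1c[OF u(2) C1c_reflect[OF C1c_moll]]) simp
        also have "\<dots> = (LINT y|(lebesgue :: (real ^ 'n) measure). 0)"
        proof (rule integral_cong_AE)
          have [measurable]: "(\<lambda>y. moll n (x - y)) \<in> borel_measurable lebesgue"
            by (intro Cc_lebesgue_measurable Cc_reflect Cc_moll)
          show "(\<lambda>y. g y $ i * moll n (x - y)) \<in> borel_measurable lebesgue" using gm by (intro borel_measurable_times) auto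
          show "AE y in lebesgue. g y $ i * moll n (x - y) = 0" using g by eventually_elim simp
        qed simp
        finally show ?thesis by simp
      qed
      then show ?thesis by (simp add: vec_eq_iff)
    qed
    then have "(conv (moll n) u has_derivative (\<lambda>h. 0)) (at x)" for x
      using conv_has_derivative[OF uL C1c_moll, of n x] by simp
    then show ?thesis unfolding c_def
      by (intro has_derivative_zero_unique[of UNIV]) auto
  qed
  have lim: "(\<lambda>n. \<integral>\<^sup>+x\<in>cube 0 (real k). ennreal ((c n - u x)\<^sup>2) \<partial>lebesgue) \<longlonglongrightarrow> 0" if k: "k > 0" for k :: nat
  proof -
    obtain r where r: "\<And>x. x \<in> cube (0 :: real ^ 'n) (real k) \<Longrightarrow> norm x \<le> r"
      using bounded_cube[of "real k" "0 :: real ^ 'n"] k unfolding bounded_iff by auto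
    \<comment> \<open>Truncating one unit outside the ball makes \<open>u\<close> square integrable;
      the mollifiers have radius at most 1, so the mollified values in the ball of radius
      \<open>r\<close> stay the same.\<close>
    define v where "v x = indicator (cball 0 (r + 1)) x * u x" for x
    have vm[measurable]: "v \<in> borel_measurable lebesgue"
      unfolding v_def by (intro borel_measurable_times borel_measurable_indicator um) simp
    have fin: "(\<integral>\<^sup>+x. ennreal ((v x)\<^sup>2) \<partial>lebesgue) < \<infinity>"
    proof -
      have "(\<integral>\<^sup>+x. ennreal ((v x)\<^sup>2) \<partial>lebesgue) = (\<integral>\<^sup>+x\<in>cball 0 (r + 1). ennreal ((norm (u x))\<^sup>2) \<partial>lebesgue)"
        by (intro nn_integral_cong) (auto simp: v_def indicator_def)
      also have "\<dots> < \<infinity>" by (rule L2_loc_nn_integral[OF u(1)]) auto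
      finally show ?thesis .
    qed
    have cv: "conv (moll n) v x = c n" if "norm x \<le> r" for n x
    proof -
      have "v y *\<^sub>R moll n (x - y) = u y *\<^sub>R moll n (x - y)" for y
      proof (cases "norm (x - y) \<ge> 1")
        case True
        have "1 / (real n + 1) \<le> 1" by simp
        then have "moll n (x - y) = 0" using True by (intro moll_support) linarith
        then show ?thesis by simp
      next
        case False
        then have "norm y \<le> r + 1" using that norm_triangle_ineq2[of y x] by (simp add: norm_minus_commute)
        then show ?thesis by (simp add: v_def)
      qed
      then have "conv (moll n) v x = conv (moll n) u x" unfolding conv_def by (simp only:)
      then show ?thesis using const by simp
    qed
    have le: "(\<integral>\<^sup>+x\<in>cube 0 (real k). ennreal ((c n - u x)\<^sup>2) \<partial>lebesgue) \<le> (\<integral>\<^sup>+x. ennreal ((conv (moll n) v x - v x)\<^sup>2) \<partial>lebesgue)" for n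
    proof (rule nn_integral_mono)
      fix x :: "real ^ 'n"
      show "ennreal ((c n - u x)\<^sup>2) * indicator (cube 0 (real k)) x \<le> ennreal ((conv (moll n) v x - v x)\<^sup>2)"
      proof (cases "x \<in> cube 0 (real k)")
        case True
        then have "norm x \<le> r" by (rule r)
        then have "v x = u x" "conv (moll n) v x = c n" using cv by (auto simp: v_def)
        then show ?thesis using True by simp
      qed simp
    qed
    have "(\<lambda>n. \<integral>\<^sup>+x. ennreal ((conv (moll n) v x - v x)\<^sup>2) \<partial>lebesgue) \<longlonglongrightarrow> 0"
      by (rule conv_moll_L2_tendsto[OF vm fin, of "r + 1"]) (simp add: v_def)
    then show ?thesis by (rule tendsto_sandwich[OF _ _ tendsto_const, rotated 2]) (auto simp: le)
  qed
  have c0: "c \<longlonglongrightarrow> 0"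
  proof -
    let ?Q = "cube (0 :: real ^ 'n) 1"
    have Q: "?Q \<in> sets lebesgue" "emeasure lebesgue ?Q = 1" "measure lebesgue ?Q = 1"
      using emeasure_cube[of 1 "0 :: real ^ 'n"] measure_cube[of 1 "0 :: real ^ 'n"] by simp_all
    define f where "f n x = c n * indicator ?Q x" for n x
    define w where "w x = u x * indicator ?Q x" for x
    note [measurable] = Q(1)
    have [measurable]: "f n \<in> borel_measurable lebesgue" "w \<in> borel_measurable lebesgue" for n
      unfolding f_def w_def by measurable
    have iQ: "integrable lebesgue (indicator ?Q :: _ \<Rightarrow> real)" using Q by (intro integrable_real_indicator) auto
    have iu: "integrable lebesgue (\<lambda>x. indicator ?Q x *\<^sub>R u x)"
      using L2_loc_set_integrable[OF u(1) bounded_cube[of 1] Q(1)] by (simp add: set_integrable_def)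
    have e1: "(\<lambda>x. indicator ?Q x *\<^sub>R f n x) = (\<lambda>x. c n * indicator ?Q x)" for n
      by (auto simp: f_def indicator_def)
    have e2: "(\<lambda>x. indicator ?Q x *\<^sub>R w x) = (\<lambda>x. indicator ?Q x *\<^sub>R u x)"
      by (auto simp: w_def indicator_def)
    have "(\<lambda>n. LINT x|lebesgue. indicator ?Q x *\<^sub>R f n x) \<longlonglongrightarrow> (LINT x|lebesgue. indicator ?Q x *\<^sub>R w x)"
    proof (rule L2_weak_limit)
      have "(\<integral>\<^sup>+x. ennreal ((indicator ?Q x)\<^sup>2) \<partial>lebesgue) = (\<integral>\<^sup>+x. indicator ?Q x \<partial>lebesgue)"
        by (intro nn_integral_cong) (simp add: indicator_def)
      then show "(\<integral>\<^sup>+x. ennreal ((indicator ?Q x)\<^sup>2) \<partial>lebesgue) < \<infinity>" using Q by simp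
      show "integrable lebesgue (\<lambda>x. indicator ?Q x *\<^sub>R f n x)" for n unfolding e1 using iQ by (intro integrable_mult_right)
      show "integrable lebesgue (\<lambda>x. indicator ?Q x *\<^sub>R w x)" unfolding e2 by (rule iu)
      have "(\<integral>\<^sup>+x. ennreal ((norm (f n x - w x))\<^sup>2) \<partial>lebesgue) = (\<integral>\<^sup>+x\<in>cube 0 (real 1). ennreal ((c n - u x)\<^sup>2) \<partial>lebesgue)" for n
        by (intro nn_integral_cong) (auto simp: f_def w_def indicator_def)
      then show "(\<lambda>n. \<integral>\<^sup>+x. ennreal ((norm (f n x - w x))\<^sup>2) \<partial>lebesgue) \<longlonglongrightarrow> 0" using lim[of 1] by simp
    qed measurable
    moreover have "(LINT x|lebesgue. indicator ?Q x *\<^sub>R w x) = 0"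
      unfolding e2 using u(3) by (simp add: anchored_def set_lebesgue_integral_def unit_cube_eq)
    moreover have "(LINT x|lebesgue. indicator ?Q x *\<^sub>R f n x) = c n" for n
      unfolding e1 using Q by simp
    ultimately show ?thesis by simp
  qed
  have AEk: "AE x in lebesgue. x \<in> cube 0 (real k) \<longrightarrow> u x = 0" if k: "k > 0" for k :: nat
  proof -
    let ?Q = "cube (0 :: real ^ 'n) (real k)"
    have Q[measurable]: "?Q \<in> sets lebesgue" using k by simp
    have "(\<integral>\<^sup>+x\<in>?Q. ennreal ((u x)\<^sup>2) \<partial>lebesgue)
      \<le> 2 * (\<integral>\<^sup>+x\<in>?Q. ennreal ((c n - u x)\<^sup>2) \<partial>lebesgue) + 2 * (ennreal ((c n)\<^sup>2) * emeasure lebesgue ?Q)" for n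
    proof -
      have "(\<integral>\<^sup>+x. ennreal ((norm (indicator ?Q x * (u x - c n) + indicator ?Q x * c n))\<^sup>2) \<partial>lebesgue)
        \<le> 2 * (\<integral>\<^sup>+x. ennreal ((norm (indicator ?Q x * (u x - c n)))\<^sup>2) \<partial>lebesgue) + 2 * (\<integral>\<^sup>+x. ennreal ((norm (indicator ?Q x * c n))\<^sup>2) \<partial>lebesgue)"
        by (rule nn_integral_norm_sq_triangle) measurable
      also have "(\<integral>\<^sup>+x. ennreal ((norm (indicator ?Q x * c n))\<^sup>2) \<partial>lebesgue) = (\<integral>\<^sup>+x. ennreal ((c n)\<^sup>2) * indicator ?Q x \<partial>lebesgue)"
        by (intro nn_integral_cong) (auto simp: indicator_def)
      also have "\<dots> = ennreal ((c n)\<^sup>2) * emeasure lebesgue ?Q" by (rule nn_integral_cmult_indicator[OF Q])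
      also have "(\<integral>\<^sup>+x. ennreal ((norm (indicator ?Q x * (u x - c n)))\<^sup>2) \<partial>lebesgue) = (\<integral>\<^sup>+x\<in>?Q. ennreal ((c n - u x)\<^sup>2) \<partial>lebesgue)"
        by (intro nn_integral_cong) (auto simp: indicator_def power2_commute)
      also have "(\<integral>\<^sup>+x. ennreal ((norm (indicator ?Q x * (u x - c n) + indicator ?Q x * c n))\<^sup>2) \<partial>lebesgue) = (\<integral>\<^sup>+x\<in>?Q. ennreal ((u x)\<^sup>2) \<partial>lebesgue)"
        by (intro nn_integral_cong) (auto simp: indicator_def)
      finally show ?thesis .
    qed
    moreover have "(\<lambda>n. 2 * (\<integral>\<^sup>+x\<in>?Q. ennreal ((c n - u x)\<^sup>2) \<partial>lebesgue) + 2 * (ennreal ((c n)\<^sup>2) * emeasure lebesgue ?Q)) \<longlonglongrightarrow> 2 * 0 + 2 * (ennreal (0\<^sup>2) * emeasure lebesgue ?Q)"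
    proof (intro tendsto_add tendsto_mult_ennreal tendsto_const lim[OF k] tendsto_ennrealI tendsto_power c0)
      have "emeasure lebesgue ?Q < \<infinity>" by (intro emeasure_bounded_finite bounded_cube Q) (use k in auto)
      then show "\<not> ((ennreal (0\<^sup>2) = 0 \<and> emeasure lebesgue ?Q = \<infinity>) \<or> (ennreal (0\<^sup>2) = \<infinity> \<and> emeasure lebesgue ?Q = 0))" by auto
    qed auto
    ultimately have "(\<integral>\<^sup>+x\<in>?Q. ennreal ((u x)\<^sup>2) \<partial>lebesgue) \<le> 2 * 0 + 2 * (ennreal (0\<^sup>2) * emeasure lebesgue ?Q)"
      by (intro LIMSEQ_le_const) auto
    then have "(\<integral>\<^sup>+x\<in>?Q. ennreal ((u x)\<^sup>2) \<partial>lebesgue) = 0" by simp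
    then have "AE x in lebesgue. ennreal ((u x)\<^sup>2) * indicator ?Q x = 0"
      by (subst (asm) nn_integral_0_iff_AE) auto
    then show ?thesis by eventually_elim (auto simp: indicator_def split: if_splits)
  qed
  then have "AE x in lebesgue. \<forall>k::nat. k > 0 \<longrightarrow> x \<in> cube 0 (real k) \<longrightarrow> u x = 0"
    unfolding AE_all_countable by auto
  then show ?thesis
  proof eventually_elim
    case (elim x)
    obtain k :: nat where "k > 0" "{x} \<subseteq> cube 0 (real k)" by (rule bounded_subset_cube[of "{x}"]) auto
    then show ?case using elim by auto
  qed
qed

subsection \<open>The Caccioppoli inequality\<close>

lemma bump_scale: "bump s x = bump 1 (s *\<^sub>R x)"
  by (simp add: bump_def)

lemma C1c_bump:
  assumes "s > 0"
  shows "C1c (bump s) (\<lambda>x. s *\<^sub>R gradient (bump 1) (s *\<^sub>R x) :: real ^ 'n)"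
proof -
  have 1: "C1c (bump 1) (gradient (bump 1) :: real ^ 'n \<Rightarrow> _)"
    by (rule test_function_C1c[OF test_function_bump]) simp
  have 2: "C1c (bump s) (gradient (bump s) :: real ^ 'n \<Rightarrow> _)"
    by (rule test_function_C1c[OF test_function_bump[OF assms]])
  have "gradient (bump s) x = s *\<^sub>R gradient (bump 1) (s *\<^sub>R x)" for x :: "real ^ 'n"
  proof (rule gradient_eqI)
    have "((\<lambda>x. bump 1 (s *\<^sub>R x)) has_derivative (\<lambda>v. gradient (bump 1) (s *\<^sub>R x) \<bullet> (s *\<^sub>R v))) (at x)"
      by (rule has_derivative_compose[OF _ C1cD(3)[OF 1]]) (auto intro!: derivative_eq_intros)
    then show "(bump s has_derivative (\<lambda>v. (s *\<^sub>R gradient (bump 1) (s *\<^sub>R x)) \<bullet> v)) (at x)"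
      unfolding bump_scale[of s, abs_def] by simp
  qed
  then have "gradient (bump s) = (\<lambda>x. s *\<^sub>R gradient (bump 1) (s *\<^sub>R x) :: real ^ 'n)" by (rule ext)
  then show ?thesis using 2 by (simp only:)
qed

text \<open>A zero of a nonnegative function is a minimum. Thus the gradient of a cut-off vanishes
  on its whole zero set, boundary included.\<close>

lemma C1c_zero_gradient:
  assumes "C1c \<eta> g" "\<And>x. \<eta> x \<ge> 0" "\<eta> x = 0"
  shows "g x = 0"
proof -
  have "(\<lambda>v. g x \<bullet> v) = (\<lambda>v. 0)"
    by (rule differential_zero_maxmin[OF UNIV_I open_UNIV C1cD(3)[OF assms(1)]]) (use assms(2,3) in simp)
  from fun_cong[OF this, of "g x"] show ?thesis by simp
qed

text \<open>The equation is tested with the squared cut-off times \<open>u\<close>; ellipticity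
  produces the energy, and Young's inequality absorbs the cross term into half of it. The constant
  is uniform in the coefficients and in \<open>R\<close> because the cut-off is a rescaling of one
  fixed bump.\<close>

lemma caccioppoli:
  fixes lam :: real
  assumes lam: "lam > 0"
  obtains C where "C > 0"
    "\<And>(a :: 'n::finite coeff) u V R. L2_loc u \<Longrightarrow> L2_loc V \<Longrightarrow> has_weak_gradient u V \<Longrightarrow> distr_div_zero (\<lambda>x. a x *v V x)
      \<Longrightarrow> AE x in lebesgue. \<forall>\<xi>. \<xi> \<bullet> (a x *v \<xi>) \<ge> lam * (norm \<xi>)\<^sup>2 \<and> norm (a x *v \<xi>) \<le> norm \<xi>
      \<Longrightarrow> R > 0
      \<Longrightarrow> (\<integral>\<^sup>+x\<in>cube 0 R. ennreal ((norm (V x))\<^sup>2) \<partial>lebesgue)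
        \<le> ennreal (C / R\<^sup>2) * (\<integral>\<^sup>+x\<in>cube 0 (2 * R). ennreal ((u x)\<^sup>2) \<partial>lebesgue)"
proof -
  have b1: "C1c (bump 1) (gradient (bump 1) :: real ^ 'n \<Rightarrow> _)"
    by (rule test_function_C1c[OF test_function_bump]) simp
  obtain B where B: "B > 0" "\<And>x :: real ^ 'n. norm (gradient (bump 1) x) \<le> B"
    using Cc_bounded[OF C1cD(2)[OF b1]] by blast
  define e where "e = exp (-4 :: real) ^ CARD('n)"
  have e: "e > 0" by (simp add: e_def)
  \<comment> \<open>4/lam^2 stems from absorption with weight lam/2, B/R bounds the gradient of the
    cut-off, and 1/e^2 compensates for a cut-off that on the inner cube is bounded below by
    \<open>e\<close> instead of being 1.\<close>
  define C where "C = 4 * B\<^sup>2 / (lam\<^sup>2 * e\<^sup>2)"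
  show thesis
  proof (rule that[of C])
    show "C > 0" using B e lam by (simp add: C_def)
  next
    fix a :: "'n coeff" and u V R
    assume u: "L2_loc u" and V: "L2_loc V" and uV: "has_weak_gradient u V" and div: "distr_div_zero (\<lambda>x. a x *v V x)"
      and ell: "AE x in lebesgue. \<forall>\<xi>. \<xi> \<bullet> (a x *v \<xi>) \<ge> lam * (norm \<xi>)\<^sup>2 \<and> norm (a x *v \<xi>) \<le> norm \<xi>" and R: "(R::real) > 0"
    define cut where "cut = (bump (1 / R) :: real ^ 'n \<Rightarrow> real)"
    define g where "g x = (1 / R) *\<^sub>R gradient (bump 1) ((1 / R) *\<^sub>R x)" for x :: "real ^ 'n"
    have cg: "C1c cut g" unfolding cut_def g_def using R by (intro C1c_bump) simp
    have cut0: "cut x \<ge> 0" for x unfolding cut_def by (rule bump_nonneg)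
    have cutQ: "cut x = 0" if "x \<notin> cube 0 (2 * R)" for x
    proof -
      have "\<not> (\<forall>i. \<bar>x $ i\<bar> < R)" using that mem_cube[of "2 * R" x 0] R by simp
      then obtain i where "\<bar>x $ i\<bar> \<ge> R" by (auto simp: not_less)
      then show ?thesis unfolding cut_def using R by (intro bump_eq_0[of _ _ i]) auto
    qed
    have gQ: "g x = 0" if "x \<notin> cube 0 (2 * R)" for x
      by (rule C1c_zero_gradient[OF cg cut0 cutQ[OF that]])
    have cute: "cut x \<ge> e" if "x \<in> cube 0 R" for x
    proof -
      have "(1 / R) *\<^sub>R x \<in> cube 0 1" using that R by (auto simp: mem_cube field_simps)
      then show ?thesis unfolding cut_def e_def bump_scale[of "1 / R"] by (rule bump_lower_bound)
    qed
    have gB: "norm (g x) \<le> B / R" for x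
      using B(2)[of "(1 / R) *\<^sub>R x"] R by (simp add: g_def divide_right_mono)
    obtain c where c: "\<And>x. norm (cut x) \<le> c" using Cc_bounded[OF C1cD(1)[OF cg]] by blast
    define Q where "Q = cube (0 :: real ^ 'n) (2 * R)"
    have Q[measurable]: "Q \<in> sets lebesgue" using R by (simp add: Q_def)
    have Qb: "bounded Q" unfolding Q_def using R by (intro bounded_cube) simp
    have cutm[measurable]: "cut \<in> borel_measurable lebesgue" by (rule Cc_lebesgue_measurable[OF C1cD(1)[OF cg]])
    have gm[measurable]: "g \<in> borel_measurable lebesgue" by (rule Cc_lebesgue_measurable[OF C1cD(2)[OF cg]])
    have um[measurable]: "u \<in> borel_measurable lebesgue" using u by (simp add: L2_loc_def)
    have Vm[measurable]: "V \<in> borel_measurable lebesgue" using V by (simp add: L2_loc_def)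
    define F where "F x = a x *v V x" for x
    have Fm[measurable]: "F \<in> borel_measurable lebesgue"
      using div unfolding F_def[abs_def] distr_div_zero_def by (intro L1_loc_set_measurable) simp
    have FV: "AE x in lebesgue. norm (F x) \<le> norm (V x) \<and> lam * (norm (V x))\<^sup>2 \<le> V x \<bullet> F x"
      using ell by eventually_elim (auto simp: F_def)
    have FL: "L2_loc F"
    proof (rule L2_locI[OF Fm])
      fix k :: nat assume k: "k > 0"
      have "(\<integral>\<^sup>+x\<in>cube 0 (real k). ennreal ((norm (F x))\<^sup>2) \<partial>lebesgue) \<le> (\<integral>\<^sup>+x\<in>cube 0 (real k). ennreal ((norm (V x))\<^sup>2) \<partial>lebesgue)"
        by (rule nn_integral_mono_AE) (use FV in \<open>eventually_elim, auto intro!: mult_right_mono ennreal_leI power_mono\<close>)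
      also have "\<dots> < \<infinity>" using k by (intro L2_loc_nn_integral[OF V] bounded_cube) auto
      finally show "(\<integral>\<^sup>+x\<in>cube 0 (real k). ennreal ((norm (F x))\<^sup>2) \<partial>lebesgue) < \<infinity>" .
    qed
    \<comment> \<open>With the square, the cross term retains one factor \<open>cut\<close>, which
      is paired with \<open>V\<close> for the absorption.\<close>
    define w where "w x = (cut x)\<^sup>2 * u x" for x
    define W where "W x = (cut x)\<^sup>2 *\<^sub>R V x + (2 * cut x * u x) *\<^sub>R g x" for x
    have wm[measurable]: "w \<in> borel_measurable lebesgue" and Wm[measurable]: "W \<in> borel_measurable lebesgue"
      unfolding w_def W_def by measurable
    have V2: "integrable lebesgue (\<lambda>x. indicator Q x *\<^sub>R (norm (V x))\<^sup>2)"
    proof (rule integrableI_bounded)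
      have "(\<integral>\<^sup>+x. ennreal (norm (indicator Q x *\<^sub>R (norm (V x))\<^sup>2)) \<partial>lebesgue) = (\<integral>\<^sup>+x\<in>Q. ennreal ((norm (V x))\<^sup>2) \<partial>lebesgue)"
        by (intro nn_integral_cong) (auto simp: indicator_def)
      then show "(\<integral>\<^sup>+x. ennreal (norm (indicator Q x *\<^sub>R (norm (V x))\<^sup>2)) \<partial>lebesgue) < \<infinity>"
        using L2_loc_nn_integral[OF V Qb Q] by simp
    qed measurable
    have u2: "integrable lebesgue (\<lambda>x. indicator Q x *\<^sub>R (u x)\<^sup>2)"
    proof (rule integrableI_bounded)
      have "(\<integral>\<^sup>+x. ennreal (norm (indicator Q x *\<^sub>R (u x)\<^sup>2)) \<partial>lebesgue) = (\<integral>\<^sup>+x\<in>Q. ennreal ((norm (u x))\<^sup>2) \<partial>lebesgue)"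
        by (intro nn_integral_cong) (auto simp: indicator_def)
      then show "(\<integral>\<^sup>+x. ennreal (norm (indicator Q x *\<^sub>R (u x)\<^sup>2)) \<partial>lebesgue) < \<infinity>"
        using L2_loc_nn_integral[OF u Qb Q] by simp
    qed measurable
    have cut2: "(cut x)\<^sup>2 \<le> c\<^sup>2" for x using c[of x] cut0[of x] by (intro power_mono) auto
    have iV: "integrable lebesgue (\<lambda>x. (cut x)\<^sup>2 * (norm (V x))\<^sup>2)"
    proof (rule Bochner_Integration.integrable_bound[of _ "\<lambda>x. c\<^sup>2 * (indicator Q x *\<^sub>R (norm (V x))\<^sup>2)"])
      show "integrable lebesgue (\<lambda>x. c\<^sup>2 * (indicator Q x *\<^sub>R (norm (V x))\<^sup>2))" using V2 by (intro integrable_mult_right)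
      show "AE x in lebesgue. norm ((cut x)\<^sup>2 * (norm (V x))\<^sup>2) \<le> norm (c\<^sup>2 * (indicator Q x *\<^sub>R (norm (V x))\<^sup>2))"
      proof (rule AE_I2)
        fix x show "norm ((cut x)\<^sup>2 * (norm (V x))\<^sup>2) \<le> norm (c\<^sup>2 * (indicator Q x *\<^sub>R (norm (V x))\<^sup>2))"
          using cut2[of x] cutQ[of x] by (cases "x \<in> Q") (auto simp: Q_def abs_mult mult_right_mono)
      qed
    qed measurable
    have iu: "integrable lebesgue (\<lambda>x. (u x)\<^sup>2 * (norm (g x))\<^sup>2)"
    proof (rule Bochner_Integration.integrable_bound[of _ "\<lambda>x. (B / R)\<^sup>2 * (indicator Q x *\<^sub>R (u x)\<^sup>2)"])
      show "integrable lebesgue (\<lambda>x. (B / R)\<^sup>2 * (indicator Q x *\<^sub>R (u x)\<^sup>2))" using u2 by (intro integrable_mult_right)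
      show "AE x in lebesgue. norm ((u x)\<^sup>2 * (norm (g x))\<^sup>2) \<le> norm ((B / R)\<^sup>2 * (indicator Q x *\<^sub>R (u x)\<^sup>2))"
      proof (rule AE_I2)
        fix x
        have "(norm (g x))\<^sup>2 \<le> (B / R)\<^sup>2" using gB[of x] by (intro power_mono) auto
        then have "(u x)\<^sup>2 * (norm (g x))\<^sup>2 \<le> (B / R)\<^sup>2 * (u x)\<^sup>2"
          using mult_left_mono[of "(norm (g x))\<^sup>2" "(B / R)\<^sup>2" "(u x)\<^sup>2"] by (simp add: mult.commute)
        then show "norm ((u x)\<^sup>2 * (norm (g x))\<^sup>2) \<le> norm ((B / R)\<^sup>2 * (indicator Q x *\<^sub>R (u x)\<^sup>2))"
          using gQ[of x] by (cases "x \<in> Q") (auto simp: Q_def abs_mult)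
      qed
    qed measurable
    obtain r where r: "\<And>x. x \<in> Q \<Longrightarrow> norm x \<le> r" using Qb unfolding bounded_iff by auto
    have supp: "w x = 0" "W x = 0" if "norm x > r" for x
    proof -
      have "x \<notin> Q" using r[of x] that by auto
      then show "w x = 0" "W x = 0" using cutQ[of x] gQ[of x] by (auto simp: Q_def w_def W_def)
    qed
    have W2le: "(norm (W x))\<^sup>2 \<le> 2 * c\<^sup>2 * ((cut x)\<^sup>2 * (norm (V x))\<^sup>2) + 8 * c\<^sup>2 * ((u x)\<^sup>2 * (norm (g x))\<^sup>2)" for x
    proof -
      have "(norm (W x))\<^sup>2 \<le> 2 * (norm ((cut x)\<^sup>2 *\<^sub>R V x))\<^sup>2 + 2 * (norm ((2 * cut x * u x) *\<^sub>R g x))\<^sup>2"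
        unfolding W_def by (rule norm_sq_add_le)
      also have "\<dots> = 2 * ((cut x)\<^sup>2 * ((cut x)\<^sup>2 * (norm (V x))\<^sup>2)) + 8 * ((cut x)\<^sup>2 * ((u x)\<^sup>2 * (norm (g x))\<^sup>2))"
        by (simp add: power_mult_distrib mult_ac)
      also have "\<dots> \<le> 2 * (c\<^sup>2 * ((cut x)\<^sup>2 * (norm (V x))\<^sup>2)) + 8 * (c\<^sup>2 * ((u x)\<^sup>2 * (norm (g x))\<^sup>2))"
        by (intro add_mono mult_left_mono mult_right_mono cut2) auto
      finally show ?thesis by simp
    qed
    have finW: "(\<integral>\<^sup>+x. ennreal ((norm (W x))\<^sup>2) \<partial>lebesgue) < \<infinity>"
    proof -
      let ?b = "\<lambda>x. 2 * c\<^sup>2 * ((cut x)\<^sup>2 * (norm (V x))\<^sup>2) + 8 * c\<^sup>2 * ((u x)\<^sup>2 * (norm (g x))\<^sup>2)"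
      have "integrable lebesgue ?b" by (intro Bochner_Integration.integrable_add integrable_mult_right iV iu)
      then have "(\<integral>\<^sup>+x. ennreal (norm (?b x)) \<partial>lebesgue) < \<infinity>" unfolding integrable_iff_bounded by blast
      moreover have "(\<integral>\<^sup>+x. ennreal ((norm (W x))\<^sup>2) \<partial>lebesgue) \<le> (\<integral>\<^sup>+x. ennreal (norm (?b x)) \<partial>lebesgue)"
        using W2le by (intro nn_integral_mono ennreal_leI) (smt (verit) real_norm_def)
      ultimately show ?thesis by (rule le_less_trans[rotated])
    qed
    have wL: "L1_loc w"
    proof (intro L2_loc_imp_L1_loc L2_imp_L2_loc wm)
      have "(\<integral>\<^sup>+x. ennreal ((norm (w x))\<^sup>2) \<partial>lebesgue) \<le> (\<integral>\<^sup>+x. ennreal (norm (c ^ 4 * (indicator Q x *\<^sub>R (u x)\<^sup>2))) \<partial>lebesgue)"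
      proof (rule nn_integral_mono, rule ennreal_leI)
        fix x
        have "((cut x)\<^sup>2)\<^sup>2 \<le> (c\<^sup>2)\<^sup>2" by (rule power_mono[OF cut2]) simp
        then have "((cut x)\<^sup>2)\<^sup>2 * (u x)\<^sup>2 \<le> c ^ 4 * (u x)\<^sup>2" by (intro mult_right_mono) auto
        then show "(norm (w x))\<^sup>2 \<le> norm (c ^ 4 * (indicator Q x *\<^sub>R (u x)\<^sup>2))"
          using cutQ[of x] by (cases "x \<in> Q") (auto simp: w_def Q_def power_mult_distrib)
      qed
      also have "\<dots> < \<infinity>"
        using integrable_mult_right[of "c ^ 4" lebesgue "\<lambda>x. indicator Q x *\<^sub>R (u x)\<^sup>2"] u2 unfolding integrable_iff_bounded by blast
      finally show "(\<integral>\<^sup>+x. ennreal ((norm (w x))\<^sup>2) \<partial>lebesgue) < \<infinity>" .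
    qed
    have int0: "(LINT x|lebesgue. W x \<bullet> F x) = 0"
    proof (rule div_zero_weak_gradient[OF _ FL wL supp(1) Wm finW supp(2)])
      show "distr_div_zero F" using div unfolding F_def[abs_def] .
      fix \<eta> :: "real ^ 'n \<Rightarrow> real" and h i assume \<eta>: "C1c \<eta> h"
      have cc: "continuous_on UNIV (\<lambda>x. (cut x)\<^sup>2)" "continuous_on UNIV (\<lambda>x. (2 * cut x) *\<^sub>R g x)"
        using cg by (auto simp: C1c_def Cc_def intro!: continuous_intros)
      have cd: "((\<lambda>x. (cut x)\<^sup>2) has_derivative (\<lambda>v. ((2 * cut x) *\<^sub>R g x) \<bullet> v)) (at x)" for x
        using has_derivative_mult[OF C1cD(3)[OF cg] C1cD(3)[OF cg], of x]
        by (simp add: power2_eq_square algebra_simps)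
      \<comment> \<open>Testing the weak gradient of \<open>u\<close> with the squared cut-off times
        \<open>\<eta>\<close> amounts to the product rule for \<open>w\<close>.\<close>
      have wk: "(LINT x|lebesgue. u x * ((cut x)\<^sup>2 *\<^sub>R h x + \<eta> x *\<^sub>R ((2 * cut x) *\<^sub>R g x)) $ i)
        = - (LINT x|lebesgue. V x $ i * ((cut x)\<^sup>2 * \<eta> x))"
        by (rule weak_gradient_C1c[OF uV C1c_mult[OF \<eta> cc cd]])
      have uL: "L1_loc u" "L1_loc (\<lambda>x. V x $ i)" by (intro L2_loc_imp_L1_loc u L2_loc_nth V)+
      have \<eta>c: "continuous_on UNIV \<eta>" using \<eta> by (simp add: C1c_def Cc_def)
      have k1: "Cc (\<lambda>x. (cut x)\<^sup>2 *\<^sub>R h x $ i)" by (intro Cc_mult_continuous Cc_nth C1cD(2)[OF \<eta>] cc)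
      have k2: "Cc (\<lambda>x. (\<eta> x * (2 * cut x)) *\<^sub>R g x $ i)"
        using cg \<eta>c by (intro Cc_mult_continuous Cc_nth C1cD(2)[OF cg] continuous_intros) (auto simp: C1c_def Cc_def)
      have k3: "Cc (\<lambda>x. (cut x)\<^sup>2 *\<^sub>R \<eta> x)" by (intro Cc_mult_continuous C1cD(1)[OF \<eta>] cc)
      have i1: "integrable lebesgue (\<lambda>x. w x * h x $ i)"
        using integrable_mult_Cc[OF uL(1) k1] by (simp add: w_def mult_ac)
      have i2: "integrable lebesgue (\<lambda>x. (2 * cut x * u x) * g x $ i * \<eta> x)"
        using integrable_mult_Cc[OF uL(1) k2] by (simp add: mult_ac)
      have i3: "integrable lebesgue (\<lambda>x. V x $ i * ((cut x)\<^sup>2 * \<eta> x))"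
        using integrable_mult_Cc[OF uL(2) k3] by (simp add: mult_ac)
      have "(LINT x|lebesgue. w x * h x $ i) + (LINT x|lebesgue. (2 * cut x * u x) * g x $ i * \<eta> x)
        = (LINT x|lebesgue. w x * h x $ i + (2 * cut x * u x) * g x $ i * \<eta> x)"
        by (rule Bochner_Integration.integral_add[OF i1 i2, symmetric])
      also have "\<dots> = (LINT x|lebesgue. u x * ((cut x)\<^sup>2 *\<^sub>R h x + \<eta> x *\<^sub>R ((2 * cut x) *\<^sub>R g x)) $ i)"
        by (intro Bochner_Integration.integral_cong refl) (simp add: w_def algebra_simps)
      also note wk
      finally have "(LINT x|lebesgue. w x * h x $ i) = - ((LINT x|lebesgue. V x $ i * ((cut x)\<^sup>2 * \<eta> x)) + (LINT x|lebesgue. (2 * cut x * u x) * g x $ i * \<eta> x))"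
        by linarith
      also have "(LINT x|lebesgue. V x $ i * ((cut x)\<^sup>2 * \<eta> x)) + (LINT x|lebesgue. (2 * cut x * u x) * g x $ i * \<eta> x)
        = (LINT x|lebesgue. V x $ i * ((cut x)\<^sup>2 * \<eta> x) + (2 * cut x * u x) * g x $ i * \<eta> x)"
        by (rule Bochner_Integration.integral_add[OF i3 i2, symmetric])
      also have "\<dots> = (LINT x|lebesgue. W x $ i * \<eta> x)"
        by (intro Bochner_Integration.integral_cong refl) (simp add: W_def algebra_simps)
      finally show "(LINT x|lebesgue. w x * h x $ i) = - (LINT x|lebesgue. W x $ i * \<eta> x)" .
    qed
    have iWF: "integrable lebesgue (\<lambda>x. W x \<bullet> F x)"
    proof (rule Bochner_Integration.integrable_bound[of _ "\<lambda>x. (norm (W x))\<^sup>2 + indicator Q x *\<^sub>R (norm (V x))\<^sup>2"])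
      have "integrable lebesgue (\<lambda>x. (norm (W x))\<^sup>2)" by (rule integrableI_bounded) (use finW in auto)
      then show "integrable lebesgue (\<lambda>x. (norm (W x))\<^sup>2 + indicator Q x *\<^sub>R (norm (V x))\<^sup>2)"
        using V2 by (rule Bochner_Integration.integrable_add)
      show "AE x in lebesgue. norm (W x \<bullet> F x) \<le> norm ((norm (W x))\<^sup>2 + indicator Q x *\<^sub>R (norm (V x))\<^sup>2)"
        using FV
      proof eventually_elim
        case (elim x)
        show ?case
        proof (cases "x \<in> Q")
          case True
          have "\<bar>W x \<bullet> F x\<bar> \<le> norm (W x) * norm (V x)"
            using Cauchy_Schwarz_ineq2[of "W x" "F x"] elim mult_left_mono[of "norm (F x)" "norm (V x)" "norm (W x)"] by auto
          also have "\<dots> \<le> 1 / 2 * (norm (W x))\<^sup>2 + (norm (V x))\<^sup>2 / (2 * 1)"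
            using two_mult_le_scaled[of 1 "norm (W x)" "norm (V x)"] by (simp add: abs_mult)
          also have "\<dots> \<le> (norm (W x))\<^sup>2 + (norm (V x))\<^sup>2" by (intro add_mono) auto
          finally show ?thesis using True by simp
        next
          case False
          then have "W x = 0" using cutQ[of x] gQ[of x] by (auto simp: Q_def W_def)
          then show ?thesis by simp
        qed
      qed
    qed measurable
    have "(LINT x|lebesgue. lam / 2 * ((cut x)\<^sup>2 * (norm (V x))\<^sup>2)) \<le> (LINT x|lebesgue. W x \<bullet> F x + 2 / lam * ((u x)\<^sup>2 * (norm (g x))\<^sup>2))"
    proof (rule integral_mono_AE)
      show "integrable lebesgue (\<lambda>x. lam / 2 * ((cut x)\<^sup>2 * (norm (V x))\<^sup>2))" using iV by (intro integrable_mult_right)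
      show "integrable lebesgue (\<lambda>x. W x \<bullet> F x + 2 / lam * ((u x)\<^sup>2 * (norm (g x))\<^sup>2))"
        using iWF iu by (intro Bochner_Integration.integrable_add integrable_mult_right)
      show "AE x in lebesgue. lam / 2 * ((cut x)\<^sup>2 * (norm (V x))\<^sup>2) \<le> W x \<bullet> F x + 2 / lam * ((u x)\<^sup>2 * (norm (g x))\<^sup>2)"
        using FV
      proof eventually_elim
        case (elim x)
        have 1: "W x \<bullet> F x = (cut x)\<^sup>2 * (V x \<bullet> F x) + 2 * cut x * u x * (g x \<bullet> F x)"
          by (simp add: W_def inner_add_left)
        have 2: "(cut x)\<^sup>2 * (V x \<bullet> F x) \<ge> (cut x)\<^sup>2 * (lam * (norm (V x))\<^sup>2)"
          using elim by (intro mult_left_mono) auto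
        have "\<bar>2 * cut x * u x * (g x \<bullet> F x)\<bar> = 2 * cut x * \<bar>u x\<bar> * \<bar>g x \<bullet> F x\<bar>"
          using cut0[of x] by (simp add: abs_mult)
        also have "\<dots> \<le> 2 * cut x * \<bar>u x\<bar> * (norm (g x) * norm (V x))"
          using Cauchy_Schwarz_ineq2[of "g x" "F x"] elim mult_left_mono[of "norm (F x)" "norm (V x)" "norm (g x)"] cut0[of x]
          by (intro mult_left_mono) auto
        also have "\<dots> = 2 * \<bar>(cut x * norm (V x)) * (\<bar>u x\<bar> * norm (g x))\<bar>"
          using cut0[of x] by (simp add: abs_mult mult_ac)
        \<comment> \<open>The weight lam/2 uses up exactly half of the elliptic term.\<close>
        also have "\<dots> \<le> 2 * ((lam / 2) / 2 * (cut x * norm (V x))\<^sup>2 + (\<bar>u x\<bar> * norm (g x))\<^sup>2 / (2 * (lam / 2)))"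
          using two_mult_le_scaled[of "lam / 2" "cut x * norm (V x)" "\<bar>u x\<bar> * norm (g x)"] lam by (intro mult_left_mono) auto
        also have "\<dots> = lam / 2 * ((cut x)\<^sup>2 * (norm (V x))\<^sup>2) + 2 / lam * ((u x)\<^sup>2 * (norm (g x))\<^sup>2)"
          by (simp add: power_mult_distrib)
        finally have 3: "\<bar>2 * cut x * u x * (g x \<bullet> F x)\<bar> \<le> lam / 2 * ((cut x)\<^sup>2 * (norm (V x))\<^sup>2) + 2 / lam * ((u x)\<^sup>2 * (norm (g x))\<^sup>2)" .
        have "(cut x)\<^sup>2 * (lam * (norm (V x))\<^sup>2) = lam / 2 * ((cut x)\<^sup>2 * (norm (V x))\<^sup>2) + lam / 2 * ((cut x)\<^sup>2 * (norm (V x))\<^sup>2)"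
          by (simp add: field_simps)
        then show ?case using 1 2 3 by linarith
      qed
    qed
    also have "\<dots> = 2 / lam * (LINT x|lebesgue. (u x)\<^sup>2 * (norm (g x))\<^sup>2)"
      using iWF iu int0 by simp
    finally have main: "(LINT x|lebesgue. (cut x)\<^sup>2 * (norm (V x))\<^sup>2) \<le> 4 / lam\<^sup>2 * (LINT x|lebesgue. (u x)\<^sup>2 * (norm (g x))\<^sup>2)"
      using lam by (simp add: field_simps power2_eq_square)
    have "(\<integral>\<^sup>+x\<in>cube 0 R. ennreal ((norm (V x))\<^sup>2) \<partial>lebesgue) \<le> (\<integral>\<^sup>+x. ennreal (1 / e\<^sup>2) * ennreal ((cut x)\<^sup>2 * (norm (V x))\<^sup>2) \<partial>lebesgue)"
    proof (rule nn_integral_mono)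
      fix x :: "real ^ 'n"
      show "ennreal ((norm (V x))\<^sup>2) * indicator (cube 0 R) x \<le> ennreal (1 / e\<^sup>2) * ennreal ((cut x)\<^sup>2 * (norm (V x))\<^sup>2)"
      proof (cases "x \<in> cube 0 R")
        case True
        have "e\<^sup>2 \<le> (cut x)\<^sup>2" using cute[OF True] e by (intro power_mono) auto
        then have "e\<^sup>2 * (norm (V x))\<^sup>2 \<le> (cut x)\<^sup>2 * (norm (V x))\<^sup>2" by (intro mult_right_mono) auto
        then have "(norm (V x))\<^sup>2 \<le> 1 / e\<^sup>2 * ((cut x)\<^sup>2 * (norm (V x))\<^sup>2)" using e by (simp add: field_simps)
        then show ?thesis using True e by (simp add: ennreal_mult[symmetric] ennreal_leI)
      qed simp
    qed
    also have "\<dots> = ennreal (1 / e\<^sup>2 * (LINT x|lebesgue. (cut x)\<^sup>2 * (norm (V x))\<^sup>2))"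
    proof -
      have "(\<integral>\<^sup>+x. ennreal (1 / e\<^sup>2) * ennreal ((cut x)\<^sup>2 * (norm (V x))\<^sup>2) \<partial>lebesgue)
        = ennreal (1 / e\<^sup>2) * (\<integral>\<^sup>+x. ennreal ((cut x)\<^sup>2 * (norm (V x))\<^sup>2) \<partial>lebesgue)"
        by (rule nn_integral_cmult) measurable
      also have "(\<integral>\<^sup>+x. ennreal ((cut x)\<^sup>2 * (norm (V x))\<^sup>2) \<partial>lebesgue) = ennreal (LINT x|lebesgue. (cut x)\<^sup>2 * (norm (V x))\<^sup>2)"
        by (rule nn_integral_eq_integral[OF iV]) simp
      also have "ennreal (1 / e\<^sup>2) * \<dots> = ennreal (1 / e\<^sup>2 * (LINT x|lebesgue. (cut x)\<^sup>2 * (norm (V x))\<^sup>2))"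
        by (rule ennreal_mult[symmetric]) (auto intro: integral_nonneg_AE)
      finally show ?thesis .
    qed
    also have "\<dots> \<le> ennreal (C / R\<^sup>2 * (LINT x|lebesgue. indicator Q x *\<^sub>R (u x)\<^sup>2))"
    proof (rule ennreal_leI)
      have "(LINT x|lebesgue. (u x)\<^sup>2 * (norm (g x))\<^sup>2) \<le> (LINT x|lebesgue. (B / R)\<^sup>2 * (indicator Q x *\<^sub>R (u x)\<^sup>2))"
      proof (rule integral_mono[OF iu])
        show "integrable lebesgue (\<lambda>x. (B / R)\<^sup>2 * (indicator Q x *\<^sub>R (u x)\<^sup>2))" using u2 by (intro integrable_mult_right)
        fix x
        have "(norm (g x))\<^sup>2 \<le> (B / R)\<^sup>2" using gB[of x] by (intro power_mono) auto
        then have "(u x)\<^sup>2 * (norm (g x))\<^sup>2 \<le> (B / R)\<^sup>2 * (u x)\<^sup>2"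
          using mult_left_mono[of "(norm (g x))\<^sup>2" "(B / R)\<^sup>2" "(u x)\<^sup>2"] by (simp add: mult.commute)
        then show "(u x)\<^sup>2 * (norm (g x))\<^sup>2 \<le> (B / R)\<^sup>2 * (indicator Q x *\<^sub>R (u x)\<^sup>2)"
          using gQ[of x] by (cases "x \<in> Q") (auto simp: Q_def)
      qed
      also have "\<dots> = (B / R)\<^sup>2 * (LINT x|lebesgue. indicator Q x *\<^sub>R (u x)\<^sup>2)" by simp
      finally have "4 / lam\<^sup>2 * (LINT x|lebesgue. (u x)\<^sup>2 * (norm (g x))\<^sup>2) \<le> 4 / lam\<^sup>2 * ((B / R)\<^sup>2 * (LINT x|lebesgue. indicator Q x *\<^sub>R (u x)\<^sup>2))"
        by (rule mult_left_mono) simp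
      then have "(LINT x|lebesgue. (cut x)\<^sup>2 * (norm (V x))\<^sup>2) \<le> 4 / lam\<^sup>2 * ((B / R)\<^sup>2 * (LINT x|lebesgue. indicator Q x *\<^sub>R (u x)\<^sup>2))"
        using main by linarith
      then have "1 / e\<^sup>2 * (LINT x|lebesgue. (cut x)\<^sup>2 * (norm (V x))\<^sup>2) \<le> 1 / e\<^sup>2 * (4 / lam\<^sup>2 * ((B / R)\<^sup>2 * (LINT x|lebesgue. indicator Q x *\<^sub>R (u x)\<^sup>2)))"
        by (rule mult_left_mono) simp
      also have "\<dots> = C / R\<^sup>2 * (LINT x|lebesgue. indicator Q x *\<^sub>R (u x)\<^sup>2)"
        by (simp add: C_def power_divide mult_ac)
      finally show "1 / e\<^sup>2 * (LINT x|lebesgue. (cut x)\<^sup>2 * (norm (V x))\<^sup>2) \<le> C / R\<^sup>2 * (LINT x|lebesgue. indicator Q x *\<^sub>R (u x)\<^sup>2)" .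
    qed
    also have "\<dots> = ennreal (C / R\<^sup>2) * ennreal (LINT x|lebesgue. indicator Q x *\<^sub>R (u x)\<^sup>2)"
      using B e lam by (intro ennreal_mult integral_nonneg_AE) (auto simp: C_def)
    also have "ennreal (LINT x|lebesgue. indicator Q x *\<^sub>R (u x)\<^sup>2) = (\<integral>\<^sup>+x. ennreal (indicator Q x *\<^sub>R (u x)\<^sup>2) \<partial>lebesgue)"
      by (rule nn_integral_eq_integral[symmetric, OF u2]) auto
    also have "\<dots> = (\<integral>\<^sup>+x\<in>cube 0 (2 * R). ennreal ((u x)\<^sup>2) \<partial>lebesgue)"
      by (intro nn_integral_cong) (auto simp: Q_def indicator_def)
    finally show "(\<integral>\<^sup>+x\<in>cube 0 R. ennreal ((norm (V x))\<^sup>2) \<partial>lebesgue)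
        \<le> ennreal (C / R\<^sup>2) * (\<integral>\<^sup>+x\<in>cube 0 (2 * R). ennreal ((u x)\<^sup>2) \<partial>lebesgue)" .
  qed
qed

subsection \<open>Lebesgue differentiation\<close>

text \<open>The centre is displaced by half the side, so the cubes shrink to \<open>x\<close> with
  \<open>x\<close> as their lower corner; this is the form of the differentiation theorem for gauge
  integrals that is applied.\<close>

lemma lebesgue_differentiation:
  fixes f :: "real ^ 'n \<Rightarrow> real"
  assumes f: "L1_loc f"
  shows "AE x in lebesgue. (\<lambda>n. average (cube (x + vec (1 / (2 * (real n + 1)))) (1 / (real n + 1))) f) \<longlonglongrightarrow> f x"
proof -
  have si: "set_integrable lebesgue (cbox a b) f" for a b using f by (simp add: L1_loc_def)
  have "f integrable_on cbox a b" for a b by (rule set_lebesgue_integral_eq_integral(1)[OF si])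
  then obtain N where N: "negligible N" and
    lim: "\<And>x e. x \<notin> N \<Longrightarrow> 0 < e \<Longrightarrow> \<exists>d>0. \<forall>h. 0 < h \<and> h < d \<longrightarrow>
        norm (integral (cbox x (x + h *\<^sub>R One)) f /\<^sub>R h ^ DIM(real ^ 'n) - f x) < e"
    using integrable_ccontinuous_explicit[of f] by blast
  have eq: "average (cube (x + vec (h / 2)) h) f = integral (cbox x (x + h *\<^sub>R One)) f /\<^sub>R h ^ DIM(real ^ 'n)"
    if h: "h > 0" for x h
  proof -
    have "One $ i = (1 :: real)" for i :: 'n
      by (simp add: cart_eq_inner_axis inner_sum_left_Basis axis_in_Basis_iff)
    then have One: "h *\<^sub>R One = (vec h :: real ^ 'n)" by (simp add: vec_eq_iff)
    have "vec (h / 2) + vec (h / 2) = (vec h :: real ^ 'n)" by (simp add: vec_eq_iff)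
    then have c: "cube (x + vec (h / 2)) h = box x (x + h *\<^sub>R One)"
      unfolding cube_eq_box[OF h] One by (simp add: add.assoc)
    have "set_integrable lebesgue (box x (x + h *\<^sub>R One)) f"
      by (rule set_integrable_subset[OF si[of x "x + h *\<^sub>R One"]]) (auto simp: box_subset_cbox)
    then have "(LINT y:box x (x + h *\<^sub>R One)|lebesgue. f y) = integral (box x (x + h *\<^sub>R One)) f"
      by (rule set_lebesgue_integral_eq_integral(2))
    also have "\<dots> = integral (cbox x (x + h *\<^sub>R One)) f" by (rule integral_open_interval)
    finally show ?thesis
      unfolding average_def measure_cube[OF h] unfolding c by (simp add: divide_inverse_commute)
  qed
  have "AE x in lebesgue. x \<notin> N" using N by (simp add: negligible_iff_null_sets AE_not_in)
  then show ?thesis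
  proof eventually_elim
    case (elim x)
    show ?case
    proof (rule LIMSEQ_I)
      fix e :: real assume "e > 0"
      then obtain d where d: "d > 0" "\<And>h. 0 < h \<Longrightarrow> h < d \<Longrightarrow> norm (integral (cbox x (x + h *\<^sub>R One)) f /\<^sub>R h ^ DIM(real ^ 'n) - f x) < e"
        using lim[OF elim] by blast
      obtain M :: nat where M: "1 / (real M + 1) < d"
        using nat_approx_posE[OF d(1)] by (metis Suc_eq_plus1 of_nat_Suc add.commute)
      show "\<exists>no. \<forall>n\<ge>no. norm (average (cube (x + vec (1 / (2 * (real n + 1)))) (1 / (real n + 1))) f - f x) < e"
      proof (intro exI[of _ M] allI impI)
        fix n assume n: "M \<le> n"
        have "1 / (real n + 1) \<le> 1 / (real M + 1)" using n by (intro divide_left_mono) auto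
        then have h: "1 / (real n + 1) < d" "0 < 1 / (real n + 1)" using M by auto
        have "1 / (2 * (real n + 1)) = (1 / (real n + 1)) / 2" by simp
        then show "norm (average (cube (x + vec (1 / (2 * (real n + 1)))) (1 / (real n + 1))) f - f x) < e"
          using eq[OF h(2), of x] d(2)[OF h(2,1)] by (simp only:)
      qed
    qed
  qed
qed

text \<open>Turns an identity of integrals over cubes, the form in which stationarity is given, into
  an identity almost everywhere.\<close>

lemma AE_eq_0_of_cubes:
  fixes f :: "real ^ 'n \<Rightarrow> real"
  assumes f: "L1_loc f" and 0: "\<And>x r. r > 0 \<Longrightarrow> (LINT y:cube x r|lebesgue. f y) = 0"
  shows "AE x in lebesgue. f x = 0"
  using lebesgue_differentiation[OF f]
proof eventually_elim
  case (elim x)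
  have "average (cube (x + vec (1 / (2 * (real n + 1)))) (1 / (real n + 1))) f = 0" for n
    unfolding average_def by (subst 0) auto
  then have "(\<lambda>n::nat. 0) \<longlonglongrightarrow> f x" using elim by simp
  then show ?case using LIMSEQ_unique[OF tendsto_const] by metis
qed

subsection \<open>The Poincare inequality\<close>

text \<open>Only the half segment from the midpoint to \<open>x\<close> is used. Keeping t away from
  0 prevents a degenerate change of variables once the right-hand side is integrated over
  \<open>x\<close>.\<close>

lemma segment_estimate:
  fixes w :: "real ^ 'n \<Rightarrow> real"
  assumes g: "continuous_on UNIV g" and w: "\<And>x. (w has_derivative (\<lambda>v. g x \<bullet> v)) (at x)"
  shows "ennreal ((w x - w ((1/2) *\<^sub>R (x + y)))\<^sup>2)
    \<le> ennreal ((norm (x - y))\<^sup>2) * (\<integral>\<^sup>+t\<in>{1/2..1}. ennreal ((norm (g (y + t *\<^sub>R (x - y))))\<^sup>2) \<partial>lborel)"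
proof -
  define f where "f t = g (y + t *\<^sub>R (x - y)) \<bullet> (x - y)" for t
  have fc: "continuous_on UNIV f" unfolding f_def by (intro continuous_intros continuous_on_compose2[OF g]) auto
  define J where "J = (LBINT t. f t * indicator {1/2..1} t)"
  have J: "J = w x - w ((1/2) *\<^sub>R (x + y))"
  proof -
    have "J = w (y + 1 *\<^sub>R (x - y)) - w (y + (1/2) *\<^sub>R (x - y))"
      unfolding J_def
    proof (rule integral_FTC_Icc_real)
      fix t :: real
      have "((\<lambda>t. w (y + t *\<^sub>R (x - y))) has_derivative (\<lambda>s. g (y + t *\<^sub>R (x - y)) \<bullet> (s *\<^sub>R (x - y)))) (at t)"
        by (rule has_derivative_compose[OF _ w]) (auto intro!: derivative_eq_intros)
      then show "((\<lambda>t. w (y + t *\<^sub>R (x - y))) has_real_derivative f t) (at t)"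
        by (simp add: has_field_derivative_def f_def mult.commute[of _ "_ \<bullet> _"])
      show "isCont f t" using fc by (simp add: continuous_on_eq_continuous_at)
    qed simp
    also have "y + (1/2) *\<^sub>R (x - y) = (1/2) *\<^sub>R (x + y)"
      by (simp add: vec_eq_iff field_simps)
    finally show ?thesis by simp
  qed
  have ci: "set_integrable lborel {1/2..1} (h :: real \<Rightarrow> real)" if "continuous_on UNIV h" for h
    unfolding set_integrable_def
    by (rule borel_integrable_compact) (auto intro: continuous_on_subset[OF that])
  have i: "integrable lborel (\<lambda>t. f t * indicator {1/2..1} t)" "integrable lborel (\<lambda>t. (f t)\<^sup>2 * indicator {1/2..1} t)"
    "integrable lborel (\<lambda>t. indicator {1/2..1::real} t :: real)"
    using ci[OF fc] ci[of "\<lambda>t. (f t)\<^sup>2"] ci[of "\<lambda>t. 1"] fc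
    by (auto simp: set_integrable_def mult.commute intro: continuous_intros)
  \<comment> \<open>On an interval of length 1/2 the mean of \<open>f\<close> is 2J; a nonnegative
    variance is the Cauchy-Schwarz bound for J^2.\<close>
  have "0 \<le> (LBINT t. (f t - 2 * J)\<^sup>2 * indicator {1/2..1} t)"
    by (intro integral_nonneg_AE) auto
  also have "\<dots> = (LBINT t. (f t)\<^sup>2 * indicator {1/2..1} t - 4 * J * (f t * indicator {1/2..1} t) + 4 * J\<^sup>2 * indicator {1/2..1} t)"
    by (intro Bochner_Integration.integral_cong) (auto simp: power2_diff algebra_simps power2_eq_square)
  also have "\<dots> = (LBINT t. (f t)\<^sup>2 * indicator {1/2..1} t) - 4 * J * J + 4 * J\<^sup>2 * (1/2)"
    using i by (simp add: J_def)
  finally have J2: "J\<^sup>2 \<le> (LBINT t. (f t)\<^sup>2 * indicator {1/2..1} t)"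
    by (simp add: power2_eq_square) (smt (verit) zero_le_square)
  then have "ennreal (J\<^sup>2) \<le> ennreal (LBINT t. (f t)\<^sup>2 * indicator {1/2..1} t)" by (rule ennreal_leI)
  also have "\<dots> = (\<integral>\<^sup>+t. ennreal ((f t)\<^sup>2 * indicator {1/2..1} t) \<partial>lborel)"
    by (rule nn_integral_eq_integral[symmetric, OF i(2)]) auto
  also have "\<dots> \<le> (\<integral>\<^sup>+t. ennreal ((norm (x - y))\<^sup>2) * (ennreal ((norm (g (y + t *\<^sub>R (x - y))))\<^sup>2) * indicator {1/2..1} t) \<partial>lborel)"
  proof (rule nn_integral_mono)
    fix t :: real
    have "\<bar>f t\<bar> \<le> norm (x - y) * norm (g (y + t *\<^sub>R (x - y)))"
      unfolding f_def using Cauchy_Schwarz_ineq2[of "g (y + t *\<^sub>R (x - y))" "x - y"] by (simp add: mult.commute)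
    then have "\<bar>f t\<bar>\<^sup>2 \<le> (norm (x - y) * norm (g (y + t *\<^sub>R (x - y))))\<^sup>2" by (rule power_mono) simp
    then show "ennreal ((f t)\<^sup>2 * indicator {1/2..1} t) \<le> ennreal ((norm (x - y))\<^sup>2) * (ennreal ((norm (g (y + t *\<^sub>R (x - y))))\<^sup>2) * indicator {1/2..1} t)"
      by (auto simp: indicator_def ennreal_mult[symmetric] power_mult_distrib intro!: ennreal_leI)
  qed
  also have "\<dots> = ennreal ((norm (x - y))\<^sup>2) * (\<integral>\<^sup>+t\<in>{1/2..1}. ennreal ((norm (g (y + t *\<^sub>R (x - y))))\<^sup>2) \<partial>lborel)"
  proof (rule nn_integral_cmult)
    have [measurable]: "g \<in> borel_measurable borel" using g by (rule borel_measurable_continuous_onI)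
    show "(\<lambda>t. ennreal ((norm (g (y + t *\<^sub>R (x - y))))\<^sup>2) * indicator {1/2..1} t) \<in> borel_measurable lborel" by measurable
  qed
  finally show ?thesis by (simp add: J)
qed

lemma convex_cube: "convex (cube x r)" if "r > 0" for x :: "real ^ 'n"
  unfolding cube_eq_box[OF that] by (rule convex_box)

text \<open>A difference of two values is split at the midpoint, and by symmetry both halves
  contribute equally. For t at least 1/2 the contraction of the cube towards \<open>y\<close> has
  Jacobian at least 2^(-n), with n the dimension, and by convexity it stays in the cube.\<close>

lemma poincare:
  obtains C where "C > 0"
    "\<And>(w :: real ^ 'n \<Rightarrow> real) g R. continuous_on UNIV g \<Longrightarrow> (\<And>x. (w has_derivative (\<lambda>v. g x \<bullet> v)) (at x)) \<Longrightarrow> R > 0 \<Longrightarrow>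
      (\<integral>\<^sup>+x\<in>cube 0 R. (\<integral>\<^sup>+y\<in>cube 0 R. ennreal ((w x - w y)\<^sup>2) \<partial>lebesgue) \<partial>lebesgue)
        \<le> ennreal (C * R\<^sup>2 * R ^ CARD('n)) * (\<integral>\<^sup>+x\<in>cube 0 R. ennreal ((norm (g x))\<^sup>2) \<partial>lebesgue)"
proof -
  define n where "n = CARD('n)"
  \<comment> \<open>4 is 2 + 2 from the two halves, then comes the square of the diameter bound 2nR
    without its \<open>R\<close>, and 2^n from the Jacobian.\<close>
  define C where "C = 4 * (2 * real n)\<^sup>2 * 2 ^ n"
  show thesis
  proof (rule that[of C])
    have "n > 0" by (simp add: n_def)
    then show "C > 0" by (simp add: C_def)
  next
    fix w :: "real ^ 'n \<Rightarrow> real" and g R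
    assume g: "continuous_on UNIV g" and w: "\<And>x. (w has_derivative (\<lambda>v. g x \<bullet> v)) (at x)" and R: "(R::real) > 0"
    define Q where "Q = cube (0 :: real ^ 'n) R"
    have Q[measurable]: "Q \<in> sets borel" unfolding Q_def by (rule cube_borel[OF R])
    have "continuous_on UNIV w"
      using w by (meson continuous_at_imp_continuous_on has_derivative_continuous)
    then have wm[measurable]: "w \<in> borel_measurable borel" by (rule borel_measurable_continuous_onI)
    have gm[measurable]: "g \<in> borel_measurable borel" using g by (rule borel_measurable_continuous_onI)
    define X where "X = (\<integral>\<^sup>+x\<in>Q. ennreal ((norm (g x))\<^sup>2) \<partial>lborel)"
    define m where "m x y = (1/2) *\<^sub>R (x + y)" for x y :: "real ^ 'n"
    have mm[measurable]: "(\<lambda>(x, y). m x y) \<in> borel_measurable (lborel \<Otimes>\<^sub>M lborel)" unfolding m_def by measurable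
    define D where "D = ennreal ((2 * real n * R)\<^sup>2)"
    define h where "h x y t = D * (ennreal ((norm (g (y + t *\<^sub>R (x - y))))\<^sup>2) * indicator {1/2..1} t) * indicator Q y * indicator Q x"
      for x y and t :: real
    have half: "(\<integral>\<^sup>+x\<in>Q. (\<integral>\<^sup>+y\<in>Q. ennreal ((w x - w (m x y))\<^sup>2) \<partial>lborel) \<partial>lborel) \<le> D * (ennreal (2 ^ n) * X) * ennreal (R ^ n)"
    proof -
      have "(\<integral>\<^sup>+x\<in>Q. (\<integral>\<^sup>+y\<in>Q. ennreal ((w x - w (m x y))\<^sup>2) \<partial>lborel) \<partial>lborel)
        = (\<integral>\<^sup>+x. (\<integral>\<^sup>+y. ennreal ((w x - w (m x y))\<^sup>2) * indicator Q y * indicator Q x \<partial>lborel) \<partial>lborel)"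
        unfolding m_def by (intro nn_integral_cong nn_integral_multc[symmetric]) measurable
      also have "\<dots> \<le> (\<integral>\<^sup>+x. (\<integral>\<^sup>+y. (\<integral>\<^sup>+t. h x y t \<partial>lborel) \<partial>lborel) \<partial>lborel)"
      proof (intro nn_integral_mono)
        fix x y :: "real ^ 'n"
        show "ennreal ((w x - w (m x y))\<^sup>2) * indicator Q y * indicator Q x \<le> (\<integral>\<^sup>+t. h x y t \<partial>lborel)"
        proof (cases "x \<in> Q \<and> y \<in> Q")
          case True
          have "norm (x - y) \<le> norm x + norm y" by (rule norm_triangle_ineq4)
          also have "\<dots> \<le> 2 * real n * R" using norm_cube_le[OF R, of x 0] norm_cube_le[OF R, of y 0] True by (simp add: Q_def n_def)
          finally have "(norm (x - y))\<^sup>2 \<le> (2 * real n * R)\<^sup>2" by (intro power_mono) auto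
          then have "ennreal ((norm (x - y))\<^sup>2) \<le> D" unfolding D_def by (rule ennreal_leI)
          then have "ennreal ((w x - w (m x y))\<^sup>2) \<le> D * (\<integral>\<^sup>+t\<in>{1/2..1}. ennreal ((norm (g (y + t *\<^sub>R (x - y))))\<^sup>2) \<partial>lborel)"
            using segment_estimate[OF g w, of x y] unfolding m_def by (meson mult_right_mono order_trans zero_le)
          also have "\<dots> = (\<integral>\<^sup>+t. h x y t \<partial>lborel)"
            unfolding h_def using True by (subst nn_integral_cmult[symmetric]) (simp_all)
          finally show ?thesis using True by simp
        qed auto
      qed
      \<comment> \<open>For fixed \<open>y\<close> and t the change of variables concerns
        \<open>x\<close>, which is therefore moved innermost.\<close>
      also have "\<dots> = (\<integral>\<^sup>+y. (\<integral>\<^sup>+x. (\<integral>\<^sup>+t. h x y t \<partial>lborel) \<partial>lborel) \<partial>lborel)"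
        by (rule lborel_pair.Fubini'[symmetric]) (unfold h_def, measurable)
      also have "\<dots> = (\<integral>\<^sup>+y. (\<integral>\<^sup>+t. (\<integral>\<^sup>+x. h x y t \<partial>lborel) \<partial>lborel) \<partial>lborel)"
        by (intro nn_integral_cong lborel_pair.Fubini') (unfold h_def, measurable)
      also have "\<dots> \<le> (\<integral>\<^sup>+y. (\<integral>\<^sup>+t. D * (ennreal (2 ^ n) * X) * indicator Q y * indicator {1/2..1::real} t \<partial>lborel) \<partial>lborel)"
      proof (intro nn_integral_mono)
        fix y :: "real ^ 'n" and t :: real
        show "(\<integral>\<^sup>+x. h x y t \<partial>lborel) \<le> D * (ennreal (2 ^ n) * X) * indicator Q y * indicator {1/2..1::real} t"
        proof (cases "y \<in> Q \<and> t \<in> {1/2..1}")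
          case True
          define f where "f z = ennreal ((norm (g z))\<^sup>2) * indicator Q z" for z
          have fm: "f \<in> borel_measurable lebesgue" unfolding f_def by (rule measurable_completion) measurable
          have "(\<integral>\<^sup>+x. h x y t \<partial>lborel) \<le> (\<integral>\<^sup>+x. D * f ((1 - t) *\<^sub>R y + t *\<^sub>R x) \<partial>lborel)"
          proof (rule nn_integral_mono)
            fix x
            have e: "y + t *\<^sub>R (x - y) = (1 - t) *\<^sub>R y + t *\<^sub>R x" by (simp add: algebra_simps)
            have "(1 - t) *\<^sub>R y + t *\<^sub>R x \<in> Q" if "x \<in> Q"
              using convexD[OF convex_cube[OF R, of "0 :: real ^ 'n"], of y x "1 - t" t] True that by (simp add: Q_def)
            then show "h x y t \<le> D * f ((1 - t) *\<^sub>R y + t *\<^sub>R x)"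
              unfolding h_def f_def e using True by (auto simp: indicator_def)
          qed
          also have "\<dots> = D * (\<integral>\<^sup>+x. f ((1 - t) *\<^sub>R y + t *\<^sub>R x) \<partial>lborel)"
            unfolding f_def by (rule nn_integral_cmult) measurable
          also have "(\<integral>\<^sup>+x. f ((1 - t) *\<^sub>R y + t *\<^sub>R x) \<partial>lborel) \<le> ennreal (2 ^ n) * X"
          proof -
            have X: "X = ennreal (\<bar>t\<bar> ^ n) * (\<integral>\<^sup>+x. f ((1 - t) *\<^sub>R y + t *\<^sub>R x) \<partial>lborel)"
              using nn_integral_lebesgue_affine[OF fm, of t "(1 - t) *\<^sub>R y"] True
              by (simp add: nn_integral_completion X_def f_def n_def)
            have "1 \<le> 2 * t" using True by auto
            then have "1 \<le> (2 * t) ^ n" by (rule one_le_power)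
            then have "1 \<le> ennreal ((2 * t) ^ n)" by simp
            also have "ennreal ((2 * t) ^ n) = ennreal (2 ^ n) * ennreal (\<bar>t\<bar> ^ n)"
              using True by (subst ennreal_mult[symmetric]) (auto simp: power_mult_distrib)
            finally have "1 * (\<integral>\<^sup>+x. f ((1 - t) *\<^sub>R y + t *\<^sub>R x) \<partial>lborel) \<le> ennreal (2 ^ n) * ennreal (\<bar>t\<bar> ^ n) * (\<integral>\<^sup>+x. f ((1 - t) *\<^sub>R y + t *\<^sub>R x) \<partial>lborel)"
              by (rule mult_right_mono) simp
            then show ?thesis by (subst X) (simp add: mult.assoc)
          qed
          finally show ?thesis using True by (simp add: mult_left_mono)
        qed (auto simp: h_def)
      qed
      also have "\<dots> = (\<integral>\<^sup>+y. D * (ennreal (2 ^ n) * X) * ennreal (1/2) * indicator Q y \<partial>lborel)"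
        by (intro nn_integral_cong, subst nn_integral_cmult_indicator) (auto simp: mult_ac)
      also have "\<dots> = D * (ennreal (2 ^ n) * X) * ennreal (1/2) * ennreal (R ^ n)"
        using emeasure_cube[OF R, of "0 :: real ^ 'n"] Q
        by (subst nn_integral_cmult_indicator) (auto simp: Q_def n_def emeasure_completion)
      also have "\<dots> \<le> D * (ennreal (2 ^ n) * X) * 1 * ennreal (R ^ n)"
        using ennreal_leI[of "1/2" 1] by (intro mult_right_mono mult_left_mono) (auto simp del: ennreal_half)
      finally show ?thesis by simp
    qed
    have msym: "m x y = m y x" for x y by (simp add: m_def add.commute)
    have half2: "(\<integral>\<^sup>+x\<in>Q. (\<integral>\<^sup>+y\<in>Q. ennreal ((w y - w (m x y))\<^sup>2) \<partial>lborel) \<partial>lborel)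
       = (\<integral>\<^sup>+x\<in>Q. (\<integral>\<^sup>+y\<in>Q. ennreal ((w x - w (m x y))\<^sup>2) \<partial>lborel) \<partial>lborel)"
    proof -
      have "(\<integral>\<^sup>+x\<in>Q. (\<integral>\<^sup>+y\<in>Q. ennreal ((w y - w (m x y))\<^sup>2) \<partial>lborel) \<partial>lborel)
        = (\<integral>\<^sup>+x. (\<integral>\<^sup>+y. ennreal ((w y - w (m x y))\<^sup>2) * indicator Q y * indicator Q x \<partial>lborel) \<partial>lborel)"
        unfolding m_def by (intro nn_integral_cong nn_integral_multc[symmetric]) measurable
      also have "\<dots> = (\<integral>\<^sup>+y. (\<integral>\<^sup>+x. ennreal ((w y - w (m x y))\<^sup>2) * indicator Q y * indicator Q x \<partial>lborel) \<partial>lborel)"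
        unfolding m_def by (rule lborel_pair.Fubini'[symmetric]) measurable
      also have "\<dots> = (\<integral>\<^sup>+y. (\<integral>\<^sup>+x. ennreal ((w y - w (m y x))\<^sup>2) * indicator Q x * indicator Q y \<partial>lborel) \<partial>lborel)"
        by (intro nn_integral_cong) (simp add: msym mult_ac)
      also have "\<dots> = (\<integral>\<^sup>+x\<in>Q. (\<integral>\<^sup>+y\<in>Q. ennreal ((w x - w (m x y))\<^sup>2) \<partial>lborel) \<partial>lborel)"
        unfolding m_def by (intro nn_integral_cong nn_integral_multc) measurable
      finally show ?thesis .
    qed
    have "(\<integral>\<^sup>+x\<in>Q. (\<integral>\<^sup>+y\<in>Q. ennreal ((w x - w y)\<^sup>2) \<partial>lborel) \<partial>lborel)
      \<le> (\<integral>\<^sup>+x. 2 * ((\<integral>\<^sup>+y\<in>Q. ennreal ((w x - w (m x y))\<^sup>2) \<partial>lborel) * indicator Q x)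
            + 2 * ((\<integral>\<^sup>+y\<in>Q. ennreal ((w y - w (m x y))\<^sup>2) \<partial>lborel) * indicator Q x) \<partial>lborel)"
    proof (rule nn_integral_mono)
      fix x :: "real ^ 'n"
      have "(\<integral>\<^sup>+y\<in>Q. ennreal ((w x - w y)\<^sup>2) \<partial>lborel)
        \<le> (\<integral>\<^sup>+y. 2 * (ennreal ((w x - w (m x y))\<^sup>2) * indicator Q y) + 2 * (ennreal ((w y - w (m x y))\<^sup>2) * indicator Q y) \<partial>lborel)"
      proof (rule nn_integral_mono)
        fix y
        have "(w x - w y)\<^sup>2 \<le> 2 * (w x - w (m x y))\<^sup>2 + 2 * (w y - w (m x y))\<^sup>2"
          using norm_sq_diff_le[of "w x - w (m x y)" "w y - w (m x y)"] by simp
        then have "ennreal ((w x - w y)\<^sup>2) \<le> ennreal (2 * (w x - w (m x y))\<^sup>2 + 2 * (w y - w (m x y))\<^sup>2)" by (rule ennreal_leI)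
        also have "\<dots> = 2 * ennreal ((w x - w (m x y))\<^sup>2) + 2 * ennreal ((w y - w (m x y))\<^sup>2)" by (simp add: ennreal_mult)
        finally show "ennreal ((w x - w y)\<^sup>2) * indicator Q y
          \<le> 2 * (ennreal ((w x - w (m x y))\<^sup>2) * indicator Q y) + 2 * (ennreal ((w y - w (m x y))\<^sup>2) * indicator Q y)"
          by (simp add: indicator_def)
      qed
      also have "\<dots> = 2 * (\<integral>\<^sup>+y\<in>Q. ennreal ((w x - w (m x y))\<^sup>2) \<partial>lborel) + 2 * (\<integral>\<^sup>+y\<in>Q. ennreal ((w y - w (m x y))\<^sup>2) \<partial>lborel)"
        unfolding m_def by (subst nn_integral_add) (auto simp: nn_integral_cmult)
      finally show "(\<integral>\<^sup>+y\<in>Q. ennreal ((w x - w y)\<^sup>2) \<partial>lborel) * indicator Q x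
        \<le> 2 * ((\<integral>\<^sup>+y\<in>Q. ennreal ((w x - w (m x y))\<^sup>2) \<partial>lborel) * indicator Q x)
            + 2 * ((\<integral>\<^sup>+y\<in>Q. ennreal ((w y - w (m x y))\<^sup>2) \<partial>lborel) * indicator Q x)"
        by (simp add: indicator_def)
    qed
    also have "\<dots> = 2 * (\<integral>\<^sup>+x\<in>Q. (\<integral>\<^sup>+y\<in>Q. ennreal ((w x - w (m x y))\<^sup>2) \<partial>lborel) \<partial>lborel)
        + 2 * (\<integral>\<^sup>+x\<in>Q. (\<integral>\<^sup>+y\<in>Q. ennreal ((w y - w (m x y))\<^sup>2) \<partial>lborel) \<partial>lborel)"
      unfolding m_def by (subst nn_integral_add) (auto simp: nn_integral_cmult)
    also have "\<dots> \<le> 2 * (D * (ennreal (2 ^ n) * X) * ennreal (R ^ n)) + 2 * (D * (ennreal (2 ^ n) * X) * ennreal (R ^ n))"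
      unfolding half2 by (intro add_mono mult_left_mono half) auto
    also have "\<dots> = 4 * (D * ennreal (2 ^ n) * ennreal (R ^ n)) * X"
    proof -
      have "2 * Y + 2 * Y = 4 * Y" for Y :: ennreal
        using distrib_right[of 2 2 Y] by simp
      from this[of "D * (ennreal (2 ^ n) * X) * ennreal (R ^ n)"] show ?thesis by (simp only: mult_ac)
    qed
    also have "4 * (D * ennreal (2 ^ n) * ennreal (R ^ n)) = ennreal (C * R\<^sup>2 * R ^ CARD('n))"
      unfolding D_def ennreal_numeral[symmetric] using R
      by (subst ennreal_mult[symmetric], simp, simp)+ (simp add: C_def n_def power_mult_distrib mult_ac)
    finally show "(\<integral>\<^sup>+x\<in>cube 0 R. (\<integral>\<^sup>+y\<in>cube 0 R. ennreal ((w x - w y)\<^sup>2) \<partial>lebesgue) \<partial>lebesgue)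
        \<le> ennreal (C * R\<^sup>2 * R ^ CARD('n)) * (\<integral>\<^sup>+x\<in>cube 0 R. ennreal ((norm (g x))\<^sup>2) \<partial>lebesgue)"
      by (simp add: Q_def X_def nn_integral_completion)
  qed
qed

text \<open>Each doubling of the radius contracts the previous value and adds an error that is
  eventually small; the contraction works because 3/8 is below 1. A bound on one interval from R1/2
  to R1 starts the iteration.\<close>

lemma dyadic_decay:
  fixes F \<delta> :: "real \<Rightarrow> real"
  assumes nonneg: "\<And>R. F R \<ge> 0" and \<delta>: "(\<delta> \<longlongrightarrow> 0) at_top"
    and rec: "\<And>R. R > 0 \<Longrightarrow> F R \<le> \<delta> R + 3 / 8 * F (R / 2)"
    and bd: "\<And>r. r > 0 \<Longrightarrow> \<exists>B. \<forall>R\<in>{r..2 * r}. F R \<le> B"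
  shows "(F \<longlongrightarrow> 0) at_top"
proof (rule order_tendstoI)
  fix e :: real assume "e < 0" then show "\<forall>\<^sub>F x in at_top. e < F x"
    by (intro always_eventually allI) (use nonneg less_le_trans in blast)
next
  fix e :: real assume e: "0 < e"
  have "\<forall>\<^sub>F R in at_top. \<delta> R < e / 4" by (rule order_tendstoD(2)[OF \<delta>]) (use e in simp)
  then obtain R0 where R0: "\<And>R. R \<ge> R0 \<Longrightarrow> \<delta> R < e / 4" by (auto simp: eventually_at_top_linorder)
  define R1 where "R1 = max R0 1"
  have R1: "R1 > 0" "\<And>R. R \<ge> R1 \<Longrightarrow> \<delta> R < e / 4" using R0 by (auto simp: R1_def)
  obtain b where "\<forall>R\<in>{R1 / 2..2 * (R1 / 2)}. F R \<le> b" using bd[of "R1 / 2"] R1(1) by auto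
  then have b: "\<And>R. R \<in> {R1 / 2..R1} \<Longrightarrow> F R \<le> b" by simp
  have b0: "b \<ge> 0" using b[of R1] nonneg[of R1] R1 by auto
  \<comment> \<open>The bound b + e/2 reproduces itself, since e/4 + 3/8 (b + e/2) does not exceed
    it.\<close>
  have base: "F R \<le> b + e / 2" if "R \<ge> R1 / 2" "R \<le> 2 ^ j * R1" for R and j :: nat
    using that
  proof (induction j arbitrary: R)
    case 0 then show ?case using b[of R] e by auto
  next
    case (Suc j)
    show ?case
    proof (cases "R \<le> R1")
      case True then show ?thesis using b[of R] Suc.prems e by auto
    next
      case False
      have "F (R / 2) \<le> b + e / 2" using False Suc.prems by (intro Suc.IH) auto
      moreover have "\<delta> R < e / 4" using False by (intro R1) auto
      moreover have "F R \<le> \<delta> R + 3 / 8 * F (R / 2)" using False R1 by (intro rec) auto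
      ultimately show ?thesis using b0 e by linarith
    qed
  qed
  \<comment> \<open>Each further doubling of the lower limit for \<open>R\<close> gains a factor 3/8
    on the initial bound, while the error stays below e/2.\<close>
  have step: "F R \<le> (3 / 8) ^ k * b + e / 2" if "R \<ge> R1 * 2 ^ k / 2" for R and k :: nat
    using that
  proof (induction k arbitrary: R)
    case 0
    obtain j :: nat where "R / R1 < 2 ^ j" using real_arch_pow[of 2 "R / R1"] by auto
    then have "R \<le> 2 ^ j * R1" using R1 by (simp add: field_simps)
    then show ?case using base[of R j] 0 by simp
  next
    case (Suc k)
    have "R1 * 1 \<le> R1 * 2 ^ k" using R1 by (intro mult_left_mono) auto
    then have R: "R \<ge> R1" using Suc.prems by simp
    have "F (R / 2) \<le> (3 / 8) ^ k * b + e / 2" using Suc.prems by (intro Suc.IH) auto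
    moreover have "\<delta> R < e / 4" using R by (rule R1)
    moreover have "F R \<le> \<delta> R + 3 / 8 * F (R / 2)" using R R1 by (intro rec) auto
    moreover have "(3 / 8) ^ Suc k * b = 3 / 8 * ((3 / 8) ^ k * b)" by simp
    ultimately show ?case using e by linarith
  qed
  have "(\<lambda>k. (3 / 8 :: real) ^ k * b) \<longlonglongrightarrow> 0 * b" by (intro tendsto_mult tendsto_const LIMSEQ_power_zero) auto
  then have "\<forall>\<^sub>F k in sequentially. (3 / 8 :: real) ^ k * b < e / 2" by (rule order_tendstoD(2)) (use e in simp)
  then obtain k where k: "(3 / 8 :: real) ^ k * b < e / 2" by (auto simp: eventually_sequentially)
  show "\<forall>\<^sub>F x in at_top. F x < e"
    unfolding eventually_at_top_linorder
    by (intro exI[of _ "R1 * 2 ^ k / 2"] allI impI) (use step[of k] k in fastforce)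
qed

subsection \<open>Stationary random coefficient fields\<close>

lemma borel_measurable_vecI:
  fixes f :: "'a \<Rightarrow> 'b::euclidean_space ^ 'n"
  assumes "\<And>i. (\<lambda>x. f x $ i) \<in> borel_measurable N"
  shows "f \<in> borel_measurable N"
proof (subst borel_measurable_euclidean_space, intro ballI)
  fix b :: "'b ^ 'n" assume "b \<in> Basis"
  then obtain i u where b: "b = axis i u" "u \<in> Basis" by (auto simp: Basis_vec_def)
  have "(\<lambda>x. f x $ i \<bullet> u) \<in> borel_measurable N" using assms by (intro borel_measurable_inner) auto
  then show "(\<lambda>x. f x \<bullet> b) \<in> borel_measurable N" by (simp add: b inner_axis)
qed

lemma borel_measurable_vec_nth:
  fixes f :: "'a \<Rightarrow> 'b::euclidean_space ^ 'n"
  assumes "f \<in> borel_measurable N"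
  shows "(\<lambda>x. f x $ i) \<in> borel_measurable N"
proof (rule measurable_compose[OF assms borel_measurable_continuous_onI])
  show "continuous_on UNIV (\<lambda>x :: 'b ^ 'n. x $ i)" by (intro continuous_intros)
qed

lemma borel_measurable_matrix_vector:
  fixes m :: "'a \<Rightarrow> real ^ 'n ^ 'n"
  assumes [measurable]: "m \<in> borel_measurable N" "u \<in> borel_measurable N"
  shows "(\<lambda>x. m x *v u x) \<in> borel_measurable N"
proof (rule borel_measurable_vecI)
  fix i
  have [measurable]: "(\<lambda>x. m x $ i $ j) \<in> borel_measurable N" "(\<lambda>x. u x $ j) \<in> borel_measurable N" for j
    by (intro borel_measurable_vec_nth assms)+
  show "(\<lambda>x. (m x *v u x) $ i) \<in> borel_measurable N"
    unfolding matrix_vector_mult_def by simp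
qed

definition elliptic :: "real \<Rightarrow> real ^ 'n ^ 'n \<Rightarrow> bool" where
  "elliptic lam m \<longleftrightarrow> transpose m = m \<and> (\<forall>\<xi>. \<xi> \<bullet> (m *v \<xi>) \<ge> lam * (norm \<xi>)\<^sup>2 \<and> norm (m *v \<xi>) \<le> norm \<xi>)"

text \<open>Closedness makes the ellipticity test in the definition of the coefficient at the origin
  a measurable event.\<close>

lemma closed_elliptic: "closed {m :: real ^ 'n ^ 'n. elliptic lam m}"
proof -
  have c: "continuous_on UNIV (\<lambda>m :: real ^ 'n ^ 'n. m *v \<xi>)" for \<xi>
    unfolding matrix_vector_mult_def by (intro continuous_intros)
  have "continuous_on UNIV (transpose :: real ^ 'n ^ 'n \<Rightarrow> _)"
    unfolding transpose_def[abs_def] by (intro continuous_intros)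
  then show ?thesis
    unfolding elliptic_def
    by (intro closed_Collect_conj closed_Collect_all closed_Collect_eq closed_Collect_le continuous_intros c) auto
qed

lemma elliptic_sym: "elliptic lam m \<Longrightarrow> u \<bullet> (m *v v) = v \<bullet> (m *v u)"
  unfolding elliptic_def by (metis dot_lmul_matrix inner_commute transpose_matrix_vector)

lemma matrix_entry_le:
  fixes m :: "real ^ 'n ^ 'n"
  assumes "\<And>\<xi>. norm (m *v \<xi>) \<le> norm \<xi>"
  shows "\<bar>m $ i $ j\<bar> \<le> 1"
proof -
  have "m $ i $ j = (m *v axis j 1) $ i" by (simp add: matrix_vector_mul_component inner_axis)
  also have "\<bar>\<dots>\<bar> \<le> norm (m *v axis j 1)" by (rule component_le_norm_cart)
  also have "\<dots> \<le> norm (axis j (1 :: real))" by (rule assms)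
  also have "\<dots> = 1" by simp
  finally show ?thesis .
qed

locale stationary_ergodic =
  fixes lam :: real and M :: "'n::finite coeff measure"
  assumes lam_pos: "0 < lam"
    and M_prob: "prob_space M"
    and M_space: "space M = Omega lam"
    and M_shift: "shift_measurable M"
    and M_coeff: "coeff_measurable M"
    and M_stationary: "stationary M"
    and M_ergodic: "ergodic M"
begin

sublocale prob_space M by (rule M_prob)

sublocale orbit: pair_sigma_finite M "lebesgue :: (real ^ 'n) measure" ..

section \<open>The shifts as a measure preserving action\<close>

lemma shift_shift: "shift y (shift z a) = shift (z + y) a"
  by (auto simp: shift_def add_ac)

lemma shift_zero [simp]: "shift 0 a = a"
  by (simp add: shift_def)

lemma shift_pair_measurable [measurable]: "(\<lambda>(a, x). shift x a) \<in> M \<Otimes>\<^sub>M lebesgue \<rightarrow>\<^sub>M M"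
  using measurable_compose[OF measurable_pair_swap' M_shift[unfolded shift_measurable_def]]
  by (simp add: split_beta')

lemma shift_meas [measurable]: "shift z \<in> M \<rightarrow>\<^sub>M M"
  using measurable_compose[OF measurable_Pair1'[of z lebesgue M] M_shift[unfolded shift_measurable_def]] by simp

lemma shift_orbit: "a \<in> space M \<Longrightarrow> (\<lambda>x. shift x a) \<in> lebesgue \<rightarrow>\<^sub>M M"
  using measurable_compose[OF measurable_Pair1'[of a M lebesgue] shift_pair_measurable] by simp

lemma shift_space: "a \<in> space M \<Longrightarrow> shift z a \<in> space M"
  by (rule measurable_space[OF shift_meas])

lemma orbit_measurable:
  assumes "f \<in> M \<rightarrow>\<^sub>M N" shows "(\<lambda>(a, x). f (shift x a)) \<in> M \<Otimes>\<^sub>M lebesgue \<rightarrow>\<^sub>M N"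
  using measurable_compose[OF shift_pair_measurable assms] by (simp add: split_beta')

lemma orbit_section_measurable:
  assumes "f \<in> M \<rightarrow>\<^sub>M N" "a \<in> space M" shows "(\<lambda>x. f (shift x a)) \<in> lebesgue \<rightarrow>\<^sub>M N"
  by (rule measurable_compose[OF shift_orbit[OF assms(2)] assms(1)])

text \<open>Stationarity applied to indicators. Invariance of the measure then also covers
  nonnegative and vector valued integrands, whereas the definition speaks of real integrable
  ones.\<close>

lemma distr_shift: "distr M M (shift z) = M"
proof (rule measure_eqI)
  fix A assume "A \<in> sets (distr M M (shift z))"
  then have A[measurable]: "A \<in> sets M" by simp
  have "integrable M (indicator A :: _ \<Rightarrow> real)" by (rule integrable_const_bound[of _ 1]) auto
  then have "(LINT a|M. indicator A (shift z a)) = (LINT a|M. indicator A a :: real)"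
    using M_stationary unfolding stationary_def by blast
  moreover have "(LINT a|M. indicator A (shift z a) :: real) = measure M (shift z -` A \<inter> space M)"
  proof -
    have "(LINT a|M. indicator A (shift z a) :: real) = (LINT a|M. indicator (shift z -` A \<inter> space M) a)"
      by (intro Bochner_Integration.integral_cong) (auto simp: indicator_def)
    then show ?thesis by simp
  qed
  ultimately show "emeasure (distr M M (shift z)) A = emeasure M A"
    by (simp add: emeasure_distr emeasure_eq_measure)
qed simp

lemma nn_integral_shift:
  assumes "f \<in> borel_measurable M" shows "(\<integral>\<^sup>+a. f (shift z a) \<partial>M) = (\<integral>\<^sup>+a. f a \<partial>M)"
  by (subst (2) distr_shift[of z, symmetric]) (rule nn_integral_distr[OF shift_meas, symmetric], simp add: assms)

lemma integral_shift:
  fixes f :: "_ \<Rightarrow> 'b::{banach, second_countable_topology}"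
  assumes "f \<in> borel_measurable M" shows "(LINT a|M. f (shift z a)) = (LINT a|M. f a)"
  by (subst (2) distr_shift[of z, symmetric]) (rule integral_distr[OF shift_meas assms, symmetric])

lemma integrable_shift:
  fixes f :: "_ \<Rightarrow> 'b::{banach, second_countable_topology}"
  assumes "integrable M f" shows "integrable M (\<lambda>a. f (shift z a))"
  by (rule integrable_distr[OF shift_meas]) (simp add: distr_shift assms)

text \<open>Fubini and invariance. Moments of a field along the orbit are thereby reduced to the
  expectation of one function of the environment.\<close>

lemma nn_integral_orbit:
  fixes f :: "_ \<Rightarrow> ennreal"
  assumes f[measurable]: "f \<in> borel_measurable M" and Q[measurable]: "Q \<in> sets lebesgue"
  shows "(\<integral>\<^sup>+a. (\<integral>\<^sup>+x\<in>Q. f (shift x a) \<partial>lebesgue) \<partial>M) = emeasure lebesgue Q * (\<integral>\<^sup>+a. f a \<partial>M)"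
proof -
  have [measurable]: "(\<lambda>(a, x). f (shift x a)) \<in> borel_measurable (M \<Otimes>\<^sub>M lebesgue)" by (rule orbit_measurable[OF f])
  have "(\<integral>\<^sup>+a. (\<integral>\<^sup>+x\<in>Q. f (shift x a) \<partial>lebesgue) \<partial>M) = (\<integral>\<^sup>+x. (\<integral>\<^sup>+a. f (shift x a) * indicator Q x \<partial>M) \<partial>lebesgue)"
    by (rule orbit.Fubini'[symmetric]) measurable
  also have "\<dots> = (\<integral>\<^sup>+x. (\<integral>\<^sup>+a. f a \<partial>M) * indicator Q x \<partial>lebesgue)"
    by (intro nn_integral_cong) (simp add: nn_integral_multc nn_integral_shift)
  also have "\<dots> = emeasure lebesgue Q * (\<integral>\<^sup>+a. f a \<partial>M)"
    by (subst nn_integral_cmult_indicator[OF Q]) (rule mult.commute)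
  finally show ?thesis .
qed

text \<open>An orbit consists of uncountably many shifts, so an almost sure property may fail
  somewhere along it. The expected volume of the set of shifts that lead into a null set is zero,
  which saves almost every shift.\<close>

lemma AE_orbit:
  assumes "AE a in M. P a" shows "AE a in M. AE x in lebesgue. P (shift x a)"
proof -
  obtain N where N: "N \<in> null_sets M" "{a \<in> space M. \<not> P a} \<subseteq> N" using assms by (auto elim!: AE_E)
  have Nm[measurable]: "N \<in> sets M" using N by auto
  have iN[measurable]: "(indicator N :: _ \<Rightarrow> ennreal) \<in> borel_measurable M" by simp
  have "(\<integral>\<^sup>+a. (\<integral>\<^sup>+x\<in>UNIV. indicator N (shift x a) \<partial>lebesgue) \<partial>M) = emeasure lebesgue (UNIV :: (real ^ 'n) set) * (\<integral>\<^sup>+a. indicator N a \<partial>M)"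
    by (rule nn_integral_orbit[OF iN]) simp
  also have "\<dots> = 0" using N by (simp add: null_setsD1)
  finally have "(\<integral>\<^sup>+a. (\<integral>\<^sup>+x. indicator N (shift x a) \<partial>lebesgue) \<partial>M) = 0" by simp
  moreover have [measurable]: "(\<lambda>(a, x). indicator N (shift x a) :: ennreal) \<in> borel_measurable (M \<Otimes>\<^sub>M lebesgue)" by (rule orbit_measurable[OF iN])
  ultimately have "AE a in M. (\<integral>\<^sup>+x. indicator N (shift x a) \<partial>lebesgue) = 0"
    by (subst (asm) nn_integral_0_iff_AE) auto
  then show ?thesis using AE_space
  proof eventually_elim
    case (elim a)
    have [measurable]: "(\<lambda>x. indicator N (shift x a) :: ennreal) \<in> borel_measurable lebesgue"
      by (rule orbit_section_measurable[OF iN elim(2)])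
    have "AE x in lebesgue. (indicator N (shift x a) :: ennreal) = 0"
      using elim(1) by (subst (asm) nn_integral_0_iff_AE) auto
    then show ?case
    proof eventually_elim
      case (elim x)
      then have "shift x a \<notin> N" by (simp add: indicator_def split: if_splits)
      then show ?case using N(2) shift_space[OF \<open>a \<in> space M\<close>] by blast
    qed
  qed
qed

text \<open>A probability space is nonempty, and a single coefficient field already forces the two
  ellipticity bounds to be compatible. The consequence serves twice: the identity matrix becomes an
  admissible default, and 1 - lam^2 is nonnegative.\<close>

lemma lam_le_1: "lam \<le> 1"
proof -
  obtain a where "a \<in> space M" using not_empty by blast
  then have "AE x in lebesgue. \<forall>\<xi>. \<xi> \<bullet> (a x *v \<xi>) \<ge> lam * (norm \<xi>)\<^sup>2 \<and> norm (a x *v \<xi>) \<le> norm \<xi>"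
    unfolding M_space Omega_def by blast
  then have ell: "AE x in lebesgue. \<forall>\<xi>. \<xi> \<bullet> (a x *v \<xi>) \<ge> lam * (norm \<xi>)\<^sup>2 \<and> norm (a x *v \<xi>) \<le> norm \<xi>" .
  show ?thesis
  proof (rule ccontr)
    assume "\<not> lam \<le> 1"
    from ell have "AE x in lebesgue. x \<notin> cube (0 :: real ^ 'n) 1"
    proof eventually_elim
      case (elim x)
      let ?e = "axis undefined 1 :: real ^ 'n"
      have "lam \<le> ?e \<bullet> (a x *v ?e)" using elim[rule_format, of ?e] by simp
      also have "\<dots> \<le> norm ?e * norm (a x *v ?e)" by (rule norm_cauchy_schwarz)
      also have "\<dots> \<le> 1" using elim[rule_format, of ?e] by simp
      finally show ?case using \<open>\<not> lam \<le> 1\<close> by simp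
    qed
    then have "cube (0 :: real ^ 'n) 1 \<in> null_sets lebesgue" by (subst AE_iff_null_sets) auto
    then show False using emeasure_cube[of 1 "0 :: real ^ 'n"] by (simp add: null_sets_def)
  qed
qed

text \<open>The cubes have the origin as a corner, matching the differentiation theorem at
  \<open>x\<close> after a shift by \<open>x\<close>. Where the limit does not exist,
  \<open>lim\<close> is unspecified; hence the test for ellipticity in the next definition.\<close>

definition local_average :: "'n coeff \<Rightarrow> real ^ 'n ^ 'n" where
  "local_average a = (\<chi> i j. lim (\<lambda>n. average (cube (vec (1 / (2 * (real n + 1)))) (1 / (real n + 1))) (\<lambda>y. a y $ i $ j)))"

text \<open>A measurable function of the environment whose orbit recovers the coefficient field
  almost everywhere; joint measurability of the field itself is not assumed.\<close>

definition coeff_at :: "'n coeff \<Rightarrow> real ^ 'n ^ 'n" where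
  "coeff_at a = (if elliptic lam (local_average a) then local_average a else mat 1)"

lemma local_average_measurable [measurable]: "local_average \<in> borel_measurable M"
proof (intro borel_measurable_vecI)
  fix i j
  have "(\<lambda>a. average (cube (vec (1 / (2 * (real n + 1)))) (1 / (real n + 1))) (\<lambda>y. a y $ i $ j)) \<in> borel_measurable M" for n
    using M_coeff unfolding coeff_measurable_def average_def by (intro borel_measurable_times) auto
  then show "(\<lambda>a. local_average a $ i $ j) \<in> borel_measurable M"
    unfolding local_average_def by (simp add: borel_measurable_lim_metric)
qed

lemma coeff_at_measurable [measurable]: "coeff_at \<in> borel_measurable M"
proof -
  have [measurable]: "{m :: real ^ 'n ^ 'n. elliptic lam m} \<in> sets borel"
    using closed_elliptic by (rule borel_closed)
  have [measurable]: "Measurable.pred borel (elliptic lam :: real ^ 'n ^ 'n \<Rightarrow> bool)"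
    by (simp add: pred_def)
  show ?thesis unfolding coeff_at_def[abs_def] by measurable
qed

lemma elliptic_coeff_at: "elliptic lam (coeff_at a)"
proof -
  have "elliptic lam (mat 1 :: real ^ 'n ^ 'n)"
    using lam_le_1 unfolding elliptic_def
    by (auto simp: transpose_mat power2_norm_eq_inner mult_left_le_one_le lam_pos less_imp_le)
  then show ?thesis by (simp add: coeff_at_def)
qed

text \<open>Averages of the shifted field near the origin are averages of \<open>a\<close> near
  \<open>x\<close>, so Lebesgue differentiation of the single field \<open>a\<close>
  applies.\<close>

lemma coeff_at_shift:
  assumes a: "a \<in> space M"
  shows "AE x in lebesgue. coeff_at (shift x a) = a x"
proof -
  have am: "a \<in> borel_measurable lebesgue" and sym: "\<And>x. transpose (a x) = a x"
    and ell: "AE x in lebesgue. \<forall>\<xi>. \<xi> \<bullet> (a x *v \<xi>) \<ge> lam * (norm \<xi>)\<^sup>2 \<and> norm (a x *v \<xi>) \<le> norm \<xi>"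
    using a unfolding M_space Omega_def by auto
  have em[measurable]: "(\<lambda>y. a y $ i $ j) \<in> borel_measurable lebesgue" for i j
    by (intro borel_measurable_vec_nth am)
  have L: "L1_loc (\<lambda>y. a y $ i $ j)" for i j
    unfolding L1_loc_def set_integrable_def
  proof (intro allI impI)
    fix K :: "(real ^ 'n) set" assume "compact K"
    then have K: "K \<in> sets lebesgue" "bounded K" by (auto simp: lmeasurable_compact fmeasurableD compact_imp_bounded)
    show "integrable lebesgue (\<lambda>y. indicator K y *\<^sub>R a y $ i $ j)"
    proof (rule integrableI_bounded_set_indicator[where B=1])
      show "emeasure lebesgue K < \<infinity>" by (rule emeasure_bounded_finite[OF K(2,1)])
      show "AE x in lebesgue. x \<in> K \<longrightarrow> norm (a x $ i $ j) \<le> 1"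
        using ell by eventually_elim (auto intro!: matrix_entry_le)
    qed (use K em in auto)
  qed
  have avg: "average (cube c r) (\<lambda>y. shift x a y $ i $ j) = average (cube (x + c) r) (\<lambda>y. a y $ i $ j)"
    if r: "r > 0" for c x r i j
  proof -
    have [measurable]: "cube (x + c) r \<in> sets lebesgue" using r by simp
    have ind: "indicator (cube (x + c) r) (y + x) = (indicator (cube c r) y :: real)" for y
      using r by (auto simp: indicator_def mem_cube)
    have "(LINT y|lebesgue. indicator (cube (x + c) r) (y + x) *\<^sub>R a (y + x) $ i $ j) = (LINT y|lebesgue. indicator (cube (x + c) r) y *\<^sub>R a y $ i $ j)"
      by (rule integral_lebesgue_shift[of "\<lambda>y. indicator (cube (x + c) r) y *\<^sub>R a y $ i $ j" x]) measurable
    then show ?thesis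
      unfolding average_def set_lebesgue_integral_def measure_cube[OF r] shift_def ind by simp
  qed
  have "AE x in lebesgue. \<forall>i j. (\<lambda>n. average (cube (x + vec (1 / (2 * (real n + 1)))) (1 / (real n + 1))) (\<lambda>y. a y $ i $ j)) \<longlonglongrightarrow> a x $ i $ j"
    using lebesgue_differentiation[OF L] by (simp add: AE_all_countable)
  then show ?thesis using ell
  proof eventually_elim
    case (elim x)
    have "local_average (shift x a) $ i $ j = a x $ i $ j" for i j
      using elim(1) by (simp add: local_average_def avg limI)
    then have "local_average (shift x a) = a x" by (simp add: vec_eq_iff)
    moreover have "elliptic lam (a x)" using elim(2) sym by (simp add: elliptic_def)
    ultimately show ?case by (simp add: coeff_at_def)
  qed
qed

lemma coeff_at_bounds:
  "\<xi> \<bullet> (coeff_at a *v \<xi>) \<ge> lam * (norm \<xi>)\<^sup>2" "norm (coeff_at a *v \<xi>) \<le> norm \<xi>"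
  "u \<bullet> (coeff_at a *v v) = v \<bullet> (coeff_at a *v u)"
  using elliptic_coeff_at[of a] elliptic_sym[OF elliptic_coeff_at[of a]] by (auto simp: elliptic_def)

lemma ergodic_average:
  fixes f :: "_ \<Rightarrow> real"
  assumes "integrable M f"
  shows "AE a in M. ((\<lambda>R. average (cube 0 R) (\<lambda>z. f (shift z a))) \<longlongrightarrow> (LINT a|M. f a)) at_top"
  using M_ergodic assms unfolding ergodic_def by blast

end

subsection \<open>Minimising the energy over bounded stationary gradients\<close>

context stationary_ergodic
begin

text \<open>Boundedness is required everywhere on the space instead of almost surely, because it is
  used along entire orbits.\<close>

definition bdd_meas :: "('n coeff \<Rightarrow> 'b::euclidean_space) \<Rightarrow> bool" where
  "bdd_meas u \<longleftrightarrow> u \<in> borel_measurable M \<and> (\<exists>c. \<forall>a\<in>space M. norm (u a) \<le> c)"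

lemma bdd_measE:
  assumes "bdd_meas u"
  obtains c where "c \<ge> 0" "\<And>a. a \<in> space M \<Longrightarrow> norm (u a) \<le> c"
proof -
  obtain c where "\<forall>a\<in>space M. norm (u a) \<le> c" using assms by (auto simp: bdd_meas_def)
  then show thesis by (intro that[of "max c 0"]) auto
qed

lemma bdd_meas_measurable [measurable_dest]: "bdd_meas u \<Longrightarrow> u \<in> borel_measurable M"
  by (simp add: bdd_meas_def)

lemma bdd_measI: "u \<in> borel_measurable M \<Longrightarrow> (\<And>a. a \<in> space M \<Longrightarrow> norm (u a) \<le> c) \<Longrightarrow> bdd_meas u"
  by (auto simp: bdd_meas_def)

lemma bdd_meas_const: "bdd_meas (\<lambda>a. c)"
  by (rule bdd_measI[of _ "norm c"]) auto

lemma bdd_meas_add: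
  assumes "bdd_meas u" "bdd_meas v" shows "bdd_meas (\<lambda>a. u a + v a)"
proof -
  obtain c where c: "\<And>a. a \<in> space M \<Longrightarrow> norm (u a) \<le> c" using bdd_measE[OF assms(1)] by blast
  obtain d where d: "\<And>a. a \<in> space M \<Longrightarrow> norm (v a) \<le> d" using bdd_measE[OF assms(2)] by blast
  show ?thesis
    by (rule bdd_measI[of _ "c + d"]) (use assms c d in \<open>auto intro!: norm_triangle_mono borel_measurable_add bdd_meas_measurable\<close>)
qed

lemma bdd_meas_scaleR:
  assumes "bdd_meas v" shows "bdd_meas (\<lambda>a. t *\<^sub>R v a)"
proof -
  obtain d where d: "\<And>a. a \<in> space M \<Longrightarrow> norm (v a) \<le> d" using bdd_measE[OF assms(1)] by blast
  show ?thesis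
    by (rule bdd_measI[of _ "\<bar>t\<bar> * d"]) (use assms d in \<open>auto intro!: mult_left_mono borel_measurable_scaleR bdd_meas_measurable\<close>)
qed

lemma bdd_meas_diff:
  assumes "bdd_meas u" "bdd_meas v" shows "bdd_meas (\<lambda>a. u a - v a)"
  using bdd_meas_add[OF assms(1) bdd_meas_scaleR[OF assms(2), of "-1"]] by simp

lemma bdd_meas_integrable: "bdd_meas u \<Longrightarrow> integrable M u"
  by (auto simp: bdd_meas_def intro!: integrable_const_bound)

lemma bdd_meas_norm_sq: "bdd_meas u \<Longrightarrow> integrable M (\<lambda>a. (norm (u a))\<^sup>2)"
proof -
  assume u: "bdd_meas u"
  obtain c where c: "\<And>a. a \<in> space M \<Longrightarrow> norm (u a) \<le> c" using bdd_measE[OF u] by blast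
  have [measurable]: "u \<in> borel_measurable M" using u by (rule bdd_meas_measurable)
  show ?thesis
    by (rule integrable_const_bound[of _ "c\<^sup>2"]) (use c in \<open>auto intro!: power_mono\<close>)
qed

lemma bdd_meas_coeff:
  assumes "bdd_meas u" shows "bdd_meas (\<lambda>a. coeff_at a *v u a)"
proof -
  obtain d where d: "\<And>a. a \<in> space M \<Longrightarrow> norm (u a) \<le> d" using bdd_measE[OF assms(1)] by blast
  show ?thesis
  proof (rule bdd_measI[of _ d])
    show "(\<lambda>a. coeff_at a *v u a) \<in> borel_measurable M"
      by (intro borel_measurable_matrix_vector coeff_at_measurable bdd_meas_measurable assms)
    show "norm (coeff_at a *v u a) \<le> d" if "a \<in> space M" for a
      using coeff_at_bounds(2)[of a "u a"] d[OF that] by linarith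
  qed
qed

lemma bdd_meas_inner_integrable:
  assumes "bdd_meas u" "bdd_meas v" shows "integrable M (\<lambda>a. u a \<bullet> v a)"
proof -
  obtain c where c: "c \<ge> 0" "\<And>a. a \<in> space M \<Longrightarrow> norm (u a) \<le> c" using bdd_measE[OF assms(1)] by blast
  obtain d where d: "d \<ge> 0" "\<And>a. a \<in> space M \<Longrightarrow> norm (v a) \<le> d" using bdd_measE[OF assms(2)] by blast
  have [measurable]: "u \<in> borel_measurable M" "v \<in> borel_measurable M" using assms by (auto simp: bdd_meas_def)
  show ?thesis
  proof (rule integrable_const_bound[of _ "c * d"])
    show "AE a in M. norm (u a \<bullet> v a) \<le> c * d"
    proof (rule AE_I2)
      fix a assume a: "a \<in> space M"
      have "norm (u a \<bullet> v a) \<le> norm (u a) * norm (v a)" by (simp add: Cauchy_Schwarz_ineq2)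
      also have "\<dots> \<le> c * d" using c(1) c(2)[OF a] d(2)[OF a] by (intro mult_mono) auto
      finally show "norm (u a \<bullet> v a) \<le> c * d" .
    qed
  qed measurable
qed

section \<open>The energy form\<close>

definition energy :: "('n coeff \<Rightarrow> real ^ 'n) \<Rightarrow> ('n coeff \<Rightarrow> real ^ 'n) \<Rightarrow> real" where
  "energy u v = (LINT a|M. u a \<bullet> (coeff_at a *v v a))"

lemma energy_integrable: "bdd_meas u \<Longrightarrow> bdd_meas v \<Longrightarrow> integrable M (\<lambda>a. u a \<bullet> (coeff_at a *v v a))"
  by (intro bdd_meas_inner_integrable bdd_meas_coeff)

lemma energy_sym: "energy u v = energy v u"
  unfolding energy_def by (subst coeff_at_bounds(3)) simp

lemma energy_add_left:
  "bdd_meas u \<Longrightarrow> bdd_meas u' \<Longrightarrow> bdd_meas v \<Longrightarrow> energy (\<lambda>a. u a + u' a) v = energy u v + energy u' v"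
  unfolding energy_def by (simp add: inner_add_left energy_integrable)

lemma energy_diff_left:
  "bdd_meas u \<Longrightarrow> bdd_meas u' \<Longrightarrow> bdd_meas v \<Longrightarrow> energy (\<lambda>a. u a - u' a) v = energy u v - energy u' v"
  unfolding energy_def by (simp add: inner_diff_left energy_integrable)

lemma energy_scale_left: "energy (\<lambda>a. t *\<^sub>R u a) v = t * energy u v"
  unfolding energy_def by simp

lemma energy_lower: "bdd_meas u \<Longrightarrow> lam * (LINT a|M. (norm (u a))\<^sup>2) \<le> energy u u"
  unfolding energy_def
  by (subst Bochner_Integration.integral_mult_right_zero[symmetric])
     (intro integral_mono energy_integrable integrable_mult_right bdd_meas_norm_sq coeff_at_bounds(1), assumption+)

lemma energy_nonneg: "bdd_meas u \<Longrightarrow> 0 \<le> energy u u"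
  using energy_lower[of u] lam_pos by (smt (verit) integral_nonneg_AE AE_I2 zero_le_power2 mult_nonneg_nonneg)

text \<open>These pairs play the part of smooth functions on the environment with their horizontal
  gradients, with regularity demanded on every orbit. The bound on \<open>h\<close> makes energies
  finite; the bound on \<open>\<zeta>\<close> later makes its contribution to the growth
  negligible.\<close>

definition smooth_pair :: "('n coeff \<Rightarrow> real) \<Rightarrow> ('n coeff \<Rightarrow> real ^ 'n) \<Rightarrow> bool" where
  "smooth_pair \<zeta> h \<longleftrightarrow> bdd_meas \<zeta> \<and> bdd_meas h \<and>
     (\<forall>a\<in>space M. continuous_on UNIV (\<lambda>x. h (shift x a)) \<and>
        (\<forall>x. ((\<lambda>x. \<zeta> (shift x a)) has_derivative (\<lambda>v. h (shift x a) \<bullet> v)) (at x)))"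

lemma smooth_pair_zero: "smooth_pair (\<lambda>a. 0) (\<lambda>a. 0)"
  by (simp add: smooth_pair_def bdd_meas_const)

lemma smooth_pair_lincomb:
  assumes "smooth_pair \<zeta> h" "smooth_pair \<zeta>' h'"
  shows "smooth_pair (\<lambda>a. \<zeta> a + t *\<^sub>R \<zeta>' a) (\<lambda>a. h a + t *\<^sub>R h' a)"
proof -
  have d: "((\<lambda>x. \<zeta> (shift x a) + t *\<^sub>R \<zeta>' (shift x a)) has_derivative (\<lambda>v. (h (shift x a) + t *\<^sub>R h' (shift x a)) \<bullet> v)) (at x)"
    if "a \<in> space M" for a x
  proof -
    have "((\<lambda>x. \<zeta> (shift x a)) has_derivative (\<lambda>v. h (shift x a) \<bullet> v)) (at x)"
      "((\<lambda>x. \<zeta>' (shift x a)) has_derivative (\<lambda>v. h' (shift x a) \<bullet> v)) (at x)"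
      using assms that by (auto simp: smooth_pair_def)
    from has_derivative_add[OF this(1) has_derivative_scaleR_right[OF this(2), of t]]
    show ?thesis by (simp add: inner_add_left)
  qed
  show ?thesis
    using assms d unfolding smooth_pair_def
    by (auto intro!: bdd_meas_add bdd_meas_scaleR continuous_intros simp del: real_scaleR_def)
qed

lemma smooth_pair_diff:
  assumes "smooth_pair \<zeta> h" "smooth_pair \<zeta>' h'"
  shows "smooth_pair (\<lambda>a. \<zeta> a - \<zeta>' a) (\<lambda>a. h a - h' a)"
  using smooth_pair_lincomb[OF assms, of "-1"] by simp

text \<open>The expectation of a difference quotient in a direction vanishes by invariance. The mean
  value theorem bounds the quotients uniformly, so dominated convergence leads to the
  derivative.\<close>

lemma smooth_pair_mean:
  assumes "smooth_pair \<zeta> h" shows "(LINT a|M. h a) = 0"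
proof -
  have z: "bdd_meas \<zeta>" and h: "bdd_meas h" using assms by (auto simp: smooth_pair_def)
  have [measurable]: "\<zeta> \<in> borel_measurable M" "h \<in> borel_measurable M" using z h by (auto simp: bdd_meas_def)
  obtain c where c: "c \<ge> 0" "\<And>a. a \<in> space M \<Longrightarrow> norm (h a) \<le> c" using bdd_measE[OF h] by blast
  have "(LINT a|M. h a \<bullet> v) = 0" for v
  proof -
    define s where "s n = 1 / (real n + 1)" for n
    have s: "s n > 0" for n by (simp add: s_def)
    have "s \<longlonglongrightarrow> 0" unfolding s_def using LIMSEQ_inverse_real_of_nat by (simp add: inverse_eq_divide add.commute)
    then have slim: "filterlim s (at 0) sequentially"
      by (rule filterlim_atI) (use s in \<open>auto intro!: always_eventually simp: less_imp_neq[symmetric]\<close>)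
    define q where "q n a = (\<zeta> (shift (s n *\<^sub>R v) a) - \<zeta> a) / s n" for n a
    have qm[measurable]: "q n \<in> borel_measurable M" for n
      unfolding q_def by measurable
    have der: "((\<lambda>x. \<zeta> (shift x a)) has_derivative (\<lambda>v. h (shift x a) \<bullet> v)) (at x)" if "a \<in> space M" for a x
      using assms that by (auto simp: smooth_pair_def)
    have "(\<lambda>n. LINT a|M. q n a) \<longlonglongrightarrow> (LINT a|M. h a \<bullet> v)"
    proof (rule integral_dominated_convergence[where w="\<lambda>a. c * norm v"])
      show "AE a in M. (\<lambda>n. q n a) \<longlonglongrightarrow> h a \<bullet> v"
      proof (rule AE_I2)
        fix a assume a: "a \<in> space M"
        have d0: "((\<lambda>x. \<zeta> (shift x a)) has_derivative (\<lambda>v. h a \<bullet> v)) (at (0 *\<^sub>R v))"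
          using der[OF a, of 0] by simp
        have "((\<lambda>t. \<zeta> (shift (t *\<^sub>R v) a)) has_derivative (\<lambda>t. h a \<bullet> (t *\<^sub>R v))) (at 0)"
          by (rule has_derivative_compose[where f="\<lambda>t. t *\<^sub>R v" and g="\<lambda>x. \<zeta> (shift x a)", OF _ d0])
             (auto intro!: derivative_eq_intros)
        then have "((\<lambda>t. \<zeta> (shift (t *\<^sub>R v) a)) has_real_derivative h a \<bullet> v) (at 0)"
          by (simp add: has_field_derivative_def mult.commute[of _ "_ \<bullet> _"])
        then have "((\<lambda>t. (\<zeta> (shift (t *\<^sub>R v) a) - \<zeta> a) / t) \<longlongrightarrow> h a \<bullet> v) (at 0)"
          by (simp add: DERIV_def)
        then show "(\<lambda>n. q n a) \<longlonglongrightarrow> h a \<bullet> v"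
          unfolding q_def by (rule filterlim_compose[OF _ slim])
      qed
      show "AE a in M. norm (q n a) \<le> c * norm v" for n
      proof (rule AE_I2)
        fix a assume a: "a \<in> space M"
        have "norm (\<zeta> (shift (s n *\<^sub>R v) a) - \<zeta> (shift 0 a)) \<le> c * norm (s n *\<^sub>R v - 0)"
        proof (rule differentiable_bound[of UNIV "\<lambda>x. \<zeta> (shift x a)" "\<lambda>x v. h (shift x a) \<bullet> v"])
          fix x
          show "onorm (\<lambda>v. h (shift x a) \<bullet> v) \<le> c"
          proof (rule onorm_le)
            fix w
            have "norm (h (shift x a) \<bullet> w) \<le> norm (h (shift x a)) * norm w" by (simp add: Cauchy_Schwarz_ineq2)
            also have "\<dots> \<le> c * norm w" by (intro mult_right_mono c shift_space a) simp
            finally show "norm (h (shift x a) \<bullet> w) \<le> c * norm w" .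
          qed
        qed (use der[OF a] in auto)
        then show "norm (q n a) \<le> c * norm v" using s[of n] by (simp add: q_def field_simps)
      qed
    qed auto
    moreover have "(LINT a|M. q n a) = 0" for n
    proof -
      have "(LINT a|M. q n a) = ((LINT a|M. \<zeta> (shift (s n *\<^sub>R v) a)) - (LINT a|M. \<zeta> a)) / s n"
        unfolding q_def using integrable_shift[OF bdd_meas_integrable[OF z]] bdd_meas_integrable[OF z] by simp
      then show ?thesis by (simp add: integral_shift)
    qed
    ultimately show ?thesis using LIMSEQ_unique[OF _ tendsto_const] by simp
  qed
  then have "(LINT a|M. h a) \<bullet> v = 0" for v
    using integral_inner_left[of v M h] bdd_meas_integrable[OF h] by simp
  then show ?thesis using inner_eq_zero_iff by blast
qed

text \<open>The discriminant criterion for a quadratic that may dip below zero by \<open>e\<close>.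
  Applied at a point within \<open>e\<close> of an infimum, it says that the derivative there is
  small.\<close>

lemma quadratic_small:
  fixes b q e :: real
  assumes "q \<ge> 0" and "\<And>t. 2 * t * b + t\<^sup>2 * q + e \<ge> 0"
  shows "b\<^sup>2 \<le> e * q"
proof (cases "q = 0")
  case True
  have "b = 0"
  proof (rule ccontr)
    assume b: "b \<noteq> 0"
    \<comment> \<open>This value of t makes the left-hand side equal to -1.\<close>
    have "2 * (- (e + 1) / (2 * b)) * b + e \<ge> 0" using assms(2)[of "- (e + 1) / (2 * b)"] True by simp
    then show False using b by (simp add: field_simps)
  qed
  then show ?thesis using True by simp
next
  case False
  then have "q > 0" using assms(1) by simp
  then show ?thesis using assms(2)[of "- b / q"] by (simp add: power2_eq_square field_simps)
qed

text \<open>The infimum need not be attained by bounded pairs. Being within \<open>e\<close> of it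
  gives an approximate Euler-Lagrange equation in every admissible direction.\<close>

lemma almost_minimiser:
  assumes "e > 0"
  obtains \<zeta> h where "smooth_pair \<zeta> h"
    "\<And>\<zeta>' k. smooth_pair \<zeta>' k \<Longrightarrow> (energy (\<lambda>a. h a + \<xi>) k)\<^sup>2 \<le> e * energy k k"
proof -
  define J where "J h = energy (\<lambda>a. h a + \<xi>) (\<lambda>a. h a + \<xi>)" for h
  define S where "S = {J h | \<zeta> h. smooth_pair \<zeta> h}"
  have bd: "bdd_meas (\<lambda>a. h a + \<xi>)" if "smooth_pair \<zeta> h" for \<zeta> h
    using that by (intro bdd_meas_add bdd_meas_const) (simp add: smooth_pair_def)
  have ne: "S \<noteq> {}" using smooth_pair_zero by (auto simp: S_def)
  have bb: "bdd_below S" unfolding S_def J_def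
    by (intro bdd_belowI[of _ 0]) (auto intro: energy_nonneg bd)
  have "Inf S < Inf S + e" using assms by simp
  then obtain x where "x \<in> S" "x < Inf S + e" using cInf_lessD[OF ne] by blast
  then obtain \<zeta> h where sp: "smooth_pair \<zeta> h" and x: "J h < Inf S + e" by (auto simp: S_def)
  show thesis
  proof (rule that[OF sp])
    fix \<zeta>' k assume k: "smooth_pair \<zeta>' k"
    have kb: "bdd_meas k" using k by (simp add: smooth_pair_def)
    show "(energy (\<lambda>a. h a + \<xi>) k)\<^sup>2 \<le> e * energy k k"
    proof (rule quadratic_small[OF energy_nonneg[OF kb]])
      fix t
      have sp': "smooth_pair (\<lambda>a. \<zeta> a + t *\<^sub>R \<zeta>' a) (\<lambda>a. h a + t *\<^sub>R k a)" by (rule smooth_pair_lincomb[OF sp k])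
      then have "Inf S \<le> J (\<lambda>a. h a + t *\<^sub>R k a)"
        by (intro cInf_lower bb) (auto simp: S_def)
      also have "J (\<lambda>a. h a + t *\<^sub>R k a) = J h + 2 * t * energy (\<lambda>a. h a + \<xi>) k + t\<^sup>2 * energy k k"
      proof -
        let ?u = "\<lambda>a. h a + \<xi>"
        let ?k = "\<lambda>a. t *\<^sub>R k a"
        have u: "bdd_meas ?u" and tk: "bdd_meas ?k" by (rule bd[OF sp], rule bdd_meas_scaleR[OF kb])
        have eq: "(\<lambda>a. h a + t *\<^sub>R k a + \<xi>) = (\<lambda>a. ?u a + ?k a)" by (simp add: add_ac)
        have "J (\<lambda>a. h a + t *\<^sub>R k a) = energy ?u (\<lambda>a. ?u a + ?k a) + energy ?k (\<lambda>a. ?u a + ?k a)"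
          unfolding J_def eq by (rule energy_add_left[OF u tk bdd_meas_add[OF u tk]])
        also have "energy ?u (\<lambda>a. ?u a + ?k a) = energy ?u ?u + energy ?k ?u"
          by (subst energy_sym) (rule energy_add_left[OF u tk u])
        also have "energy ?k (\<lambda>a. ?u a + ?k a) = energy ?u ?k + energy ?k ?k"
          by (subst energy_sym) (rule energy_add_left[OF u tk tk])
        also have "energy ?k ?u = t * energy ?u k" by (simp add: energy_scale_left energy_sym[of k])
        also have "energy ?u ?k = t * energy ?u k" by (subst energy_sym) (simp add: energy_scale_left energy_sym[of k])
        also have "energy ?k ?k = t\<^sup>2 * energy k k"
          by (simp add: energy_scale_left energy_sym[of k ?k] power2_eq_square)
        finally show ?thesis by (simp add: J_def)
      qed
      finally show "2 * t * energy (\<lambda>a. h a + \<xi>) k + t\<^sup>2 * energy k k + e \<ge> 0" using x by linarith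
    qed
  qed
qed

text \<open>Testing two consecutive approximate equations with the increment bounds its energy by a
  multiple of (1/16)^n. The tolerances are chosen so small that the weights 2^n, required for
  pointwise convergence, still leave a geometric series.\<close>

lemma minimising_sequence:
  obtains \<zeta> h where "\<And>n::nat. smooth_pair (\<zeta> n) (h n)"
    "\<And>n \<zeta>' k. smooth_pair \<zeta>' k \<Longrightarrow> \<bar>energy (\<lambda>a. h n a + \<xi>) k\<bar> \<le> (1/4) ^ n * sqrt (energy k k)"
    "(\<Sum>n. 2 ^ n * (\<integral>\<^sup>+a. ennreal ((norm (h (Suc n) a - h n a))\<^sup>2) \<partial>M)) < \<infinity>"
proof -
  have "\<forall>n. \<exists>p. smooth_pair (fst p) (snd p) \<and>
    (\<forall>\<zeta>' k. smooth_pair \<zeta>' k \<longrightarrow> (energy (\<lambda>a. snd p a + \<xi>) k)\<^sup>2 \<le> ((1/4) ^ n)\<^sup>2 * energy k k)"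
  proof
    fix n :: nat
    \<comment> \<open>The tolerance is squared because it enters the approximate equation through a
      square root.\<close>
    have "((1/4 :: real) ^ n)\<^sup>2 > 0" by simp
    then obtain z h where "smooth_pair z h"
      "\<And>\<zeta>' k. smooth_pair \<zeta>' k \<Longrightarrow> (energy (\<lambda>a. h a + \<xi>) k)\<^sup>2 \<le> ((1/4) ^ n)\<^sup>2 * energy k k"
      using almost_minimiser[of "((1/4 :: real) ^ n)\<^sup>2" \<xi>] by metis
    then show "\<exists>p. smooth_pair (fst p) (snd p) \<and>
      (\<forall>\<zeta>' k. smooth_pair \<zeta>' k \<longrightarrow> (energy (\<lambda>a. snd p a + \<xi>) k)\<^sup>2 \<le> ((1/4) ^ n)\<^sup>2 * energy k k)"
      by (intro exI[of _ "(z, h)"]) simp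
  qed
  then obtain p where p: "\<And>n. smooth_pair (fst (p n)) (snd (p n))"
    "\<And>n \<zeta>' k. smooth_pair \<zeta>' k \<Longrightarrow> (energy (\<lambda>a. snd (p n) a + \<xi>) k)\<^sup>2 \<le> ((1/4) ^ n)\<^sup>2 * energy k k"
    by metis
  define h where "h n = snd (p n)" for n
  have hb: "bdd_meas (h n)" for n using p(1)[of n] by (simp add: smooth_pair_def h_def)
  have E: "\<bar>energy (\<lambda>a. h n a + \<xi>) k\<bar> \<le> (1/4) ^ n * sqrt (energy k k)" if "smooth_pair \<zeta>' k" for n \<zeta>' k
  proof -
    have "\<bar>energy (\<lambda>a. h n a + \<xi>) k\<bar> \<le> sqrt (((1/4) ^ n)\<^sup>2 * energy k k)"
      using p(2)[OF that, of n] by (intro real_le_rsqrt) (simp add: h_def)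
    then show ?thesis by (simp add: real_sqrt_mult)
  qed
  have cau: "(\<integral>\<^sup>+a. ennreal ((norm (h (Suc n) a - h n a))\<^sup>2) \<partial>M) \<le> ennreal (4 / lam * (1/16) ^ n)" for n
  proof -
    define k where "k = (\<lambda>a. h (Suc n) a - h n a)"
    have ks: "smooth_pair (\<lambda>a. fst (p (Suc n)) a - fst (p n) a) k"
      unfolding k_def h_def by (rule smooth_pair_diff[OF p(1) p(1)])
    have kb: "bdd_meas k" using ks by (simp add: smooth_pair_def)
    define q where "q = energy k k"
    have q0: "q \<ge> 0" unfolding q_def by (rule energy_nonneg[OF kb])
    have "k = (\<lambda>a. (h (Suc n) a + \<xi>) - (h n a + \<xi>))" by (simp add: k_def)
    then have "q = energy (\<lambda>a. (h (Suc n) a + \<xi>) - (h n a + \<xi>)) k" by (simp add: q_def)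
    also have "\<dots> = energy (\<lambda>a. h (Suc n) a + \<xi>) k - energy (\<lambda>a. h n a + \<xi>) k"
      by (intro energy_diff_left bdd_meas_add bdd_meas_const hb kb)
    also have "\<dots> \<le> (1/4) ^ Suc n * sqrt q + (1/4) ^ n * sqrt q"
    proof -
      have "x - y \<le> b + c" if "\<bar>x\<bar> \<le> b" "\<bar>y\<bar> \<le> c" for x y b c :: real using that by linarith
      from this[OF E[OF ks, of "Suc n"] E[OF ks, of n]] show ?thesis by (simp only: q_def)
    qed
    also have "\<dots> \<le> 2 * (1/4) ^ n * sqrt q"
      using q0 by (simp add: field_simps)
    finally have "sqrt q * sqrt q \<le> (2 * (1/4) ^ n) * sqrt q" using q0 by simp
    then have "sqrt q \<le> 2 * (1/4) ^ n"
    proof (cases "q = 0")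
      case False
      then have "sqrt q > 0" using q0 by simp
      with \<open>sqrt q * sqrt q \<le> (2 * (1/4) ^ n) * sqrt q\<close> show ?thesis by (rule mult_right_le_imp_le)
    qed simp
    then have "(sqrt q)\<^sup>2 \<le> (2 * (1/4) ^ n)\<^sup>2" using q0 by (intro power_mono) auto
    then have "q \<le> 4 * (1/16) ^ n"
      using q0 by (simp add: power_mult_distrib power2_eq_square power_mult_distrib[symmetric])
    moreover have "lam * (LINT a|M. (norm (k a))\<^sup>2) \<le> q" unfolding q_def by (rule energy_lower[OF kb])
    ultimately have "lam * (LINT a|M. (norm (k a))\<^sup>2) \<le> lam * (4 / lam * (1/16) ^ n)"
      using lam_pos by simp
    then have "(LINT a|M. (norm (k a))\<^sup>2) \<le> 4 / lam * (1/16) ^ n"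
      using lam_pos by (rule mult_left_le_imp_le)
    then have "ennreal (LINT a|M. (norm (k a))\<^sup>2) \<le> ennreal (4 / lam * (1/16) ^ n)" by (rule ennreal_leI)
    then show ?thesis
      by (subst nn_integral_eq_integral[OF bdd_meas_norm_sq[OF kb, unfolded k_def]]) (auto simp: k_def)
  qed
  have "(\<Sum>n. 2 ^ n * (\<integral>\<^sup>+a. ennreal ((norm (h (Suc n) a - h n a))\<^sup>2) \<partial>M)) \<le> (\<Sum>n. ennreal (4 / lam * (1/8) ^ n))"
  proof (rule suminf_le)
    fix n
    have "2 ^ n * (\<integral>\<^sup>+a. ennreal ((norm (h (Suc n) a - h n a))\<^sup>2) \<partial>M) \<le> 2 ^ n * ennreal (4 / lam * (1/16) ^ n)"
      by (intro mult_left_mono cau) simp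
    also have "2 ^ n * ennreal (4 / lam * (1/16) ^ n) = ennreal (2 ^ n * (4 / lam * (1/16) ^ n))"
      using lam_pos by (subst ennreal_mult) (auto simp: ennreal_power[symmetric])
    also have "2 ^ n * (4 / lam * (1/16) ^ n) = 4 / lam * (1/8 :: real) ^ n"
      by (simp add: power_mult_distrib[symmetric] mult.left_commute)
    finally show "2 ^ n * (\<integral>\<^sup>+a. ennreal ((norm (h (Suc n) a - h n a))\<^sup>2) \<partial>M) \<le> ennreal (4 / lam * (1/8) ^ n)" .
  qed auto
  also have "\<dots> = ennreal (\<Sum>n. 4 / lam * (1/8) ^ n)"
    using lam_pos by (intro suminf_ennreal2 summable_mult summable_geometric) auto
  finally have fin: "(\<Sum>n. 2 ^ n * (\<integral>\<^sup>+a. ennreal ((norm (h (Suc n) a - h n a))\<^sup>2) \<partial>M)) < \<infinity>"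
    by (rule le_less_trans) simp
  show thesis
    by (rule that[of "\<lambda>n. fst (p n)" h]) (use p(1) E fin in \<open>auto simp: h_def\<close>)
qed

end

subsection \<open>Limits in the local mean square\<close>

lemma L2_weak_limit_inner:
  fixes f :: "nat \<Rightarrow> 'a \<Rightarrow> 'b::euclidean_space"
  assumes [measurable]: "\<And>n. f n \<in> borel_measurable N" "g \<in> borel_measurable N" "\<theta> \<in> borel_measurable N"
    and T: "(\<integral>\<^sup>+x. ennreal ((norm (\<theta> x))\<^sup>2) \<partial>N) < \<infinity>"
    and int: "\<And>n. integrable N (\<lambda>x. \<theta> x \<bullet> f n x)" "integrable N (\<lambda>x. \<theta> x \<bullet> g x)"
    and lim: "(\<lambda>n. \<integral>\<^sup>+x. ennreal ((norm (f n x - g x))\<^sup>2) \<partial>N) \<longlonglongrightarrow> 0"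
  shows "(\<lambda>n. LINT x|N. \<theta> x \<bullet> f n x) \<longlonglongrightarrow> (LINT x|N. \<theta> x \<bullet> g x)"
proof (rule tendsto_L1_int[OF int])
  have le: "(\<integral>\<^sup>+x. norm (\<theta> x \<bullet> f n x - \<theta> x \<bullet> g x) \<partial>N) \<le> (\<integral>\<^sup>+x. ennreal (norm (norm (\<theta> x) *\<^sub>R (f n x - g x))) \<partial>N)" for n
    by (intro nn_integral_mono ennreal_leI) (simp add: inner_diff_right[symmetric] Cauchy_Schwarz_ineq2)
  have "(\<lambda>n. \<integral>\<^sup>+x. ennreal (norm (norm (\<theta> x) *\<^sub>R (f n x - g x))) \<partial>N) \<longlonglongrightarrow> 0"
    by (rule tendsto_zero_scaled_bound[OF nn_integral_mult_le_scaled T lim]; measurable)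
  then show "(\<lambda>n. \<integral>\<^sup>+x. norm (\<theta> x \<bullet> f n x - \<theta> x \<bullet> g x) \<partial>N) \<longlonglongrightarrow> 0"
    by (rule tendsto_sandwich[OF _ _ tendsto_const, rotated 2]) (use le in auto)
qed

lemma integrable_inner_square:
  fixes f :: "'a \<Rightarrow> 'b::euclidean_space"
  assumes [measurable]: "f \<in> borel_measurable N" "\<theta> \<in> borel_measurable N"
    and "(\<integral>\<^sup>+x. ennreal ((norm (\<theta> x))\<^sup>2) \<partial>N) < \<infinity>" "(\<integral>\<^sup>+x. ennreal ((norm (f x))\<^sup>2) \<partial>N) < \<infinity>"
  shows "integrable N (\<lambda>x. \<theta> x \<bullet> f x)"
proof (rule Bochner_Integration.integrable_bound)
  show "integrable N (\<lambda>x. norm (\<theta> x) *\<^sub>R f x)" using assms(3,4) by (intro integrable_mult_square) auto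
  show "AE x in N. norm (\<theta> x \<bullet> f x) \<le> norm (norm (\<theta> x) *\<^sub>R f x)" by (simp add: Cauchy_Schwarz_ineq2)
qed measurable

lemma lim_indicator_scaleR:
  fixes F :: "nat \<Rightarrow> 'b::real_normed_vector"
  shows "lim (\<lambda>n. indicator Q x *\<^sub>R F n) = indicator Q x *\<^sub>R lim F"
  by (cases "x \<in> Q") (simp_all add: lim_const)

lemma nn_integral_indicator_norm_sq:
  "(\<integral>\<^sup>+x. ennreal ((norm (indicator Q x *\<^sub>R f x))\<^sup>2) \<partial>N) = (\<integral>\<^sup>+x\<in>Q. ennreal ((norm (f x))\<^sup>2) \<partial>N)"
  by (intro nn_integral_cong) (auto simp: indicator_def)

text \<open>The pointwise \<open>lim\<close> on the whole space restricts to the right limit on each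
  cube, so the limits on different cubes are consistent without passing to a diagonal
  sequence.\<close>

lemma cube_fast_limit:
  fixes F :: "nat \<Rightarrow> real ^ 'n \<Rightarrow> 'b::euclidean_space"
  assumes Fm[measurable]: "\<And>n. F n \<in> borel_measurable lebesgue"
    and fin: "\<And>k::nat. k > 0 \<Longrightarrow> (\<Sum>n. 2 ^ n * (\<integral>\<^sup>+x\<in>cube 0 (real k). ennreal ((norm (F (Suc n) x - F n x))\<^sup>2) \<partial>lebesgue)) < \<infinity>"
  shows "AE x in lebesgue. (\<lambda>n. F n x) \<longlonglongrightarrow> lim (\<lambda>n. F n x)"
    and "\<And>k::nat. k > 0 \<Longrightarrow> (\<lambda>n. \<integral>\<^sup>+x\<in>cube 0 (real k). ennreal ((norm (F n x - lim (\<lambda>n. F n x)))\<^sup>2) \<partial>lebesgue) \<longlonglongrightarrow> 0"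
proof -
  have *: "(AE x in lebesgue. x \<in> cube 0 (real k) \<longrightarrow> (\<lambda>n. F n x) \<longlonglongrightarrow> lim (\<lambda>n. F n x)) \<and>
    (\<lambda>n. \<integral>\<^sup>+x\<in>cube 0 (real k). ennreal ((norm (F n x - lim (\<lambda>n. F n x)))\<^sup>2) \<partial>lebesgue) \<longlonglongrightarrow> 0" if k: "k > 0" for k :: nat
  proof -
    let ?Q = "cube (0 :: real ^ 'n) (real k)"
    have Q[measurable]: "?Q \<in> sets lebesgue" using k by simp
    define f where "f n x = indicator ?Q x *\<^sub>R F n x" for n x
    have fm: "f n \<in> borel_measurable lebesgue" for n unfolding f_def by measurable
    have eq: "(\<integral>\<^sup>+x. ennreal ((norm (f (Suc n) x - f n x))\<^sup>2) \<partial>lebesgue) = (\<integral>\<^sup>+x\<in>?Q. ennreal ((norm (F (Suc n) x - F n x))\<^sup>2) \<partial>lebesgue)" for n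
      unfolding f_def scaleR_right_diff_distrib[symmetric] by (rule nn_integral_indicator_norm_sq)
    have l: "lim (\<lambda>n. f n x) = indicator ?Q x *\<^sub>R lim (\<lambda>n. F n x)" for x
      unfolding f_def by (rule lim_indicator_scaleR)
    have fin': "(\<Sum>n. 2 ^ n * (\<integral>\<^sup>+x. ennreal ((norm (f (Suc n) x - f n x))\<^sup>2) \<partial>lebesgue)) < \<infinity>"
      unfolding eq by (rule fin[OF k])
    have "(\<integral>\<^sup>+x. ennreal ((norm (f n x - lim (\<lambda>n. f n x)))\<^sup>2) \<partial>lebesgue) = (\<integral>\<^sup>+x\<in>?Q. ennreal ((norm (F n x - lim (\<lambda>n. F n x)))\<^sup>2) \<partial>lebesgue)" for n
      unfolding l unfolding f_def scaleR_right_diff_distrib[symmetric] by (rule nn_integral_indicator_norm_sq)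
    then have 2: "(\<lambda>n. \<integral>\<^sup>+x\<in>?Q. ennreal ((norm (F n x - lim (\<lambda>n. F n x)))\<^sup>2) \<partial>lebesgue) \<longlonglongrightarrow> 0"
      using L2_fast_limit(2)[OF fm fin'] by simp
    have "AE x in lebesgue. (\<lambda>n. f n x) \<longlonglongrightarrow> lim (\<lambda>n. f n x)" by (rule L2_fast_limit(1)[OF fm fin'])
    then have 1: "AE x in lebesgue. x \<in> ?Q \<longrightarrow> (\<lambda>n. F n x) \<longlonglongrightarrow> lim (\<lambda>n. F n x)"
      unfolding l
    proof eventually_elim
      case (elim x)
      then show ?case by (cases "x \<in> ?Q") (auto simp: f_def)
    qed
    show ?thesis using 1 2 by blast
  qed
  then have "AE x in lebesgue. \<forall>k::nat. k > 0 \<longrightarrow> x \<in> cube 0 (real k) \<longrightarrow> (\<lambda>n. F n x) \<longlonglongrightarrow> lim (\<lambda>n. F n x)"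
    unfolding AE_all_countable by auto
  then show "AE x in lebesgue. (\<lambda>n. F n x) \<longlonglongrightarrow> lim (\<lambda>n. F n x)"
  proof eventually_elim
    case (elim x)
    obtain k :: nat where "k > 0" "{x} \<subseteq> cube 0 (real k)" by (rule bounded_subset_cube[of "{x}"]) auto
    then show ?case using elim by auto
  qed
  show "(\<lambda>n. \<integral>\<^sup>+x\<in>cube 0 (real k). ennreal ((norm (F n x - lim (\<lambda>n. F n x)))\<^sup>2) \<partial>lebesgue) \<longlonglongrightarrow> 0" if "k > 0" for k :: nat
    using *[OF that] by blast
qed

lemma set_nn_integral_norm_sq_triangle:
  fixes f g :: "'a \<Rightarrow> 'b::{second_countable_topology,real_inner}"
  assumes [measurable]: "f \<in> borel_measurable N" "g \<in> borel_measurable N" "Q \<in> sets N"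
  shows "(\<integral>\<^sup>+x\<in>Q. ennreal ((norm (f x + g x))\<^sup>2) \<partial>N)
     \<le> 2 * (\<integral>\<^sup>+x\<in>Q. ennreal ((norm (f x))\<^sup>2) \<partial>N) + 2 * (\<integral>\<^sup>+x\<in>Q. ennreal ((norm (g x))\<^sup>2) \<partial>N)"
  using nn_integral_norm_sq_triangle[of "\<lambda>x. indicator Q x *\<^sub>R f x" N "\<lambda>x. indicator Q x *\<^sub>R g x"]
  unfolding scaleR_right_distrib[symmetric] nn_integral_indicator_norm_sq by simp

lemma L2_loc_limit:
  fixes F :: "nat \<Rightarrow> real ^ 'n \<Rightarrow> 'b::euclidean_space"
  assumes F: "\<And>n. L2_loc (F n)" and G[measurable]: "G \<in> borel_measurable lebesgue"
    and lim: "\<And>k::nat. k > 0 \<Longrightarrow> (\<lambda>n. \<integral>\<^sup>+x\<in>cube 0 (real k). ennreal ((norm (F n x - G x))\<^sup>2) \<partial>lebesgue) \<longlonglongrightarrow> 0"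
  shows "L2_loc G"
proof (rule L2_locI[OF G])
  fix k :: nat assume k: "k > 0"
  let ?Q = "cube (0 :: real ^ 'n) (real k)"
  have Q[measurable]: "?Q \<in> sets lebesgue" using k by simp
  have Fm[measurable]: "F n \<in> borel_measurable lebesgue" for n using F by (simp add: L2_loc_def)
  have "eventually (\<lambda>n. (\<integral>\<^sup>+x\<in>?Q. ennreal ((norm (F n x - G x))\<^sup>2) \<partial>lebesgue) < 1) sequentially"
    by (rule order_tendstoD(2)[OF lim[OF k]]) simp
  then obtain n where n: "(\<integral>\<^sup>+x\<in>?Q. ennreal ((norm (F n x - G x))\<^sup>2) \<partial>lebesgue) < 1" by (auto simp: eventually_sequentially)
  have "(\<integral>\<^sup>+x\<in>?Q. ennreal ((norm ((G x - F n x) + F n x))\<^sup>2) \<partial>lebesgue)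
    \<le> 2 * (\<integral>\<^sup>+x\<in>?Q. ennreal ((norm (G x - F n x))\<^sup>2) \<partial>lebesgue) + 2 * (\<integral>\<^sup>+x\<in>?Q. ennreal ((norm (F n x))\<^sup>2) \<partial>lebesgue)"
    by (rule set_nn_integral_norm_sq_triangle) measurable
  also have "\<dots> < \<infinity>"
  proof -
    have "(\<integral>\<^sup>+x\<in>?Q. ennreal ((norm (G x - F n x))\<^sup>2) \<partial>lebesgue) < \<infinity>"
      using n by (simp add: norm_minus_commute) (meson ennreal_one_less_top order_less_trans)
    moreover have "(\<integral>\<^sup>+x\<in>?Q. ennreal ((norm (F n x))\<^sup>2) \<partial>lebesgue) < \<infinity>"
      using k by (intro L2_loc_nn_integral[OF F] bounded_cube) auto
    ultimately show ?thesis by (simp add: ennreal_mult_less_top)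
  qed
  finally show "(\<integral>\<^sup>+x\<in>?Q. ennreal ((norm (G x))\<^sup>2) \<partial>lebesgue) < \<infinity>" by simp
qed

lemma L2_loc_weak_limit:
  fixes F :: "nat \<Rightarrow> real ^ 'n \<Rightarrow> 'b::euclidean_space"
  assumes F: "\<And>n. L2_loc (F n)" and G: "L2_loc G"
    and lim: "(\<lambda>n. \<integral>\<^sup>+x\<in>cube 0 (real k). ennreal ((norm (F n x - G x))\<^sup>2) \<partial>lebesgue) \<longlonglongrightarrow> 0"
    and \<theta>: "\<theta> \<in> borel_measurable lebesgue" "(\<integral>\<^sup>+x. ennreal ((\<theta> x :: real)\<^sup>2) \<partial>lebesgue) < \<infinity>"
    and k: "k > 0" and supp: "\<And>x. x \<notin> cube 0 (real k) \<Longrightarrow> \<theta> x = 0"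
  shows "(\<lambda>n. LINT x|lebesgue. \<theta> x *\<^sub>R F n x) \<longlonglongrightarrow> (LINT x|lebesgue. \<theta> x *\<^sub>R G x)"
proof -
  let ?Q = "cube (0 :: real ^ 'n) (real k)"
  have Q[measurable]: "?Q \<in> sets lebesgue" using k by simp
  have Fm[measurable]: "F n \<in> borel_measurable lebesgue" for n using F by (simp add: L2_loc_def)
  have Gm[measurable]: "G \<in> borel_measurable lebesgue" using G by (simp add: L2_loc_def)
  have eq: "\<theta> x *\<^sub>R f x = \<theta> x *\<^sub>R (indicator ?Q x *\<^sub>R f x)" for f :: "real ^ 'n \<Rightarrow> 'b" and x
    using supp[of x] by (cases "x \<in> ?Q") auto
  have fin: "(\<integral>\<^sup>+x. ennreal ((norm (indicator ?Q x *\<^sub>R f x))\<^sup>2) \<partial>lebesgue) < \<infinity>" if "L2_loc f" for f :: "real ^ 'n \<Rightarrow> 'b"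
    unfolding nn_integral_indicator_norm_sq using k by (intro L2_loc_nn_integral[OF that] bounded_cube) auto
  have "(\<lambda>n. LINT x|lebesgue. \<theta> x *\<^sub>R (indicator ?Q x *\<^sub>R F n x)) \<longlonglongrightarrow> (LINT x|lebesgue. \<theta> x *\<^sub>R (indicator ?Q x *\<^sub>R G x))"
  proof (rule L2_weak_limit[OF _ _ \<theta>])
    show "integrable lebesgue (\<lambda>x. \<theta> x *\<^sub>R (indicator ?Q x *\<^sub>R F n x))" for n
      by (intro integrable_mult_square \<theta> fin F) measurable
    show "integrable lebesgue (\<lambda>x. \<theta> x *\<^sub>R (indicator ?Q x *\<^sub>R G x))"
      by (intro integrable_mult_square \<theta> fin G) measurable
    show "(\<lambda>n. \<integral>\<^sup>+x. ennreal ((norm (indicator ?Q x *\<^sub>R F n x - indicator ?Q x *\<^sub>R G x))\<^sup>2) \<partial>lebesgue) \<longlonglongrightarrow> 0"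
      unfolding scaleR_right_diff_distrib[symmetric] nn_integral_indicator_norm_sq by (rule lim)
  qed measurable
  then show ?thesis by (simp only: eq[symmetric])
qed

lemma L2_loc_continuous:
  fixes f :: "real ^ 'n \<Rightarrow> 'b::euclidean_space"
  assumes "continuous_on UNIV f" shows "L2_loc f"
proof -
  have "L1_loc (\<lambda>x. (norm (f x))\<^sup>2)" using assms by (intro L1_loc_continuous continuous_intros)
  then show ?thesis unfolding L2_loc_def L1_loc_def
    using continuous_on_imp_lebesgue_measurable[OF assms] by blast
qed

text \<open>Integration by parts holds for the C^1 approximants, and both pairings are continuous in
  the local mean square; weak gradients are thus closed under such limits.\<close>

lemma has_weak_gradient_limit:
  fixes F :: "nat \<Rightarrow> real ^ 'n \<Rightarrow> real" and G :: "nat \<Rightarrow> real ^ 'n \<Rightarrow> real ^ 'n"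
  assumes G: "\<And>n. continuous_on UNIV (G n)" and d: "\<And>n x. (F n has_derivative (\<lambda>v. G n x \<bullet> v)) (at x)"
    and u: "L2_loc u" "L2_loc g"
    and limF: "\<And>k::nat. k > 0 \<Longrightarrow> (\<lambda>n. \<integral>\<^sup>+x\<in>cube 0 (real k). ennreal ((norm (F n x - u x))\<^sup>2) \<partial>lebesgue) \<longlonglongrightarrow> 0"
    and limG: "\<And>k::nat. k > 0 \<Longrightarrow> (\<lambda>n. \<integral>\<^sup>+x\<in>cube 0 (real k). ennreal ((norm (G n x - g x))\<^sup>2) \<partial>lebesgue) \<longlonglongrightarrow> 0"
  shows "has_weak_gradient u g"
  unfolding has_weak_gradient_def
proof (intro conjI allI impI)
  show "L1_loc u" "L1_loc g" by (intro L2_loc_imp_L1_loc u)+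
  fix \<eta> :: "real ^ 'n \<Rightarrow> real" and i assume \<eta>: "test_function \<eta>"
  have c: "C1c \<eta> (gradient \<eta>)" by (rule test_function_C1c[OF \<eta>])
  have F: "continuous_on UNIV (F n)" for n
    using d by (meson continuous_at_imp_continuous_on has_derivative_continuous)
  obtain r1 where r1: "\<And>x. norm x \<ge> r1 \<Longrightarrow> \<eta> x = 0" using Cc_support[OF C1cD(1)[OF c]] by blast
  obtain r2 where r2: "\<And>x. norm x \<ge> r2 \<Longrightarrow> gradient \<eta> x = 0" using Cc_support[OF C1cD(2)[OF c]] by blast
  obtain k :: nat where k: "k > 0" "cball 0 (max r1 r2) \<subseteq> cube (0 :: real ^ 'n) (real k)"
    by (rule bounded_subset_cube[OF bounded_cball])
  have out: "\<eta> x = 0" "gradient \<eta> x = 0" if "x \<notin> cube 0 (real k)" for x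
  proof -
    have "norm x > max r1 r2" using that k(2) by (auto simp: subset_iff not_le[symmetric])
    then show "\<eta> x = 0" "gradient \<eta> x = 0" using r1 r2 by auto
  qed
  have Cp: "Cc (partial_deriv i \<eta>)" using Cc_nth[OF C1cD(2)[OF c], of i] by (simp add: gradient_def)
  have eq: "(LINT x|lebesgue. partial_deriv i \<eta> x *\<^sub>R F n x) = - (LINT x|lebesgue. \<eta> x *\<^sub>R G n x) $ i" for n
  proof -
    have i: "integrable lebesgue (\<lambda>x. F n x *\<^sub>R gradient \<eta> x)"
      by (intro Cc_integrable Cc_mult_continuous C1cD(2)[OF c] F)
    have "(LINT x|lebesgue. partial_deriv i \<eta> x *\<^sub>R F n x) = (LINT x|lebesgue. (F n x *\<^sub>R gradient \<eta> x) $ i)"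
      by (intro Bochner_Integration.integral_cong) (auto simp: gradient_def)
    also have "\<dots> = (LINT x|lebesgue. F n x *\<^sub>R gradient \<eta> x) $ i"
      by (rule integral_bounded_linear[OF bounded_linear_vec_nth i])
    also have "(LINT x|lebesgue. F n x *\<^sub>R gradient \<eta> x) = - (LINT x|lebesgue. \<eta> x *\<^sub>R G n x)"
      by (rule integration_by_parts[OF c F G d])
    finally show ?thesis by simp
  qed
  have "(\<lambda>n. LINT x|lebesgue. partial_deriv i \<eta> x *\<^sub>R F n x) \<longlonglongrightarrow> (LINT x|lebesgue. partial_deriv i \<eta> x *\<^sub>R u x)"
    by (rule L2_loc_weak_limit[OF L2_loc_continuous[OF F] u(1) limF[OF k(1)] Cc_lebesgue_measurable[OF Cp] Cc_L2[OF Cp] k(1)])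
       (use out(2) in \<open>simp add: gradient_def vec_eq_iff\<close>)
  moreover have "(\<lambda>n. - (LINT x|lebesgue. \<eta> x *\<^sub>R G n x) $ i) \<longlonglongrightarrow> - (LINT x|lebesgue. \<eta> x *\<^sub>R g x) $ i"
    by (intro tendsto_minus tendsto_vec_nth L2_loc_weak_limit[OF L2_loc_continuous[OF G] u(2) limG[OF k(1)] Cc_lebesgue_measurable[OF C1cD(1)[OF c]] Cc_L2[OF C1cD(1)[OF c]] k(1)] out)
  ultimately have "(LINT x|lebesgue. partial_deriv i \<eta> x *\<^sub>R u x) = - (LINT x|lebesgue. \<eta> x *\<^sub>R g x) $ i"
    unfolding eq by (rule LIMSEQ_unique)
  also have "(LINT x|lebesgue. \<eta> x *\<^sub>R g x) $ i = (LINT x|lebesgue. g x $ i * \<eta> x)"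
  proof -
    obtain B where B: "\<And>x. norm (\<eta> x) \<le> B" using Cc_bounded[OF C1cD(1)[OF c]] by blast
    have gm: "g \<in> borel_measurable lebesgue" using u(2) by (simp add: L2_loc_def)
    have "integrable lebesgue (\<lambda>x. \<eta> x *\<^sub>R (indicator (cube 0 (real k)) x *\<^sub>R g x))"
    proof (rule integrable_mult_square)
      show "(\<lambda>x. indicator (cube 0 (real k)) x *\<^sub>R g x) \<in> borel_measurable lebesgue"
        using k gm by (intro borel_measurable_scaleR borel_measurable_indicator) auto
      show "(\<integral>\<^sup>+x. ennreal ((norm (indicator (cube 0 (real k)) x *\<^sub>R g x))\<^sup>2) \<partial>lebesgue) < \<infinity>"
        unfolding nn_integral_indicator_norm_sq using k by (intro L2_loc_nn_integral[OF u(2)] bounded_cube) auto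
    qed (intro Cc_lebesgue_measurable Cc_L2 C1cD(1)[OF c])+
    moreover have "\<eta> x *\<^sub>R (indicator (cube 0 (real k)) x *\<^sub>R g x) = \<eta> x *\<^sub>R g x" for x
      using out(1)[of x] by (cases "x \<in> cube 0 (real k)") auto
    ultimately have "integrable lebesgue (\<lambda>x. \<eta> x *\<^sub>R g x)" by (simp only:)
    from integral_bounded_linear[OF bounded_linear_vec_nth this, of i] show ?thesis by (simp add: mult.commute)
  qed
  finally show "(LINT x|lebesgue. u x * partial_deriv i \<eta> x) = - (LINT x|lebesgue. g x $ i * \<eta> x)"
    by (simp add: mult.commute)
qed

text \<open>Jensen's inequality on the unit cube, whose volume is 1. It lets the double integral in
  Poincare's inequality control a function with its mean over the unit cube removed.\<close>

lemma square_minus_mean_le: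
  fixes w :: "real ^ 'n \<Rightarrow> real"
  assumes "continuous_on UNIV w"
  shows "ennreal ((w x - (LINT y:unit_cube|lebesgue. w y))\<^sup>2) \<le> (\<integral>\<^sup>+y\<in>unit_cube. ennreal ((w x - w y)\<^sup>2) \<partial>lebesgue)"
proof -
  let ?Q = "unit_cube :: (real ^ 'n) set"
  have b: "bounded ?Q" unfolding unit_cube_eq by (rule bounded_cube) simp
  define v where "v y = w x - w y" for y
  have vc: "continuous_on UNIV v" unfolding v_def by (intro continuous_intros assms)
  have i0: "set_integrable lebesgue ?Q (\<lambda>y. 1 :: real)" and iv: "set_integrable lebesgue ?Q v"
    and iv2: "set_integrable lebesgue ?Q (\<lambda>y. (v y)\<^sup>2)" and iw: "set_integrable lebesgue ?Q w"
    by (intro L2_loc_set_integrable L2_loc_continuous continuous_intros vc assms b unit_cube_sets)+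
  define m where "m = (LINT y:?Q|lebesgue. v y)"
  have one: "(LINT y:?Q|lebesgue. 1 :: real) = 1"
    using measure_cube[of 1 "0 :: real ^ 'n"] by (simp add: set_lebesgue_integral_def unit_cube_eq)
  have wx: "(LINT y:?Q|lebesgue. w x) = w x"
    using measure_cube[of 1 "0 :: real ^ 'n"] by (simp add: set_lebesgue_integral_def unit_cube_eq)
  have "m = (LINT y:?Q|lebesgue. w x) - (LINT y:?Q|lebesgue. w y)"
    unfolding m_def v_def by (intro set_integral_diff(2) iw L2_loc_set_integrable L2_loc_continuous continuous_intros b unit_cube_sets)
  then have m: "m = w x - (LINT y:?Q|lebesgue. w y)" by (simp add: wx)
  have "0 \<le> (LINT y|lebesgue. indicator ?Q y *\<^sub>R (v y - m)\<^sup>2)" by (intro integral_nonneg_AE AE_I2) auto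
  also have "\<dots> = (LINT y|lebesgue. indicator ?Q y *\<^sub>R (v y)\<^sup>2 - 2 * m * (indicator ?Q y *\<^sub>R v y) + m\<^sup>2 * (indicator ?Q y *\<^sub>R 1))"
    by (intro Bochner_Integration.integral_cong) (auto simp: power2_diff algebra_simps)
  also have "\<dots> = (LINT y:?Q|lebesgue. (v y)\<^sup>2) - 2 * m * m + m\<^sup>2 * 1"
    using iv iv2 i0 one unfolding m_def set_lebesgue_integral_def set_integrable_def by simp
  finally have "m\<^sup>2 \<le> (LINT y:?Q|lebesgue. (v y)\<^sup>2)" by (simp add: power2_eq_square)
  then have "ennreal (m\<^sup>2) \<le> ennreal (LINT y|lebesgue. indicator ?Q y *\<^sub>R (v y)\<^sup>2)"
    unfolding set_lebesgue_integral_def by (rule ennreal_leI)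
  also have "\<dots> = (\<integral>\<^sup>+y. ennreal (indicator ?Q y *\<^sub>R (v y)\<^sup>2) \<partial>lebesgue)"
    using iv2 unfolding set_integrable_def by (intro nn_integral_eq_integral[symmetric]) auto
  also have "\<dots> = (\<integral>\<^sup>+y\<in>?Q. ennreal ((w x - w y)\<^sup>2) \<partial>lebesgue)"
    by (intro nn_integral_cong) (auto simp: v_def indicator_def)
  finally show ?thesis by (simp only: m)
qed

subsection \<open>The limit of a minimising sequence\<close>

locale corrector_sequence = stationary_ergodic lam M
  for lam :: real and M :: "'n::finite coeff measure" +
  fixes \<xi> :: "real ^ 'n" and \<zeta> :: "nat \<Rightarrow> 'n coeff \<Rightarrow> real" and h :: "nat \<Rightarrow> 'n coeff \<Rightarrow> real ^ 'n"
  assumes pair: "\<And>n. smooth_pair (\<zeta> n) (h n)"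
    and small: "\<And>n \<zeta>' k. smooth_pair \<zeta>' k \<Longrightarrow> \<bar>energy (\<lambda>a. h n a + \<xi>) k\<bar> \<le> (1/4) ^ n * sqrt (energy k k)"
    and fast: "(\<Sum>n. 2 ^ n * (\<integral>\<^sup>+a. ennreal ((norm (h (Suc n) a - h n a))\<^sup>2) \<partial>M)) < \<infinity>"
begin

lemma h_bdd: "bdd_meas (h n)" and zeta_bdd: "bdd_meas (\<zeta> n)"
  using pair[of n] by (auto simp: smooth_pair_def)

lemma h_meas [measurable]: "h n \<in> borel_measurable M" and zeta_meas [measurable]: "\<zeta> n \<in> borel_measurable M"
  using h_bdd zeta_bdd by (auto simp: bdd_meas_def)

text \<open>Given by a formula for every \<open>a\<close>: where the sequence diverges the value is
  arbitrary, but measurability persists.\<close>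

definition g :: "'n coeff \<Rightarrow> real ^ 'n" where
  "g a = lim (\<lambda>n. h n a)"

lemma g_meas [measurable]: "g \<in> borel_measurable M"
  unfolding g_def[abs_def] by (rule borel_measurable_lim_metric) measurable

lemma h_tendsto_g: "(\<lambda>n. \<integral>\<^sup>+a. ennreal ((norm (h n a - g a))\<^sup>2) \<partial>M) \<longlonglongrightarrow> 0"
  unfolding g_def by (rule L2_fast_limit(2)[OF h_meas fast])

lemma bdd_L2: "bdd_meas u \<Longrightarrow> (\<integral>\<^sup>+a. ennreal ((norm (u a))\<^sup>2) \<partial>M) < \<infinity>"
  using bdd_meas_norm_sq[of u] by (simp add: integrable_iff_bounded)

lemma g_L2: "(\<integral>\<^sup>+a. ennreal ((norm (g a))\<^sup>2) \<partial>M) < \<infinity>"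
proof -
  have "eventually (\<lambda>n. (\<integral>\<^sup>+a. ennreal ((norm (h n a - g a))\<^sup>2) \<partial>M) < 1) sequentially"
    by (rule order_tendstoD(2)[OF h_tendsto_g]) simp
  then obtain n where n: "(\<integral>\<^sup>+a. ennreal ((norm (h n a - g a))\<^sup>2) \<partial>M) < 1" by (auto simp: eventually_sequentially)
  have "(\<integral>\<^sup>+a. ennreal ((norm ((g a - h n a) + h n a))\<^sup>2) \<partial>M)
    \<le> 2 * (\<integral>\<^sup>+a. ennreal ((norm (g a - h n a))\<^sup>2) \<partial>M) + 2 * (\<integral>\<^sup>+a. ennreal ((norm (h n a))\<^sup>2) \<partial>M)"
    by (rule nn_integral_norm_sq_triangle) measurable
  also have "\<dots> < \<infinity>"
  proof -
    have "(\<integral>\<^sup>+a. ennreal ((norm (g a - h n a))\<^sup>2) \<partial>M) < \<infinity>"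
      using n by (simp add: norm_minus_commute) (meson ennreal_one_less_top order_less_trans)
    then show ?thesis using bdd_L2[OF h_bdd] by (simp add: ennreal_mult_less_top)
  qed
  finally show ?thesis by simp
qed

lemma diff_L2: "(\<integral>\<^sup>+a. ennreal ((norm (h n a - g a))\<^sup>2) \<partial>M) < \<infinity>"
proof -
  have "(\<integral>\<^sup>+a. ennreal ((norm (h n a + (- g a)))\<^sup>2) \<partial>M)
    \<le> 2 * (\<integral>\<^sup>+a. ennreal ((norm (h n a))\<^sup>2) \<partial>M) + 2 * (\<integral>\<^sup>+a. ennreal ((norm (- g a))\<^sup>2) \<partial>M)"
    by (rule nn_integral_norm_sq_triangle) measurable
  also have "\<dots> < \<infinity>" using bdd_L2[OF h_bdd] g_L2 by (simp add: ennreal_mult_less_top)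
  finally show ?thesis by simp
qed

lemma integrable_of_L2:
  fixes u :: "'n coeff \<Rightarrow> 'b::euclidean_space"
  assumes [measurable]: "u \<in> borel_measurable M" and "(\<integral>\<^sup>+a. ennreal ((norm (u a))\<^sup>2) \<partial>M) < \<infinity>"
  shows "integrable M u"
proof -
  have "integrable M (\<lambda>a. 1 *\<^sub>R u a)"
    by (rule integrable_mult_square) (use assms in \<open>auto simp: emeasure_space_1\<close>)
  then show ?thesis by simp
qed

lemma integrable_norm_sq:
  fixes u :: "'n coeff \<Rightarrow> 'b::euclidean_space"
  assumes [measurable]: "u \<in> borel_measurable M" and "(\<integral>\<^sup>+a. ennreal ((norm (u a))\<^sup>2) \<partial>M) < \<infinity>"
  shows "integrable M (\<lambda>a. (norm (u a))\<^sup>2)"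
  by (rule integrableI_bounded) (use assms in auto)

lemma g_integrable: "integrable M g"
  by (rule integrable_of_L2[OF g_meas g_L2])

lemma tendsto_inner_g:
  fixes \<theta> :: "'n coeff \<Rightarrow> real ^ 'n"
  assumes \<theta>[measurable]: "\<theta> \<in> borel_measurable M" and fin: "(\<integral>\<^sup>+a. ennreal ((norm (\<theta> a))\<^sup>2) \<partial>M) < \<infinity>"
  shows "(\<lambda>n. LINT a|M. \<theta> a \<bullet> h n a) \<longlonglongrightarrow> (LINT a|M. \<theta> a \<bullet> g a)"
  by (rule L2_weak_limit_inner[OF h_meas g_meas \<theta> fin _ _ h_tendsto_g])
     (intro integrable_inner_square \<theta> fin h_meas g_meas g_L2 bdd_L2 h_bdd)+

lemma g_mean: "(LINT a|M. g a) = 0"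
proof -
  have "(LINT a|M. g a) \<bullet> v = 0" for v
  proof -
    have "(\<lambda>n. LINT a|M. v \<bullet> h n a) \<longlonglongrightarrow> (LINT a|M. v \<bullet> g a)"
      by (rule tendsto_inner_g) (auto simp: emeasure_space_1)
    moreover have "(LINT a|M. v \<bullet> h n a) = 0" for n
      using smooth_pair_mean[OF pair[of n]] bdd_meas_integrable[OF h_bdd] by (simp add: integral_inner_right)
    ultimately have "(LINT a|M. v \<bullet> g a) = 0" using LIMSEQ_unique[OF _ tendsto_const] by simp
    then show ?thesis using g_integrable by (simp add: integral_inner_right inner_commute)
  qed
  then show ?thesis using inner_eq_zero_iff by blast
qed

section \<open>The flux, its Euler-Lagrange equation and the energy bound\<close>

definition flux :: "'n coeff \<Rightarrow> real ^ 'n" where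
  "flux a = coeff_at a *v (g a + \<xi>)"

lemma flux_meas [measurable]: "flux \<in> borel_measurable M"
  unfolding flux_def[abs_def] by (intro borel_measurable_matrix_vector) measurable

lemma flux_L2: "(\<integral>\<^sup>+a. ennreal ((norm (flux a))\<^sup>2) \<partial>M) < \<infinity>"
proof -
  have "(\<integral>\<^sup>+a. ennreal ((norm (flux a))\<^sup>2) \<partial>M) \<le> (\<integral>\<^sup>+a. ennreal ((norm (g a + \<xi>))\<^sup>2) \<partial>M)"
    unfolding flux_def by (intro nn_integral_mono ennreal_leI power_mono coeff_at_bounds(2)) simp
  also have "\<dots> \<le> 2 * (\<integral>\<^sup>+a. ennreal ((norm (g a))\<^sup>2) \<partial>M) + 2 * (\<integral>\<^sup>+a. ennreal ((norm \<xi>)\<^sup>2) \<partial>M)"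
    by (rule nn_integral_norm_sq_triangle) measurable
  also have "\<dots> < \<infinity>" using g_L2 by (simp add: ennreal_mult_less_top emeasure_space_1)
  finally show ?thesis .
qed

lemma flux_integrable: "integrable M flux"
  by (rule integrable_of_L2[OF flux_meas flux_L2])

text \<open>The errors of the approximate equations vanish in the limit. By symmetry of the
  coefficients the energy pairs the varying gradient with one fixed bounded function, and such a
  pairing is continuous in mean square.\<close>

lemma euler_lagrange:
  assumes k: "smooth_pair \<zeta>' k" shows "(LINT a|M. flux a \<bullet> k a) = 0"
proof -
  have kb: "bdd_meas k" using k by (simp add: smooth_pair_def)
  have Ak: "bdd_meas (\<lambda>a. coeff_at a *v k a)" by (rule bdd_meas_coeff[OF kb])
  have i: "integrable M (\<lambda>a. (coeff_at a *v k a) \<bullet> \<xi>)" by (intro bdd_meas_inner_integrable Ak bdd_meas_const)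
  have ih: "integrable M (\<lambda>a. (coeff_at a *v k a) \<bullet> h n a)" for n by (intro bdd_meas_inner_integrable Ak h_bdd)
  have ig: "integrable M (\<lambda>a. (coeff_at a *v k a) \<bullet> g a)"
    by (intro integrable_inner_square bdd_meas_measurable[OF Ak] g_meas bdd_L2[OF Ak] g_L2)
  have e: "energy (\<lambda>a. h n a + \<xi>) k = (LINT a|M. (coeff_at a *v k a) \<bullet> h n a) + (LINT a|M. (coeff_at a *v k a) \<bullet> \<xi>)" for n
  proof -
    have "energy (\<lambda>a. h n a + \<xi>) k = (LINT a|M. (coeff_at a *v k a) \<bullet> h n a + (coeff_at a *v k a) \<bullet> \<xi>)"
      unfolding energy_def by (intro Bochner_Integration.integral_cong) (auto simp: inner_commute[of "coeff_at _ *v k _"] inner_add_left)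
    then show ?thesis by (simp add: Bochner_Integration.integral_add[OF ih i])
  qed
  have "(\<lambda>n. energy (\<lambda>a. h n a + \<xi>) k) \<longlonglongrightarrow> (LINT a|M. (coeff_at a *v k a) \<bullet> g a) + (LINT a|M. (coeff_at a *v k a) \<bullet> \<xi>)"
    unfolding e by (intro tendsto_add tendsto_const tendsto_inner_g bdd_meas_measurable[OF Ak] bdd_L2[OF Ak])
  moreover have "(\<lambda>n. energy (\<lambda>a. h n a + \<xi>) k) \<longlonglongrightarrow> 0"
  proof (rule tendsto_0_le[where K=1])
    have "(\<lambda>n. (1/4 :: real) ^ n * sqrt (energy k k)) \<longlonglongrightarrow> 0 * sqrt (energy k k)"
      by (intro tendsto_mult tendsto_const LIMSEQ_power_zero) simp
    then show "(\<lambda>n. (1/4 :: real) ^ n * sqrt (energy k k)) \<longlonglongrightarrow> 0" by simp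
    show "\<forall>\<^sub>F n in sequentially. norm (energy (\<lambda>a. h n a + \<xi>) k) \<le> norm ((1/4 :: real) ^ n * sqrt (energy k k)) * 1"
    proof (intro always_eventually allI)
      fix n show "norm (energy (\<lambda>a. h n a + \<xi>) k) \<le> norm ((1/4 :: real) ^ n * sqrt (energy k k)) * 1"
        using small[OF k, of n] by simp
    qed
  qed
  ultimately have "(LINT a|M. (coeff_at a *v k a) \<bullet> g a) + (LINT a|M. (coeff_at a *v k a) \<bullet> \<xi>) = 0"
    by (rule LIMSEQ_unique)
  then have "(LINT a|M. (coeff_at a *v k a) \<bullet> g a + (coeff_at a *v k a) \<bullet> \<xi>) = 0"
    by (simp add: Bochner_Integration.integral_add[OF ig i])
  moreover have "(coeff_at a *v k a) \<bullet> g a + (coeff_at a *v k a) \<bullet> \<xi> = flux a \<bullet> k a" for a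
    unfolding inner_add_right[symmetric] flux_def
    by (subst inner_commute) (simp add: coeff_at_bounds(3)[of "g a + \<xi>"] inner_commute)
  ultimately show ?thesis by simp
qed

text \<open>\<open>g\<close> is a mean square limit of admissible directions, so the equation may be
  tested with the solution itself.\<close>

lemma flux_orthogonal_g: "(LINT a|M. flux a \<bullet> g a) = 0"
proof -
  have "(\<lambda>n. LINT a|M. flux a \<bullet> h n a) \<longlonglongrightarrow> (LINT a|M. flux a \<bullet> g a)"
    by (rule tendsto_inner_g[OF flux_meas flux_L2])
  then show ?thesis using euler_lagrange[OF pair] LIMSEQ_unique[OF _ tendsto_const] by simp
qed

text \<open>Since \<open>g\<close> has mean zero, only the fluctuation of the flux of \<open>\<xi>\<close> about its mean \<open>m\<close>
  enters the energy estimate, and \<open>\<bar>m\<bar> \<ge> lam \<bar>\<xi>\<bar>\<close>; this is where the factor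
  \<open>1 - lam\<^sup>2\<close> comes from.\<close>

lemma g_bound: "(LINT a|M. (norm (g a))\<^sup>2) \<le> (1 - lam\<^sup>2) / lam\<^sup>2 * (LINT a|M. (norm (coeff_at a *v \<xi>))\<^sup>2)"
proof -
  define w where "w a = coeff_at a *v \<xi>" for a
  have wb: "bdd_meas w" unfolding w_def[abs_def] by (intro bdd_meas_coeff bdd_meas_const)
  define m where "m = (LINT a|M. w a)"
  have wmb: "bdd_meas (\<lambda>a. w a - m)" by (intro bdd_meas_diff wb bdd_meas_const)
  have wint: "integrable M w" by (rule bdd_meas_integrable[OF wb])
  have g2: "integrable M (\<lambda>a. (norm (g a))\<^sup>2)" by (rule integrable_norm_sq[OF g_meas g_L2])
  have wg: "integrable M (\<lambda>a. w a \<bullet> g a)"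
    by (intro integrable_inner_square bdd_meas_measurable[OF wb] g_meas bdd_L2[OF wb] g_L2)
  have wmg: "integrable M (\<lambda>a. (w a - m) \<bullet> g a)"
    by (intro integrable_inner_square bdd_meas_measurable[OF wmb] g_meas bdd_L2[OF wmb] g_L2)
  have fg: "integrable M (\<lambda>a. flux a \<bullet> g a)"
    by (intro integrable_inner_square flux_meas g_meas flux_L2 g_L2)
  have pw: "lam * (norm (g a))\<^sup>2 \<le> flux a \<bullet> g a - w a \<bullet> g a" for a
  proof -
    have "flux a \<bullet> g a - w a \<bullet> g a = g a \<bullet> (coeff_at a *v g a)"
      by (simp add: flux_def w_def matrix_vector_right_distrib inner_add_left inner_commute[of "g a"])
    then show ?thesis using coeff_at_bounds(1)[of "g a" a] by simp
  qed
  have "lam * (LINT a|M. (norm (g a))\<^sup>2) \<le> (LINT a|M. flux a \<bullet> g a - w a \<bullet> g a)"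
    by (subst Bochner_Integration.integral_mult_right_zero[symmetric])
       (intro integral_mono integrable_mult_right g2 Bochner_Integration.integrable_diff fg wg pw)
  also have "\<dots> = - (LINT a|M. w a \<bullet> g a)" using fg wg flux_orthogonal_g by simp
  also have "(LINT a|M. w a \<bullet> g a) = (LINT a|M. (w a - m) \<bullet> g a)"
  proof -
    have "(LINT a|M. m \<bullet> g a) = 0" using g_mean g_integrable by (simp add: integral_inner_right)
    moreover have "integrable M (\<lambda>a. m \<bullet> g a)" using g_integrable by simp
    ultimately show ?thesis using wg by (simp add: inner_diff_left)
  qed
  also have "- (LINT a|M. (w a - m) \<bullet> g a) \<le> (LINT a|M. lam / 2 * (norm (g a))\<^sup>2 + 1 / (2 * lam) * (norm (w a - m))\<^sup>2)"
  proof -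
    have "- ((w a - m) \<bullet> g a) \<le> lam / 2 * (norm (g a))\<^sup>2 + 1 / (2 * lam) * (norm (w a - m))\<^sup>2" for a
    proof -
      have "- ((w a - m) \<bullet> g a) \<le> \<bar>norm (g a) * norm (w a - m)\<bar>"
        using Cauchy_Schwarz_ineq2[of "w a - m" "g a"] by (simp add: abs_mult mult.commute)
      also have "\<dots> \<le> lam / 2 * (norm (g a))\<^sup>2 + (norm (w a - m))\<^sup>2 / (2 * lam)" by (rule two_mult_le_scaled[OF lam_pos])
      finally show ?thesis by simp
    qed
    then have "(LINT a|M. - ((w a - m) \<bullet> g a)) \<le> (LINT a|M. lam / 2 * (norm (g a))\<^sup>2 + 1 / (2 * lam) * (norm (w a - m))\<^sup>2)"
      by (intro integral_mono Bochner_Integration.integrable_minus Bochner_Integration.integrable_add integrable_mult_right wmg g2 bdd_meas_norm_sq[OF wmb])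
    then show ?thesis by simp
  qed
  also have "\<dots> = lam / 2 * (LINT a|M. (norm (g a))\<^sup>2) + 1 / (2 * lam) * (LINT a|M. (norm (w a - m))\<^sup>2)"
    using g2 bdd_meas_norm_sq[OF wmb] by simp
  finally have "lam * (LINT a|M. (norm (g a))\<^sup>2) \<le> lam / 2 * (LINT a|M. (norm (g a))\<^sup>2) + 1 / (2 * lam) * (LINT a|M. (norm (w a - m))\<^sup>2)" .
  then have 1: "(LINT a|M. (norm (g a))\<^sup>2) \<le> 1 / lam\<^sup>2 * (LINT a|M. (norm (w a - m))\<^sup>2)"
    using lam_pos by (simp add: field_simps power2_eq_square)
  have "(LINT a|M. (norm (w a - m))\<^sup>2) = (LINT a|M. (norm (w a))\<^sup>2 - 2 * (w a \<bullet> m) + (norm m)\<^sup>2)"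
    by (intro Bochner_Integration.integral_cong) (auto simp: power2_norm_eq_inner inner_simps inner_commute)
  also have "\<dots> = (LINT a|M. (norm (w a))\<^sup>2) - 2 * (m \<bullet> m) + (norm m)\<^sup>2"
    using bdd_meas_norm_sq[OF wb] wint by (simp add: m_def prob_space)
  finally have 2: "(LINT a|M. (norm (w a - m))\<^sup>2) = (LINT a|M. (norm (w a))\<^sup>2) - (norm m)\<^sup>2"
    by (simp add: power2_norm_eq_inner)
  \<comment> \<open>Together with the lower bound on \<open>m\<close> this makes |m|^2 at least
    lam^2 times the second moment of \<open>w\<close>.\<close>
  have w2: "(LINT a|M. (norm (w a))\<^sup>2) \<le> (norm \<xi>)\<^sup>2"
  proof -
    have "(LINT a|M. (norm (w a))\<^sup>2) \<le> (LINT a|M. (norm \<xi>)\<^sup>2)"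
      by (intro integral_mono bdd_meas_norm_sq[OF wb]) (auto simp: w_def intro!: power_mono coeff_at_bounds(2))
    then show ?thesis by (simp add: prob_space)
  qed
  have "lam * (norm \<xi>)\<^sup>2 \<le> \<xi> \<bullet> m"
  proof -
    have "(LINT a|M. lam * (norm \<xi>)\<^sup>2) \<le> (LINT a|M. \<xi> \<bullet> w a)"
    proof (rule integral_mono)
      show "integrable M (\<lambda>a. \<xi> \<bullet> w a)" using wint by simp
      show "lam * (norm \<xi>)\<^sup>2 \<le> \<xi> \<bullet> w a" for a unfolding w_def by (rule coeff_at_bounds(1))
    qed simp
    then show ?thesis using wint by (simp add: m_def prob_space)
  qed
  also have "\<dots> \<le> norm \<xi> * norm m" by (rule norm_cauchy_schwarz)
  finally have "lam * norm \<xi> \<le> norm m"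
    by (cases "\<xi> = 0") (auto simp: power2_eq_square)
  then have "(lam * norm \<xi>)\<^sup>2 \<le> (norm m)\<^sup>2" using lam_pos by (intro power_mono) auto
  then have "lam\<^sup>2 * (LINT a|M. (norm (w a))\<^sup>2) \<le> (norm m)\<^sup>2"
    using mult_left_mono[OF w2, of "lam\<^sup>2"] by (simp add: power_mult_distrib)
  then have "(LINT a|M. (norm (w a - m))\<^sup>2) \<le> (1 - lam\<^sup>2) * (LINT a|M. (norm (w a))\<^sup>2)"
    unfolding 2 by (simp add: left_diff_distrib)
  then have "1 / lam\<^sup>2 * (LINT a|M. (norm (w a - m))\<^sup>2) \<le> 1 / lam\<^sup>2 * ((1 - lam\<^sup>2) * (LINT a|M. (norm (w a))\<^sup>2))"
    by (rule mult_left_mono) simp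
  then show ?thesis using 1 by (simp add: w_def)
qed

text \<open>The mean over the unit cube is removed before the limit, which fixes the free random
  constant and makes the limit anchored.\<close>

definition approx :: "nat \<Rightarrow> 'n coeff \<Rightarrow> real ^ 'n \<Rightarrow> real" where
  "approx n a x = \<zeta> n (shift x a) - (LINT y:unit_cube|lebesgue. \<zeta> n (shift y a))"

definition potential :: "'n coeff \<Rightarrow> real ^ 'n \<Rightarrow> real" where
  "potential a x = lim (\<lambda>n. approx n a x)"

text \<open>One event of full measure on which the convergence of gradients and potentials along the
  orbit becomes deterministic.\<close>

definition good :: "'n coeff \<Rightarrow> bool" where
  "good a \<longleftrightarrow> a \<in> space M \<and> (\<forall>k::nat. k > 0 \<longrightarrow>
     (\<Sum>n. 2 ^ n * (\<integral>\<^sup>+x\<in>cube 0 (real k). ennreal ((norm (h (Suc n) (shift x a) - h n (shift x a)))\<^sup>2) \<partial>lebesgue)) < \<infinity>)"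

text \<open>The expectation of the weighted series over a cube is its volume times the finite series
  \<open>fast\<close>.\<close>

lemma AE_good: "AE a in M. good a"
proof -
  have "AE a in M. (\<Sum>n. 2 ^ n * (\<integral>\<^sup>+x\<in>cube 0 (real k). ennreal ((norm (h (Suc n) (shift x a) - h n (shift x a)))\<^sup>2) \<partial>lebesgue)) < \<infinity>"
    if k: "k > 0" for k :: nat
  proof -
    let ?Q = "cube (0 :: real ^ 'n) (real k)"
    have Q[measurable]: "?Q \<in> sets lebesgue" using k by simp
    define d where "d n a = ennreal ((norm (h (Suc n) a - h n a))\<^sup>2)" for n a
    have d[measurable]: "d n \<in> borel_measurable M" for n unfolding d_def by measurable
    have [measurable]: "(\<lambda>(a, x). d n (shift x a)) \<in> borel_measurable (M \<Otimes>\<^sub>M lebesgue)" for n by (rule orbit_measurable[OF d])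
    have m[measurable]: "(\<lambda>a. \<integral>\<^sup>+x\<in>?Q. d n (shift x a) \<partial>lebesgue) \<in> borel_measurable M" for n
      by (rule lebesgue.borel_measurable_nn_integral) measurable
    have "(\<integral>\<^sup>+a. (\<Sum>n. 2 ^ n * (\<integral>\<^sup>+x\<in>?Q. d n (shift x a) \<partial>lebesgue)) \<partial>M)
      = (\<Sum>n. (\<integral>\<^sup>+a. 2 ^ n * (\<integral>\<^sup>+x\<in>?Q. d n (shift x a) \<partial>lebesgue) \<partial>M))"
      by (rule nn_integral_suminf) measurable
    also have "\<dots> = (\<Sum>n. emeasure lebesgue ?Q * (2 ^ n * (\<integral>\<^sup>+a. d n a \<partial>M)))"
      by (simp add: nn_integral_cmult nn_integral_orbit[OF d Q] mult.left_commute)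
    also have "\<dots> = emeasure lebesgue ?Q * (\<Sum>n. 2 ^ n * (\<integral>\<^sup>+a. d n a \<partial>M))"
      by (rule ennreal_suminf_cmult)
    also have "\<dots> < \<infinity>"
      using fast k by (simp add: d_def emeasure_cube ennreal_mult_less_top)
    finally have "AE a in M. (\<Sum>n. 2 ^ n * (\<integral>\<^sup>+x\<in>?Q. d n (shift x a) \<partial>lebesgue)) \<noteq> \<infinity>"
      by (intro nn_integral_noteq_infinite) (auto intro: borel_measurable_suminf)
    then show ?thesis by eventually_elim (simp add: d_def less_top)
  qed
  then have "AE a in M. \<forall>k::nat. k > 0 \<longrightarrow>
     (\<Sum>n. 2 ^ n * (\<integral>\<^sup>+x\<in>cube 0 (real k). ennreal ((norm (h (Suc n) (shift x a) - h n (shift x a)))\<^sup>2) \<partial>lebesgue)) < \<infinity>"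
    unfolding AE_all_countable by auto
  then show ?thesis using AE_space by eventually_elim (simp add: good_def)
qed

end

subsection \<open>The potential of the limiting gradient\<close>

context corrector_sequence
begin

lemma space_good: "good a \<Longrightarrow> a \<in> space M"
  by (simp add: good_def)

lemma h_orbit_continuous: "a \<in> space M \<Longrightarrow> continuous_on UNIV (\<lambda>x. h n (shift x a))"
  using pair[of n] by (simp add: smooth_pair_def)

lemma zeta_orbit_derivative:
  "a \<in> space M \<Longrightarrow> ((\<lambda>x. \<zeta> n (shift x a)) has_derivative (\<lambda>v. h n (shift x a) \<bullet> v)) (at x)"
  using pair[of n] by (simp add: smooth_pair_def)

lemma zeta_orbit_continuous: "a \<in> space M \<Longrightarrow> continuous_on UNIV (\<lambda>x. \<zeta> n (shift x a))"
  using zeta_orbit_derivative by (meson continuous_at_imp_continuous_on has_derivative_continuous)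

lemma approx_derivative:
  assumes "a \<in> space M"
  shows "(approx n a has_derivative (\<lambda>v. h n (shift x a) \<bullet> v)) (at x)"
  using has_derivative_diff[OF zeta_orbit_derivative[OF assms] has_derivative_const] by (simp add: approx_def[abs_def])

lemma approx_continuous: "a \<in> space M \<Longrightarrow> continuous_on UNIV (approx n a)"
  using approx_derivative by (meson continuous_at_imp_continuous_on has_derivative_continuous)

lemma zeta_diff_derivative:
  assumes "a \<in> space M"
  shows "((\<lambda>x. \<zeta> m (shift x a) - \<zeta> n (shift x a)) has_derivative (\<lambda>v. (h m (shift x a) - h n (shift x a)) \<bullet> v)) (at x)"
  using has_derivative_diff[OF zeta_orbit_derivative[OF assms, of m x] zeta_orbit_derivative[OF assms, of n x]]
  by (simp add: inner_diff_left)

lemma h_diff_continuous: "a \<in> space M \<Longrightarrow> continuous_on UNIV (\<lambda>x. h m (shift x a) - h n (shift x a))"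
  by (intro continuous_intros h_orbit_continuous)

lemma approx_diff: 
  assumes "a \<in> space M"
  shows "approx m a x - approx n a x = (\<zeta> m (shift x a) - \<zeta> n (shift x a)) - (LINT y:unit_cube|lebesgue. \<zeta> m (shift y a) - \<zeta> n (shift y a))"
proof -
  have "set_integrable lebesgue unit_cube (\<lambda>y. \<zeta> n (shift y a))" for n
    by (intro L2_loc_set_integrable L2_loc_continuous zeta_orbit_continuous assms unit_cube_sets)
       (simp add: unit_cube_eq bounded_cube)
  then show ?thesis by (simp add: approx_def set_integral_diff)
qed

text \<open>Poincare's inequality transfers rapid convergence from the gradients to the potentials.
  The subtracted means belong to the unit cube, which lies inside every cube of positive integer
  side.\<close>

lemma approx_fast:
  assumes a: "good a" and k: "k > 0"
  shows "(\<Sum>n. 2 ^ n * (\<integral>\<^sup>+x\<in>cube 0 (real k). ennreal ((norm (approx (Suc n) a x - approx n a x))\<^sup>2) \<partial>lebesgue)) < \<infinity>"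
proof -
  have sp: "a \<in> space M" using a by (rule space_good)
  let ?Q = "cube (0 :: real ^ 'n) (real k)"
  obtain C where C: "C > 0" "\<And>(w :: real ^ 'n \<Rightarrow> real) g R. continuous_on UNIV g \<Longrightarrow> (\<And>x. (w has_derivative (\<lambda>v. g x \<bullet> v)) (at x)) \<Longrightarrow> R > 0 \<Longrightarrow>
      (\<integral>\<^sup>+x\<in>cube 0 R. (\<integral>\<^sup>+y\<in>cube 0 R. ennreal ((w x - w y)\<^sup>2) \<partial>lebesgue) \<partial>lebesgue)
        \<le> ennreal (C * R\<^sup>2 * R ^ CARD('n)) * (\<integral>\<^sup>+x\<in>cube 0 R. ennreal ((norm (g x))\<^sup>2) \<partial>lebesgue)"
    by (rule poincare) blast
  define c where "c = ennreal (C * (real k)\<^sup>2 * real k ^ CARD('n))"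
  define X where "X n = (\<integral>\<^sup>+x\<in>?Q. ennreal ((norm (h (Suc n) (shift x a) - h n (shift x a)))\<^sup>2) \<partial>lebesgue)" for n
  have le: "(\<integral>\<^sup>+x\<in>?Q. ennreal ((norm (approx (Suc n) a x - approx n a x))\<^sup>2) \<partial>lebesgue) \<le> c * X n" for n
  proof -
    define w where "w x = \<zeta> (Suc n) (shift x a) - \<zeta> n (shift x a)" for x
    have wc: "continuous_on UNIV w" unfolding w_def by (intro continuous_intros zeta_orbit_continuous sp)
    have sub: "unit_cube \<subseteq> ?Q" unfolding unit_cube_eq using k by (intro cube_mono) auto
    have "(\<integral>\<^sup>+x\<in>?Q. ennreal ((norm (approx (Suc n) a x - approx n a x))\<^sup>2) \<partial>lebesgue)
      \<le> (\<integral>\<^sup>+x\<in>?Q. (\<integral>\<^sup>+y\<in>?Q. ennreal ((w x - w y)\<^sup>2) \<partial>lebesgue) \<partial>lebesgue)"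
    proof (intro nn_integral_mono mult_right_mono)
      fix x
      have "ennreal ((norm (approx (Suc n) a x - approx n a x))\<^sup>2) = ennreal ((w x - (LINT y:unit_cube|lebesgue. w y))\<^sup>2)"
        by (simp add: approx_diff[OF sp] w_def)
      also have "\<dots> \<le> (\<integral>\<^sup>+y\<in>unit_cube. ennreal ((w x - w y)\<^sup>2) \<partial>lebesgue)" by (rule square_minus_mean_le[OF wc])
      also have "\<dots> \<le> (\<integral>\<^sup>+y\<in>?Q. ennreal ((w x - w y)\<^sup>2) \<partial>lebesgue)"
        using sub by (intro nn_integral_mono) (auto simp: indicator_def)
      finally show "ennreal ((norm (approx (Suc n) a x - approx n a x))\<^sup>2) \<le> (\<integral>\<^sup>+y\<in>?Q. ennreal ((w x - w y)\<^sup>2) \<partial>lebesgue)" .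
    qed simp
    also have "\<dots> \<le> c * X n"
      unfolding c_def X_def
      by (rule C(2)[OF h_diff_continuous[OF sp]]) (use zeta_diff_derivative[OF sp] k in \<open>auto simp: w_def[abs_def]\<close>)
    finally show ?thesis .
  qed
  have "(\<Sum>n. 2 ^ n * (\<integral>\<^sup>+x\<in>?Q. ennreal ((norm (approx (Suc n) a x - approx n a x))\<^sup>2) \<partial>lebesgue)) \<le> (\<Sum>n. c * (2 ^ n * X n))"
  proof (rule suminf_le)
    fix n
    have "2 ^ n * (\<integral>\<^sup>+x\<in>?Q. ennreal ((norm (approx (Suc n) a x - approx n a x))\<^sup>2) \<partial>lebesgue) \<le> 2 ^ n * (c * X n)"
      by (intro mult_left_mono le) simp
    then show "2 ^ n * (\<integral>\<^sup>+x\<in>?Q. ennreal ((norm (approx (Suc n) a x - approx n a x))\<^sup>2) \<partial>lebesgue) \<le> c * (2 ^ n * X n)"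
      by (simp add: mult.left_commute)
  qed auto
  also have "\<dots> = c * (\<Sum>n. 2 ^ n * X n)" by (rule ennreal_suminf_cmult)
  also have "\<dots> < \<infinity>" using a k by (auto simp: good_def X_def c_def ennreal_mult_less_top)
  finally show ?thesis .
qed

lemma h_orbit_limit:
  assumes a: "good a" and k: "k > 0"
  shows "(\<lambda>n. \<integral>\<^sup>+x\<in>cube 0 (real k). ennreal ((norm (h n (shift x a) - g (shift x a)))\<^sup>2) \<partial>lebesgue) \<longlonglongrightarrow> 0"
  unfolding g_def
  by (rule cube_fast_limit(2)[OF continuous_on_imp_lebesgue_measurable[OF h_orbit_continuous[OF space_good[OF a]]] _ k])
     (use a in \<open>simp add: good_def\<close>)

lemma approx_limit:
  assumes a: "good a" and k: "k > 0"
  shows "(\<lambda>n. \<integral>\<^sup>+x\<in>cube 0 (real k). ennreal ((norm (approx n a x - potential a x))\<^sup>2) \<partial>lebesgue) \<longlonglongrightarrow> 0"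
  unfolding potential_def
  by (rule cube_fast_limit(2)[OF continuous_on_imp_lebesgue_measurable[OF approx_continuous[OF space_good[OF a]]] approx_fast[OF a] k])

lemma approx_AE_limit:
  assumes a: "good a" shows "AE x in lebesgue. (\<lambda>n. approx n a x) \<longlonglongrightarrow> potential a x"
  unfolding potential_def
  by (rule cube_fast_limit(1)[OF continuous_on_imp_lebesgue_measurable[OF approx_continuous[OF space_good[OF a]]] approx_fast[OF a]])

lemma g_orbit_meas: "a \<in> space M \<Longrightarrow> (\<lambda>x. g (shift x a)) \<in> borel_measurable lebesgue"
  by (rule orbit_section_measurable[OF g_meas])

lemma potential_meas: "a \<in> space M \<Longrightarrow> potential a \<in> borel_measurable lebesgue"
  unfolding potential_def[abs_def]
  by (intro borel_measurable_lim_metric continuous_on_imp_lebesgue_measurable) (rule approx_continuous)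

lemma g_orbit_L2: "good a \<Longrightarrow> L2_loc (\<lambda>x. g (shift x a))"
  by (rule L2_loc_limit[OF L2_loc_continuous[OF h_orbit_continuous] g_orbit_meas h_orbit_limit]) (auto dest: space_good)

lemma potential_L2: "good a \<Longrightarrow> L2_loc (potential a)"
  by (rule L2_loc_limit[OF L2_loc_continuous[OF approx_continuous] potential_meas approx_limit]) (auto dest: space_good)

lemma potential_weak_gradient: "good a \<Longrightarrow> has_weak_gradient (potential a) (\<lambda>x. g (shift x a))"
  by (rule has_weak_gradient_limit[OF h_orbit_continuous approx_derivative potential_L2 g_orbit_L2 approx_limit h_orbit_limit])
     (auto dest: space_good)

lemma approx_anchored:
  assumes "a \<in> space M" shows "(LINT y:unit_cube|lebesgue. approx n a y) = 0"
proof -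
  have "set_integrable lebesgue unit_cube (\<lambda>y. \<zeta> n (shift y a))" "set_integrable lebesgue (unit_cube :: (real ^ 'n) set) (\<lambda>y. c :: real)" for c
    by (intro L2_loc_set_integrable L2_loc_continuous zeta_orbit_continuous assms unit_cube_sets continuous_on_const,
        simp add: unit_cube_eq bounded_cube)+
  then have "(LINT y:unit_cube|lebesgue. approx n a y) = (LINT y:unit_cube|lebesgue. \<zeta> n (shift y a))
     - (LINT y:(unit_cube :: (real ^ 'n) set)|lebesgue. (LINT y:unit_cube|lebesgue. \<zeta> n (shift y a)))"
    unfolding approx_def by (intro set_integral_diff)
  also have "(LINT y:(unit_cube :: (real ^ 'n) set)|lebesgue. c) = (c :: real)" for c
    using measure_cube[of 1 "0 :: real ^ 'n"] by (simp add: set_lebesgue_integral_def unit_cube_eq)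
  finally show ?thesis by simp
qed

lemma potential_anchored:
  assumes a: "good a" shows "anchored (potential a)"
proof -
  have sp: "a \<in> space M" using a by (rule space_good)
  let ?Q = "unit_cube :: (real ^ 'n) set"
  have Q: "?Q = cube 0 (real 1)" by (simp add: unit_cube_eq)
  have "(\<lambda>n. LINT x|lebesgue. (indicator ?Q x :: real) *\<^sub>R approx n a x) \<longlonglongrightarrow> (LINT x|lebesgue. (indicator ?Q x :: real) *\<^sub>R potential a x)"
  proof (rule L2_loc_weak_limit[OF L2_loc_continuous[OF approx_continuous[OF sp]] potential_L2[OF a] approx_limit[OF a]])
    show "(0::nat) < 1" "(0::nat) < 1" by simp_all
    show "(indicator ?Q :: _ \<Rightarrow> real) \<in> borel_measurable lebesgue" by simp
    have "(\<integral>\<^sup>+x. ennreal ((indicator ?Q x)\<^sup>2) \<partial>lebesgue) = (\<integral>\<^sup>+x. indicator ?Q x \<partial>lebesgue)"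
      by (intro nn_integral_cong) (simp add: indicator_def)
    then show "(\<integral>\<^sup>+x. ennreal ((indicator ?Q x)\<^sup>2) \<partial>lebesgue) < \<infinity>" by (simp add: unit_cube_eq emeasure_cube)
    show "indicator ?Q x = (0::real)" if "x \<notin> cube 0 (real 1)" for x using that by (simp add: Q)
  qed
  moreover have "(LINT x|lebesgue. (indicator ?Q x :: real) *\<^sub>R approx n a x) = 0" for n
    using approx_anchored[OF sp, of n] by (simp add: set_lebesgue_integral_def)
  ultimately have "(LINT x|lebesgue. (indicator ?Q x :: real) *\<^sub>R potential a x) = 0"
    using LIMSEQ_unique[OF _ tendsto_const] by simp
  then show ?thesis by (simp add: anchored_def set_lebesgue_integral_def)
qed

text \<open>Poincare's inequality for a potential that need not be C^1: it holds for differences of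
  approximants and passes to the limit by Fatou, once in each variable. Subtracting a fixed
  \<open>\<zeta> n\<close> leaves the gradient error between \<open>g\<close> and \<open>h n\<close>
  on the right.\<close>

lemma potential_poincare:
  obtains C where "C > 0"
    "\<And>a n R. good a \<Longrightarrow> R > 0 \<Longrightarrow>
      (\<integral>\<^sup>+x\<in>cube 0 R. (\<integral>\<^sup>+y\<in>cube 0 R. ennreal (((potential a x - \<zeta> n (shift x a)) - (potential a y - \<zeta> n (shift y a)))\<^sup>2) \<partial>lebesgue) \<partial>lebesgue)
        \<le> ennreal (C * R\<^sup>2 * R ^ CARD('n)) * (\<integral>\<^sup>+x\<in>cube 0 R. ennreal ((norm (g (shift x a) - h n (shift x a)))\<^sup>2) \<partial>lebesgue)"
proof -
  obtain C where C: "C > 0" "\<And>(w :: real ^ 'n \<Rightarrow> real) g R. continuous_on UNIV g \<Longrightarrow> (\<And>x. (w has_derivative (\<lambda>v. g x \<bullet> v)) (at x)) \<Longrightarrow> R > 0 \<Longrightarrow>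
      (\<integral>\<^sup>+x\<in>cube 0 R. (\<integral>\<^sup>+y\<in>cube 0 R. ennreal ((w x - w y)\<^sup>2) \<partial>lebesgue) \<partial>lebesgue)
        \<le> ennreal (C * R\<^sup>2 * R ^ CARD('n)) * (\<integral>\<^sup>+x\<in>cube 0 R. ennreal ((norm (g x))\<^sup>2) \<partial>lebesgue)"
    by (rule poincare) blast
  show thesis
  \<comment> \<open>The factor 2 is the price of inserting \<open>g\<close> between the gradients of
    index m and n.\<close>
  proof (rule that[of "2 * C"])
    show "2 * C > 0" using C by simp
  next
    fix a n R assume a: "good a" and R: "(R::real) > 0"
    have sp: "a \<in> space M" using a by (rule space_good)
    define Q where "Q = cube (0 :: real ^ 'n) R"
    have Q[measurable]: "Q \<in> sets lebesgue" using R by (simp add: Q_def)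
    define K where "K = ennreal (C * R\<^sup>2 * R ^ CARD('n))"
    define X where "X = (\<integral>\<^sup>+x\<in>Q. ennreal ((norm (g (shift x a) - h n (shift x a)))\<^sup>2) \<partial>lebesgue)"
    define D where "D m x = approx m a x - \<zeta> n (shift x a)" for m x
    define E where "E x = potential a x - \<zeta> n (shift x a)" for x
    have zm: "(\<lambda>x. \<zeta> n (shift x a)) \<in> borel_measurable lebesgue"
      by (rule continuous_on_imp_lebesgue_measurable[OF zeta_orbit_continuous[OF sp]])
    have Dm[measurable]: "D m \<in> borel_measurable lebesgue" for m
      unfolding D_def by (intro borel_measurable_diff zm continuous_on_imp_lebesgue_measurable[OF approx_continuous[OF sp]])
    have Em[measurable]: "E \<in> borel_measurable lebesgue"
      unfolding E_def by (intro borel_measurable_diff zm potential_meas sp)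
    have hm[measurable]: "(\<lambda>x. h m (shift x a)) \<in> borel_measurable lebesgue" for m
      by (rule continuous_on_imp_lebesgue_measurable[OF h_orbit_continuous[OF sp]])
    have gm[measurable]: "(\<lambda>x. g (shift x a)) \<in> borel_measurable lebesgue" by (rule g_orbit_meas[OF sp])
    have lim: "AE x in lebesgue. (\<lambda>m. D m x) \<longlonglongrightarrow> E x"
      using approx_AE_limit[OF a] by eventually_elim (auto simp: D_def E_def intro!: tendsto_intros)
    define I where "I m x = (\<integral>\<^sup>+y. ennreal ((D m x - D m y)\<^sup>2) * indicator Q y * indicator Q x \<partial>lebesgue)" for m x
    have pm: "(\<lambda>(x, y). ennreal ((D m x - D m y)\<^sup>2) * indicator Q y * indicator Q x) \<in> borel_measurable (lebesgue \<Otimes>\<^sub>M lebesgue)" for m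
      by measurable
    have Im[measurable]: "I m \<in> borel_measurable lebesgue" for m
      unfolding I_def[abs_def] by (rule lebesgue.borel_measurable_nn_integral[OF pm])
    have inner: "AE x in lebesgue. (\<integral>\<^sup>+y\<in>Q. ennreal ((E x - E y)\<^sup>2) \<partial>lebesgue) * indicator Q x \<le> liminf (\<lambda>m. I m x)"
      using lim
    proof eventually_elim
      case (elim x)
      have "(\<integral>\<^sup>+y\<in>Q. ennreal ((E x - E y)\<^sup>2) \<partial>lebesgue) * indicator Q x = (\<integral>\<^sup>+y. ennreal ((E x - E y)\<^sup>2) * indicator Q y * indicator Q x \<partial>lebesgue)"
        by (rule nn_integral_multc[symmetric]) measurable
      also have "\<dots> \<le> (\<integral>\<^sup>+y. liminf (\<lambda>m. ennreal ((D m x - D m y)\<^sup>2) * indicator Q y * indicator Q x) \<partial>lebesgue)"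
      proof (rule nn_integral_mono_AE)
        show "AE y in lebesgue. ennreal ((E x - E y)\<^sup>2) * indicator Q y * indicator Q x \<le> liminf (\<lambda>m. ennreal ((D m x - D m y)\<^sup>2) * indicator Q y * indicator Q x)"
          using lim
        proof eventually_elim
          case (elim y)
          have "(\<lambda>m. ennreal ((D m x - D m y)\<^sup>2) * indicator Q y * indicator Q x) \<longlonglongrightarrow> ennreal ((E x - E y)\<^sup>2) * indicator Q y * indicator Q x"
          proof (cases "x \<in> Q \<and> y \<in> Q")
            case True
            have "(\<lambda>m. ennreal ((D m x - D m y)\<^sup>2)) \<longlonglongrightarrow> ennreal ((E x - E y)\<^sup>2)"
              by (intro tendsto_intros elim \<open>(\<lambda>m. D m x) \<longlonglongrightarrow> E x\<close>)
            then show ?thesis using True by simp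
          qed auto
          then have "liminf (\<lambda>m. ennreal ((D m x - D m y)\<^sup>2) * indicator Q y * indicator Q x) = ennreal ((E x - E y)\<^sup>2) * indicator Q y * indicator Q x"
            by (intro lim_imp_Liminf) auto
          then show ?case by (simp only: order_refl)
        qed
      qed
      also have "\<dots> \<le> liminf (\<lambda>m. I m x)"
        unfolding I_def by (rule nn_integral_liminf) measurable
      finally show ?case .
    qed
    have I_le: "(\<integral>\<^sup>+x. I m x \<partial>lebesgue) \<le> K * (2 * (\<integral>\<^sup>+x\<in>Q. ennreal ((norm (h m (shift x a) - g (shift x a)))\<^sup>2) \<partial>lebesgue) + 2 * X)" for m
    proof -
      define w where "w x = \<zeta> m (shift x a) - \<zeta> n (shift x a)" for x
      \<comment> \<open>The means subtracted in \<open>approx\<close> cancel in differences.\<close>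
      have Dw: "D m x - D m y = w x - w y" for x y by (simp add: D_def w_def approx_def)
      have "(\<integral>\<^sup>+x. I m x \<partial>lebesgue) = (\<integral>\<^sup>+x\<in>Q. (\<integral>\<^sup>+y\<in>Q. ennreal ((D m x - D m y)\<^sup>2) \<partial>lebesgue) \<partial>lebesgue)"
        unfolding I_def by (intro nn_integral_cong nn_integral_multc) measurable
      also have "\<dots> = (\<integral>\<^sup>+x\<in>Q. (\<integral>\<^sup>+y\<in>Q. ennreal ((w x - w y)\<^sup>2) \<partial>lebesgue) \<partial>lebesgue)"
        by (simp only: Dw)
      also have "\<dots> \<le> K * (\<integral>\<^sup>+x\<in>Q. ennreal ((norm (h m (shift x a) - h n (shift x a)))\<^sup>2) \<partial>lebesgue)"
        unfolding K_def Q_def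
        by (rule C(2)[OF h_diff_continuous[OF sp] _ R]) (use zeta_diff_derivative[OF sp] in \<open>simp add: w_def[abs_def]\<close>)
      also have "(\<integral>\<^sup>+x\<in>Q. ennreal ((norm (h m (shift x a) - h n (shift x a)))\<^sup>2) \<partial>lebesgue)
        \<le> 2 * (\<integral>\<^sup>+x\<in>Q. ennreal ((norm (h m (shift x a) - g (shift x a)))\<^sup>2) \<partial>lebesgue) + 2 * X"
        using set_nn_integral_norm_sq_triangle[of "\<lambda>x. h m (shift x a) - g (shift x a)" lebesgue "\<lambda>x. g (shift x a) - h n (shift x a)" Q]
        by (simp add: X_def)
      finally show ?thesis by (simp add: mult_left_mono)
    qed
    have Xlim: "(\<lambda>m. K * (2 * (\<integral>\<^sup>+x\<in>Q. ennreal ((norm (h m (shift x a) - g (shift x a)))\<^sup>2) \<partial>lebesgue) + 2 * X)) \<longlonglongrightarrow> K * (2 * 0 + 2 * X)"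
    proof (intro tendsto_mult_ennreal tendsto_add tendsto_const)
      obtain k :: nat where k: "k > 0" "Q \<subseteq> cube 0 (real k)"
        using bounded_subset_cube[OF bounded_cube[OF R, of "0 :: real ^ 'n"]] unfolding Q_def by blast
      show "(\<lambda>m. \<integral>\<^sup>+x\<in>Q. ennreal ((norm (h m (shift x a) - g (shift x a)))\<^sup>2) \<partial>lebesgue) \<longlonglongrightarrow> 0"
      proof (rule tendsto_sandwich[OF _ _ tendsto_const h_orbit_limit[OF a k(1)]])
        show "\<forall>\<^sub>F m in sequentially. (\<integral>\<^sup>+x\<in>Q. ennreal ((norm (h m (shift x a) - g (shift x a)))\<^sup>2) \<partial>lebesgue)
          \<le> (\<integral>\<^sup>+x\<in>cube 0 (real k). ennreal ((norm (h m (shift x a) - g (shift x a)))\<^sup>2) \<partial>lebesgue)"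
          using k(2) by (intro always_eventually allI nn_integral_mono) (auto simp: indicator_def)
      qed simp
      have "X < \<infinity>"
      proof -
        have "L2_loc (\<lambda>x. h n (shift x a))" by (rule L2_loc_continuous[OF h_orbit_continuous[OF sp]])
        then have "(\<integral>\<^sup>+x\<in>Q. ennreal ((norm (- h n (shift x a)))\<^sup>2) \<partial>lebesgue) < \<infinity>"
          using L2_loc_nn_integral[OF _ bounded_cube[OF R] cube_sets[OF R]] unfolding Q_def by simp
        moreover have "(\<integral>\<^sup>+x\<in>Q. ennreal ((norm (g (shift x a)))\<^sup>2) \<partial>lebesgue) < \<infinity>"
          unfolding Q_def by (rule L2_loc_nn_integral[OF g_orbit_L2[OF a] bounded_cube[OF R] cube_sets[OF R]])
        ultimately show ?thesis
          using set_nn_integral_norm_sq_triangle[of "\<lambda>x. g (shift x a)" lebesgue "\<lambda>x. - h n (shift x a)" Q]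
          by (auto simp: X_def ennreal_mult_less_top intro: le_less_trans)
      qed
      then show "\<not> ((K = 0 \<and> 2 * 0 + 2 * X = \<infinity>) \<or> (K = \<infinity> \<and> 2 * 0 + 2 * X = 0))"
        by (auto simp: K_def ennreal_mult_eq_top_iff)
    qed auto
    have "(\<integral>\<^sup>+x\<in>Q. (\<integral>\<^sup>+y\<in>Q. ennreal ((E x - E y)\<^sup>2) \<partial>lebesgue) \<partial>lebesgue) \<le> (\<integral>\<^sup>+x. liminf (\<lambda>m. I m x) \<partial>lebesgue)"
      by (rule nn_integral_mono_AE[OF inner])
    also have "\<dots> \<le> liminf (\<lambda>m. \<integral>\<^sup>+x. I m x \<partial>lebesgue)" by (rule nn_integral_liminf) measurable
    also have "\<dots> \<le> liminf (\<lambda>m. K * (2 * (\<integral>\<^sup>+x\<in>Q. ennreal ((norm (h m (shift x a) - g (shift x a)))\<^sup>2) \<partial>lebesgue) + 2 * X))"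
      by (intro Liminf_mono always_eventually allI I_le)
    also have "\<dots> = K * (2 * 0 + 2 * X)" by (intro lim_imp_Liminf Xlim) simp
    also have "\<dots> = ennreal (2 * C * R\<^sup>2 * R ^ CARD('n)) * X"
    proof -
      have "ennreal (2 * C * R\<^sup>2 * R ^ CARD('n)) = ennreal (2 * (C * R\<^sup>2 * R ^ CARD('n)))" by (simp add: mult.assoc)
      also have "\<dots> = 2 * K" using C(1) R by (subst ennreal_mult) (auto simp: K_def)
      finally show ?thesis by (simp add: mult_ac)
    qed
    finally show "(\<integral>\<^sup>+x\<in>cube 0 R. (\<integral>\<^sup>+y\<in>cube 0 R. ennreal (((potential a x - \<zeta> n (shift x a)) - (potential a y - \<zeta> n (shift y a)))\<^sup>2) \<partial>lebesgue) \<partial>lebesgue)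
        \<le> ennreal (2 * C * R\<^sup>2 * R ^ CARD('n)) * (\<integral>\<^sup>+x\<in>cube 0 R. ennreal ((norm (g (shift x a) - h n (shift x a)))\<^sup>2) \<partial>lebesgue)"
      by (simp add: E_def Q_def X_def)
  qed
qed

end

subsection \<open>Sublinear growth\<close>

lemma average_eq:
  fixes f :: "real ^ 'm \<Rightarrow> real"
  assumes R: "R > 0" and f: "\<And>x. f x \<ge> 0" "f \<in> borel_measurable lebesgue"
  shows "average (cube 0 R) f = enn2real (\<integral>\<^sup>+x\<in>cube 0 R. ennreal (f x) \<partial>lebesgue) / R ^ CARD('m)"
proof -
  have "(LINT x:cube 0 R|lebesgue. f x) = enn2real (\<integral>\<^sup>+x. ennreal (indicator (cube 0 R) x *\<^sub>R f x) \<partial>lebesgue)"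
    unfolding set_lebesgue_integral_def
    by (rule integral_eq_nn_integral) (use R f in auto)
  also have "(\<integral>\<^sup>+x. ennreal (indicator (cube 0 R) x *\<^sub>R f x) \<partial>lebesgue) = (\<integral>\<^sup>+x\<in>cube 0 R. ennreal (f x) \<partial>lebesgue)"
    by (intro nn_integral_cong) (auto simp: indicator_def)
  finally show ?thesis by (simp add: average_def measure_cube[OF R])
qed

lemma real_sq_sum: "(x - y :: real)\<^sup>2 \<le> 2 * ((x - u) - (y - v))\<^sup>2 + 2 * (u - v)\<^sup>2"
  using norm_sq_add_le[of "(x - u) - (y - v)" "u - v"] by simp

context corrector_sequence
begin

text \<open>A function bounded by \<open>z\<close> has oscillation at most 2z on every cube and
  contributes 2 (2z)^2 = 8 z^2; the gradient error controls the rest. Finiteness is recorded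
  separately because \<open>enn2real\<close> sends an infinite integral to zero.\<close>

lemma oscillation_finite:
  assumes a: "good a" and R: "R > 0"
  shows "(\<integral>\<^sup>+x\<in>cube 0 R. (\<integral>\<^sup>+y\<in>cube 0 R. ennreal ((potential a x - potential a y)\<^sup>2) \<partial>lebesgue) \<partial>lebesgue) < \<infinity>" (is ?fin)
    and "z \<ge> 0 \<Longrightarrow> (\<And>a. a \<in> space M \<Longrightarrow> \<bar>\<zeta> n a\<bar> \<le> z) \<Longrightarrow> C > 0 \<Longrightarrow>
     (\<integral>\<^sup>+x\<in>cube 0 R. (\<integral>\<^sup>+y\<in>cube 0 R. ennreal (((potential a x - \<zeta> n (shift x a)) - (potential a y - \<zeta> n (shift y a)))\<^sup>2) \<partial>lebesgue) \<partial>lebesgue)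
        \<le> ennreal (C * R\<^sup>2 * R ^ CARD('n)) * (\<integral>\<^sup>+x\<in>cube 0 R. ennreal ((norm (g (shift x a) - h n (shift x a)))\<^sup>2) \<partial>lebesgue) \<Longrightarrow>
     enn2real (\<integral>\<^sup>+x\<in>cube 0 R. (\<integral>\<^sup>+y\<in>cube 0 R. ennreal ((potential a x - potential a y)\<^sup>2) \<partial>lebesgue) \<partial>lebesgue)
       \<le> R ^ CARD('n) * R ^ CARD('n) * (2 * C * R\<^sup>2 * average (cube 0 R) (\<lambda>x. (norm (g (shift x a) - h n (shift x a)))\<^sup>2) + 8 * z\<^sup>2)"
proof -
  have sp: "a \<in> space M" using a by (rule space_good)
  define Q where "Q = cube (0 :: real ^ 'n) R"
  have Q[measurable]: "Q \<in> sets lebesgue" using R by (simp add: Q_def)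
  have eQ: "emeasure lebesgue Q = ennreal (R ^ CARD('n))" using R by (simp add: Q_def emeasure_cube)
  have pm[measurable]: "potential a \<in> borel_measurable lebesgue" by (rule potential_meas[OF sp])
  have zm[measurable]: "(\<lambda>x. \<zeta> n (shift x a)) \<in> borel_measurable lebesgue" for n
    by (rule continuous_on_imp_lebesgue_measurable[OF zeta_orbit_continuous[OF sp]])
  have hm[measurable]: "(\<lambda>x. h n (shift x a)) \<in> borel_measurable lebesgue" for n
    by (rule continuous_on_imp_lebesgue_measurable[OF h_orbit_continuous[OF sp]])
  have gm[measurable]: "(\<lambda>x. g (shift x a)) \<in> borel_measurable lebesgue" by (rule g_orbit_meas[OF sp])
  define T where "T = (\<integral>\<^sup>+x\<in>Q. (\<integral>\<^sup>+y\<in>Q. ennreal ((potential a x - potential a y)\<^sup>2) \<partial>lebesgue) \<partial>lebesgue)"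
  show main: "enn2real (\<integral>\<^sup>+x\<in>cube 0 R. (\<integral>\<^sup>+y\<in>cube 0 R. ennreal ((potential a x - potential a y)\<^sup>2) \<partial>lebesgue) \<partial>lebesgue)
       \<le> R ^ CARD('n) * R ^ CARD('n) * (2 * C * R\<^sup>2 * average (cube 0 R) (\<lambda>x. (norm (g (shift x a) - h n (shift x a)))\<^sup>2) + 8 * z\<^sup>2)"
    if z: "z \<ge> 0" "\<And>a. a \<in> space M \<Longrightarrow> \<bar>\<zeta> n a\<bar> \<le> z" and C: "C > 0"
      and P: "(\<integral>\<^sup>+x\<in>cube 0 R. (\<integral>\<^sup>+y\<in>cube 0 R. ennreal (((potential a x - \<zeta> n (shift x a)) - (potential a y - \<zeta> n (shift y a)))\<^sup>2) \<partial>lebesgue) \<partial>lebesgue)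
        \<le> ennreal (C * R\<^sup>2 * R ^ CARD('n)) * (\<integral>\<^sup>+x\<in>cube 0 R. ennreal ((norm (g (shift x a) - h n (shift x a)))\<^sup>2) \<partial>lebesgue)" for n z C
  proof -
    define P1 where "P1 x y = ennreal (((potential a x - \<zeta> n (shift x a)) - (potential a y - \<zeta> n (shift y a)))\<^sup>2)" for x y
    have p1m[measurable]: "(\<lambda>(x, y). P1 x y) \<in> borel_measurable (lebesgue \<Otimes>\<^sub>M lebesgue)"
      unfolding P1_def by measurable
    define X where "X = (\<integral>\<^sup>+x\<in>Q. ennreal ((norm (g (shift x a) - h n (shift x a)))\<^sup>2) \<partial>lebesgue)"
    have Xfin: "X < \<infinity>"
    proof -
      have "L2_loc (\<lambda>x. h n (shift x a))" by (rule L2_loc_continuous[OF h_orbit_continuous[OF sp]])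
      then have "(\<integral>\<^sup>+x\<in>Q. ennreal ((norm (- h n (shift x a)))\<^sup>2) \<partial>lebesgue) < \<infinity>"
        using L2_loc_nn_integral[OF _ bounded_cube[OF R] cube_sets[OF R]] unfolding Q_def by simp
      moreover have "(\<integral>\<^sup>+x\<in>Q. ennreal ((norm (g (shift x a)))\<^sup>2) \<partial>lebesgue) < \<infinity>"
        unfolding Q_def by (rule L2_loc_nn_integral[OF g_orbit_L2[OF a] bounded_cube[OF R] cube_sets[OF R]])
      ultimately show ?thesis
        using set_nn_integral_norm_sq_triangle[of "\<lambda>x. g (shift x a)" lebesgue "\<lambda>x. - h n (shift x a)" Q]
        by (auto simp: X_def ennreal_mult_less_top intro: le_less_trans)
    qed
    then obtain X' where X': "X = ennreal X'" "X' \<ge> 0" by (cases X) auto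
    have av: "average (cube 0 R) (\<lambda>x. (norm (g (shift x a) - h n (shift x a)))\<^sup>2) = X' / R ^ CARD('n)"
      using average_eq[OF R, of "\<lambda>x. (norm (g (shift x a) - h n (shift x a)))\<^sup>2"] X' by (simp add: X_def[unfolded Q_def, symmetric])
    have pt: "ennreal ((potential a x - potential a y)\<^sup>2) \<le> 2 * P1 x y + ennreal (8 * z\<^sup>2)" for x y
    proof -
      have "\<bar>\<zeta> n (shift x a) - \<zeta> n (shift y a)\<bar> \<le> \<bar>2 * z\<bar>"
        using z(2)[OF shift_space[OF sp, of x]] z(2)[OF shift_space[OF sp, of y]] z(1) by linarith
      then have "(\<zeta> n (shift x a) - \<zeta> n (shift y a))\<^sup>2 \<le> (2 * z)\<^sup>2" by (rule abs_le_square_iff[THEN iffD1])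
      then have "(potential a x - potential a y)\<^sup>2 \<le> 2 * ((potential a x - \<zeta> n (shift x a)) - (potential a y - \<zeta> n (shift y a)))\<^sup>2 + 8 * z\<^sup>2"
        using real_sq_sum[of "potential a x" "potential a y" "\<zeta> n (shift x a)" "\<zeta> n (shift y a)"] by (simp add: power_mult_distrib)
      then have "ennreal ((potential a x - potential a y)\<^sup>2) \<le> ennreal (2 * ((potential a x - \<zeta> n (shift x a)) - (potential a y - \<zeta> n (shift y a)))\<^sup>2 + 8 * z\<^sup>2)"
        by (rule ennreal_leI)
      also have "\<dots> = 2 * P1 x y + ennreal (8 * z\<^sup>2)" unfolding P1_def by (subst ennreal_plus) (auto simp: ennreal_mult)
      finally show ?thesis .
    qed
    have "T \<le> (\<integral>\<^sup>+x\<in>Q. (\<integral>\<^sup>+y\<in>Q. (2 * P1 x y + ennreal (8 * z\<^sup>2)) \<partial>lebesgue) \<partial>lebesgue)"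
      unfolding T_def by (intro nn_integral_mono mult_right_mono pt) auto
    also have "\<dots> = (\<integral>\<^sup>+x\<in>Q. (2 * (\<integral>\<^sup>+y\<in>Q. P1 x y \<partial>lebesgue) + ennreal (8 * z\<^sup>2) * ennreal (R ^ CARD('n))) \<partial>lebesgue)"
    proof (rule nn_integral_cong)
      fix x
      have [measurable]: "P1 x \<in> borel_measurable lebesgue" unfolding P1_def by measurable
      have "(\<integral>\<^sup>+y\<in>Q. (2 * P1 x y + ennreal (8 * z\<^sup>2)) \<partial>lebesgue) = (\<integral>\<^sup>+y. 2 * (P1 x y * indicator Q y) + ennreal (8 * z\<^sup>2) * indicator Q y \<partial>lebesgue)"
        by (intro nn_integral_cong) (auto simp: indicator_def)
      also have "\<dots> = 2 * (\<integral>\<^sup>+y\<in>Q. P1 x y \<partial>lebesgue) + ennreal (8 * z\<^sup>2) * ennreal (R ^ CARD('n))"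
        by (simp add: nn_integral_add nn_integral_cmult nn_integral_cmult_indicator eQ)
      finally show "(\<integral>\<^sup>+y\<in>Q. (2 * P1 x y + ennreal (8 * z\<^sup>2)) \<partial>lebesgue) * indicator Q x =
        (2 * (\<integral>\<^sup>+y\<in>Q. P1 x y \<partial>lebesgue) + ennreal (8 * z\<^sup>2) * ennreal (R ^ CARD('n))) * indicator Q x" by simp
    qed
    also have "\<dots> = (\<integral>\<^sup>+x. 2 * ((\<integral>\<^sup>+y\<in>Q. P1 x y \<partial>lebesgue) * indicator Q x) + ennreal (8 * z\<^sup>2) * ennreal (R ^ CARD('n)) * indicator Q x \<partial>lebesgue)"
      by (intro nn_integral_cong) (auto simp: indicator_def)
    also have "\<dots> = 2 * (\<integral>\<^sup>+x\<in>Q. (\<integral>\<^sup>+y\<in>Q. P1 x y \<partial>lebesgue) \<partial>lebesgue) + ennreal (8 * z\<^sup>2) * ennreal (R ^ CARD('n)) * ennreal (R ^ CARD('n))"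
    proof -
      have [measurable]: "(\<lambda>x. \<integral>\<^sup>+y\<in>Q. P1 x y \<partial>lebesgue) \<in> borel_measurable lebesgue"
        by (rule lebesgue.borel_measurable_nn_integral) measurable
      show ?thesis by (simp add: nn_integral_add nn_integral_cmult nn_integral_cmult_indicator eQ)
    qed
    also have "\<dots> \<le> 2 * (ennreal (C * R\<^sup>2 * R ^ CARD('n)) * X) + ennreal (8 * z\<^sup>2) * ennreal (R ^ CARD('n)) * ennreal (R ^ CARD('n))"
      using P unfolding P1_def X_def Q_def by (intro add_right_mono mult_left_mono) auto
    also have "\<dots> = ennreal (2 * (C * R\<^sup>2 * R ^ CARD('n) * X') + 8 * z\<^sup>2 * R ^ CARD('n) * R ^ CARD('n))"
      using C R X'(2) unfolding X'(1)
      by (simp add: ennreal_mult[symmetric] ennreal_plus[symmetric] ennreal_numeral[symmetric] del: ennreal_plus ennreal_numeral)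
    finally have "T \<le> ennreal (2 * (C * R\<^sup>2 * R ^ CARD('n) * X') + 8 * z\<^sup>2 * R ^ CARD('n) * R ^ CARD('n))" .
    then have "enn2real T \<le> 2 * (C * R\<^sup>2 * R ^ CARD('n) * X') + 8 * z\<^sup>2 * R ^ CARD('n) * R ^ CARD('n)"
      using C R X'(2) by (intro enn2real_leI) auto
    also have "\<dots> = R ^ CARD('n) * R ^ CARD('n) * (2 * C * R\<^sup>2 * (X' / R ^ CARD('n)) + 8 * z\<^sup>2)"
      using R by (simp add: field_simps)
    finally show ?thesis unfolding av T_def Q_def .
  qed
  have "L2_loc (potential a)" by (rule potential_L2[OF a])
  then have "(\<integral>\<^sup>+x\<in>Q. ennreal ((norm (potential a x))\<^sup>2) \<partial>lebesgue) < \<infinity>"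
    unfolding Q_def by (rule L2_loc_nn_integral[OF _ bounded_cube[OF R] cube_sets[OF R]])
  then obtain X where X: "(\<integral>\<^sup>+x\<in>Q. ennreal ((potential a x)\<^sup>2) \<partial>lebesgue) = ennreal X" "X \<ge> 0"
    by (cases "\<integral>\<^sup>+x\<in>Q. ennreal ((potential a x)\<^sup>2) \<partial>lebesgue") auto
  have "T \<le> (\<integral>\<^sup>+x\<in>Q. (2 * ennreal ((potential a x)\<^sup>2) * ennreal (R ^ CARD('n)) + 2 * ennreal X) \<partial>lebesgue)"
    unfolding T_def
  proof (intro nn_integral_mono mult_right_mono)
    fix x
    have "(\<integral>\<^sup>+y\<in>Q. ennreal ((potential a x - potential a y)\<^sup>2) \<partial>lebesgue)
      \<le> (\<integral>\<^sup>+y. 2 * ennreal ((potential a x)\<^sup>2) * indicator Q y + 2 * (ennreal ((potential a y)\<^sup>2) * indicator Q y) \<partial>lebesgue)"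
    proof (rule nn_integral_mono)
      fix y
      have "(potential a x - potential a y)\<^sup>2 \<le> 2 * (potential a x)\<^sup>2 + 2 * (potential a y)\<^sup>2"
        using norm_sq_diff_le[of "potential a x" "potential a y"] by simp
      then have "ennreal ((potential a x - potential a y)\<^sup>2) \<le> ennreal (2 * (potential a x)\<^sup>2 + 2 * (potential a y)\<^sup>2)" by (rule ennreal_leI)
      also have "\<dots> = 2 * ennreal ((potential a x)\<^sup>2) + 2 * ennreal ((potential a y)\<^sup>2)" by (subst ennreal_plus) (auto simp: ennreal_mult)
      finally show "ennreal ((potential a x - potential a y)\<^sup>2) * indicator Q y \<le> 2 * ennreal ((potential a x)\<^sup>2) * indicator Q y + 2 * (ennreal ((potential a y)\<^sup>2) * indicator Q y)"
        by (auto simp: indicator_def)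
    qed
    also have "\<dots> = 2 * ennreal ((potential a x)\<^sup>2) * ennreal (R ^ CARD('n)) + 2 * ennreal X"
      by (simp add: nn_integral_add nn_integral_cmult nn_integral_cmult_indicator eQ X(1))
    finally show "(\<integral>\<^sup>+y\<in>Q. ennreal ((potential a x - potential a y)\<^sup>2) \<partial>lebesgue) \<le> 2 * ennreal ((potential a x)\<^sup>2) * ennreal (R ^ CARD('n)) + 2 * ennreal X" .
  qed simp
  also have "\<dots> = (\<integral>\<^sup>+x. (2 * ennreal (R ^ CARD('n))) * (ennreal ((potential a x)\<^sup>2) * indicator Q x) + 2 * ennreal X * indicator Q x \<partial>lebesgue)"
    by (intro nn_integral_cong) (auto simp: indicator_def mult_ac)
  also have "\<dots> = 2 * ennreal (R ^ CARD('n)) * ennreal X + 2 * ennreal X * ennreal (R ^ CARD('n))"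
    by (simp add: nn_integral_add nn_integral_cmult nn_integral_cmult_indicator eQ X(1))
  also have "\<dots> < \<infinity>" by (simp add: ennreal_mult_less_top)
  finally show ?fin by (simp add: T_def Q_def)
qed

text \<open>Values on the cube of side \<open>R\<close> are compared with values on the concentric
  cube of half the side. Passing from R/2 to \<open>R\<close> in the factor 1/R^2 gains 1/4, and 3/2
  times 1/4 is the contraction factor 3/8; the power of 2 is the ratio of the volumes.\<close>

lemma growth_recursion:
  assumes a: "good a" and R: "R > 0"
  defines "F \<equiv> \<lambda>R. 1 / R\<^sup>2 * average (cube 0 R) (\<lambda>y. \<bar>potential a y\<bar>\<^sup>2)"
  shows "F R \<le> 3 * 2 ^ CARD('n) * (enn2real (\<integral>\<^sup>+x\<in>cube 0 R. (\<integral>\<^sup>+y\<in>cube 0 R. ennreal ((potential a x - potential a y)\<^sup>2) \<partial>lebesgue) \<partial>lebesgue)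
      / (R ^ CARD('n) * R ^ CARD('n) * R\<^sup>2)) + 3 / 8 * F (R / 2)"
proof -
  have sp: "a \<in> space M" using a by (rule space_good)
  let ?d = "CARD('n)"
  define Q where "Q = cube (0 :: real ^ 'n) R"
  define Q' where "Q' = cube (0 :: real ^ 'n) (R / 2)"
  have R2: "R / 2 > 0" using R by simp
  have Q[measurable]: "Q \<in> sets lebesgue" and Q'[measurable]: "Q' \<in> sets lebesgue" using R by (simp_all add: Q_def Q'_def)
  have sub: "Q' \<subseteq> Q" unfolding Q_def Q'_def using R by (intro cube_mono) auto
  have eQ: "emeasure lebesgue Q = ennreal (R ^ ?d)" "emeasure lebesgue Q' = ennreal ((R / 2) ^ ?d)"
    using R by (simp_all add: Q_def Q'_def emeasure_cube[OF R] emeasure_cube[OF R2])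
  define u where "u = potential a"
  have um[measurable]: "u \<in> borel_measurable lebesgue" unfolding u_def by (rule potential_meas[OF sp])
  define T where "T = (\<integral>\<^sup>+x\<in>Q. (\<integral>\<^sup>+y\<in>Q. ennreal ((u x - u y)\<^sup>2) \<partial>lebesgue) \<partial>lebesgue)"
  have "T < \<infinity>" unfolding T_def Q_def u_def by (rule oscillation_finite(1)[OF a R])
  then obtain T' where T': "T = ennreal T'" "T' \<ge> 0" by (cases T) auto
  have fin: "(\<integral>\<^sup>+x\<in>B. ennreal ((u x)\<^sup>2) \<partial>lebesgue) < \<infinity>" if "bounded B" "B \<in> sets lebesgue" for B
    using L2_loc_nn_integral[OF potential_L2[OF a] that] by (simp add: u_def)
  have "bounded Q" "bounded Q'" unfolding Q_def Q'_def by (intro bounded_cube R R2)+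
  from fin[OF this(1) Q] fin[OF this(2) Q']
  obtain X X' where X: "(\<integral>\<^sup>+x\<in>Q. ennreal ((u x)\<^sup>2) \<partial>lebesgue) = ennreal X" "X \<ge> 0"
    and X': "(\<integral>\<^sup>+x\<in>Q'. ennreal ((u x)\<^sup>2) \<partial>lebesgue) = ennreal X'" "X' \<ge> 0"
    by (cases "\<integral>\<^sup>+x\<in>Q. ennreal ((u x)\<^sup>2) \<partial>lebesgue"; cases "\<integral>\<^sup>+x\<in>Q'. ennreal ((u x)\<^sup>2) \<partial>lebesgue") auto
  have F: "F R = 1 / R\<^sup>2 * (X / R ^ ?d)" "F (R / 2) = 1 / (R / 2)\<^sup>2 * (X' / (R / 2) ^ ?d)"
    unfolding F_def using X X' average_eq[OF R, of "\<lambda>y. \<bar>potential a y\<bar>\<^sup>2"] average_eq[OF R2, of "\<lambda>y. \<bar>potential a y\<bar>\<^sup>2"] um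
    by (simp_all add: Q_def Q'_def u_def)
  \<comment> \<open>Any coefficient of y^2 below 4 would give a contraction; with 3 and 3/2 the
    difference of the two sides is half a perfect square.\<close>
  have pt: "(x :: real)\<^sup>2 \<le> 3 * (x - y)\<^sup>2 + 3 / 2 * y\<^sup>2" for x y
  proof -
    have "0 \<le> (2 * x - 3 * y)\<^sup>2 / 2" by simp
    also have "\<dots> = 3 * (x - y)\<^sup>2 + 3 / 2 * y\<^sup>2 - x\<^sup>2" by (simp add: power2_eq_square field_simps)
    finally show ?thesis by simp
  qed
  have inner: "ennreal ((u x)\<^sup>2) * ennreal ((R / 2) ^ ?d) \<le> 3 * (\<integral>\<^sup>+y\<in>Q. ennreal ((u x - u y)\<^sup>2) \<partial>lebesgue) + ennreal (3 / 2 * X')" for x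
  proof -
    have "ennreal ((u x)\<^sup>2) * ennreal ((R / 2) ^ ?d) = (\<integral>\<^sup>+y. ennreal ((u x)\<^sup>2) * indicator Q' y \<partial>lebesgue)"
      by (simp add: nn_integral_cmult_indicator eQ)
    also have "\<dots> \<le> (\<integral>\<^sup>+y. 3 * (ennreal ((u x - u y)\<^sup>2) * indicator Q y) + ennreal (3 / 2) * (ennreal ((u y)\<^sup>2) * indicator Q' y) \<partial>lebesgue)"
    proof (rule nn_integral_mono)
      fix y
      have "ennreal ((u x)\<^sup>2) \<le> ennreal (3 * (u x - u y)\<^sup>2 + 3 / 2 * (u y)\<^sup>2)" by (rule ennreal_leI[OF pt])
      also have "\<dots> = 3 * ennreal ((u x - u y)\<^sup>2) + ennreal (3 / 2) * ennreal ((u y)\<^sup>2)"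
      proof -
        have "ennreal (3 * (u x - u y)\<^sup>2) = 3 * ennreal ((u x - u y)\<^sup>2)" by (subst ennreal_mult) auto
        moreover have "ennreal (3 / 2 * (u y)\<^sup>2) = ennreal (3 / 2) * ennreal ((u y)\<^sup>2)" by (rule ennreal_mult) auto
        ultimately show ?thesis by (subst ennreal_plus) simp_all
      qed
      finally show "ennreal ((u x)\<^sup>2) * indicator Q' y \<le> 3 * (ennreal ((u x - u y)\<^sup>2) * indicator Q y) + ennreal (3 / 2) * (ennreal ((u y)\<^sup>2) * indicator Q' y)"
        using sub by (auto simp: indicator_def)
    qed
    also have "\<dots> = 3 * (\<integral>\<^sup>+y\<in>Q. ennreal ((u x - u y)\<^sup>2) \<partial>lebesgue) + ennreal (3 / 2) * ennreal X'"
      by (simp add: nn_integral_add nn_integral_cmult X'(1))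
    also have "ennreal (3 / 2) * ennreal X' = ennreal (3 / 2 * X')" using X'(2) by (intro ennreal_mult[symmetric]) auto
    finally show ?thesis .
  qed
  have pm[measurable]: "(\<lambda>(x, y). ennreal ((u x - u y)\<^sup>2) * indicator Q y) \<in> borel_measurable (lebesgue \<Otimes>\<^sub>M lebesgue)" by measurable
  have im[measurable]: "(\<lambda>x. \<integral>\<^sup>+y\<in>Q. ennreal ((u x - u y)\<^sup>2) \<partial>lebesgue) \<in> borel_measurable lebesgue"
    by (rule lebesgue.borel_measurable_nn_integral[OF pm])
  have "ennreal (X * (R / 2) ^ ?d) = (\<integral>\<^sup>+x. ennreal ((R / 2) ^ ?d) * (ennreal ((u x)\<^sup>2) * indicator Q x) \<partial>lebesgue)"
    using X R by (subst nn_integral_cmult) (auto simp: ennreal_mult mult.commute)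
  also have "\<dots> \<le> (\<integral>\<^sup>+x. 3 * ((\<integral>\<^sup>+y\<in>Q. ennreal ((u x - u y)\<^sup>2) \<partial>lebesgue) * indicator Q x) + ennreal (3 / 2 * X') * indicator Q x \<partial>lebesgue)"
    by (intro nn_integral_mono) (use inner in \<open>auto simp: indicator_def mult.commute\<close>)
  also have "\<dots> = 3 * T + ennreal (3 / 2 * X') * ennreal (R ^ ?d)"
    by (simp add: nn_integral_add nn_integral_cmult nn_integral_cmult_indicator eQ T_def)
  also have "\<dots> = ennreal (3 * T' + 3 / 2 * X' * R ^ ?d)"
  proof -
    have "3 * T = ennreal (3 * T')" unfolding T'(1) using T'(2) by (subst ennreal_mult) auto
    moreover have "ennreal (3 / 2 * X') * ennreal (R ^ ?d) = ennreal (3 / 2 * X' * R ^ ?d)"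
      using X'(2) R by (intro ennreal_mult[symmetric]) auto
    ultimately show ?thesis using T'(2) X'(2) R by (simp add: ennreal_plus)
  qed
  finally have "X * (R / 2) ^ ?d \<le> 3 * T' + 3 / 2 * X' * R ^ ?d"
    by (subst (asm) ennreal_le_iff) (use T'(2) X'(2) R in auto)
  then have "X * (R / 2) ^ ?d / ((R / 2) ^ ?d * R ^ ?d * R\<^sup>2) \<le> (3 * T' + 3 / 2 * X' * R ^ ?d) / ((R / 2) ^ ?d * R ^ ?d * R\<^sup>2)"
    using R by (intro divide_right_mono) auto
  also have "X * (R / 2) ^ ?d / ((R / 2) ^ ?d * R ^ ?d * R\<^sup>2) = F R" using R by (simp add: F field_simps)
  also have "(3 * T' + 3 / 2 * X' * R ^ ?d) / ((R / 2) ^ ?d * R ^ ?d * R\<^sup>2) = 3 * 2 ^ ?d * (T' / (R ^ ?d * R ^ ?d * R\<^sup>2)) + 3 / 8 * F (R / 2)"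
  proof -
    have "(3 * t + 3 / 2 * x * p) / (p / q * p * s) = 3 * q * (t / (p * p * s)) + 3 / 8 * (1 / (s / 4) * (x / (p / q)))"
      if "p \<noteq> 0" "q \<noteq> 0" "s \<noteq> 0" for p q s t x :: real
      using that by (simp add: field_simps)
    from this[of "R ^ ?d" "2 ^ ?d" "R\<^sup>2" T' X'] show ?thesis
      using R by (simp add: F power_divide)
  qed
  finally have "F R \<le> 3 * 2 ^ ?d * (T' / (R ^ ?d * R ^ ?d * R\<^sup>2)) + 3 / 8 * F (R / 2)" .
  moreover have "enn2real T = T'" using T' by simp
  ultimately show ?thesis unfolding T_def Q_def u_def by simp
qed

text \<open>The order of choices matters. First n is taken so large that, by the ergodic theorem,
  the limiting average of |g - h n|^2 is small; for this fixed n, the bound on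
  \<open>\<zeta> n\<close> is then beaten by the factor 1/R^2.\<close>

lemma AE_sublinear: "AE a in M. sublinear (potential a)"
proof -
  define e where "e n = (LINT a|M. (norm (g a - h n a))\<^sup>2)" for n
  have fin: "(\<integral>\<^sup>+a. ennreal ((norm (g a - h n a))\<^sup>2) \<partial>M) < \<infinity>" for n
    using diff_L2[of n] by (simp add: norm_minus_commute)
  have i: "integrable M (\<lambda>a. (norm (g a - h n a))\<^sup>2)" for n
    by (rule integrable_norm_sq[OF _ fin]) measurable
  have elim0: "e \<longlonglongrightarrow> 0"
  proof -
    have "ennreal (e n) = (\<integral>\<^sup>+a. ennreal ((norm (h n a - g a))\<^sup>2) \<partial>M)" for n
      unfolding e_def by (subst nn_integral_eq_integral[OF i, symmetric]) (auto simp: norm_minus_commute)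
    then have "(\<lambda>n. ennreal (e n)) \<longlonglongrightarrow> ennreal 0" using h_tendsto_g by simp
    then show ?thesis by (subst (asm) tendsto_ennreal_iff) (auto simp: e_def)
  qed
  obtain C where C: "C > 0" "\<And>a n R. good a \<Longrightarrow> R > 0 \<Longrightarrow>
      (\<integral>\<^sup>+x\<in>cube 0 R. (\<integral>\<^sup>+y\<in>cube 0 R. ennreal (((potential a x - \<zeta> n (shift x a)) - (potential a y - \<zeta> n (shift y a)))\<^sup>2) \<partial>lebesgue) \<partial>lebesgue)
        \<le> ennreal (C * R\<^sup>2 * R ^ CARD('n)) * (\<integral>\<^sup>+x\<in>cube 0 R. ennreal ((norm (g (shift x a) - h n (shift x a)))\<^sup>2) \<partial>lebesgue)"
    by (rule potential_poincare) blast
  have "AE a in M. \<forall>n. ((\<lambda>R. average (cube 0 R) (\<lambda>z. (norm (g (shift z a) - h n (shift z a)))\<^sup>2)) \<longlongrightarrow> e n) at_top"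
    unfolding AE_all_countable e_def using ergodic_average[OF i] by blast
  then show ?thesis using AE_good
  proof eventually_elim
    case (elim a)
    then have erg: "\<And>n. ((\<lambda>R. average (cube 0 R) (\<lambda>z. (norm (g (shift z a) - h n (shift z a)))\<^sup>2)) \<longlongrightarrow> e n) at_top"
      and a: "good a" by auto
    have sp: "a \<in> space M" using a by (rule space_good)
    let ?d = "CARD('n)"
    define T where "T R = enn2real (\<integral>\<^sup>+x\<in>cube 0 R. (\<integral>\<^sup>+y\<in>cube 0 R. ennreal ((potential a x - potential a y)\<^sup>2) \<partial>lebesgue) \<partial>lebesgue)" for R
    define S where "S R = T R / (R ^ ?d * R ^ ?d * R\<^sup>2)" for R
    define F where "F R = 1 / R\<^sup>2 * average (cube 0 R) (\<lambda>y. \<bar>potential a y\<bar>\<^sup>2)" for R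
    have S0: "S R \<ge> 0" if "R > 0" for R using that by (simp add: S_def T_def)
    have Slim: "(S \<longlongrightarrow> 0) at_top"
    proof (rule order_tendstoI)
      fix y :: real assume y: "y < 0"
      show "\<forall>\<^sub>F R in at_top. y < S R"
        using eventually_gt_at_top[of "0 :: real"]
      proof eventually_elim
        case (elim R)
        then show ?case using S0[of R] y by linarith
      qed
    next
      fix y :: real assume y: "0 < y"
      have "(\<lambda>n. 2 * C * e n) \<longlonglongrightarrow> 2 * C * 0" by (intro tendsto_intros elim0)
      then have "\<forall>\<^sub>F n in sequentially. 2 * C * e n < y" by (rule order_tendstoD(2)) (use y in simp)
      then obtain n where n: "2 * C * e n < y" by (auto simp: eventually_sequentially)
      obtain z where z: "z \<ge> 0" "\<And>a. a \<in> space M \<Longrightarrow> \<bar>\<zeta> n a\<bar> \<le> z"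
        using bdd_measE[OF zeta_bdd[of n]] by (metis real_norm_def)
      define U where "U R = 2 * C * average (cube 0 R) (\<lambda>x. (norm (g (shift x a) - h n (shift x a)))\<^sup>2) + 8 * z\<^sup>2 * (inverse R * inverse R)" for R
      have "(U \<longlongrightarrow> 2 * C * e n + 8 * z\<^sup>2 * (0 * 0)) at_top"
        unfolding U_def by (intro tendsto_intros erg tendsto_inverse_0_at_top filterlim_ident)
      then have "\<forall>\<^sub>F R in at_top. U R < y" by (rule order_tendstoD(2)) (use n in simp)
      then show "\<forall>\<^sub>F R in at_top. S R < y"
        using eventually_gt_at_top[of "0 :: real"]
      proof eventually_elim
        case (elim R)
        have R: "R > 0" by fact
        have "T R \<le> R ^ ?d * R ^ ?d * (2 * C * R\<^sup>2 * average (cube 0 R) (\<lambda>x. (norm (g (shift x a) - h n (shift x a)))\<^sup>2) + 8 * z\<^sup>2)"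
          unfolding T_def by (rule oscillation_finite(2)[OF a R z C(1) C(2)[OF a R]])
        then have "S R \<le> R ^ ?d * R ^ ?d * (2 * C * R\<^sup>2 * average (cube 0 R) (\<lambda>x. (norm (g (shift x a) - h n (shift x a)))\<^sup>2) + 8 * z\<^sup>2) / (R ^ ?d * R ^ ?d * R\<^sup>2)"
          unfolding S_def using R by (intro divide_right_mono) auto
        also have "\<dots> = U R" using R by (simp add: U_def field_simps power2_eq_square)
        finally show ?case using elim by simp
      qed
    qed
    have "(F \<longlongrightarrow> 0) at_top"
    proof (rule dyadic_decay[where \<delta>="\<lambda>R. 3 * 2 ^ ?d * S R"])
      show "F R \<ge> 0" for R
        unfolding F_def average_def set_lebesgue_integral_def
        by (intro mult_nonneg_nonneg integral_nonneg_AE AE_I2) auto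
      have "((\<lambda>R. 3 * 2 ^ ?d * S R) \<longlongrightarrow> 3 * 2 ^ ?d * 0) at_top" by (intro tendsto_mult tendsto_const Slim)
      then show "((\<lambda>R. 3 * 2 ^ ?d * S R) \<longlongrightarrow> 0) at_top" by simp
      show "F R \<le> 3 * 2 ^ ?d * S R + 3 / 8 * F (R / 2)" if "R > 0" for R
        using growth_recursion[OF a that] by (simp add: F_def S_def T_def)
      \<comment> \<open>For radii between r and 2r the largest cube bounds the integrals and the
        smallest radius bounds the prefactors.\<close>
      show "\<exists>B. \<forall>R\<in>{r..2 * r}. F R \<le> B" if r: "r > 0" for r
      proof -
        have pm: "(\<lambda>y. \<bar>potential a y\<bar>\<^sup>2) \<in> borel_measurable lebesgue" using potential_meas[OF sp] by measurable
        have r2: "2 * r > 0" using r by simp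
        have "(\<integral>\<^sup>+x\<in>cube 0 (2 * r). ennreal (\<bar>potential a x\<bar>\<^sup>2) \<partial>lebesgue) < \<infinity>"
          using L2_loc_nn_integral[OF potential_L2[OF a] bounded_cube[OF r2] cube_sets[OF r2]] by simp
        then obtain X where X: "(\<integral>\<^sup>+x\<in>cube 0 (2 * r). ennreal (\<bar>potential a x\<bar>\<^sup>2) \<partial>lebesgue) = ennreal X" "X \<ge> 0"
          by (cases "\<integral>\<^sup>+x\<in>cube 0 (2 * r). ennreal (\<bar>potential a x\<bar>\<^sup>2) \<partial>lebesgue") auto
        have "F R \<le> 1 / r\<^sup>2 * (X / r ^ ?d)" if R: "R \<in> {r..2 * r}" for R
        proof -
          have R0: "R > 0" using R r by auto
          have sub: "cube (0 :: real ^ 'n) R \<subseteq> cube 0 (2 * r)" using R R0 by (intro cube_mono) auto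
          have "(\<integral>\<^sup>+x\<in>cube 0 R. ennreal (\<bar>potential a x\<bar>\<^sup>2) \<partial>lebesgue) \<le> ennreal X"
            unfolding X(1)[symmetric] by (intro nn_integral_mono) (use sub in \<open>auto simp: indicator_def\<close>)
          then have "enn2real (\<integral>\<^sup>+x\<in>cube 0 R. ennreal (\<bar>potential a x\<bar>\<^sup>2) \<partial>lebesgue) \<le> X" using X(2) by (intro enn2real_leI)
          then have "average (cube 0 R) (\<lambda>y. \<bar>potential a y\<bar>\<^sup>2) \<le> X / r ^ ?d"
            unfolding average_eq[OF R0 _ pm, OF zero_le_power2] using R r X(2)
            by (intro frac_le power_mono) auto
          then show ?thesis unfolding F_def using R r X(2)
            by (intro mult_mono frac_le power_mono) (auto simp: average_def set_lebesgue_integral_def intro!: mult_nonneg_nonneg integral_nonneg_AE)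
        qed
        then show ?thesis by blast
      qed
    qed
    then have "((\<lambda>R. ereal (F R)) \<longlongrightarrow> ereal 0) at_top" by (intro tendsto_ereal)
    then have "Limsup at_top (\<lambda>R. ereal (F R)) = ereal 0" by (intro lim_imp_Limsup) auto
    then show ?case unfolding sublinear_def F_def by (simp add: zero_ereal_def)
  qed
qed

end

subsection \<open>The equation\<close>

lemma (in pair_sigma_finite) integrable_pair_bound:
  fixes f :: "'a \<times> 'b \<Rightarrow> 'c::{banach, second_countable_topology}"
  assumes f[measurable]: "f \<in> borel_measurable (M1 \<Otimes>\<^sub>M M2)"
    and bd: "\<And>x y. norm (f (x, y)) \<le> u x * v y"
    and u: "integrable M1 u" "\<And>x. u x \<ge> 0" and v: "integrable M2 v" "\<And>y. v y \<ge> 0"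
  shows "integrable (M1 \<Otimes>\<^sub>M M2) f"
proof (rule integrableI_bounded[OF f])
  have [measurable]: "u \<in> borel_measurable M1" "v \<in> borel_measurable M2" using u(1) v(1) by auto
  have "(\<integral>\<^sup>+p. norm (f p) \<partial>(M1 \<Otimes>\<^sub>M M2)) = (\<integral>\<^sup>+x. (\<integral>\<^sup>+y. norm (f (x, y)) \<partial>M2) \<partial>M1)"
    by (rule M2.nn_integral_fst[symmetric]) measurable
  also have "\<dots> \<le> (\<integral>\<^sup>+x. (\<integral>\<^sup>+y. ennreal (u x) * ennreal (v y) \<partial>M2) \<partial>M1)"
    using bd u(2) v(2) by (intro nn_integral_mono) (simp add: ennreal_mult[symmetric] ennreal_leI)
  also have "\<dots> = (\<integral>\<^sup>+x. ennreal (u x) \<partial>M1) * (\<integral>\<^sup>+y. ennreal (v y) \<partial>M2)"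
    by (simp add: nn_integral_cmult nn_integral_multc)
  also have "\<dots> = ennreal (integral\<^sup>L M1 u) * ennreal (integral\<^sup>L M2 v)"
    using u v by (simp add: nn_integral_eq_integral)
  also have "\<dots> < \<infinity>" by (simp add: ennreal_mult_less_top)
  finally show "(\<integral>\<^sup>+p. norm (f p) \<partial>(M1 \<Otimes>\<^sub>M M2)) < \<infinity>" .
qed

lemma L1_loc_bounded:
  fixes f :: "real ^ 'n \<Rightarrow> real"
  assumes f: "f \<in> borel_measurable lebesgue" and c: "\<And>x. \<bar>f x\<bar> \<le> c"
  shows "L1_loc f"
  unfolding L1_loc_def set_integrable_def
proof (intro allI impI)
  fix K :: "(real ^ 'n) set" assume "compact K"
  then have K: "K \<in> sets lebesgue" "bounded K" by (auto simp: lmeasurable_compact fmeasurableD compact_imp_bounded)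
  show "integrable lebesgue (\<lambda>y. indicator K y *\<^sub>R f y)"
    by (rule integrableI_bounded_set_indicator[where B=c, OF K(1) f emeasure_bounded_finite[OF K(2,1)]])
       (rule AE_I2, use c in simp)
qed

text \<open>There are uncountably many test functions but only countably many \<open>moll n\<close>,
  so conditions on translates of the latter can hold outside a single null set of environments.
  Weighting a translate by \<open>\<theta>\<close> and integrating over the translation gives the
  mollified \<open>\<theta>\<close>, and in the limit \<open>\<theta>\<close> itself.\<close>

lemma distr_div_zero_mollified:
  fixes F :: "real ^ 'n \<Rightarrow> real ^ 'n"
  assumes F: "L1_loc F" and 0: "\<And>n. AE x in lebesgue. (LINT y|lebesgue. F y \<bullet> gradient (moll n) (y - x)) = 0"
  shows "distr_div_zero F"
  unfolding distr_div_zero_def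
proof (intro conjI allI impI F)
  fix \<theta> :: "real ^ 'n \<Rightarrow> real" assume "test_function \<theta>"
  then have c: "C1c \<theta> (gradient \<theta>)" by (rule test_function_C1c)
  have Fm[measurable]: "F \<in> borel_measurable lebesgue" by (rule L1_loc_set_measurable[OF F])
  have Fi: "L1_loc (\<lambda>x. F x $ i)" for i by (rule L1_loc_nth[OF F])
  have \<theta>L: "L1_loc \<theta>" using c by (intro L1_loc_continuous) (simp add: C1c_def Cc_def)
  have \<theta>m[measurable]: "\<theta> \<in> borel_measurable lebesgue" by (rule L1_loc_set_measurable[OF \<theta>L])
  obtain r where r: "\<And>x. norm x \<ge> r \<Longrightarrow> \<theta> x = 0" using Cc_support[OF C1cD(1)[OF c]] by blast
  have Cg: "Cc (\<lambda>y. gradient \<theta> y $ i)" for i by (intro Cc_nth C1cD(2)[OF c])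
  have CcL: "L1_loc k" if "Cc k" for k :: "real ^ 'n \<Rightarrow> real" using that by (intro L1_loc_continuous) (simp add: Cc_def)
  have Cconv: "Cc (conv (moll n) k)" if k: "Cc k" for n and k :: "real ^ 'n \<Rightarrow> real"
  proof -
    obtain s where s: "s > 0" "\<And>x. norm x \<ge> s \<Longrightarrow> k x = 0" using Cc_support[OF k] by blast
    have "conv (moll n) k x = 0" if "norm x \<ge> s + 1" for x
      by (rule conv_moll_support[of s]) (use s that in auto)
    then show ?thesis unfolding Cc_def using conv_continuous[OF CcL[OF k] Cc_moll] by blast
  qed
  have zero: "(\<Sum>i\<in>UNIV. LINT y|lebesgue. F y $ i * conv (moll n) (\<lambda>z. gradient \<theta> z $ i) y) = 0" for n
  proof -
    let ?\<gamma> = "gradient (moll n) :: real ^ 'n \<Rightarrow> real ^ 'n"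
    have g: "Cc ?\<gamma>" by (rule C1cD(2)[OF C1c_moll])
    have gm[measurable]: "?\<gamma> \<in> borel_measurable borel" by (rule Cc_measurable[OF g])
    obtain B where B: "B > 0" "\<And>x. norm (?\<gamma> x) \<le> B" using Cc_bounded[OF g] by blast
    have g0: "?\<gamma> z = 0" if "norm z \<ge> 1" for z
    proof (rule C1c_zero_gradient[OF C1c_moll moll_nonneg])
      have "1 / (real n + 1) \<le> 1" by simp
      then show "moll n z = 0" using that by (intro moll_support) linarith
    qed
    have [measurable]: "(\<lambda>x. x) \<in> lebesgue \<rightarrow>\<^sub>M (borel :: (real ^ 'n) measure)"
      by (rule measurable_completion) simp
    have d[measurable]: "(\<lambda>(x, y). y - x) \<in> borel_measurable (lebesgue \<Otimes>\<^sub>M (lebesgue :: (real ^ 'n) measure))"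
      unfolding split_beta'
      by (intro borel_measurable_diff measurable_compose[OF measurable_fst] measurable_compose[OF measurable_snd]) measurable
    have pm[measurable]: "(\<lambda>(x, y). ?\<gamma> (y - x)) \<in> borel_measurable (lebesgue \<Otimes>\<^sub>M (lebesgue :: (real ^ 'n) measure))"
      using measurable_compose[OF d gm] by (simp add: split_beta')
    define K where "K = cball (0 :: real ^ 'n) (r + 1)"
    have iK: "integrable lebesgue (\<lambda>y. B * norm (indicator K y *\<^sub>R F y))"
      using F unfolding L1_loc_def set_integrable_def K_def by (intro integrable_mult_right integrable_norm) auto
    have int: "integrable (lebesgue \<Otimes>\<^sub>M lebesgue) (\<lambda>(x, y). \<theta> x * (F y \<bullet> ?\<gamma> (y - x)))"
    proof (rule lebesgue_pair.integrable_pair_bound)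
      show "(\<lambda>(x, y). \<theta> x * (F y \<bullet> ?\<gamma> (y - x))) \<in> borel_measurable (lebesgue \<Otimes>\<^sub>M lebesgue)"
        by measurable
      show "integrable lebesgue (\<lambda>x. \<bar>\<theta> x\<bar>)" using Cc_integrable[OF C1cD(1)[OF c]] by (rule integrable_abs)
      show "integrable lebesgue (\<lambda>y. B * norm (indicator K y *\<^sub>R F y))" by (rule iK)
      fix x y :: "real ^ 'n"
      show "norm (case (x, y) of (x, y) \<Rightarrow> \<theta> x * (F y \<bullet> ?\<gamma> (y - x))) \<le> \<bar>\<theta> x\<bar> * (B * norm (indicator K y *\<^sub>R F y))"
      proof (cases "norm x \<ge> r \<or> norm (y - x) \<ge> 1")
        case True
        then have z: "\<theta> x * (F y \<bullet> ?\<gamma> (y - x)) = 0" using r g0 by auto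
        show ?thesis unfolding prod.case z using B(1) by simp
      next
        case False
        then have "norm y \<le> r + 1" using norm_triangle_ineq2[of y x] by linarith
        then have yK: "y \<in> K" by (simp add: K_def)
        have "\<bar>F y \<bullet> ?\<gamma> (y - x)\<bar> \<le> norm (F y) * norm (?\<gamma> (y - x))" by (rule Cauchy_Schwarz_ineq2)
        also have "\<dots> \<le> norm (F y) * B" by (intro mult_left_mono B) simp
        finally have "\<bar>\<theta> x\<bar> * \<bar>F y \<bullet> ?\<gamma> (y - x)\<bar> \<le> \<bar>\<theta> x\<bar> * (norm (F y) * B)" by (rule mult_left_mono) simp
        then show ?thesis using yK by (simp add: abs_mult mult.commute)
      qed
    qed (use B(1) in auto)
    have "(LINT x|lebesgue. \<theta> x * (LINT y|lebesgue. F y \<bullet> ?\<gamma> (y - x))) = 0"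
      by (rule integral_eq_zero_AE) (use 0[of n] in \<open>eventually_elim, simp\<close>)
    then have "0 = (LINT x|lebesgue. (LINT y|lebesgue. \<theta> x * (F y \<bullet> ?\<gamma> (y - x))))" by simp
    \<comment> \<open>After the exchange the inner integral pairs \<open>F y\<close> with the
      gradient of the mollified \<open>\<theta>\<close>.\<close>
    also have "\<dots> = (LINT y|lebesgue. (LINT x|lebesgue. \<theta> x * (F y \<bullet> ?\<gamma> (y - x))))"
      by (rule lebesgue_pair.Fubini_integral[OF int, symmetric])
    also have "\<dots> = (LINT y|lebesgue. (\<Sum>i\<in>UNIV. F y $ i * conv (moll n) (\<lambda>z. gradient \<theta> z $ i) y))"
    proof (intro Bochner_Integration.integral_cong refl)
      fix y
      have "(LINT x|lebesgue. \<theta> x * (F y \<bullet> ?\<gamma> (y - x))) = (LINT x|lebesgue. F y \<bullet> (\<theta> x *\<^sub>R ?\<gamma> (y - x)))" by simp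
      also have "\<dots> = F y \<bullet> conv ?\<gamma> \<theta> y"
        unfolding conv_def by (rule integral_inner_right) (rule conv_integrable[OF \<theta>L g])
      also have "conv ?\<gamma> \<theta> y $ i = conv (moll n) (\<lambda>z. gradient \<theta> z $ i) y" for i
        unfolding gradient_conv[OF \<theta>L C1c_moll, symmetric]
        using conv_partial_moll[OF c, of i n y] by (simp add: gradient_def)
      then have "F y \<bullet> conv ?\<gamma> \<theta> y = (\<Sum>i\<in>UNIV. F y $ i * conv (moll n) (\<lambda>z. gradient \<theta> z $ i) y)"
        by (simp add: inner_vec_def)
      finally show "(LINT x|lebesgue. \<theta> x * (F y \<bullet> ?\<gamma> (y - x))) = (\<Sum>i\<in>UNIV. F y $ i * conv (moll n) (\<lambda>z. gradient \<theta> z $ i) y)" .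
    qed
    also have "\<dots> = (\<Sum>i\<in>UNIV. LINT y|lebesgue. F y $ i * conv (moll n) (\<lambda>z. gradient \<theta> z $ i) y)"
    proof (rule Bochner_Integration.integral_sum)
      fix i show "integrable lebesgue (\<lambda>y. F y $ i * conv (moll n) (\<lambda>z. gradient \<theta> z $ i) y)"
        using integrable_mult_Cc[OF Fi Cconv[OF Cg]] by simp
    qed
    finally show ?thesis by simp
  qed
  have "(\<lambda>n. \<Sum>i\<in>UNIV. LINT y|lebesgue. F y $ i * conv (moll n) (\<lambda>z. gradient \<theta> z $ i) y)
    \<longlonglongrightarrow> (\<Sum>i\<in>UNIV. LINT y|lebesgue. F y $ i * gradient \<theta> y $ i)"
    by (intro tendsto_sum tendsto_integral_conv_moll Fi Cg)
  then have "(\<lambda>n::nat. 0) \<longlonglongrightarrow> (\<Sum>i\<in>UNIV. LINT y|lebesgue. F y $ i * gradient \<theta> y $ i)"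
    by (simp only: zero)
  then have "(\<Sum>i\<in>UNIV. LINT y|lebesgue. F y $ i * gradient \<theta> y $ i) = 0"
    by (rule LIMSEQ_unique[OF _ tendsto_const])
  also have "(\<Sum>i\<in>UNIV. LINT y|lebesgue. F y $ i * gradient \<theta> y $ i) = (LINT y|lebesgue. (\<Sum>i\<in>UNIV. F y $ i * gradient \<theta> y $ i))"
  proof (rule Bochner_Integration.integral_sum[symmetric])
    fix i show "integrable lebesgue (\<lambda>y. F y $ i * gradient \<theta> y $ i)"
      using integrable_mult_Cc[OF Fi Cg] by simp
  qed
  finally show "(LINT x|lebesgue. gradient \<theta> x \<bullet> F x) = 0"
    by (simp add: inner_vec_def mult.commute)
qed

context corrector_sequence
begin

sublocale orbit': pair_sigma_finite "lebesgue :: (real ^ 'n) measure" M ..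

text \<open>Averaging a bounded function along its orbit gives an admissible pair, because seen
  along an orbit the average is an ordinary convolution. This supplies enough directions for the
  Euler-Lagrange equation.\<close>

lemma mollified_pair:
  assumes f: "bdd_meas f"
  shows "smooth_pair (\<lambda>a. LINT y|lebesgue. f (shift y a) *\<^sub>R moll n (0 - y))
    (\<lambda>a. LINT y|lebesgue. f (shift y a) *\<^sub>R gradient (moll n) (0 - y))"
proof -
  have fm[measurable]: "f \<in> borel_measurable M" by (rule bdd_meas_measurable[OF f])
  obtain c where c: "c \<ge> 0" "\<And>a. a \<in> space M \<Longrightarrow> norm (f a) \<le> c" using bdd_measE[OF f] by blast
  have [measurable]: "(\<lambda>(a, x). f (shift x a)) \<in> borel_measurable (M \<Otimes>\<^sub>M lebesgue)" by (rule orbit_measurable[OF fm])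
  have bL: "L1_loc (\<lambda>y. f (shift y a))" if a: "a \<in> space M" for a
    by (rule L1_loc_bounded[OF orbit_section_measurable[OF fm a]]) (use c(2)[OF shift_space[OF a]] in simp)
  have conv_eq: "(LINT y|lebesgue. f (shift y (shift x a)) *\<^sub>R k (0 - y)) = conv k (\<lambda>y. f (shift y a)) x"
    if a: "a \<in> space M" and k: "Cc k" for x a and k :: "real ^ 'n \<Rightarrow> 'z::euclidean_space"
  proof -
    have "(\<lambda>y. f (shift y a) *\<^sub>R k (x - y)) \<in> borel_measurable lebesgue"
      by (rule borel_measurable_integrable[OF conv_integrable[OF bL[OF a] k]])
    from integral_lebesgue_shift[OF this, of x]
    show ?thesis by (simp add: conv_def shift_shift add.commute)
  qed
  have bdd: "bdd_meas (\<lambda>a. LINT y|lebesgue. f (shift y a) *\<^sub>R k (0 - y))"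
    if k: "Cc k" for k :: "real ^ 'n \<Rightarrow> 'z::euclidean_space"
  proof (rule bdd_measI)
    have km[measurable]: "(\<lambda>y. k (0 - y)) \<in> borel_measurable lebesgue" by (intro Cc_lebesgue_measurable Cc_reflect k)
    show "(\<lambda>a. LINT y|lebesgue. f (shift y a) *\<^sub>R k (0 - y)) \<in> borel_measurable M"
      by (rule lebesgue.borel_measurable_lebesgue_integral) measurable
    fix a assume a: "a \<in> space M"
    show "norm (LINT y|lebesgue. f (shift y a) *\<^sub>R k (0 - y)) \<le> (LINT y|lebesgue. c * norm (k (0 - y)))"
    proof (rule Bochner_Integration.integral_norm_bound_integral)
      show "integrable lebesgue (\<lambda>y. f (shift y a) *\<^sub>R k (0 - y))" by (rule conv_integrable[OF bL[OF a] k])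
      show "integrable lebesgue (\<lambda>y. c * norm (k (0 - y)))"
        by (intro integrable_mult_right integrable_norm Cc_integrable Cc_reflect k)
      show "norm (f (shift y a) *\<^sub>R k (0 - y)) \<le> c * norm (k (0 - y))" for y
        using c(2)[OF shift_space[OF a, of y]] by (simp add: mult_right_mono)
    qed
  qed
  have g: "Cc (gradient (moll n) :: real ^ 'n \<Rightarrow> _)" by (rule C1cD(2)[OF C1c_moll])
  show ?thesis
    unfolding smooth_pair_def
  proof (intro conjI ballI allI)
    show "bdd_meas (\<lambda>a. LINT y|lebesgue. f (shift y a) *\<^sub>R moll n (0 - y))" by (rule bdd[OF Cc_moll])
    show "bdd_meas (\<lambda>a. LINT y|lebesgue. f (shift y a) *\<^sub>R gradient (moll n) (0 - y))" by (rule bdd[OF g])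
    fix a assume a: "a \<in> space M"
    show "continuous_on UNIV (\<lambda>x. LINT y|lebesgue. f (shift y (shift x a)) *\<^sub>R gradient (moll n) (0 - y))"
      unfolding conv_eq[OF a g] by (rule conv_continuous[OF bL[OF a] g])
    show "((\<lambda>x. LINT y|lebesgue. f (shift y (shift x a)) *\<^sub>R moll n (0 - y)) has_derivative
        (\<lambda>v. (LINT y|lebesgue. f (shift y (shift x a)) *\<^sub>R gradient (moll n) (0 - y)) \<bullet> v)) (at x)" for x
      unfolding conv_eq[OF a g] conv_eq[OF a Cc_moll] by (rule conv_has_derivative[OF bL[OF a] C1c_moll])
  qed
qed

text \<open>Duality: Euler-Lagrange is tested with the mollification of an arbitrary bounded
  \<open>f\<close>, and invariance moves the mollifier onto the flux. So \<open>W\<close> has zero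
  expectation against every bounded \<open>f\<close>, in particular against its own sign.\<close>

lemma flux_mollified_zero: "AE a in M. (LINT y|lebesgue. flux (shift y a) \<bullet> gradient (moll n) y) = 0"
proof -
  let ?\<gamma> = "gradient (moll n) :: real ^ 'n \<Rightarrow> real ^ 'n"
  have g: "Cc ?\<gamma>" by (rule C1cD(2)[OF C1c_moll])
  have gm[measurable]: "?\<gamma> \<in> borel_measurable lebesgue" by (rule Cc_lebesgue_measurable[OF g])
  have gr[measurable]: "(\<lambda>y. ?\<gamma> (0 - y)) \<in> borel_measurable lebesgue" by (intro Cc_lebesgue_measurable Cc_reflect g)
  have gi: "integrable lebesgue ?\<gamma>" by (rule Cc_integrable[OF g])
  have gri: "integrable lebesgue (\<lambda>y. ?\<gamma> (0 - y))" by (intro Cc_integrable Cc_reflect g)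
  have [measurable]: "(\<lambda>(y, a). shift y a) \<in> lebesgue \<Otimes>\<^sub>M M \<rightarrow>\<^sub>M M" using M_shift by (simp add: shift_measurable_def)
  have fl[measurable]: "(\<lambda>(y, a). flux (shift y a)) \<in> borel_measurable (lebesgue \<Otimes>\<^sub>M M)"
    using measurable_compose[OF M_shift[unfolded shift_measurable_def] flux_meas] by (simp add: split_beta')
  have fl2[measurable]: "(\<lambda>(a, y). flux (shift y a)) \<in> borel_measurable (M \<Otimes>\<^sub>M lebesgue)" by (rule orbit_measurable[OF flux_meas])
  define W where "W a = (LINT y|lebesgue. flux (shift y a) \<bullet> ?\<gamma> y)" for a
  have Wm[measurable]: "W \<in> borel_measurable M"
    unfolding W_def[abs_def] by (rule lebesgue.borel_measurable_lebesgue_integral) measurable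
  have q_int: "integrable (lebesgue \<Otimes>\<^sub>M M) (\<lambda>(y, a). f a * (flux (shift y a) \<bullet> ?\<gamma> y))" if f: "bdd_meas f" for f
  proof (rule integrableI_bounded)
    have fm[measurable]: "f \<in> borel_measurable M" by (rule bdd_meas_measurable[OF f])
    obtain c where c: "c \<ge> 0" "\<And>a. a \<in> space M \<Longrightarrow> norm (f a) \<le> c" using bdd_measE[OF f] by blast
    show qm[measurable]: "(\<lambda>(y, a). f a * (flux (shift y a) \<bullet> ?\<gamma> y)) \<in> borel_measurable (lebesgue \<Otimes>\<^sub>M M)" by measurable
    have "(\<integral>\<^sup>+p. ennreal (norm (case p of (y, a) \<Rightarrow> f a * (flux (shift y a) \<bullet> ?\<gamma> y))) \<partial>(lebesgue \<Otimes>\<^sub>M M))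
      = (\<integral>\<^sup>+y. (\<integral>\<^sup>+a. ennreal (norm (f a * (flux (shift y a) \<bullet> ?\<gamma> y))) \<partial>M) \<partial>lebesgue)"
      by (subst nn_integral_fst[symmetric]) auto
    also have "\<dots> \<le> (\<integral>\<^sup>+y. (\<integral>\<^sup>+a. ennreal (c * norm (?\<gamma> y)) * ennreal (norm (flux (shift y a))) \<partial>M) \<partial>lebesgue)"
    proof (intro nn_integral_mono)
      fix y a assume "a \<in> space M"
      have "norm (f a * (flux (shift y a) \<bullet> ?\<gamma> y)) \<le> c * (norm (flux (shift y a)) * norm (?\<gamma> y))"
        unfolding real_norm_def abs_mult using c(2)[OF \<open>a \<in> space M\<close>] c(1)
        by (intro mult_mono Cauchy_Schwarz_ineq2) auto
      then show "ennreal (norm (f a * (flux (shift y a) \<bullet> ?\<gamma> y))) \<le> ennreal (c * norm (?\<gamma> y)) * ennreal (norm (flux (shift y a)))"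
        using c(1) by (simp add: ennreal_mult[symmetric] ennreal_leI mult_ac)
    qed
    also have "\<dots> = (\<integral>\<^sup>+y. ennreal (c * norm (?\<gamma> y)) * (\<integral>\<^sup>+a. ennreal (norm (flux a)) \<partial>M) \<partial>lebesgue)"
    proof (rule nn_integral_cong)
      fix y
      have "(\<integral>\<^sup>+a. ennreal (norm (flux (shift y a))) \<partial>M) = (\<integral>\<^sup>+a. ennreal (norm (flux a)) \<partial>M)"
        by (rule nn_integral_shift) measurable
      then show "(\<integral>\<^sup>+a. ennreal (c * norm (?\<gamma> y)) * ennreal (norm (flux (shift y a))) \<partial>M) = ennreal (c * norm (?\<gamma> y)) * (\<integral>\<^sup>+a. ennreal (norm (flux a)) \<partial>M)"
        by (subst nn_integral_cmult) measurable
    qed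
    also have "\<dots> = (\<integral>\<^sup>+y. ennreal (c * norm (?\<gamma> y)) \<partial>lebesgue) * (\<integral>\<^sup>+a. ennreal (norm (flux a)) \<partial>M)"
      by (rule nn_integral_multc) measurable
    also have "\<dots> < \<infinity>"
    proof -
      have "integrable lebesgue (\<lambda>y. c * norm (?\<gamma> y))" using gi by (intro integrable_mult_right integrable_norm)
      then have "(\<integral>\<^sup>+y. ennreal (c * norm (?\<gamma> y)) \<partial>lebesgue) < \<infinity>"
        using c(1) by (simp add: nn_integral_eq_integral)
      moreover have "(\<integral>\<^sup>+a. ennreal (norm (flux a)) \<partial>M) < \<infinity>" using flux_integrable by (simp add: integrable_iff_bounded)
      ultimately show ?thesis by (simp add: ennreal_mult_less_top)
    qed
    finally show "(\<integral>\<^sup>+p. ennreal (norm (case p of (y, a) \<Rightarrow> f a * (flux (shift y a) \<bullet> ?\<gamma> y))) \<partial>(lebesgue \<Otimes>\<^sub>M M)) < \<infinity>" .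
  qed
  have dual: "(LINT a|M. f a * W a) = 0" if f: "bdd_meas f" for f
  proof -
    have fm[measurable]: "f \<in> borel_measurable M" by (rule bdd_meas_measurable[OF f])
    obtain c where c: "c \<ge> 0" "\<And>a. a \<in> space M \<Longrightarrow> norm (f a) \<le> c" using bdd_measE[OF f] by blast
    have [measurable]: "(\<lambda>(a, x). f (shift x a)) \<in> borel_measurable (M \<Otimes>\<^sub>M lebesgue)" by (rule orbit_measurable[OF fm])
    have bL: "L1_loc (\<lambda>y. f (shift y a))" if a: "a \<in> space M" for a
      by (rule L1_loc_bounded[OF orbit_section_measurable[OF fm a]]) (use c(2)[OF shift_space[OF a]] in simp)
    \<comment> \<open>Set to zero off the space, since the product majorant used for joint
      integrability has to hold at all points.\<close>
    define p where "p a y = (if a \<in> space M then f (shift y a) * (flux a \<bullet> ?\<gamma> (0 - y)) else 0)" for a y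
    have p_int: "integrable (M \<Otimes>\<^sub>M lebesgue) (\<lambda>(a, y). p a y)"
    proof (rule orbit.integrable_pair_bound)
      have "(\<lambda>(a, y). f (shift y a) * (flux a \<bullet> ?\<gamma> (0 - y))) \<in> borel_measurable (M \<Otimes>\<^sub>M lebesgue)" by measurable
      then show "(\<lambda>(a, y). p a y) \<in> borel_measurable (M \<Otimes>\<^sub>M lebesgue)"
        by (rule measurable_cong[THEN iffD1, rotated]) (auto simp: p_def space_pair_measure)
      show "integrable M (\<lambda>a. c * norm (flux a))" using flux_integrable by (intro integrable_mult_right integrable_norm)
      show "integrable lebesgue (\<lambda>y. norm (?\<gamma> (0 - y)))" using gri by (rule integrable_norm)
      fix a y
      show "norm (case (a, y) of (a, y) \<Rightarrow> p a y) \<le> c * norm (flux a) * norm (?\<gamma> (0 - y))"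
      proof (cases "a \<in> space M")
        case True
        have "\<bar>f (shift y a)\<bar> * \<bar>flux a \<bullet> ?\<gamma> (0 - y)\<bar> \<le> c * (norm (flux a) * norm (?\<gamma> (0 - y)))"
          using c(2)[OF shift_space[OF True, of y]] c(1) by (intro mult_mono Cauchy_Schwarz_ineq2) auto
        then show ?thesis using True by (simp add: p_def abs_mult mult.assoc)
      qed (use c(1) in \<open>simp add: p_def\<close>)
    qed (use c(1) in auto)
    have "0 = (LINT a|M. flux a \<bullet> (LINT y|lebesgue. f (shift y a) *\<^sub>R ?\<gamma> (0 - y)))"
      using euler_lagrange[OF mollified_pair[OF f]] by simp
    also have "\<dots> = (LINT a|M. (LINT y|lebesgue. p a y))"
    proof (intro Bochner_Integration.integral_cong refl)
      fix a assume a: "a \<in> space M"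
      have "flux a \<bullet> (LINT y|lebesgue. f (shift y a) *\<^sub>R ?\<gamma> (0 - y)) = (LINT y|lebesgue. flux a \<bullet> (f (shift y a) *\<^sub>R ?\<gamma> (0 - y)))"
        by (rule integral_inner_right[symmetric]) (rule conv_integrable[OF bL[OF a] g])
      then show "flux a \<bullet> (LINT y|lebesgue. f (shift y a) *\<^sub>R ?\<gamma> (0 - y)) = (LINT y|lebesgue. p a y)"
        using a by (simp add: p_def)
    qed
    also have "\<dots> = (LINT y|lebesgue. (LINT a|M. p a y))"
      by (rule orbit.Fubini_integral[OF p_int, symmetric])
    also have "\<dots> = (LINT y|lebesgue. (LINT a|M. f a * (flux (shift (0 - y) a) \<bullet> ?\<gamma> (0 - y))))"
    proof (rule Bochner_Integration.integral_cong[OF refl])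
      fix y
      have m: "(\<lambda>a. f (shift y a) * (flux a \<bullet> ?\<gamma> (0 - y))) \<in> borel_measurable M" by measurable
      have "(LINT a|M. p a y) = (LINT a|M. f (shift y a) * (flux a \<bullet> ?\<gamma> (0 - y)))"
        by (intro Bochner_Integration.integral_cong) (auto simp: p_def)
      \<comment> \<open>Shifting the environment by -y frees \<open>f\<close> of the translation and
        puts it on the flux.\<close>
      also have "\<dots> = (LINT a|M. f (shift y (shift (0 - y) a)) * (flux (shift (0 - y) a) \<bullet> ?\<gamma> (0 - y)))"
        by (rule integral_shift[OF m, symmetric])
      finally show "(LINT a|M. p a y) = (LINT a|M. f a * (flux (shift (0 - y) a) \<bullet> ?\<gamma> (0 - y)))"
        by (simp add: shift_shift)
    qed
    also have "\<dots> = (LINT y|lebesgue. (LINT a|M. f a * (flux (shift y a) \<bullet> ?\<gamma> y)))"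
    proof (rule integral_reflect[where f="\<lambda>y. LINT a|M. f a * (flux (shift y a) \<bullet> ?\<gamma> y)" and x=0])
      show "(\<lambda>y. LINT a|M. f a * (flux (shift y a) \<bullet> ?\<gamma> y)) \<in> borel_measurable lebesgue"
        by (rule borel_measurable_lebesgue_integral) measurable
    qed
    also have "\<dots> = (LINT a|M. (LINT y|lebesgue. f a * (flux (shift y a) \<bullet> ?\<gamma> y)))"
      by (rule orbit'.Fubini_integral[OF q_int[OF f], symmetric])
    finally show ?thesis by (simp add: W_def)
  qed
  have "bdd_meas (\<lambda>a. sgn (W a))" by (rule bdd_measI[of _ 1]) (auto simp: sgn_if)
  from dual[OF this] have z: "(LINT a|M. \<bar>W a\<bar>) = 0" by (simp add: abs_sgn mult.commute)
  have "integrable M (\<lambda>a. LINT y|lebesgue. 1 * (flux (shift y a) \<bullet> ?\<gamma> y))"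
    by (rule orbit'.integrable_snd[OF q_int[OF bdd_meas_const]])
  then have "integrable M W" by (simp add: W_def[abs_def])
  then have "integrable M (\<lambda>a. \<bar>W a\<bar>)" by simp
  then have "AE a in M. \<bar>W a\<bar> = 0" using z by (subst (asm) integral_nonneg_eq_0_iff_AE) auto
  then show ?thesis by (simp add: W_def)
qed

text \<open>\<open>AE_orbit\<close> spreads the identity at the origin to almost every translate,
  and countability of the mollifiers leaves one exceptional event.\<close>

lemma AE_flux_equation: "AE a in M. \<forall>n. AE x in lebesgue. (LINT y|lebesgue. flux (shift y a) \<bullet> gradient (moll n) (y - x)) = 0"
  unfolding AE_all_countable
proof
  fix n
  show "AE a in M. AE x in lebesgue. (LINT y|lebesgue. flux (shift y a) \<bullet> gradient (moll n) (y - x)) = 0"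
    using AE_orbit[OF flux_mollified_zero[of n]] AE_space
  proof eventually_elim
    case (elim a)
    from elim(1) show ?case
    proof eventually_elim
      case (elim x)
      have "Cc (\<lambda>y. gradient (moll n) (y - x))" by (intro Cc_translate C1cD(2)[OF C1c_moll])
      then have [measurable]: "(\<lambda>y. gradient (moll n) (y - x)) \<in> borel_measurable lebesgue" by (rule Cc_lebesgue_measurable)
      have [measurable]: "(\<lambda>y. flux (shift y a)) \<in> borel_measurable lebesgue"
        by (rule orbit_section_measurable[OF flux_meas \<open>a \<in> space M\<close>])
      have "(LINT y|lebesgue. flux (shift (y + x) a) \<bullet> gradient (moll n) (y + x - x)) = (LINT y|lebesgue. flux (shift y a) \<bullet> gradient (moll n) (y - x))"
        by (rule integral_lebesgue_shift[of "\<lambda>y. flux (shift y a) \<bullet> gradient (moll n) (y - x)"]) measurable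
      then show ?case using elim by (simp add: shift_shift add.commute)
    qed
  qed
qed

lemma flux_orbit_L1:
  assumes a: "good a" shows "L1_loc (\<lambda>x. flux (shift x a))"
proof (intro L2_loc_imp_L1_loc L2_locI)
  have sp: "a \<in> space M" using a by (rule space_good)
  show "(\<lambda>x. flux (shift x a)) \<in> borel_measurable lebesgue" by (rule orbit_section_measurable[OF flux_meas sp])
  fix k :: nat assume k: "k > 0"
  let ?Q = "cube (0 :: real ^ 'n) (real k)"
  have Q[measurable]: "?Q \<in> sets lebesgue" using k by simp
  have [measurable]: "(\<lambda>x. g (shift x a)) \<in> borel_measurable lebesgue" by (rule g_orbit_meas[OF sp])
  have "(\<integral>\<^sup>+x\<in>?Q. ennreal ((norm (flux (shift x a)))\<^sup>2) \<partial>lebesgue) \<le> (\<integral>\<^sup>+x\<in>?Q. ennreal ((norm (g (shift x a) + \<xi>))\<^sup>2) \<partial>lebesgue)"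
    unfolding flux_def by (intro nn_integral_mono mult_right_mono ennreal_leI power_mono coeff_at_bounds(2)) auto
  also have "\<dots> \<le> 2 * (\<integral>\<^sup>+x\<in>?Q. ennreal ((norm (g (shift x a)))\<^sup>2) \<partial>lebesgue) + 2 * (\<integral>\<^sup>+x\<in>?Q. ennreal ((norm \<xi>)\<^sup>2) \<partial>lebesgue)"
    by (rule set_nn_integral_norm_sq_triangle) measurable
  also have "\<dots> < \<infinity>"
  proof -
    have "(\<integral>\<^sup>+x\<in>?Q. ennreal ((norm (g (shift x a)))\<^sup>2) \<partial>lebesgue) < \<infinity>"
      using k by (intro L2_loc_nn_integral[OF g_orbit_L2[OF a]] bounded_cube) auto
    moreover have "(\<integral>\<^sup>+x\<in>?Q. ennreal ((norm \<xi>)\<^sup>2) \<partial>lebesgue) < \<infinity>"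
      using k by (simp add: nn_integral_cmult_indicator emeasure_cube ennreal_mult_less_top)
    ultimately show ?thesis by (simp add: ennreal_mult_less_top)
  qed
  finally show "(\<integral>\<^sup>+x\<in>?Q. ennreal ((norm (flux (shift x a)))\<^sup>2) \<partial>lebesgue) < \<infinity>" .
qed

text \<open>The flux was formed with the coefficient at the origin; along the orbit this agrees with
  \<open>a\<close> almost everywhere, and the weak formulation does not see the difference.\<close>

lemma AE_equation: "AE a in M. distr_div_zero (\<lambda>x. a x *v (g (shift x a) + \<xi>))"
  using AE_flux_equation AE_good
proof eventually_elim
  case (elim a)
  then have a: "good a" by simp
  have sp: "a \<in> space M" using a by (rule space_good)
  have div: "distr_div_zero (\<lambda>x. flux (shift x a))"
    by (rule distr_div_zero_mollified[OF flux_orbit_L1[OF a]]) (use elim in blast)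
  have eq: "AE x in lebesgue. flux (shift x a) = a x *v (g (shift x a) + \<xi>)"
    using coeff_at_shift[OF sp] by eventually_elim (simp add: flux_def)
  have m1[measurable]: "(\<lambda>x. flux (shift x a)) \<in> borel_measurable lebesgue" by (rule orbit_section_measurable[OF flux_meas sp])
  have am: "a \<in> borel_measurable lebesgue" using sp unfolding M_space Omega_def by blast
  have m2[measurable]: "(\<lambda>x. a x *v (g (shift x a) + \<xi>)) \<in> borel_measurable lebesgue"
    by (intro borel_measurable_matrix_vector am borel_measurable_add g_orbit_meas[OF sp] borel_measurable_const)
  show ?case
    unfolding distr_div_zero_def
  proof (intro conjI allI impI)
    show "L1_loc (\<lambda>x. a x *v (g (shift x a) + \<xi>))"
      unfolding L1_loc_def set_integrable_def
    proof (intro allI impI)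
      fix K :: "(real ^ 'n) set" assume K: "compact K"
      then have Km[measurable]: "K \<in> sets lebesgue" by (simp add: lmeasurable_compact fmeasurableD)
      have "integrable lebesgue (\<lambda>x. indicator K x *\<^sub>R flux (shift x a))"
        using flux_orbit_L1[OF a] K unfolding L1_loc_def set_integrable_def by blast
      then show "integrable lebesgue (\<lambda>x. indicator K x *\<^sub>R (a x *v (g (shift x a) + \<xi>)))"
      proof (rule integrable_cong_AE_imp)
        show "(\<lambda>x. indicator K x *\<^sub>R (a x *v (g (shift x a) + \<xi>))) \<in> borel_measurable lebesgue"
          by (intro borel_measurable_scaleR borel_measurable_indicator Km m2)
        show "AE x in lebesgue. indicator K x *\<^sub>R flux (shift x a) = indicator K x *\<^sub>R (a x *v (g (shift x a) + \<xi>))"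
          using eq by eventually_elim (simp only:)
      qed
    qed
    fix \<eta> :: "real ^ 'n \<Rightarrow> real" assume \<eta>: "test_function \<eta>"
    have [measurable]: "gradient \<eta> \<in> borel_measurable lebesgue"
      by (intro Cc_lebesgue_measurable C1cD(2)[OF test_function_C1c[OF \<eta>]])
    have "(LINT x|lebesgue. gradient \<eta> x \<bullet> (a x *v (g (shift x a) + \<xi>))) = (LINT x|lebesgue. gradient \<eta> x \<bullet> flux (shift x a))"
    proof (rule integral_cong_AE)
      show "AE x in lebesgue. gradient \<eta> x \<bullet> (a x *v (g (shift x a) + \<xi>)) = gradient \<eta> x \<bullet> flux (shift x a)"
        using eq by eventually_elim (simp only:)
    qed (intro borel_measurable_inner m1 m2, measurable)+
    then show "(LINT x|lebesgue. gradient \<eta> x \<bullet> (a x *v (g (shift x a) + \<xi>))) = 0"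
      using div \<eta> by (simp add: distr_div_zero_def)
  qed
qed

end

lemma sublinear_tendsto:
  fixes u :: "real ^ 'n \<Rightarrow> real"
  assumes "sublinear u"
  shows "((\<lambda>R. 1 / R\<^sup>2 * average (cube 0 R) (\<lambda>y. \<bar>u y\<bar>\<^sup>2)) \<longlongrightarrow> 0) at_top"
proof -
  let ?F = "\<lambda>R. 1 / R\<^sup>2 * average (cube 0 R) (\<lambda>y. \<bar>u y\<bar>\<^sup>2)"
  have nonneg: "0 \<le> ?F R" for R
    unfolding average_def set_lebesgue_integral_def
    by (intro mult_nonneg_nonneg integral_nonneg_AE AE_I2) auto
  have "Liminf at_top (\<lambda>R. ereal (?F R)) \<le> Limsup at_top (\<lambda>R. ereal (?F R))"
    by (rule Liminf_le_Limsup) simp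
  moreover have "0 \<le> Liminf at_top (\<lambda>R. ereal (?F R))"
    by (intro Liminf_bounded always_eventually allI) (use nonneg in simp)
  ultimately have "((\<lambda>R. ereal (?F R)) \<longlongrightarrow> ereal 0) at_top"
    using assms unfolding sublinear_def by (intro Liminf_eq_Limsup) (auto simp: zero_ereal_def)
  then show ?thesis by (simp only: lim_ereal)
qed

section \<open>The limit as a corrector\<close>

context corrector_sequence
begin

text \<open>Joint measurability is inherited from the approximants, which depend on the pair (a, x)
  only through the measurable shift and a random constant.\<close>

lemma potential_random_field: "random_field M potential"
proof -
  have u: "(unit_cube :: (real ^ 'n) set) \<in> sets lebesgue" by simp
  have z[measurable]: "(\<lambda>(a, x). \<zeta> n (shift x a)) \<in> borel_measurable (M \<Otimes>\<^sub>M lebesgue)" for n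
    by (rule orbit_measurable[OF zeta_meas])
  have m[measurable]: "(\<lambda>a. LINT y:unit_cube|lebesgue. \<zeta> n (shift y a)) \<in> borel_measurable M" for n
    unfolding set_lebesgue_integral_def
    by (rule lebesgue.borel_measurable_lebesgue_integral) (use u in measurable)
  have "(\<lambda>(a, x). approx n a x) \<in> borel_measurable (M \<Otimes>\<^sub>M lebesgue)" for n
    unfolding approx_def by measurable
  then have "(\<lambda>p. lim (\<lambda>n. (case p of (a, x) \<Rightarrow> approx n a x))) \<in> borel_measurable (M \<Otimes>\<^sub>M lebesgue)"
    by (rule borel_measurable_lim_metric)
  then show ?thesis unfolding random_field_def potential_def by (simp add: split_beta')
qed

lemma g_stationary_field: "stationary_field M (\<lambda>a x. g (shift x a) $ i)"
  unfolding stationary_field_def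
proof (intro conjI allI impI)
  have gi[measurable]: "(\<lambda>a. g a $ i) \<in> borel_measurable M" by (rule borel_measurable_vec_nth[OF g_meas])
  show "random_field M (\<lambda>a x. g (shift x a) $ i)"
    unfolding random_field_def by (rule orbit_measurable[OF gi])
  show "(\<integral>\<^sup>+a. (\<integral>\<^sup>+y\<in>cube x r. ennreal \<bar>g (shift y a) $ i\<bar> \<partial>lebesgue) \<partial>M) < \<infinity>" if r: "r > 0" for x r
  proof -
    have "(\<integral>\<^sup>+a. (\<integral>\<^sup>+y\<in>cube x r. ennreal \<bar>g (shift y a) $ i\<bar> \<partial>lebesgue) \<partial>M) = emeasure lebesgue (cube x r) * (\<integral>\<^sup>+a. ennreal \<bar>g a $ i\<bar> \<partial>M)"
      by (rule nn_integral_orbit[of "\<lambda>a. ennreal \<bar>g a $ i\<bar>"]) (use r in measurable)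
    moreover have "integrable M (\<lambda>a. g a $ i)"
      by (rule integrable_bounded_linear[OF bounded_linear_vec_nth g_integrable])
    ultimately show ?thesis
      using r by (simp add: emeasure_cube integrable_iff_bounded ennreal_mult_less_top)
  qed
  show "AE a in M. \<forall>x0 r x. r > 0 \<longrightarrow>
        set_integrable lebesgue (cube x0 r) (\<lambda>y. g (shift y (shift x a)) $ i) \<and>
        (LINT y:(\<lambda>q. x + q) ` cube x0 r|lebesgue. g (shift y a) $ i)
          = (LINT y:cube x0 r|lebesgue. g (shift y (shift x a)) $ i)"
    using AE_good
  proof eventually_elim
    case (elim a)
    show ?case
    proof (intro allI impI)
      fix x0 x :: "real ^ 'n" and r :: real assume r: "r > 0"
      have si: "integrable lebesgue (\<lambda>y. indicator (cube (x + x0) r) y *\<^sub>R g (shift y a) $ i)"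
        using L2_loc_set_integrable[OF L2_loc_nth[OF g_orbit_L2[OF elim]] bounded_cube[OF r] cube_sets[OF r]]
        unfolding set_integrable_def .
      \<comment> \<open>The identity holds exactly: both sides read \<open>g\<close> at the same
        point of the orbit.\<close>
      have eq: "indicator (cube (x + x0) r) (y + x) *\<^sub>R g (shift (y + x) a) $ i = indicator (cube x0 r) y *\<^sub>R g (shift y (shift x a)) $ i" for y
        using r by (simp add: shift_shift add.commute indicator_def mem_cube)
      show "set_integrable lebesgue (cube x0 r) (\<lambda>y. g (shift y (shift x a)) $ i) \<and>
        (LINT y:(\<lambda>q. x + q) ` cube x0 r|lebesgue. g (shift y a) $ i)
          = (LINT y:cube x0 r|lebesgue. g (shift y (shift x a)) $ i)"
        unfolding translate_cube set_integrable_def set_lebesgue_integral_def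
        using integrable_lebesgue_shift[OF si, of x] integral_lebesgue_shift[OF borel_measurable_integrable[OF si], of x]
        unfolding eq by simp
    qed
  qed
qed

lemma g_orbit_mean: "(LINT a|M. (LINT y:unit_cube|lebesgue. g (shift y a))) = 0"
proof -
  let ?Q = "unit_cube :: (real ^ 'n) set"
  have Q[measurable]: "?Q \<in> sets lebesgue" by simp
  have [measurable]: "(\<lambda>(a, y). g (shift y a)) \<in> borel_measurable (M \<Otimes>\<^sub>M lebesgue)" by (rule orbit_measurable[OF g_meas])
  have m: "(\<lambda>(a, y). indicator ?Q y *\<^sub>R g (shift y a)) \<in> borel_measurable (M \<Otimes>\<^sub>M lebesgue)" by measurable
  have int: "integrable (M \<Otimes>\<^sub>M lebesgue) (\<lambda>(a, y). indicator ?Q y *\<^sub>R g (shift y a))"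
  proof (rule integrableI_bounded[OF m])
    have "(\<integral>\<^sup>+p. ennreal (norm (case p of (a, y) \<Rightarrow> indicator ?Q y *\<^sub>R g (shift y a))) \<partial>(M \<Otimes>\<^sub>M lebesgue))
      = (\<integral>\<^sup>+a. (\<integral>\<^sup>+y. ennreal (norm (indicator ?Q y *\<^sub>R g (shift y a))) \<partial>lebesgue) \<partial>M)"
      using m by (subst lebesgue.nn_integral_fst[symmetric]) auto
    also have "\<dots> = (\<integral>\<^sup>+a. (\<integral>\<^sup>+y\<in>?Q. ennreal (norm (g (shift y a))) \<partial>lebesgue) \<partial>M)"
      by (intro nn_integral_cong) (auto simp: indicator_def)
    also have "\<dots> = emeasure lebesgue ?Q * (\<integral>\<^sup>+a. ennreal (norm (g a)) \<partial>M)"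
      by (rule nn_integral_orbit[of "\<lambda>a. ennreal (norm (g a))"]) measurable
    also have "\<dots> < \<infinity>"
      using g_integrable by (simp add: unit_cube_eq emeasure_cube integrable_iff_bounded)
    finally show "(\<integral>\<^sup>+p. ennreal (norm (case p of (a, y) \<Rightarrow> indicator ?Q y *\<^sub>R g (shift y a))) \<partial>(M \<Otimes>\<^sub>M lebesgue)) < \<infinity>" .
  qed
  have "(LINT a|M. (LINT y:?Q|lebesgue. g (shift y a))) = (LINT y|lebesgue. (LINT a|M. indicator ?Q y *\<^sub>R g (shift y a)))"
    unfolding set_lebesgue_integral_def by (rule orbit.Fubini_integral[OF int, symmetric])
  also have "\<dots> = (LINT y|(lebesgue :: (real ^ 'n) measure). 0)"
  proof (rule Bochner_Integration.integral_cong[OF refl])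
    fix y
    have "(LINT a|M. g (shift y a)) = 0" using integral_shift[OF g_meas, of y] g_mean by simp
    then show "(LINT a|M. indicator ?Q y *\<^sub>R g (shift y a)) = 0" by simp
  qed
  finally show ?thesis by simp
qed

lemma g_orbit_bound:
  "(\<integral>\<^sup>+a. (\<integral>\<^sup>+y\<in>unit_cube. ennreal ((norm (g (shift y a)))\<^sup>2) \<partial>lebesgue) \<partial>M)
     \<le> ennreal ((1 - lam\<^sup>2) / lam\<^sup>2) * (\<integral>\<^sup>+a. (\<integral>\<^sup>+y\<in>unit_cube. ennreal ((norm (a y *v \<xi>))\<^sup>2) \<partial>lebesgue) \<partial>M)"
proof -
  let ?Q = "unit_cube :: (real ^ 'n) set"
  have Q[measurable]: "?Q \<in> sets lebesgue" by simp
  have eQ: "emeasure lebesgue ?Q = 1" by (simp add: unit_cube_eq emeasure_cube)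
  have wb: "bdd_meas (\<lambda>a. coeff_at a *v \<xi>)" by (intro bdd_meas_coeff bdd_meas_const)
  have wm[measurable]: "(\<lambda>a. coeff_at a *v \<xi>) \<in> borel_measurable M" by (rule bdd_meas_measurable[OF wb])
  have 1: "(\<integral>\<^sup>+a. (\<integral>\<^sup>+y\<in>?Q. ennreal ((norm (g (shift y a)))\<^sup>2) \<partial>lebesgue) \<partial>M) = ennreal (LINT a|M. (norm (g a))\<^sup>2)"
  proof -
    have "(\<integral>\<^sup>+a. (\<integral>\<^sup>+y\<in>?Q. ennreal ((norm (g (shift y a)))\<^sup>2) \<partial>lebesgue) \<partial>M) = emeasure lebesgue ?Q * (\<integral>\<^sup>+a. ennreal ((norm (g a))\<^sup>2) \<partial>M)"
      by (rule nn_integral_orbit[of "\<lambda>a. ennreal ((norm (g a))\<^sup>2)"]) measurable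
    then show ?thesis using nn_integral_eq_integral[OF integrable_norm_sq[OF g_meas g_L2]] by (simp add: eQ)
  qed
  have 2: "(\<integral>\<^sup>+a. (\<integral>\<^sup>+y\<in>?Q. ennreal ((norm (a y *v \<xi>))\<^sup>2) \<partial>lebesgue) \<partial>M) = ennreal (LINT a|M. (norm (coeff_at a *v \<xi>))\<^sup>2)"
  proof -
    have "(\<integral>\<^sup>+a. (\<integral>\<^sup>+y\<in>?Q. ennreal ((norm (a y *v \<xi>))\<^sup>2) \<partial>lebesgue) \<partial>M)
      = (\<integral>\<^sup>+a. (\<integral>\<^sup>+y\<in>?Q. ennreal ((norm (coeff_at (shift y a) *v \<xi>))\<^sup>2) \<partial>lebesgue) \<partial>M)"
    proof (rule nn_integral_cong, rule nn_integral_cong_AE)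
      fix a assume "a \<in> space M"
      from coeff_at_shift[OF this]
      show "AE y in lebesgue. ennreal ((norm (a y *v \<xi>))\<^sup>2) * indicator ?Q y = ennreal ((norm (coeff_at (shift y a) *v \<xi>))\<^sup>2) * indicator ?Q y"
        by eventually_elim (simp only:)
    qed
    also have "\<dots> = emeasure lebesgue ?Q * (\<integral>\<^sup>+a. ennreal ((norm (coeff_at a *v \<xi>))\<^sup>2) \<partial>M)"
      by (rule nn_integral_orbit[of "\<lambda>a. ennreal ((norm (coeff_at a *v \<xi>))\<^sup>2)"]) measurable
    finally show ?thesis using nn_integral_eq_integral[OF bdd_meas_norm_sq[OF wb]] by (simp add: eQ)
  qed
  have "lam\<^sup>2 \<le> 1" using lam_pos lam_le_1 by (simp add: power_le_one)
  then show ?thesis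
    unfolding 1 2 using ennreal_leI[OF g_bound] by (subst ennreal_mult[symmetric]) (auto intro!: integral_nonneg_AE)
qed

lemma is_corrector_potential: "is_corrector lam M \<xi> potential"
  unfolding is_corrector_def
proof (intro conjI exI[of _ "\<lambda>a x. g (shift x a)"] allI)
  show "random_field M potential" by (rule potential_random_field)
  show "gradient_field M potential (\<lambda>a x. g (shift x a))"
    unfolding gradient_field_def
  proof (intro conjI allI)
    show "random_field M (\<lambda>a x. g (shift x a) $ i)" for i
      using g_stationary_field by (simp add: stationary_field_def)
    show "AE a in M. has_weak_gradient (potential a) (\<lambda>x. g (shift x a))"
      using AE_good by eventually_elim (rule potential_weak_gradient)
  qed
  show "AE a in M. H1_loc (potential a) \<and> distr_div_zero (\<lambda>x. a x *v (g (shift x a) + \<xi>)) \<and> sublinear (potential a) \<and> anchored (potential a)"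
    using AE_good AE_equation AE_sublinear
  proof eventually_elim
    case (elim a)
    have "H1_loc (potential a)"
      unfolding H1_loc_def using potential_L2[OF elim(1)] g_orbit_L2[OF elim(1)] potential_weak_gradient[OF elim(1)] by blast
    then show ?case using elim(2,3) potential_anchored[OF elim(1)] by blast
  qed
  show "stationary_field M (\<lambda>a x. g (shift x a) $ i)" for i by (rule g_stationary_field)
qed (rule g_orbit_bound g_orbit_mean)+

end

subsection \<open>Uniqueness\<close>

text \<open>Exchanging the integrals weights \<open>F y\<close> by the volume of the unit cube about
  \<open>y\<close> inside the large cube. This volume is at most 1, and equal to 1 away from the
  boundary, so moving averages and plain integrals differ by a boundary layer.\<close>

lemma nn_integral_unit_cubes_upper:
  fixes F :: "real ^ 'n \<Rightarrow> ennreal"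
  assumes F[measurable]: "F \<in> borel_measurable lebesgue" and R: "R > 0"
  shows "(\<integral>\<^sup>+z\<in>cube 0 R. (\<integral>\<^sup>+y\<in>cube z 1. F y \<partial>lebesgue) \<partial>lebesgue) \<le> (\<integral>\<^sup>+y\<in>cube 0 (R + 1). F y \<partial>lebesgue)"
    and "(\<integral>\<^sup>+y\<in>cube 0 R. F y \<partial>lebesgue) \<le> (\<integral>\<^sup>+z\<in>cube 0 (R + 1). (\<integral>\<^sup>+y\<in>cube z 1. F y \<partial>lebesgue) \<partial>lebesgue)"
proof -
  have sym: "indicator (cube z 1) y = (indicator (cube y 1) z :: ennreal)" for y z :: "real ^ 'n"
    by (simp add: indicator_def mem_cube abs_minus_commute)
  have swap: "(\<integral>\<^sup>+z\<in>cube 0 S. (\<integral>\<^sup>+y\<in>cube z 1. F y \<partial>lebesgue) \<partial>lebesgue)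
    = (\<integral>\<^sup>+y. F y * emeasure lebesgue (cube y 1 \<inter> cube 0 S) \<partial>lebesgue)" if S: "S > 0" for S
  proof -
    have [measurable]: "cube (0 :: real ^ 'n) S \<in> sets lebesgue" using S by simp
    have idm[measurable]: "(\<lambda>x. x) \<in> lebesgue \<rightarrow>\<^sub>M (borel :: (real ^ 'n) measure)" by (rule measurable_completion) simp
    have d[measurable]: "(\<lambda>(z, y). y - z) \<in> borel_measurable (lebesgue \<Otimes>\<^sub>M (lebesgue :: (real ^ 'n) measure))"
      unfolding split_beta'
      by (intro borel_measurable_diff measurable_compose[OF measurable_fst] measurable_compose[OF measurable_snd]) measurable
    have ib: "(indicator (cube (0 :: real ^ 'n) 1) :: _ \<Rightarrow> ennreal) \<in> borel_measurable borel" using cube_borel[of 1 "0 :: real ^ 'n"] by simp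
    have "(\<lambda>(z, y). indicator (cube (0 :: real ^ 'n) 1) (y - z) :: ennreal) \<in> borel_measurable (lebesgue \<Otimes>\<^sub>M lebesgue)"
      using measurable_compose[OF d ib] by (simp add: split_beta')
    moreover have "indicator (cube (0 :: real ^ 'n) 1) (y - z) = (indicator (cube z 1) y :: ennreal)" for y z :: "real ^ 'n"
      by (simp add: indicator_def mem_cube)
    ultimately have [measurable]: "(\<lambda>(z, y). indicator (cube z 1) y :: ennreal) \<in> borel_measurable (lebesgue \<Otimes>\<^sub>M (lebesgue :: (real ^ 'n) measure))"
      by simp
    have "(\<integral>\<^sup>+z\<in>cube 0 S. (\<integral>\<^sup>+y\<in>cube z 1. F y \<partial>lebesgue) \<partial>lebesgue)
      = (\<integral>\<^sup>+z. (\<integral>\<^sup>+y. F y * indicator (cube z 1) y * indicator (cube 0 S) z \<partial>lebesgue) \<partial>lebesgue)"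
      by (intro nn_integral_cong nn_integral_multc[symmetric]) (simp_all add: borel_measurable_times_ennreal)
    also have "\<dots> = (\<integral>\<^sup>+y. (\<integral>\<^sup>+z. F y * indicator (cube z 1) y * indicator (cube 0 S) z \<partial>lebesgue) \<partial>lebesgue)"
      by (rule lebesgue_pair.Fubini'[symmetric]) measurable
    also have "\<dots> = (\<integral>\<^sup>+y. (\<integral>\<^sup>+z. F y * indicator (cube y 1 \<inter> cube 0 S) z \<partial>lebesgue) \<partial>lebesgue)"
      by (intro nn_integral_cong) (simp add: sym indicator_inter_arith mult.assoc)
    also have "\<dots> = (\<integral>\<^sup>+y. F y * emeasure lebesgue (cube y 1 \<inter> cube 0 S) \<partial>lebesgue)"
      using S by (intro nn_integral_cong nn_integral_cmult_indicator) auto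
    finally show ?thesis .
  qed
  have R1: "R + 1 > 0" using R by simp
  have one: "emeasure lebesgue (cube y 1) = 1" for y :: "real ^ 'n" by (simp add: emeasure_cube)
  show "(\<integral>\<^sup>+z\<in>cube 0 R. (\<integral>\<^sup>+y\<in>cube z 1. F y \<partial>lebesgue) \<partial>lebesgue) \<le> (\<integral>\<^sup>+y\<in>cube 0 (R + 1). F y \<partial>lebesgue)"
    unfolding swap[OF R]
  proof (rule nn_integral_mono)
    fix y :: "real ^ 'n"
    show "F y * emeasure lebesgue (cube y 1 \<inter> cube 0 R) \<le> F y * indicator (cube 0 (R + 1)) y"
    proof (cases "y \<in> cube 0 (R + 1)")
      case True
      have "emeasure lebesgue (cube y 1 \<inter> cube 0 R) \<le> emeasure lebesgue (cube y 1)" by (intro emeasure_mono) auto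
      then have "F y * emeasure lebesgue (cube y 1 \<inter> cube 0 R) \<le> F y * 1" unfolding one by (intro mult_left_mono) auto
      then show ?thesis using True by simp
    next
      case False
      have "cube y 1 \<inter> cube 0 R = {}"
      proof (rule ccontr)
        assume "cube y 1 \<inter> cube 0 R \<noteq> {}"
        then obtain z where z: "z \<in> cube y 1" "z \<in> cube 0 R" by blast
        have "\<bar>y $ i - 0 $ i\<bar> < (R + 1) / 2" for i
        proof -
          have "\<bar>z $ i - y $ i\<bar> < 1 / 2" "\<bar>z $ i\<bar> < R / 2" using z R by (auto simp: mem_cube)
          then show ?thesis by (simp only: zero_index abs_less_iff) argo
        qed
        then show False using False R1 by (simp add: mem_cube)
      qed
      then show ?thesis by simp
    qed
  qed
  show "(\<integral>\<^sup>+y\<in>cube 0 R. F y \<partial>lebesgue) \<le> (\<integral>\<^sup>+z\<in>cube 0 (R + 1). (\<integral>\<^sup>+y\<in>cube z 1. F y \<partial>lebesgue) \<partial>lebesgue)"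
    unfolding swap[OF R1]
  proof (rule nn_integral_mono)
    fix y :: "real ^ 'n"
    show "F y * indicator (cube 0 R) y \<le> F y * emeasure lebesgue (cube y 1 \<inter> cube 0 (R + 1))"
    proof (cases "y \<in> cube 0 R")
      case True
      have "cube y 1 \<subseteq> cube 0 (R + 1)"
      proof
        fix z assume z: "z \<in> cube y 1"
        have "\<bar>z $ i - 0 $ i\<bar> < (R + 1) / 2" for i
        proof -
          have "\<bar>z $ i - y $ i\<bar> < 1 / 2" "\<bar>y $ i\<bar> < R / 2" using z True R by (auto simp: mem_cube)
          then show ?thesis by (simp only: zero_index abs_less_iff) argo
        qed
        then show "z \<in> cube 0 (R + 1)" using R1 by (simp add: mem_cube)
      qed
      then have "cube y 1 \<inter> cube 0 (R + 1) = cube y 1" by blast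
      then show ?thesis using True by (simp add: one)
    qed simp
  qed
qed

lemma has_weak_gradient_diff:
  fixes u v :: "real ^ 'n \<Rightarrow> real"
  assumes u: "has_weak_gradient u g" and v: "has_weak_gradient v h"
  shows "has_weak_gradient (\<lambda>x. u x - v x) (\<lambda>x. g x - h x)"
  unfolding has_weak_gradient_def
proof (intro conjI allI impI)
  have uL: "L1_loc u" "L1_loc g" "L1_loc v" "L1_loc h" using u v by (auto simp: has_weak_gradient_def)
  then show "L1_loc (\<lambda>x. u x - v x)" "L1_loc (\<lambda>x. g x - h x)"
    unfolding L1_loc_def by (auto intro!: set_integral_diff(1))
  fix \<eta> :: "real ^ 'n \<Rightarrow> real" and i assume \<eta>: "test_function \<eta>"
  have c: "Cc \<eta>" "Cc (partial_deriv i \<eta>)"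
    using C1cD(1)[OF test_function_C1c[OF \<eta>]] C1cD(1)[OF test_function_C1c[OF test_function_partial[OF \<eta>]]] by auto
  have i: "integrable lebesgue (\<lambda>x. u x * partial_deriv i \<eta> x)" "integrable lebesgue (\<lambda>x. v x * partial_deriv i \<eta> x)"
    "integrable lebesgue (\<lambda>x. g x $ i * \<eta> x)" "integrable lebesgue (\<lambda>x. h x $ i * \<eta> x)"
    using integrable_mult_Cc[OF uL(1) c(2)] integrable_mult_Cc[OF uL(3) c(2)]
      integrable_mult_Cc[OF L1_loc_nth[OF uL(2)] c(1)] integrable_mult_Cc[OF L1_loc_nth[OF uL(4)] c(1)] by auto
  have "(LINT x|lebesgue. u x * partial_deriv i \<eta> x) = - (LINT x|lebesgue. g x $ i * \<eta> x)"
    "(LINT x|lebesgue. v x * partial_deriv i \<eta> x) = - (LINT x|lebesgue. h x $ i * \<eta> x)"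
    using u v \<eta> by (auto simp: has_weak_gradient_def)
  then show "(LINT x|lebesgue. (u x - v x) * partial_deriv i \<eta> x) = - (LINT x|lebesgue. (g x - h x) $ i * \<eta> x)"
    using i by (simp add: left_diff_distrib)
qed

lemma distr_div_zero_diff:
  fixes F G :: "real ^ 'n \<Rightarrow> real ^ 'n"
  assumes F: "distr_div_zero F" and G: "distr_div_zero G"
  shows "distr_div_zero (\<lambda>x. F x - G x)"
  unfolding distr_div_zero_def
proof (intro conjI allI impI)
  have L: "L1_loc F" "L1_loc G" using F G by (auto simp: distr_div_zero_def)
  then show "L1_loc (\<lambda>x. F x - G x)" unfolding L1_loc_def by (auto intro!: set_integral_diff(1))
  fix \<eta> :: "real ^ 'n \<Rightarrow> real" assume \<eta>: "test_function \<eta>"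
  have c: "Cc (\<lambda>x. gradient \<eta> x $ i)" for i by (intro Cc_nth C1cD(2)[OF test_function_C1c[OF \<eta>]])
  have i: "integrable lebesgue (\<lambda>x. gradient \<eta> x \<bullet> H x)" if "L1_loc H" for H
  proof -
    have "integrable lebesgue (\<lambda>x. \<Sum>i\<in>UNIV. H x $ i *\<^sub>R gradient \<eta> x $ i)"
      by (intro Bochner_Integration.integrable_sum integrable_mult_Cc L1_loc_nth that c)
    then show ?thesis by (simp add: inner_vec_def mult.commute)
  qed
  show "(LINT x|lebesgue. gradient \<eta> x \<bullet> (F x - G x)) = 0"
    using F G \<eta> i[OF L(1)] i[OF L(2)] by (simp add: distr_div_zero_def inner_diff_right)
qed

lemma nn_integral_cube_shift:
  fixes F :: "real ^ 'n \<Rightarrow> ennreal"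
  assumes [measurable]: "F \<in> borel_measurable lebesgue" and r: "r > 0"
  shows "(\<integral>\<^sup>+y\<in>cube z r. F (y + x) \<partial>lebesgue) = (\<integral>\<^sup>+y\<in>cube (z + x) r. F y \<partial>lebesgue)"
proof -
  have [measurable]: "cube (z + x) r \<in> sets lebesgue" using r by simp
  have "(\<integral>\<^sup>+y. F (y + x) * indicator (cube (z + x) r) (y + x) \<partial>lebesgue) = (\<integral>\<^sup>+y\<in>cube (z + x) r. F y \<partial>lebesgue)"
    by (rule nn_integral_lebesgue_shift) measurable
  moreover have "indicator (cube (z + x) r) (y + x) = (indicator (cube z r) y :: ennreal)" for y
    using r by (simp add: indicator_def mem_cube)
  ultimately show ?thesis by simp
qed

lemma L1_loc_cubes:
  fixes v :: "real ^ 'n \<Rightarrow> real"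
  assumes "\<And>x r. r > 0 \<Longrightarrow> set_integrable lebesgue (cube x r) v"
  shows "L1_loc v"
  unfolding L1_loc_def
proof (intro allI impI)
  fix K :: "(real ^ 'n) set" assume K: "compact K"
  obtain k :: nat where k: "k > 0" "K \<subseteq> cube 0 (real k)" using bounded_subset_cube[OF compact_imp_bounded[OF K]] by blast
  have "K \<in> sets lebesgue" using K by (simp add: lmeasurable_compact fmeasurableD)
  then show "set_integrable lebesgue K v"
    by (rule set_integrable_subset[rotated]) (use k assms[of "real k" 0] in auto)
qed

text \<open>On one event the cube integrals agree for all cubes and all shifts. Differentiation then
  gives a pointwise identity for every shift, with an exceptional set of \<open>y\<close> that may
  depend on the shift.\<close>

lemma stationary_section:
  fixes v :: "'n::finite coeff \<Rightarrow> real ^ 'n \<Rightarrow> real"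
  assumes "stationary_field M v"
  shows "AE a in M. \<forall>x. AE y in lebesgue. v (shift x a) y = v a (y + x)"
proof -
  have "AE a in M. \<forall>x0 r x. r > 0 \<longrightarrow>
        set_integrable lebesgue (cube x0 r) (v (shift x a)) \<and>
        (LINT y:(\<lambda>q. x + q) ` cube x0 r|lebesgue. v a y)
          = (LINT y:cube x0 r|lebesgue. v (shift x a) y)"
    using assms by (simp add: stationary_field_def)
  then show ?thesis
  proof eventually_elim
    case (elim a)
    show ?case
    proof
      fix x :: "real ^ 'n"
      have si: "set_integrable lebesgue (cube x0 r) (v (shift x' a))" if "r > 0" for x0 r x'
        using elim that by blast
      have "shift 0 a = a" by (simp add: shift_def)
      then have si0: "integrable lebesgue (\<lambda>y. indicator (cube x0 r) y *\<^sub>R v a y)" if "r > 0" for x0 r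
        using si[OF that, of x0 0] by (simp add: set_integrable_def)
      have ind: "indicator (cube (x + x0) r) (y + x) = (indicator (cube x0 r) y :: real)" if "r > 0" for x0 r y
        using that by (simp add: indicator_def mem_cube add.commute)
      have sh: "set_integrable lebesgue (cube x0 r) (\<lambda>y. v a (y + x))"
        "(LINT y:cube x0 r|lebesgue. v a (y + x)) = (LINT y:cube x0 r|lebesgue. v (shift x a) y)" if r: "r > 0" for x0 r
      proof -
        show "set_integrable lebesgue (cube x0 r) (\<lambda>y. v a (y + x))"
          using integrable_lebesgue_shift[OF si0[OF r, of "x + x0"], of x] by (simp add: set_integrable_def ind[OF r])
        have "(LINT y:cube x0 r|lebesgue. v a (y + x)) = (LINT y:cube (x + x0) r|lebesgue. v a y)"
          using integral_lebesgue_shift[OF borel_measurable_integrable[OF si0[OF r, of "x + x0"]], of x]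
          by (simp add: set_lebesgue_integral_def ind[OF r])
        then show "(LINT y:cube x0 r|lebesgue. v a (y + x)) = (LINT y:cube x0 r|lebesgue. v (shift x a) y)"
          using elim r unfolding translate_cube by metis
      qed
      have "AE y in lebesgue. v (shift x a) y - v a (y + x) = 0"
      proof (rule AE_eq_0_of_cubes)
        show "L1_loc (\<lambda>y. v (shift x a) y - v a (y + x))"
          by (intro L1_loc_cubes set_integral_diff(1) si sh(1))
        show "(LINT y:cube x0 r|lebesgue. v (shift x a) y - v a (y + x)) = 0" if "r > 0" for x0 r
          using set_integral_diff(2)[OF si[OF that] sh(1)[OF that]] sh(2)[OF that] by simp
      qed
      then show "AE y in lebesgue. v (shift x a) y = v a (y + x)" by simp
    qed
  qed
qed

lemma sublinear_diff:
  fixes u v :: "real ^ 'n \<Rightarrow> real"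
  assumes u: "sublinear u" "L2_loc u" and v: "sublinear v" "L2_loc v"
  shows "((\<lambda>R. 1 / R\<^sup>2 * average (cube 0 R) (\<lambda>y. (u y - v y)\<^sup>2)) \<longlongrightarrow> 0) at_top"
proof (rule tendsto_sandwich[where f = "\<lambda>_. 0"])
  have um[measurable]: "u \<in> borel_measurable lebesgue" "v \<in> borel_measurable lebesgue"
    using u v by (auto simp: L2_loc_def)
  show "\<forall>\<^sub>F R in at_top. 0 \<le> 1 / R\<^sup>2 * average (cube 0 R) (\<lambda>y. (u y - v y)\<^sup>2)"
    unfolding average_def set_lebesgue_integral_def
    by (intro always_eventually allI mult_nonneg_nonneg integral_nonneg_AE AE_I2) auto
  let ?F = "\<lambda>w R. 1 / R\<^sup>2 * average (cube 0 R) (\<lambda>y. \<bar>w y\<bar>\<^sup>2)"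
  show "((\<lambda>R. 2 * ?F u R + 2 * ?F v R) \<longlongrightarrow> 0) at_top"
    using tendsto_add[OF tendsto_mult_left[OF sublinear_tendsto[OF u(1)], of 2] tendsto_mult_left[OF sublinear_tendsto[OF v(1)], of 2]] by simp
  show "\<forall>\<^sub>F R in at_top. 1 / R\<^sup>2 * average (cube 0 R) (\<lambda>y. (u y - v y)\<^sup>2) \<le> 2 * ?F u R + 2 * ?F v R"
    using eventually_gt_at_top[of 0]
  proof eventually_elim
    case (elim R)
    have Q[measurable]: "cube (0 :: real ^ 'n) R \<in> sets lebesgue" using elim by simp
    have i: "set_integrable lebesgue (cube 0 R) (\<lambda>y. \<bar>w y\<bar>\<^sup>2)" if "L2_loc w" for w :: "real ^ 'n \<Rightarrow> real"
    proof -
      have "set_integrable lebesgue (closure (cube 0 R)) (\<lambda>y. \<bar>w y\<bar>\<^sup>2)"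
        using that bounded_cube[OF elim, of "0 :: real ^ 'n"] by (auto simp: L2_loc_def)
      then show ?thesis by (rule set_integrable_subset) (auto simp: closure_subset)
    qed
    have le: "(u y - v y)\<^sup>2 \<le> 2 * \<bar>u y\<bar>\<^sup>2 + 2 * \<bar>v y\<bar>\<^sup>2" for y
      using norm_sq_diff_le[of "u y" "v y"] by simp
    have ii: "set_integrable lebesgue (cube 0 R) (\<lambda>y. 2 * \<bar>u y\<bar>\<^sup>2 + 2 * \<bar>v y\<bar>\<^sup>2)"
      by (intro set_integral_add(1) set_integrable_mult_right i u v)
    have "(LINT y:cube 0 R|lebesgue. (u y - v y)\<^sup>2) \<le> (LINT y:cube 0 R|lebesgue. 2 * \<bar>u y\<bar>\<^sup>2 + 2 * \<bar>v y\<bar>\<^sup>2)"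
    proof (rule set_integral_mono[OF _ ii le])
      show "set_integrable lebesgue (cube 0 R) (\<lambda>y. (u y - v y)\<^sup>2)"
        by (rule set_integrable_bound[OF ii]) (use le in \<open>auto simp: set_borel_measurable_def\<close>)
    qed
    also have "\<dots> = 2 * (LINT y:cube 0 R|lebesgue. \<bar>u y\<bar>\<^sup>2) + 2 * (LINT y:cube 0 R|lebesgue. \<bar>v y\<bar>\<^sup>2)"
      using set_integral_add(2)[OF set_integrable_mult_right[OF i[OF u(2)], of 2] set_integrable_mult_right[OF i[OF v(2)], of 2]] by simp
    finally have "1 / R\<^sup>2 * average (cube 0 R) (\<lambda>y. (u y - v y)\<^sup>2)
      \<le> 1 / R\<^sup>2 * (1 / measure lebesgue (cube (0 :: real ^ 'n) R) * (2 * (LINT y:cube 0 R|lebesgue. \<bar>u y\<bar>\<^sup>2) + 2 * (LINT y:cube 0 R|lebesgue. \<bar>v y\<bar>\<^sup>2)))"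
      unfolding average_def by (intro mult_left_mono) auto
    then show ?case by (simp add: average_def algebra_simps)
  qed
qed (rule tendsto_const)

text \<open>Caccioppoli's inequality turns sublinear growth into vanishing averaged energy.\<close>

lemma liouville_energy:
  fixes u :: "real ^ 'n \<Rightarrow> real" and a :: "'n::finite coeff"
  assumes lam: "lam > 0" and u: "L2_loc u" and V: "L2_loc V" and wg: "has_weak_gradient u V"
    and eq: "distr_div_zero (\<lambda>x. a x *v V x)"
    and ell: "AE x in lebesgue. \<forall>\<xi>. \<xi> \<bullet> (a x *v \<xi>) \<ge> lam * (norm \<xi>)\<^sup>2 \<and> norm (a x *v \<xi>) \<le> norm \<xi>"
    and growth: "((\<lambda>R. 1 / R\<^sup>2 * average (cube 0 R) (\<lambda>y. (u y)\<^sup>2)) \<longlongrightarrow> 0) at_top"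
  shows "((\<lambda>R. average (cube 0 R) (\<lambda>y. (norm (V y))\<^sup>2)) \<longlongrightarrow> 0) at_top"
proof -
  obtain C where C: "C > 0" "\<And>(a :: 'n coeff) u V R. L2_loc u \<Longrightarrow> L2_loc V \<Longrightarrow> has_weak_gradient u V \<Longrightarrow> distr_div_zero (\<lambda>x. a x *v V x)
      \<Longrightarrow> AE x in lebesgue. \<forall>\<xi>. \<xi> \<bullet> (a x *v \<xi>) \<ge> lam * (norm \<xi>)\<^sup>2 \<and> norm (a x *v \<xi>) \<le> norm \<xi>
      \<Longrightarrow> R > 0
      \<Longrightarrow> (\<integral>\<^sup>+x\<in>cube 0 R. ennreal ((norm (V x))\<^sup>2) \<partial>lebesgue)
        \<le> ennreal (C / R\<^sup>2) * (\<integral>\<^sup>+x\<in>cube 0 (2 * R). ennreal ((u x)\<^sup>2) \<partial>lebesgue)"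
    using caccioppoli[OF lam] by blast
  have [measurable]: "u \<in> borel_measurable lebesgue" "V \<in> borel_measurable lebesgue"
    using u V by (auto simp: L2_loc_def)
  let ?G = "\<lambda>R. 1 / R\<^sup>2 * average (cube 0 R) (\<lambda>y. (u y)\<^sup>2)"
  let ?d = "CARD('n)"
  show ?thesis
  proof (rule tendsto_sandwich[where f = "\<lambda>_. 0"])
    show "\<forall>\<^sub>F R in at_top. 0 \<le> average (cube 0 R) (\<lambda>y. (norm (V y))\<^sup>2)"
      unfolding average_def set_lebesgue_integral_def
      by (intro always_eventually allI mult_nonneg_nonneg integral_nonneg_AE AE_I2) auto
    have "filterlim (\<lambda>R :: real. 2 * R) at_top at_top"
      by (rule filterlim_tendsto_pos_mult_at_top[OF tendsto_const _ filterlim_ident]) simp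
    from tendsto_mult_left[OF filterlim_compose[OF growth this], of "4 * C * 2 ^ ?d"]
    show "((\<lambda>R. 4 * C * 2 ^ ?d * ?G (2 * R)) \<longlongrightarrow> 0) at_top" by simp
    show "\<forall>\<^sub>F R in at_top. average (cube 0 R) (\<lambda>y. (norm (V y))\<^sup>2) \<le> 4 * C * 2 ^ ?d * ?G (2 * R)"
      using eventually_gt_at_top[of 0]
    proof eventually_elim
      case (elim R)
      have R2: "2 * R > 0" using elim by simp
      let ?U = "\<integral>\<^sup>+x\<in>cube 0 (2 * R). ennreal ((u x)\<^sup>2) \<partial>lebesgue"
      have fin: "?U < \<infinity>" using L2_loc_nn_integral[OF u bounded_cube[OF R2] cube_sets[OF R2]] by simp
      have "enn2real (\<integral>\<^sup>+x\<in>cube 0 R. ennreal ((norm (V x))\<^sup>2) \<partial>lebesgue) \<le> enn2real (ennreal (C / R\<^sup>2) * ?U)"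
        by (rule enn2real_mono[OF C(2)[OF u V wg eq ell elim]]) (use fin in \<open>simp add: ennreal_mult_less_top\<close>)
      also have "\<dots> = C / R\<^sup>2 * enn2real ?U" using C(1) by (simp add: enn2real_mult)
      finally have "average (cube 0 R) (\<lambda>y. (norm (V y))\<^sup>2) \<le> C / R\<^sup>2 * enn2real ?U / R ^ ?d"
        by (subst average_eq[OF elim]) (use elim in \<open>auto simp del: divide_divide_eq_left intro!: divide_right_mono\<close>)
      also have "\<dots> = 4 * C * 2 ^ ?d * ?G (2 * R)"
        using elim by (subst average_eq[OF R2]) (auto simp: power_mult_distrib field_simps)
      finally show ?case .
    qed
  qed (rule tendsto_const)
qed

section \<open>Stationary gradients of vanishing average energy\<close>

context stationary_ergodic
begin

text \<open>The ergodic theorem needs a function of \<open>a\<close> alone. The energy in the unit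
  cube is one, and by stationarity its value at a shifted environment is the energy in the shifted
  cube. Its averages are therefore dominated by averages of |V|^2, and its expectation
  vanishes.\<close>

lemma stationary_zero_energy:
  fixes V :: "'n coeff \<Rightarrow> real ^ 'n \<Rightarrow> real ^ 'n"
  assumes Vm: "\<And>i. random_field M (\<lambda>a x. V a x $ i)"
    and fin: "(\<integral>\<^sup>+a. (\<integral>\<^sup>+y\<in>unit_cube. ennreal ((norm (V a y))\<^sup>2) \<partial>lebesgue) \<partial>M) < \<infinity>"
    and st: "AE a in M. \<forall>x. AE y in lebesgue. V (shift x a) y = V a (y + x)"
    and lim: "AE a in M. L2_loc (V a) \<longrightarrow> ((\<lambda>R. average (cube 0 R) (\<lambda>y. (norm (V a y))\<^sup>2)) \<longlongrightarrow> 0) at_top"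
  shows "AE a in M. L2_loc (V a) \<and> (AE x in lebesgue. V a x = 0)"
proof -
  let ?Q = "unit_cube :: (real ^ 'n) set"
  have Q[measurable]: "?Q \<in> sets lebesgue" by simp
  have Q1: "cube 0 1 = ?Q" by (simp add: unit_cube_eq)
  have "(\<lambda>p. V (fst p) (snd p)) \<in> borel_measurable (M \<Otimes>\<^sub>M lebesgue)"
    by (rule borel_measurable_vecI) (use Vm in \<open>simp add: random_field_def split_beta'\<close>)
  then have pm[measurable]: "(\<lambda>(a, x). V a x) \<in> borel_measurable (M \<Otimes>\<^sub>M lebesgue)" by (simp add: split_beta')
  have Va: "V a \<in> borel_measurable lebesgue" if "a \<in> space M" for a
    using measurable_compose[OF measurable_Pair1'[OF that] pm] by simp
  define f0 where "f0 a = (\<integral>\<^sup>+y\<in>?Q. ennreal ((norm (V a y))\<^sup>2) \<partial>lebesgue)" for a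
  have f0m[measurable]: "f0 \<in> borel_measurable M"
    unfolding f0_def by (rule lebesgue.borel_measurable_nn_integral) measurable
  have f0fin: "(\<integral>\<^sup>+a. f0 a \<partial>M) < \<infinity>" using fin by (simp add: f0_def)
  \<comment> \<open>Ergodicity is stated for real integrands. Almost surely \<open>f\<close> and
    \<open>f0\<close> agree, and along an orbit the inequality of \<open>f\<close> against
    \<open>f0\<close> is enough.\<close>
  define f where "f a = enn2real (f0 a)" for a
  have fm[measurable]: "f \<in> borel_measurable M" unfolding f_def by measurable
  have f0top: "AE a in M. f0 a \<noteq> \<infinity>" by (rule nn_integral_PInf_AE[OF f0m]) (use f0fin in simp)
  have ff0: "(\<integral>\<^sup>+a. ennreal (f a) \<partial>M) = (\<integral>\<^sup>+a. f0 a \<partial>M)"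
    by (rule nn_integral_cong_AE) (use f0top in eventually_elim, auto simp: f_def top.not_eq_extremum)
  have fint: "integrable M f"
    by (rule integrableI_bounded) (use ff0 f0fin in \<open>auto simp: f_def\<close>)
  have orb: "AE a in M. a \<in> space M \<and> (\<forall>x. f0 (shift x a) = (\<integral>\<^sup>+y\<in>cube x 1. ennreal ((norm (V a y))\<^sup>2) \<partial>lebesgue))"
    using st AE_space
  proof eventually_elim
    case (elim a)
    have [measurable]: "V a \<in> borel_measurable lebesgue" by (rule Va[OF elim(2)])
    have "f0 (shift x a) = (\<integral>\<^sup>+y\<in>cube x 1. ennreal ((norm (V a y))\<^sup>2) \<partial>lebesgue)" for x
    proof -
      have "f0 (shift x a) = (\<integral>\<^sup>+y\<in>cube 0 1. ennreal ((norm (V a (y + x)))\<^sup>2) \<partial>lebesgue)"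
        unfolding f0_def Q1
      proof (rule nn_integral_cong_AE)
        from elim(1)[rule_format, of x]
        show "AE y in lebesgue. ennreal ((norm (V (shift x a) y))\<^sup>2) * indicator ?Q y = ennreal ((norm (V a (y + x)))\<^sup>2) * indicator ?Q y"
          by eventually_elim simp
      qed
      also have "\<dots> = (\<integral>\<^sup>+y\<in>cube (0 + x) 1. ennreal ((norm (V a y))\<^sup>2) \<partial>lebesgue)"
        by (rule nn_integral_cube_shift) auto
      finally show ?thesis by simp
    qed
    then show ?case using elim(2) by blast
  qed
  have "AE a in M. \<forall>k::nat. (\<integral>\<^sup>+z\<in>cube 0 (real k + 1). f0 (shift z a) \<partial>lebesgue) \<noteq> \<infinity>"
    unfolding AE_all_countable
  proof
    fix k :: nat
    have [measurable]: "cube (0 :: real ^ 'n) (real k + 1) \<in> sets lebesgue" by simp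
    have [measurable]: "(\<lambda>(a, x). f0 (shift x a)) \<in> borel_measurable (M \<Otimes>\<^sub>M lebesgue)" by (rule orbit_measurable[OF f0m])
    show "AE a in M. (\<integral>\<^sup>+z\<in>cube 0 (real k + 1). f0 (shift z a) \<partial>lebesgue) \<noteq> \<infinity>"
    proof (rule nn_integral_PInf_AE)
      show "(\<lambda>a. \<integral>\<^sup>+z\<in>cube 0 (real k + 1). f0 (shift z a) \<partial>lebesgue) \<in> borel_measurable M"
        by (rule lebesgue.borel_measurable_nn_integral) measurable
      have "(\<integral>\<^sup>+a. (\<integral>\<^sup>+z\<in>cube 0 (real k + 1). f0 (shift z a) \<partial>lebesgue) \<partial>M) = emeasure lebesgue (cube (0 :: real ^ 'n) (real k + 1)) * (\<integral>\<^sup>+a. f0 a \<partial>M)"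
        by (rule nn_integral_orbit) measurable
      also have "\<dots> < \<infinity>" using f0fin by (simp add: emeasure_cube ennreal_mult_less_top)
      finally show "(\<integral>\<^sup>+a. (\<integral>\<^sup>+z\<in>cube 0 (real k + 1). f0 (shift z a) \<partial>lebesgue) \<partial>M) \<noteq> \<infinity>" by simp
    qed
  qed
  \<comment> \<open>A finite second moment yields local square integrability almost surely, which is
    the premise in the hypothesis \<open>lim\<close>.\<close>
  then have L2: "AE a in M. L2_loc (V a)"
    using orb
  proof eventually_elim
    case (elim a)
    have [measurable]: "V a \<in> borel_measurable lebesgue" by (rule Va) (use elim in blast)
    have eq: "f0 (shift x a) = (\<integral>\<^sup>+y\<in>cube x 1. ennreal ((norm (V a y))\<^sup>2) \<partial>lebesgue)" for x using elim(2) by blast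
    show ?case
    proof (rule L2_locI)
      fix k :: nat assume k: "k > 0"
      have "(\<integral>\<^sup>+x\<in>cube 0 (real k). ennreal ((norm (V a x))\<^sup>2) \<partial>lebesgue) \<le> (\<integral>\<^sup>+z\<in>cube 0 (real k + 1). f0 (shift z a) \<partial>lebesgue)"
        unfolding eq by (rule nn_integral_unit_cubes_upper(2)) (use k in auto)
      also have "\<dots> < \<infinity>" using elim(1) by (simp add: less_top)
      finally show "(\<integral>\<^sup>+x\<in>cube 0 (real k). ennreal ((norm (V a x))\<^sup>2) \<partial>lebesgue) < \<infinity>" .
    qed simp
  qed
  have "AE a in M. (LINT a|M. f a) = 0"
    using ergodic_average[OF fint] L2 lim orb
  proof eventually_elim
    case (elim a)
    have [measurable]: "V a \<in> borel_measurable lebesgue" by (rule Va) (use elim in blast)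
    have eq: "f0 (shift x a) = (\<integral>\<^sup>+y\<in>cube x 1. ennreal ((norm (V a y))\<^sup>2) \<partial>lebesgue)" for x using elim(4) by blast
    have as: "a \<in> space M" using elim(4) by blast
    have f0a: "(\<lambda>z. f0 (shift z a)) \<in> borel_measurable lebesgue" by (rule orbit_section_measurable[OF f0m as])
    let ?A = "\<lambda>R. average (cube 0 R) (\<lambda>z. (norm (V a z))\<^sup>2)"
    have "((\<lambda>R. average (cube 0 R) (\<lambda>z. f (shift z a))) \<longlongrightarrow> 0) at_top"
    proof (rule tendsto_sandwich[where f = "\<lambda>_. 0"])
      show "\<forall>\<^sub>F R in at_top. 0 \<le> average (cube 0 R) (\<lambda>z. f (shift z a))"
        unfolding average_def set_lebesgue_integral_def
        by (intro always_eventually allI mult_nonneg_nonneg integral_nonneg_AE AE_I2) (auto simp: f_def)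
      have "filterlim (\<lambda>R :: real. R + 1) at_top at_top"
        by (rule filterlim_at_top_mono[OF filterlim_ident]) (auto intro!: always_eventually)
      from tendsto_mult_left[OF filterlim_compose[OF elim(3)[rule_format, OF elim(2)] this], of "2 ^ CARD('n)"]
      show "((\<lambda>R. 2 ^ CARD('n) * ?A (R + 1)) \<longlongrightarrow> 0) at_top" by simp
      \<comment> \<open>For R at least 1 the cube of side R + 1 exceeds that of side R in volume by
        at most the factor 2 to the dimension.\<close>
      show "\<forall>\<^sub>F R in at_top. average (cube 0 R) (\<lambda>z. f (shift z a)) \<le> 2 ^ CARD('n) * ?A (R + 1)"
        using eventually_ge_at_top[of 1]
      proof eventually_elim
        case R: (elim R)
        have R1: "R > 0" "R + 1 > 0" using R by auto
        let ?I = "\<integral>\<^sup>+y\<in>cube 0 (R + 1). ennreal ((norm (V a y))\<^sup>2) \<partial>lebesgue"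
        have fin: "?I < \<infinity>" by (rule L2_loc_nn_integral[OF elim(2) bounded_cube[OF R1(2)] cube_sets[OF R1(2)]])
        have "(\<integral>\<^sup>+z\<in>cube 0 R. ennreal (f (shift z a)) \<partial>lebesgue) \<le> (\<integral>\<^sup>+z\<in>cube 0 R. f0 (shift z a) \<partial>lebesgue)"
          unfolding f_def by (intro nn_integral_mono mult_right_mono) (auto simp: ennreal_enn2real_if)
        also have "\<dots> \<le> ?I" unfolding eq by (rule nn_integral_unit_cubes_upper(1)[OF _ R1(1)]) simp
        finally have le: "enn2real (\<integral>\<^sup>+z\<in>cube 0 R. ennreal (f (shift z a)) \<partial>lebesgue) \<le> enn2real ?I"
          by (rule enn2real_mono) (use fin in simp)
        have "average (cube 0 R) (\<lambda>z. f (shift z a)) = enn2real (\<integral>\<^sup>+z\<in>cube 0 R. ennreal (f (shift z a)) \<partial>lebesgue) / R ^ CARD('n)"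
          by (rule average_eq[OF R1(1)]) (use f0a in \<open>auto simp: f_def\<close>)
        also have "\<dots> \<le> enn2real ?I / R ^ CARD('n)" by (rule divide_right_mono[OF le]) (use R1 in simp)
        also have "\<dots> = ((R + 1) / R) ^ CARD('n) * (enn2real ?I / (R + 1) ^ CARD('n))"
          using R1 by (simp add: power_divide)
        also have "\<dots> \<le> 2 ^ CARD('n) * (enn2real ?I / (R + 1) ^ CARD('n))"
          using R R1 by (intro mult_right_mono power_mono) (auto simp: field_simps)
        also have "enn2real ?I / (R + 1) ^ CARD('n) = ?A (R + 1)"
          by (rule average_eq[OF R1(2), symmetric]) auto
        finally show ?case .
      qed
    qed (rule tendsto_const)
    from tendsto_unique[OF trivial_limit_at_top_linorder elim(1) this] show ?case .
  qed
  then have "(LINT a|M. f a) = 0" by simp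
  then have "(\<integral>\<^sup>+a. ennreal (f a) \<partial>M) = 0"
    using nn_integral_eq_integral[OF fint] by (simp only: ennreal_0) (simp add: f_def)
  then have "(\<integral>\<^sup>+a. f0 a \<partial>M) = 0" using ff0 by simp
  then have "AE a in M. f0 a = 0" by (simp add: nn_integral_0_iff_AE)
  \<comment> \<open>A vanishing \<open>f0\<close> concerns the unit cube at the origin only; the
    almost all shifts supplied by \<open>AE_orbit\<close> give unit cubes that together account for
    all of space.\<close>
  from AE_orbit[OF this] L2 orb show ?thesis
  proof eventually_elim
    case (elim a)
    have [measurable]: "V a \<in> borel_measurable lebesgue" by (rule Va) (use elim in blast)
    have eq: "f0 (shift x a) = (\<integral>\<^sup>+y\<in>cube x 1. ennreal ((norm (V a y))\<^sup>2) \<partial>lebesgue)" for x using elim(3) by blast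
    have "AE x in lebesgue. x \<in> cube 0 (real (Suc k)) \<longrightarrow> V a x = 0" for k
    proof -
      have [measurable]: "cube (0 :: real ^ 'n) (real (Suc k)) \<in> sets lebesgue" by (rule cube_sets) simp
      have "(\<integral>\<^sup>+y\<in>cube 0 (real (Suc k)). ennreal ((norm (V a y))\<^sup>2) \<partial>lebesgue) \<le> (\<integral>\<^sup>+z\<in>cube 0 (real (Suc k) + 1). f0 (shift z a) \<partial>lebesgue)"
        unfolding eq by (rule nn_integral_unit_cubes_upper(2)) auto
      also have "\<dots> = (\<integral>\<^sup>+z. 0 \<partial>(lebesgue :: (real ^ 'n) measure))"
        by (rule nn_integral_cong_AE) (use elim(1) in eventually_elim, simp)
      finally have "(\<integral>\<^sup>+y\<in>cube 0 (real (Suc k)). ennreal ((norm (V a y))\<^sup>2) \<partial>lebesgue) = 0" by simp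
      then have "AE y in lebesgue. ennreal ((norm (V a y))\<^sup>2) * indicator (cube 0 (real (Suc k))) y = 0"
        by (subst (asm) nn_integral_0_iff_AE) measurable
      then show ?thesis by eventually_elim (auto simp: indicator_def)
    qed
    then have "AE x in lebesgue. \<forall>k. x \<in> cube 0 (real (Suc k)) \<longrightarrow> V a x = 0" by (rule AE_all_countable[THEN iffD2, OF allI])
    then have "AE x in lebesgue. V a x = 0"
    proof eventually_elim
      case (elim x)
      obtain k :: nat where "k > 0" "{x} \<subseteq> cube 0 (real k)" using bounded_subset_cube[of "{x}"] by auto
      then show ?case using elim[rule_format, of "k - 1"] by simp
    qed
    then show ?case using elim(2) by blast
  qed
qed

text \<open>Since |a \<xi>| is at most |\<xi>|, the energy bound demanded of a corrector already
  entails a finite second moment of its gradient.\<close>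

lemma corrector_moment:
  assumes "(\<integral>\<^sup>+a. (\<integral>\<^sup>+y\<in>unit_cube. ennreal ((norm (G a y))\<^sup>2) \<partial>lebesgue) \<partial>M)
         \<le> ennreal ((1 - lam\<^sup>2) / lam\<^sup>2) *
            (\<integral>\<^sup>+a. (\<integral>\<^sup>+y\<in>unit_cube. ennreal ((norm (a y *v \<xi>))\<^sup>2) \<partial>lebesgue) \<partial>M)"
  shows "(\<integral>\<^sup>+a. (\<integral>\<^sup>+y\<in>(unit_cube :: (real ^ 'n) set). ennreal ((norm (G a y))\<^sup>2) \<partial>lebesgue) \<partial>M) < \<infinity>"
proof -
  have "(\<integral>\<^sup>+a. (\<integral>\<^sup>+y\<in>unit_cube. ennreal ((norm (a y *v \<xi>))\<^sup>2) \<partial>lebesgue) \<partial>M)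
    \<le> (\<integral>\<^sup>+a. (\<integral>\<^sup>+y\<in>(unit_cube :: (real ^ 'n) set). ennreal ((norm \<xi>)\<^sup>2) \<partial>lebesgue) \<partial>M)"
  proof (rule nn_integral_mono, rule nn_integral_mono_AE)
    fix a assume "a \<in> space M"
    then have "AE x in lebesgue. \<forall>\<xi>. \<xi> \<bullet> (a x *v \<xi>) \<ge> lam * (norm \<xi>)\<^sup>2 \<and> norm (a x *v \<xi>) \<le> norm \<xi>"
      unfolding M_space Omega_def by blast
    then show "AE x in lebesgue. ennreal ((norm (a x *v \<xi>))\<^sup>2) * indicator unit_cube x \<le> ennreal ((norm \<xi>)\<^sup>2) * indicator unit_cube x"
      by eventually_elim (intro mult_right_mono ennreal_leI power_mono, auto)
  qed
  also have "\<dots> < \<infinity>"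
    by (simp add: nn_integral_cmult_indicator unit_cube_eq emeasure_cube emeasure_space_1)
  finally show ?thesis using assms by (simp add: ennreal_mult_less_top le_less_trans)
qed

lemma corrector_unique:
  assumes \<phi>: "is_corrector lam M \<xi> \<phi>" and \<psi>: "is_corrector lam M \<xi> \<psi>"
  shows "same_field M \<phi> \<psi>"
proof -
  obtain G where G: "gradient_field M \<phi> G"
    "AE a in M. H1_loc (\<phi> a) \<and> distr_div_zero (\<lambda>x. a x *v (G a x + \<xi>)) \<and> sublinear (\<phi> a) \<and> anchored (\<phi> a)"
    "\<And>i. stationary_field M (\<lambda>a x. G a x $ i)"
    "(\<integral>\<^sup>+a. (\<integral>\<^sup>+y\<in>unit_cube. ennreal ((norm (G a y))\<^sup>2) \<partial>lebesgue) \<partial>M)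
         \<le> ennreal ((1 - lam\<^sup>2) / lam\<^sup>2) * (\<integral>\<^sup>+a. (\<integral>\<^sup>+y\<in>unit_cube. ennreal ((norm (a y *v \<xi>))\<^sup>2) \<partial>lebesgue) \<partial>M)"
    using \<phi> unfolding is_corrector_def by blast
  obtain G' where G': "gradient_field M \<psi> G'"
    "AE a in M. H1_loc (\<psi> a) \<and> distr_div_zero (\<lambda>x. a x *v (G' a x + \<xi>)) \<and> sublinear (\<psi> a) \<and> anchored (\<psi> a)"
    "\<And>i. stationary_field M (\<lambda>a x. G' a x $ i)"
    "(\<integral>\<^sup>+a. (\<integral>\<^sup>+y\<in>unit_cube. ennreal ((norm (G' a y))\<^sup>2) \<partial>lebesgue) \<partial>M)
         \<le> ennreal ((1 - lam\<^sup>2) / lam\<^sup>2) * (\<integral>\<^sup>+a. (\<integral>\<^sup>+y\<in>unit_cube. ennreal ((norm (a y *v \<xi>))\<^sup>2) \<partial>lebesgue) \<partial>M)"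
    using \<psi> unfolding is_corrector_def by blast
  let ?Q = "unit_cube :: (real ^ 'n) set"
  have Q[measurable]: "?Q \<in> sets lebesgue" by simp
  define V where "V a x = G a x - G' a x" for a x
  define u where "u a x = \<phi> a x - \<psi> a x" for a x
  have rf: "random_field M (\<lambda>a x. G a x $ i)" "random_field M (\<lambda>a x. G' a x $ i)" for i
    using G(1) G'(1) by (auto simp: gradient_field_def)
  have pm[measurable]: "(\<lambda>p. G (fst p) (snd p)) \<in> borel_measurable (M \<Otimes>\<^sub>M lebesgue)" "(\<lambda>p. G' (fst p) (snd p)) \<in> borel_measurable (M \<Otimes>\<^sub>M lebesgue)"
    by (rule borel_measurable_vecI, use rf in \<open>simp add: random_field_def split_beta'\<close>)+
  have sm: "G a \<in> borel_measurable lebesgue" "G' a \<in> borel_measurable lebesgue" if "a \<in> space M" for a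
    using measurable_compose[OF measurable_Pair1'[OF that] pm(1)] measurable_compose[OF measurable_Pair1'[OF that] pm(2)] by auto
  have fin: "(\<integral>\<^sup>+a. (\<integral>\<^sup>+y\<in>?Q. ennreal ((norm (V a y))\<^sup>2) \<partial>lebesgue) \<partial>M) < \<infinity>"
  proof -
    have "(\<integral>\<^sup>+a. (\<integral>\<^sup>+y\<in>?Q. ennreal ((norm (V a y))\<^sup>2) \<partial>lebesgue) \<partial>M)
      \<le> (\<integral>\<^sup>+a. 2 * (\<integral>\<^sup>+y\<in>?Q. ennreal ((norm (G a y))\<^sup>2) \<partial>lebesgue) + 2 * (\<integral>\<^sup>+y\<in>?Q. ennreal ((norm (G' a y))\<^sup>2) \<partial>lebesgue) \<partial>M)"
    proof (rule nn_integral_mono)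
      fix a assume a: "a \<in> space M"
      have [measurable]: "G a \<in> borel_measurable lebesgue" "G' a \<in> borel_measurable lebesgue" using sm[OF a] .
      show "(\<integral>\<^sup>+y\<in>?Q. ennreal ((norm (V a y))\<^sup>2) \<partial>lebesgue)
        \<le> 2 * (\<integral>\<^sup>+y\<in>?Q. ennreal ((norm (G a y))\<^sup>2) \<partial>lebesgue) + 2 * (\<integral>\<^sup>+y\<in>?Q. ennreal ((norm (G' a y))\<^sup>2) \<partial>lebesgue)"
        using set_nn_integral_norm_sq_triangle[of "G a" lebesgue "\<lambda>y. - G' a y" ?Q] by (simp add: V_def)
    qed
    also have "\<dots> = 2 * (\<integral>\<^sup>+a. (\<integral>\<^sup>+y\<in>?Q. ennreal ((norm (G a y))\<^sup>2) \<partial>lebesgue) \<partial>M) + 2 * (\<integral>\<^sup>+a. (\<integral>\<^sup>+y\<in>?Q. ennreal ((norm (G' a y))\<^sup>2) \<partial>lebesgue) \<partial>M)"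
    proof -
      have [measurable]: "(\<lambda>a. \<integral>\<^sup>+y\<in>?Q. ennreal ((norm (G a y))\<^sup>2) \<partial>lebesgue) \<in> borel_measurable M"
        "(\<lambda>a. \<integral>\<^sup>+y\<in>?Q. ennreal ((norm (G' a y))\<^sup>2) \<partial>lebesgue) \<in> borel_measurable M"
        using pm by (intro lebesgue.borel_measurable_nn_integral; simp add: split_beta')+
      show ?thesis by (simp add: nn_integral_add nn_integral_cmult)
    qed
    also have "\<dots> < \<infinity>" using corrector_moment[OF G(4)] corrector_moment[OF G'(4)] by (simp add: ennreal_mult_less_top)
    finally show ?thesis .
  qed
  have st: "AE a in M. \<forall>x. AE y in lebesgue. V (shift x a) y = V a (y + x)"
  proof -
    \<comment> \<open>The components are finitely many, so their quantifier may move in and out of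
      the almost sure statements; the one over \<open>x\<close> already stands inside.\<close>
    have "AE a in M. \<forall>i. \<forall>x. AE y in lebesgue. G (shift x a) y $ i = G a (y + x) $ i"
      "AE a in M. \<forall>i. \<forall>x. AE y in lebesgue. G' (shift x a) y $ i = G' a (y + x) $ i"
      using stationary_section[OF G(3)] stationary_section[OF G'(3)] by (simp_all add: AE_all_countable)
    then show ?thesis
    proof eventually_elim
      case (elim a)
      show ?case
      proof
        fix x
        have "AE y in lebesgue. \<forall>i. G (shift x a) y $ i = G a (y + x) $ i" "AE y in lebesgue. \<forall>i. G' (shift x a) y $ i = G' a (y + x) $ i"
          using elim by (simp_all add: AE_all_countable)
        then show "AE y in lebesgue. V (shift x a) y = V a (y + x)"
          by eventually_elim (simp add: V_def vec_eq_iff)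
      qed
    qed
  qed
  have wg: "AE a in M. has_weak_gradient (\<phi> a) (G a) \<and> has_weak_gradient (\<psi> a) (G' a)"
    using G(1) G'(1) by (simp add: gradient_field_def)
  have du: "AE a in M. a \<in> space M \<and> L2_loc (u a) \<and> has_weak_gradient (u a) (V a) \<and> distr_div_zero (\<lambda>x. a x *v V a x) \<and> anchored (u a)
    \<and> ((\<lambda>R. 1 / R\<^sup>2 * average (cube 0 R) (\<lambda>y. (u a y)\<^sup>2)) \<longlongrightarrow> 0) at_top"
    using wg G(2) G'(2) AE_space
  proof eventually_elim
    case (elim a)
    have L: "L2_loc (\<phi> a)" "L2_loc (\<psi> a)" using elim by (auto simp: H1_loc_def)
    have si: "set_integrable lebesgue ?Q (\<phi> a)" "set_integrable lebesgue ?Q (\<psi> a)"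
      using L2_loc_set_integrable[OF L(1), of ?Q] L2_loc_set_integrable[OF L(2), of ?Q] bounded_cube[of 1 "0 :: real ^ 'n"] by (auto simp: unit_cube_eq)
    have "L2_loc (u a)"
    proof (rule L2_locI)
      have [measurable]: "\<phi> a \<in> borel_measurable lebesgue" "\<psi> a \<in> borel_measurable lebesgue" using L by (auto simp: L2_loc_def)
      show "u a \<in> borel_measurable lebesgue" unfolding u_def by measurable
      fix k :: nat assume k: "k > 0"
      have [measurable]: "cube (0 :: real ^ 'n) (real k) \<in> sets lebesgue" using k by simp
      have "(\<integral>\<^sup>+x\<in>cube 0 (real k). ennreal ((norm (u a x))\<^sup>2) \<partial>lebesgue)
        \<le> 2 * (\<integral>\<^sup>+x\<in>cube 0 (real k). ennreal ((norm (\<phi> a x))\<^sup>2) \<partial>lebesgue) + 2 * (\<integral>\<^sup>+x\<in>cube 0 (real k). ennreal ((norm (- \<psi> a x))\<^sup>2) \<partial>lebesgue)"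
        using set_nn_integral_norm_sq_triangle[of "\<phi> a" lebesgue "\<lambda>x. - \<psi> a x" "cube 0 (real k)"] by (simp add: u_def)
      also have "\<dots> < \<infinity>"
        using L2_loc_nn_integral[OF L(1), of "cube 0 (real k)"] L2_loc_nn_integral[OF L(2), of "cube 0 (real k)"] k
        by (simp add: bounded_cube ennreal_mult_less_top)
      finally show "(\<integral>\<^sup>+x\<in>cube 0 (real k). ennreal ((norm (u a x))\<^sup>2) \<partial>lebesgue) < \<infinity>" .
    qed
    moreover have "has_weak_gradient (u a) (V a)"
      using has_weak_gradient_diff[of "\<phi> a" "G a" "\<psi> a" "G' a"] elim(1) by (simp add: u_def[abs_def] V_def[abs_def])
    moreover have "distr_div_zero (\<lambda>x. a x *v V a x)"
    proof -
      have "distr_div_zero (\<lambda>x. a x *v (G a x + \<xi>) - a x *v (G' a x + \<xi>))" using elim(2,3) by (intro distr_div_zero_diff) auto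
      then show ?thesis by (simp add: V_def matrix_vector_right_distrib matrix_vector_mult_diff_distrib)
    qed
    moreover have "anchored (u a)"
      using elim(2,3) set_integral_diff(2)[OF si] by (simp add: anchored_def u_def)
    moreover have "((\<lambda>R. 1 / R\<^sup>2 * average (cube 0 R) (\<lambda>y. (u a y)\<^sup>2)) \<longlongrightarrow> 0) at_top"
      unfolding u_def using elim(2,3) L by (intro sublinear_diff) auto
    ultimately show ?case using elim(4) by blast
  qed
  have lim: "AE a in M. L2_loc (V a) \<longrightarrow> ((\<lambda>R. average (cube 0 R) (\<lambda>y. (norm (V a y))\<^sup>2)) \<longlongrightarrow> 0) at_top"
    using du
  proof eventually_elim
    case (elim a)
    then have "AE x in lebesgue. \<forall>\<xi>. \<xi> \<bullet> (a x *v \<xi>) \<ge> lam * (norm \<xi>)\<^sup>2 \<and> norm (a x *v \<xi>) \<le> norm \<xi>"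
      unfolding M_space Omega_def by blast
    with elim show ?case by (blast intro: liouville_energy[OF lam_pos])
  qed
  have "random_field M (\<lambda>a x. V a x $ i)" for i
    using rf[of i] by (simp add: random_field_def V_def split_beta')
  from stationary_zero_energy[OF this fin st lim] du
  have "AE a in M. AE x in lebesgue. u a x = 0"
    by eventually_elim (blast intro: anchored_zero_gradient)
  then show ?thesis by (simp add: same_field_def u_def)
qed

end

theorem proposition2p15:
  fixes lam :: real
    and M :: "(real ^ 'n \<Rightarrow> real ^ 'n ^ 'n) measure"
    and \<xi> :: "real ^ 'n"
  assumes "0 < lam"
    and "prob_space M"
    and "space M = Omega lam"
    and "shift_measurable M"
    and "coeff_measurable M"
    and "stationary M"
    and "ergodic M"
  shows "\<exists>\<phi>. is_corrector lam M \<xi> \<phi> \<and>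
           (\<forall>\<psi>. is_corrector lam M \<xi> \<psi> \<longrightarrow> same_field M \<phi> \<psi>)"
proof -
  interpret stationary_ergodic lam M by (rule stationary_ergodic.intro) (fact assms)+
  obtain \<zeta> h where "\<And>n::nat. smooth_pair (\<zeta> n) (h n)"
    "\<And>n \<zeta>' k. smooth_pair \<zeta>' k \<Longrightarrow> \<bar>energy (\<lambda>a. h n a + \<xi>) k\<bar> \<le> (1/4) ^ n * sqrt (energy k k)"
    "(\<Sum>n. 2 ^ n * (\<integral>\<^sup>+a. ennreal ((norm (h (Suc n) a - h n a))\<^sup>2) \<partial>M)) < \<infinity>"
    using minimising_sequence[of \<xi>] by blast
  then interpret corrector_sequence lam M \<xi> \<zeta> h by unfold_locales
  show ?thesis using is_corrector_potential corrector_unique by blast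
qed

end
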